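(* Let $U_s$ be a domain on $\mathbb{S}^n$ and let $\partial V_s$ be a sufficiently smooth hypersurface in $U_s$ bounding a subdomain $V_s$ of $U_s$. Let $k\ge0$ and let $f\in C^1(U_s\times\mathbb{R}^n,\mathcal{M}_k)$, $g\in C^1(U_s\times\mathbb{R}^n,\overline{\mathcal{M}}_k)$ satisfy $R_k^Sf(x_s,u)=0$ and $g(x_s,u)R_k^S=0$. Then $$\int_{\partial V_s}\big(g(x_s,u),\,P_kn(x_s)f(x_s,u)\big)_u\,d\Sigma(x_s)=0,$$ where $d\Sigma$ is the $(n-1)$-dimensional scalar Lebesgue measure on $\partial V_s$ and $n(x_s)$ is the unit vector tangent to $\mathbb{S}^n$ at $x_s$, orthogonal to $\partial V_s$ and pointing outward from $V_s$.
   Context: $Cl_{n+1}$ is the real Clifford algebra generated by $\mathbb{R}^{n+1}$ with orthonormal basis $e_1,\dots,e_{n+1}$ and relations $e_ie_j+e_je_i=-2\delta_{ij}$; $\mathbb{R}^n=\mathrm{span}(e_1,\dots,e_n)\subset\mathbb{R}^{n+1}\subset Cl_{n+1}$. $\mathbb{S}^n$ is the unit sphere of $\mathbb{R}^{n+1}$ and $\mathbb{S}^{n-1}$ the unit sphere of $\mathbb{R}^n$. Reversion $a\mapsto\tilde a$ is the linear anti-automorphism of $Cl_{n+1}$ fixing all vectors. With $D_u=\sum_{j=1}^ne_j\partial_{u_j}$: $\mathcal{H}_k$ is the space of $Cl_{n+1}$-valued harmonic polynomials in $u\in\mathbb{R}^n$ homogeneous of degree $k$; $\mathcal{M}_k$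 (resp. $\overline{\mathcal{M}}_k$) is the space of $Cl_{n+1}$-valued polynomials homogeneous of degree $k$ with $D_up=0$ (left monogenic) (resp. $pD_u=\sum_j\partial_{u_j}p\,e_j=0$, right monogenic); both are $0$ for $k=-1$. $P_k:\mathcal{H}_k=\mathcal{M}_k\oplus u\mathcal{M}_{k-1}\to\mathcal{M}_k$ and $P_{k,r}:\mathcal{H}_k=\overline{\mathcal{M}}_k\oplus\overline{\mathcal{M}}_{k-1}u\to\overline{\mathcal{M}}_k$ are the projections; $P_{k,r}$ is written on the right of its argument. $C^1(U_s\times\mathbb{R}^n,\mathcal{M}_k)$ denotes $C^1$ functions $f(x_s,u)$ with $f(x_s,\cdot)\in\mathcal{M}_k$ for each $x_s$; similarly for $\overline{\mathcal{M}}_k$. The spherical Dirac operator is $D_s=D_{s,x_s}=x_s(\Lambda+\frac n2)$ with $\Lambda=\sum_{1\le i<j\le n+1}e_ie_j\big(x_{s,i}\frac{\partial}{\partial x_{s,j}}-x_{s,j}\frac{\partial}{\partial x_{s,i}}\big)$ (vector fields tangent to $\mathbb{S}^n$). Its right action is $gD_s:=\widetilde{D_s\tilde g}$. The $n$-spherical Rarita-Schwinger type operators are $R_k^Sf(x_s,u)=P_kD_{s,x_s}f(x_s,u)$ (left) and $g(x_s,u)R_k^S=g(x_s,u)D_{s,x_s}P_{k,r}$ (right). For $Cl_{n+1}$-valued polynomials, $(P(u),Q(u))_u=\int_{\mathbb{S}^{n-1}}P(u)Q(u)\,ds(u)$, $ds$ the surface measure on $\mathbb{S}^{n-1}$. 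*)

theory Defs
  imports "HOL-Analysis.Analysis" "HOL-Library.Option_ord"
begin

section \<open>Real Clifford algebras\<close>

text \<open>
  The Clifford algebra with generators \<open>e\<^sub>i\<close> (\<open>i\<close> in a finite linearly ordered type) and relations
  \<open>e\<^sub>i e\<^sub>j + e\<^sub>j e\<^sub>i = - 2 \<delta>\<^sub>i\<^sub>j\<close>, in coordinates with respect to the basis \<open>e\<^sub>A\<close>, where \<open>A\<close> is a set of
  indices and \<open>e\<^sub>A\<close> is the product of the \<open>e\<^sub>i\<close>, \<open>i \<in> A\<close>, in increasing order.
\<close>

type_synonym 'a clifford = "(real, 'a set) vec"

definition cl_basis :: "'a::finite set \<Rightarrow> 'a clifford" where
  "cl_basis A = axis A 1"

abbreviation cl_gen :: "'a::finite \<Rightarrow> 'a clifford" where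
  "cl_gen i \<equiv> cl_basis {i}"

text \<open>
  \<open>e\<^sub>A e\<^sub>B = \<plusminus> e\<^bsub>A \<triangle> B\<^esub>\<close>: sorting costs one sign for every pair \<open>j < i\<close> with \<open>i \<in> A\<close>, \<open>j \<in> B\<close>, and
  every common index costs one more because \<open>e\<^sub>i\<^sup>2 = - 1\<close>.
\<close>

definition cl_sign :: "'a::{finite,linorder} set \<Rightarrow> 'a set \<Rightarrow> real" where
  "cl_sign A B = (- 1) ^ card {(i, j). i \<in> A \<and> j \<in> B \<and> j \<le> i}"

definition cl_mult :: "'a::{finite,linorder} clifford \<Rightarrow> 'a clifford \<Rightarrow> 'a clifford" (infixl \<open>\<odot>\<close> 70) where
  "a \<odot> b = (\<Sum>A\<in>UNIV. \<Sum>B\<in>UNIV. (a $ A * b $ B * cl_sign A B) *\<^sub>R cl_basis (sym_diff A B))"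

text \<open>Reversing a product of \<open>m\<close> distinct generators takes \<open>m choose 2\<close> transpositions.\<close>

definition cl_reversion :: "'a::{finite,linorder} clifford \<Rightarrow> 'a clifford" where
  "cl_reversion a = (\<chi> A. (- 1) ^ (card A choose 2) * a $ A)"

definition cl_vec :: "real ^ 'a::finite \<Rightarrow> 'a clifford" where
  "cl_vec x = (\<Sum>i\<in>UNIV. x $ i *\<^sub>R cl_gen i)"

subsection \<open>The algebra laws\<close>

lemma cl_mult_bilinear:
  fixes a b c :: "'a::{finite,linorder} clifford"
  shows "(a + b) \<odot> c = a \<odot> c + b \<odot> c" "a \<odot> (b + c) = a \<odot> b + a \<odot> c"
    "(r *\<^sub>R a) \<odot> b = r *\<^sub>R (a \<odot> b)" "a \<odot> (r *\<^sub>R b) = r *\<^sub>R (a \<odot> b)"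
  by (simp_all add: cl_mult_def algebra_simps sum.distrib scaleR_sum_right)

lemma bilinear_cl_mult: "bilinear ((\<odot>) :: 'a::{finite,linorder} clifford \<Rightarrow> _)"
  unfolding bilinear_def by (auto intro!: linearI simp: cl_mult_bilinear)

lemma cl_sum_basis: "a = (\<Sum>A\<in>UNIV. a $ A *\<^sub>R cl_basis A)"
  by (simp add: cl_basis_def vec_eq_iff axis_def if_distrib cong: if_cong)

lemma cl_mult_basis: "cl_basis A \<odot> cl_basis B = cl_sign A B *\<^sub>R cl_basis (sym_diff A B)"
proof -
  have "cl_basis A \<odot> cl_basis B
      = (\<Sum>A'\<in>UNIV. \<Sum>B'\<in>UNIV. if B' = B then (if A' = A then cl_sign A B *\<^sub>R cl_basis (sym_diff A B) else 0) else 0)"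
    unfolding cl_mult_def
    by (intro sum.cong refl) (auto simp: cl_basis_def axis_def)
  then show ?thesis by simp
qed

lemma cl_sign_prod: "cl_sign A B = (\<Prod>i\<in>A. \<Prod>j\<in>B. if j \<le> i then - 1 else 1)"
proof -
  have "{(i, j). i \<in> A \<and> j \<in> B \<and> j \<le> i} = {p \<in> A \<times> B. snd p \<le> fst p}" by auto
  moreover have "(\<Prod>i\<in>A. \<Prod>j\<in>B. if j \<le> i then - 1 else (1::real))
      = (\<Prod>p\<in>A \<times> B. if snd p \<le> fst p then - 1 else 1)"
    by (simp add: prod.cartesian_product case_prod_unfold)
  moreover have "\<dots> = (\<Prod>p\<in>{p \<in> A \<times> B. snd p \<le> fst p}. - 1)"
    by (rule prod.inter_filter [symmetric]) simp
  ultimately show ?thesis by (simp add: cl_sign_def)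
qed

lemma prod_sign_sym_diff:
  fixes f :: "'b::finite \<Rightarrow> real"
  assumes "\<And>i. f i * f i = 1"
  shows "prod f (sym_diff A B) = prod f A * prod f B"
proof -
  have "prod f A = prod f (A - B) * prod f (A \<inter> B)"
    by (subst prod.union_disjoint [symmetric]) (auto intro!: prod.cong)
  moreover have "prod f B = prod f (B - A) * prod f (A \<inter> B)"
    by (subst prod.union_disjoint [symmetric]) (auto intro!: prod.cong)
  moreover have "prod f (sym_diff A B) = prod f (A - B) * prod f (B - A)"
    by (rule prod.union_disjoint) auto
  moreover have "prod f (A \<inter> B) * prod f (A \<inter> B) = 1"
    by (simp add: assms flip: prod.distrib)
  ultimately show ?thesis by (simp add: algebra_simps)
qed

lemma cl_sign_sym_diff:
  "cl_sign (sym_diff A B) C = cl_sign A C * cl_sign B C"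
  "cl_sign C (sym_diff A B) = cl_sign C A * cl_sign C B"
proof -
  have *: "(\<Prod>i\<in>C. if P i then - 1 else (1::real)) * (\<Prod>i\<in>C. if P i then - 1 else 1) = 1" for P C
    unfolding prod.distrib [symmetric] by (rule prod.neutral) simp
  show "cl_sign (sym_diff A B) C = cl_sign A C * cl_sign B C"
    unfolding cl_sign_prod by (rule prod_sign_sym_diff) (rule *)
  show "cl_sign C (sym_diff A B) = cl_sign C A * cl_sign C B"
    unfolding cl_sign_prod prod.distrib [symmetric]
    by (intro prod.cong refl prod_sign_sym_diff) auto
qed

lemma cl_linear_eqI:
  assumes "linear f" "linear g" "\<And>A. f (cl_basis A) = g (cl_basis A)"
  shows "f a = g a"
  by (subst (1 2) cl_sum_basis [of a])
    (simp add: linear_sum [OF assms(1)] linear_sum [OF assms(2)] assms(3)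
      linear_cmul [OF assms(1)] linear_cmul [OF assms(2)])

lemma cl_mult_assoc: "(a \<odot> b) \<odot> c = a \<odot> (b \<odot> c)"
proof (rule cl_linear_eqI [of "\<lambda>a. (a \<odot> b) \<odot> c"], goal_cases)
  case (3 A)
  show ?case
  proof (rule cl_linear_eqI [of "\<lambda>b. (cl_basis A \<odot> b) \<odot> c"], goal_cases)
    case (3 B)
    show ?case
    proof (rule cl_linear_eqI [of "\<lambda>c. (cl_basis A \<odot> cl_basis B) \<odot> c"], goal_cases)
      case (3 C)
      have "sym_diff (sym_diff A B) C = sym_diff A (sym_diff B C)" by blast
      then show ?case
        by (simp add: cl_mult_basis cl_mult_bilinear cl_sign_sym_diff mult_ac)
    qed (auto intro!: linearI simp: cl_mult_bilinear)
  qed (auto intro!: linearI simp: cl_mult_bilinear)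
qed (auto intro!: linearI simp: cl_mult_bilinear)

lemma cl_mult_one: "cl_basis {} \<odot> a = a" "a \<odot> cl_basis {} = a"
  by (rule cl_linear_eqI [of "\<lambda>a. cl_basis {} \<odot> a"] cl_linear_eqI [of "\<lambda>a. a \<odot> cl_basis {}"];
      auto intro!: linearI simp: cl_mult_bilinear cl_mult_basis cl_sign_def)+

lemma cl_gen_anticommute:
  "cl_gen i \<odot> cl_gen j + cl_gen j \<odot> cl_gen i = (if i = j then - 2 else 0) *\<^sub>R cl_basis {}"
proof -
  have "cl_sign {i} {j} = (if j \<le> i then - 1 else 1)" for i j :: 'a
    by (simp add: cl_sign_prod)
  then show ?thesis
    by (auto simp: cl_mult_basis Un_commute simp flip: scaleR_left_distrib)
qed

lemma cl_reversion_linear: "linear cl_reversion"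
  by (rule linearI) (simp_all add: cl_reversion_def vec_eq_iff algebra_simps)

lemma cl_reversion_basis: "cl_reversion (cl_basis A) = (- 1) ^ (card A choose 2) *\<^sub>R cl_basis A"
  by (simp add: cl_reversion_def cl_basis_def vec_eq_iff axis_def)

lemma cl_reversion_vec: "cl_reversion (cl_vec x) = cl_vec x"
  by (simp add: cl_vec_def linear_sum [OF cl_reversion_linear] linear_cmul [OF cl_reversion_linear]
      cl_reversion_basis numeral_2_eq_2)

lemma cl_sign_swap: "cl_sign A B * cl_sign B A = (- 1) ^ (card A * card B + card (A \<inter> B))"
proof -
  let ?S = "{(i, j). i \<in> A \<and> j \<in> B \<and> j \<le> i}" and ?T = "{(i, j). i \<in> A \<and> j \<in> B \<and> i \<le> j}"
  have "card {(i, j). i \<in> B \<and> j \<in> A \<and> j \<le> i} = card ?T"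
    by (rule bij_betw_same_card [of prod.swap]) (auto simp: bij_betw_def inj_on_def image_iff)
  moreover have "card ?S + card ?T = card (?S \<union> ?T) + card (?S \<inter> ?T)"
    by (rule card_Un_Int) (auto intro: finite_subset [OF subset_UNIV])
  moreover have "?S \<union> ?T = A \<times> B" by auto
  moreover have "?S \<inter> ?T = (\<lambda>i. (i, i)) ` (A \<inter> B)" by auto
  then have "card (?S \<inter> ?T) = card (A \<inter> B)" by (simp add: card_image inj_on_def)
  ultimately show ?thesis
    by (simp add: cl_sign_def card_cartesian_product flip: power_add)
qed

lemma choose_two_parity:
  "even ((a + b) choose 2) \<longleftrightarrow> even ((a + c choose 2) + (b + c choose 2) + (a + c) * (b + c) + c)"
proof -
  have add: "(x + y) choose 2 = (x choose 2) + (y choose 2) + x * y" for x y :: nat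
    by (induction x) (auto simp: numeral_2_eq_2)
  show ?thesis by (auto simp: add algebra_simps)
qed

lemma cl_reversion_mult: "cl_reversion (a \<odot> b) = cl_reversion b \<odot> cl_reversion a"
proof (rule cl_linear_eqI [of "\<lambda>a. cl_reversion (a \<odot> b)"], goal_cases)
  case (3 A)
  show ?case
  proof (rule cl_linear_eqI [of "\<lambda>b. cl_reversion (cl_basis A \<odot> b)"], goal_cases)
    case (3 B)
    let ?a = "card (A - B)" and ?b = "card (B - A)" and ?c = "card (A \<inter> B)"
    have A: "card A = ?a + ?c" and B: "card B = ?b + ?c"
      by (simp_all add: card_Diff_subset_Int Int_commute card_mono)
    have S: "card (sym_diff A B) = ?a + ?b"
      by (rule card_Un_disjoint) auto
    have sq: "cl_sign B A * cl_sign B A = 1"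
      by (simp add: cl_sign_def flip: power_mult_distrib)
    have "cl_sign A B = cl_sign A B * cl_sign B A * cl_sign B A"
      using sq by (simp add: mult.assoc)
    then have AB: "cl_sign A B = (- 1) ^ (card A * card B + ?c) * cl_sign B A"
      by (simp add: cl_sign_swap)
    have sgn: "(- 1 :: real) ^ (card (sym_diff A B) choose 2)
        = (- 1) ^ ((card A choose 2) + (card B choose 2) + card A * card B + ?c)"
      unfolding S A B using choose_two_parity [of ?a ?b ?c] by (simp add: minus_one_power_iff)
    have m: "(- 1 :: real) ^ m * (- 1) ^ m = 1" for m
      by (simp flip: power_mult_distrib)
    have "cl_sign A B * (- 1) ^ (card (sym_diff A B) choose 2)
        = (- 1) ^ (card A choose 2) * (- 1) ^ (card B choose 2) * cl_sign B A
          * ((- 1) ^ (card A * card B + ?c) * (- 1) ^ (card A * card B + ?c))"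
      unfolding sgn AB by (simp add: power_add)
    then have "cl_sign A B * (- 1) ^ (card (sym_diff A B) choose 2)
        = (- 1) ^ (card A choose 2) * (- 1) ^ (card B choose 2) * cl_sign B A"
      unfolding m by simp
    moreover have "sym_diff B A = sym_diff A B" by blast
    ultimately show ?case
      by (simp add: cl_mult_basis cl_mult_bilinear cl_reversion_basis linear_cmul [OF cl_reversion_linear] mult_ac)
  qed (auto intro!: linearI simp: cl_mult_bilinear linear_add [OF cl_reversion_linear]
        linear_cmul [OF cl_reversion_linear])
qed (auto intro!: linearI simp: cl_mult_bilinear linear_add [OF cl_reversion_linear]
        linear_cmul [OF cl_reversion_linear])


section \<open>The spaces \<open>\<real>\<^sup>n\<close> and \<open>\<real>\<^sup>n\<^sup>+\<^sup>1\<close>\<close>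

text \<open>
  With \<open>n = CARD('n)\<close>, the generators \<open>e\<^sub>1, \<dots>, e\<^sub>n\<close> are indexed by \<open>Some j\<close> and \<open>e\<^sub>n\<^sub>+\<^sub>1\<close> by \<open>None\<close>.
  That \<open>None\<close> is the least element of \<open>'n option\<close> only affects the signs of the basis elements \<open>e\<^sub>A\<close>.
\<close>

definition cl_vec_n :: "real ^ 'n::finite \<Rightarrow> ('n option) clifford" where
  "cl_vec_n u = (\<Sum>j\<in>UNIV. u $ j *\<^sub>R cl_gen (Some j))"

type_synonym 'n cl_fun = "(real, 'n) vec \<Rightarrow> ('n option) clifford"

definition partial_deriv :: "'a::finite \<Rightarrow> (real ^ 'a \<Rightarrow> 'b::real_normed_vector) \<Rightarrow> real ^ 'a \<Rightarrow> 'b" where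
  "partial_deriv j f x = vector_derivative (\<lambda>t. f (x + t *\<^sub>R axis j 1)) (at 0)"

text \<open>For a set that is not open, being \<open>C\<^sup>1\<close> means having local \<open>C\<^sup>1\<close> extensions.\<close>

definition C1_on :: "'a::real_normed_vector set \<Rightarrow> ('a \<Rightarrow> 'b::real_normed_vector) \<Rightarrow> bool" where
  "C1_on S f \<longleftrightarrow>
    (\<forall>x\<in>S. \<exists>W F (F' :: 'a \<Rightarrow> 'a \<Rightarrow>\<^sub>L 'b). open W \<and> x \<in> W \<and>
       (\<forall>y\<in>W. (F has_derivative F' y) (at y)) \<and> continuous_on W F' \<and>
       (\<forall>y\<in>W \<inter> S. F y = f y))"


section \<open>Monogenic polynomials\<close>

definition homogeneous_polys :: "nat \<Rightarrow> ('n::finite) cl_fun set" where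
  "homogeneous_polys k = {p. polynomial_function p \<and> (\<forall>t u. p (t *\<^sub>R u) = t ^ k *\<^sub>R p u)}"

definition left_monogenic :: "int \<Rightarrow> ('n::{finite,linorder}) cl_fun set" where
  "left_monogenic k = (if k < 0 then {\<lambda>u. 0} else
     {p \<in> homogeneous_polys (nat k). \<forall>u. (\<Sum>j\<in>UNIV. cl_gen (Some j) \<odot> partial_deriv j p u) = 0})"

definition right_monogenic :: "int \<Rightarrow> ('n::{finite,linorder}) cl_fun set" where
  "right_monogenic k = (if k < 0 then {\<lambda>u. 0} else
     {p \<in> homogeneous_polys (nat k). \<forall>u. (\<Sum>j\<in>UNIV. partial_deriv j p u \<odot> cl_gen (Some j)) = 0})"

definition harmonic_polys :: "nat \<Rightarrow> ('n::finite) cl_fun set" where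
  "harmonic_polys k =
     {p \<in> homogeneous_polys k. \<forall>u. (\<Sum>j\<in>UNIV. partial_deriv j (partial_deriv j p) u) = 0}"

text \<open>
  The projections along \<open>u \<M>\<^bsub>k-1\<^esub>\<close> and \<open>\<M>\<^bsub>k-1\<^esub> u\<close>; their domain is \<open>harmonic_polys k\<close>, which is the
  direct sum of \<open>\<M>\<^sub>k\<close> and \<open>u \<M>\<^bsub>k-1\<^esub>\<close> (Fischer decomposition), and likewise on the right.
\<close>

definition left_proj ::
    "nat \<Rightarrow> ('n::{finite,linorder}) cl_fun \<Rightarrow> 'n cl_fun" where
  "left_proj k h = (THE p. h \<in> harmonic_polys k \<and> p \<in> left_monogenic (int k) \<and>
     (\<exists>q\<in>left_monogenic (int k - 1). h = (\<lambda>u. p u + cl_vec_n u \<odot> q u)))"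

definition right_proj ::
    "nat \<Rightarrow> ('n::{finite,linorder}) cl_fun \<Rightarrow> 'n cl_fun" where
  "right_proj k h = (THE p. h \<in> harmonic_polys k \<and> p \<in> right_monogenic (int k) \<and>
     (\<exists>q\<in>right_monogenic (int k - 1). h = (\<lambda>u. p u + q u \<odot> cl_vec_n u)))"


section \<open>Rarita-Schwinger type operators on the sphere\<close>

text \<open>
  The fields \<open>x\<^sub>i \<partial>\<^sub>j - x\<^sub>j \<partial>\<^sub>i\<close> are tangent to the sphere, so they may be applied to any extension of
  a function on the sphere; we take the one that is constant along rays.
\<close>

definition sphere_extension :: "(real ^ 'a::finite \<Rightarrow> 'b) \<Rightarrow> real ^ 'a \<Rightarrow> 'b" where
  "sphere_extension f x = f (x /\<^sub>R norm x)"

definition sphere_Lambda ::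
    "(real ^ 'a::{finite,linorder} \<Rightarrow> 'a clifford) \<Rightarrow> (real, 'a) vec \<Rightarrow> 'a clifford" where
  "sphere_Lambda f x = (\<Sum>(i, j)\<in>{(i, j). i < j}. (cl_gen i \<odot> cl_gen j) \<odot>
     (x $ i *\<^sub>R partial_deriv j (sphere_extension f) x - x $ j *\<^sub>R partial_deriv i (sphere_extension f) x))"

definition sphere_dirac ::
    "(real ^ ('n::{finite,linorder} option) \<Rightarrow> ('n option) clifford) \<Rightarrow>
     real ^ ('n option) \<Rightarrow> ('n option) clifford" where
  "sphere_dirac f x = cl_vec x \<odot> (sphere_Lambda f x + (real CARD('n) / 2) *\<^sub>R f x)"

definition sphere_dirac_right ::
    "(real ^ ('n::{finite,linorder} option) \<Rightarrow> ('n option) clifford) \<Rightarrow>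
     real ^ ('n option) \<Rightarrow> ('n option) clifford" where
  "sphere_dirac_right g x = cl_reversion (sphere_dirac (\<lambda>y. cl_reversion (g y)) x)"

definition rarita_schwinger ::
    "nat \<Rightarrow> (real ^ ('n::{finite,linorder} option) \<Rightarrow> 'n cl_fun) \<Rightarrow>
     real ^ ('n option) \<Rightarrow> 'n cl_fun" where
  "rarita_schwinger k f x = left_proj k (\<lambda>u. sphere_dirac (\<lambda>y. f y u) x)"

definition rarita_schwinger_right ::
    "nat \<Rightarrow> (real ^ ('n::{finite,linorder} option) \<Rightarrow> 'n cl_fun) \<Rightarrow>
     real ^ ('n option) \<Rightarrow> 'n cl_fun" where
  "rarita_schwinger_right k g x = right_proj k (\<lambda>u. sphere_dirac_right (\<lambda>y. g y u) x)"


section \<open>Surface measure\<close>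

text \<open>
  The \<open>d\<close>-dimensional Hausdorff measure, normalised to agree with Lebesgue measure on \<open>\<real>\<^sup>d\<close>; on a
  \<open>d\<close>-dimensional \<open>C\<^sup>1\<close> submanifold it is the Lebesgue (surface) measure. Empty sets in a cover must
  not contribute, which matters for \<open>d = 0\<close> (counting measure), where \<open>0 ^ 0 = 1\<close>.
\<close>

definition hausdorff_content :: "nat \<Rightarrow> 'a::metric_space set \<Rightarrow> ennreal" where
  "hausdorff_content d C =
     (if C = {} then 0 else ennreal (unit_ball_vol (real d) * (diameter C / 2) ^ d))"

definition hausdorff_outer :: "nat \<Rightarrow> 'a::metric_space set \<Rightarrow> ennreal" where
  "hausdorff_outer d A =
     (SUP \<delta>\<in>{0::real<..}.
       INF C\<in>{C :: nat \<Rightarrow> 'a set. A \<subseteq> (\<Union>i. C i) \<and> (\<forall>i. bounded (C i) \<and> diameter (C i) \<le> \<delta>)}.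
         \<Sum>i. hausdorff_content d (C i))"

definition hausdorff_measure :: "nat \<Rightarrow> 'a::metric_space measure" where
  "hausdorff_measure d = measure_of UNIV (sets borel) (hausdorff_outer d)"

definition sphere_pairing ::
    "('n::{finite,linorder}) cl_fun \<Rightarrow>
     'n cl_fun \<Rightarrow> ('n option) clifford" where
  "sphere_pairing P Q = (LINT u:sphere 0 1|hausdorff_measure (CARD('n) - 1). P u \<odot> Q u)"


section \<open>Domains on the sphere\<close>

definition sphere_domain :: "(real ^ 'a::finite) set \<Rightarrow> bool" where
  "sphere_domain U \<longleftrightarrow> openin (top_of_set (sphere 0 1)) U \<and> connected U \<and> U \<noteq> {}"

definition sphere_boundary :: "(real ^ 'a::finite) set \<Rightarrow> (real ^ 'a) set" where
  "sphere_boundary V = (top_of_set (sphere 0 1)) frontier_of V"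

text \<open>
  The boundary of \<open>V\<close> in the sphere is a \<open>C\<^sup>1\<close> hypersurface with \<open>V\<close> locally on one side: near every
  boundary point \<open>V\<close> is the set \<open>\<rho> < 0\<close>, where the gradient \<open>G\<close> of \<open>\<rho>\<close> has a nonzero component
  tangent to the sphere.
\<close>

definition C1_boundary :: "(real ^ 'a::finite) set \<Rightarrow> bool" where
  "C1_boundary V \<longleftrightarrow>
    (\<forall>x\<in>sphere_boundary V. \<exists>W \<rho> G. open W \<and> x \<in> W \<and>
       (\<forall>y\<in>W. (\<rho> has_derivative (\<lambda>h. G y \<bullet> h)) (at y)) \<and> continuous_on W G \<and>
       G x \<notin> span {x} \<and> V \<inter> W = {y \<in> sphere 0 1 \<inter> W. \<rho> y < (0::real)})"

definition tangent_vectors :: "'a::real_normed_vector set \<Rightarrow> 'a \<Rightarrow> 'a set" where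
  "tangent_vectors M x =
     {\<tau>. \<exists>\<gamma>. \<gamma> 0 = x \<and> (\<forall>\<^sub>F t in nhds 0. \<gamma> t \<in> M) \<and> (\<gamma> has_vector_derivative \<tau>) (at (0::real))}"

text \<open>Outward: the geodesic of the sphere issuing from \<open>x\<close> in direction \<open>\<nu>\<close> leaves \<open>V\<close>.\<close>

definition outward_unit_normal :: "(real ^ 'a::finite) set \<Rightarrow> real ^ 'a \<Rightarrow> real ^ 'a \<Rightarrow> bool" where
  "outward_unit_normal V x \<nu> \<longleftrightarrow>
     norm \<nu> = 1 \<and> \<nu> \<bullet> x = 0 \<and> (\<forall>\<tau>\<in>tangent_vectors (sphere_boundary V) x. \<nu> \<bullet> \<tau> = 0) \<and>
     (\<forall>\<^sub>F t in at_right 0. cos t *\<^sub>R x + sin t *\<^sub>R \<nu> \<notin> V)"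

end

theory Submission
  imports Defs
begin

text \<open>
  For \<open>x\<close> on the sphere and functions extended constantly along rays, \<open>D\<^sub>s f = - D f + (n / 2) x f\<close> with the
  flat Dirac operator \<open>D\<close> of \<open>\<real>\<^sup>n\<^sup>+\<^sup>1\<close>. Hence the field with components \<open>X\<^sub>a = (g, e\<^sub>a f)\<^sub>u\<close> satisfies
  \<open>div X = n (x \<bullet> X) - (g D\<^sub>s, f)\<^sub>u - (g, D\<^sub>s f)\<^sub>u\<close>, where \<open>div X - n (x \<bullet> X)\<close> is the divergence on the sphere of
  the tangential part of \<open>X\<close>. By the Fischer decomposition, \<open>R\<^sub>k f = 0\<close> means \<open>D\<^sub>s f = u q\<close> with \<open>q\<close> monogenic,
  and \<open>u q\<close> is orthogonal to \<open>g\<close> by the divergence theorem in the unit ball of \<open>\<real>\<^sup>n\<close>; likewise on the right.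
  So the spherical divergence vanishes, and with it the flux of \<open>X\<close> through the boundary of \<open>V\<close>. The integrand
  of the theorem is that flux density, again because \<open>P\<^sub>k\<close> only removes a multiple of \<open>u\<close>.

  The divergence theorem on the sphere is reduced to the flat one by stereographic projection from a point
  outside the closure of \<open>V\<close>. The flat one is proved for the Hausdorff measure: near a boundary point the domain
  is sliced by lines in a direction \<open>e\<close> transversal to the boundary, and projecting the boundary along \<open>e\<close>
  scales its Hausdorff measure by the factor \<open>e \<bullet> \<nu>\<close>.
\<close>

subsection \<open>Hausdorff measure\<close>

text \<open>Surface measure is a Hausdorff measure, so surface integrals have to be computed from
  coverings. The key is the constant relating Hausdorff measure on a hyperplane times length to
  volume: translation invariance and rotation make it the same for all directions, and comparing two
  directions yields the cosine factor of a projection. Curved pieces are reduced to flat ones by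
  bi-Lipschitz maps with constants near 1. The constant survives as a factor
  \<open>slab_factor\<close> in the divergence theorem, which is then applied only to fields whose
  divergence vanishes.

  The variable \<open>u\<close> is removed by interpolation: f(x, u) and g(x, u) are combinations of
  fixed polynomials \<open>L i\<close> in \<open>u\<close> with coefficients f(x, a_i) and g(x,
  a_i). The integral over \<open>u\<close> becomes a finite bilinear form in these coefficients, so
  differentiation in \<open>x\<close> never passes under an integral. Statements about
  \<open>g\<close> are obtained from those about \<open>f\<close> by reversion.\<close>

definition hausdorff_pre :: "real \<Rightarrow> nat \<Rightarrow> 'a::metric_space set \<Rightarrow> ennreal" where
  "hausdorff_pre \<delta> d A =
     (INF C\<in>{C :: nat \<Rightarrow> 'a set. A \<subseteq> (\<Union>i. C i) \<and> (\<forall>i. bounded (C i) \<and> diameter (C i) \<le> \<delta>)}.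
         \<Sum>i. hausdorff_content d (C i))"

lemma hausdorff_outer_SUP: "hausdorff_outer d A = (SUP \<delta>\<in>{0<..}. hausdorff_pre \<delta> d A)"
  by (simp add: hausdorff_outer_def hausdorff_pre_def)

lemma hausdorff_pre_le_outer: "0 < \<delta> \<Longrightarrow> hausdorff_pre \<delta> d A \<le> hausdorff_outer d A"
  unfolding hausdorff_outer_SUP by (rule SUP_upper) simp

lemma hausdorff_pre_le:
  assumes "A \<subseteq> (\<Union>i. C i)" "\<And>i. bounded (C i)" "\<And>i. diameter (C i) \<le> \<delta>"
  shows "hausdorff_pre \<delta> d A \<le> (\<Sum>i. hausdorff_content d (C i))"
  unfolding hausdorff_pre_def by (rule INF_lower) (use assms in auto)

lemma hausdorff_pre_antimono:
  assumes "\<delta> \<le> \<delta>'" shows "hausdorff_pre \<delta>' d A \<le> hausdorff_pre \<delta> d A"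
  unfolding hausdorff_pre_def
  by (rule INF_superset_mono) (use assms order_trans in blast)+

lemma hausdorff_outer_mono: "A \<subseteq> B \<Longrightarrow> hausdorff_outer d A \<le> hausdorff_outer d B"
  unfolding hausdorff_outer_SUP hausdorff_pre_def
  by (intro SUP_mono' INF_superset_mono) auto

lemma hausdorff_content_empty [simp]: "hausdorff_content d {} = 0"
  by (simp add: hausdorff_content_def)

lemma hausdorff_outer_empty [simp]: "hausdorff_outer d {} = 0"
proof -
  have "hausdorff_pre \<delta> d {} \<le> 0" if "\<delta> > 0" for \<delta>
    using hausdorff_pre_le [of "{}" "\<lambda>_. {}" \<delta> d] that by simp
  then show ?thesis unfolding hausdorff_outer_SUP
    by (metis (mono_tags, lifting) SUP_least greaterThan_iff le_zero_eq)
qed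

text \<open>Near-optimal covers of the \<open>A n\<close>, each with excess
  \<open>e * (1/2) ^ Suc n\<close>, are merged into one sequence through \<open>prod_decode\<close>.
  The mesh \<open>\<delta>\<close> is kept fixed during the merging; the supremum over
  \<open>\<delta>\<close> is taken only at the end.\<close>

lemma hausdorff_outer_countably_subadditive:
  fixes A :: "nat \<Rightarrow> 'a::metric_space set"
  shows "hausdorff_outer d (\<Union>i. A i) \<le> (\<Sum>i. hausdorff_outer d (A i))"
proof -
  have "hausdorff_pre \<delta> d (\<Union>i. A i) \<le> (\<Sum>i. hausdorff_outer d (A i))" if "\<delta> > 0" for \<delta>
  proof (rule ennreal_le_epsilon)
    fix e :: real assume e: "0 < e" and fin: "(\<Sum>i. hausdorff_outer d (A i)) < top"
    have less: "hausdorff_pre \<delta> d (A n) < hausdorff_outer d (A n) + e * (1/2) ^ Suc n" for n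
    proof -
      have "hausdorff_outer d (A n) < top"
        using fin by (rule ennreal_suminf_lessD)
      then have "hausdorff_outer d (A n) < hausdorff_outer d (A n) + e * (1/2) ^ Suc n"
        using e by (auto simp: less_top)
      with hausdorff_pre_le_outer [OF that, of d "A n"] show ?thesis
        by (rule le_less_trans)
    qed
    have "\<exists>C. A n \<subseteq> (\<Union>i. C i) \<and> (\<forall>i. bounded (C i) \<and> diameter (C i) \<le> \<delta>) \<and>
        (\<Sum>i. hausdorff_content d (C i)) < hausdorff_outer d (A n) + e * (1/2) ^ Suc n" for n
      using less [of n] unfolding hausdorff_pre_def INF_less_iff by blast
    then obtain B where B: "\<And>n. A n \<subseteq> (\<Union>i. B n i)" "\<And>n i. bounded (B n i)"
      "\<And>n i. diameter (B n i) \<le> \<delta>"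
      "\<And>n. (\<Sum>i. hausdorff_content d (B n i)) < hausdorff_outer d (A n) + e * (1/2) ^ Suc n"
      by metis
    define C where "C = case_prod B \<circ> prod_decode"
    have "(\<Union>n. A n) \<subseteq> (\<Union>i. C i)"
      using B(1) by (auto simp: C_def subset_eq) (metis prod.case prod_encode_inverse)
    then have "hausdorff_pre \<delta> d (\<Union>n. A n) \<le> (\<Sum>i. hausdorff_content d (C i))"
      by (rule hausdorff_pre_le) (auto simp: C_def case_prod_unfold B)
    also have "\<dots> = (\<Sum>n. \<Sum>i. hausdorff_content d (B n i))"
      unfolding C_def comp_def
      by (rule suminf_ennreal_2dimen [where f="\<lambda>p. hausdorff_content d (case_prod B p)"]) simp
    also have "\<dots> \<le> (\<Sum>n. hausdorff_outer d (A n) + e * (1/2) ^ Suc n)"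
      by (intro suminf_le allI less_imp_le B) auto
    also have "\<dots> = (\<Sum>n. hausdorff_outer d (A n)) + (\<Sum>n. ennreal e * ennreal ((1/2) ^ Suc n))"
      using e by (subst suminf_add [symmetric])
        (auto simp del: ennreal_suminf_cmult simp add: ennreal_mult [symmetric])
    also have "\<dots> = (\<Sum>n. hausdorff_outer d (A n)) + e"
      unfolding ennreal_suminf_cmult
      by (subst suminf_ennreal_eq [OF zero_le_power power_half_series]) auto
    finally show "hausdorff_pre \<delta> d (\<Union>i. A i) \<le> (\<Sum>i. hausdorff_outer d (A i)) + e" .
  qed
  then show ?thesis
    unfolding hausdorff_outer_SUP [of d "\<Union>i. A i"] by (intro SUP_least) auto
qed

lemma hausdorff_outer_Un_le: "hausdorff_outer d (A \<union> B) \<le> hausdorff_outer d A + hausdorff_outer d B"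
proof -
  have "A \<union> B = (\<Union>i. if i = 0 then A else if i = Suc 0 then B else {})"
    by (auto split: if_splits)
  then have "hausdorff_outer d (A \<union> B)
      \<le> (\<Sum>i. hausdorff_outer d (if i = 0 then A else if i = Suc 0 then B else {}))"
    using hausdorff_outer_countably_subadditive [of d "\<lambda>i. if i = 0 then A else if i = Suc 0 then B else {}"]
    by simp
  also have "\<dots> = (\<Sum>i\<in>{0, Suc 0}. hausdorff_outer d (if i = 0 then A else if i = Suc 0 then B else {}))"
    by (rule suminf_finite) auto
  finally show ?thesis by simp
qed

section \<open>Caratheodory's criterion for the Hausdorff outer measure\<close>

text \<open>A set of diameter less than \<open>r\<close> cannot meet both \<open>A\<close> and
  \<open>B\<close>, so a fine cover of the union splits into a cover of \<open>A\<close> and one of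
  \<open>B\<close> with no cover set counted twice.\<close>

lemma hausdorff_outer_separated:
  fixes A B :: "'a::metric_space set"
  assumes "0 < r" and sep: "\<And>a b. a \<in> A \<Longrightarrow> b \<in> B \<Longrightarrow> r \<le> dist a b"
  shows "hausdorff_outer d A + hausdorff_outer d B \<le> hausdorff_outer d (A \<union> B)"
proof -
  have pre: "hausdorff_pre \<delta> d A + hausdorff_pre \<delta> d B \<le> hausdorff_pre \<delta> d (A \<union> B)"
    if \<delta>: "0 < \<delta>" "\<delta> < r" for \<delta>
    unfolding hausdorff_pre_def [of \<delta> d "A \<union> B"]
  proof (rule INF_greatest, clarify)
    fix C :: "nat \<Rightarrow> 'a set"
    assume C: "A \<union> B \<subseteq> (\<Union>i. C i)" "\<forall>i. bounded (C i) \<and> diameter (C i) \<le> \<delta>"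
    \<comment> \<open>A set sorted into the other family is replaced by \<open>{}\<close>, whose
      content is 0 even for \<open>d = 0\<close>.\<close>
    define C1 where "C1 i = (if C i \<inter> A = {} then {} else C i)" for i
    define C2 where "C2 i = (if C i \<inter> A = {} then C i else {})" for i
    have nb: "b \<notin> C i" if "b \<in> B" "C i \<inter> A \<noteq> {}" for b i
    proof
      assume "b \<in> C i"
      from that obtain a where "a \<in> C i" "a \<in> A" by blast
      then have "dist a b \<le> diameter (C i)"
        using C(2) \<open>b \<in> C i\<close> by (intro diameter_bounded_bound) auto
      with sep [OF \<open>a \<in> A\<close> \<open>b \<in> B\<close>] \<delta> C(2) show False
        by (meson leD order_trans)
    qed
    have "b \<in> C2 i" if "b \<in> B" "b \<in> C i" for b i
    proof -
      have "C i \<inter> A = {}" using nb that by blast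
      then have "C2 i = C i" unfolding C2_def by (rule if_P)
      then show ?thesis using that(2) by (simp only:)
    qed
    note mem_C2 = this
    have B: "B \<subseteq> (\<Union>i. C2 i)"
    proof
      fix b assume b: "b \<in> B"
      then have "b \<in> (\<Union>i. C i)" using C(1) by (rule subsetD [rotated, OF UnI2])
      then obtain i where "b \<in> C i" by (rule UN_E)
      from mem_C2 [OF b this] show "b \<in> (\<Union>i. C2 i)" by (rule UN_I [OF UNIV_I])
    qed
    have "a \<in> C1 i" if "a \<in> A" "a \<in> C i" for a i
    proof -
      have "C i \<inter> A \<noteq> {}" using that by blast
      then have "C1 i = C i" unfolding C1_def by (rule if_not_P)
      then show ?thesis using that(2) by (simp only:)
    qed
    note mem_C1 = this
    have A: "A \<subseteq> (\<Union>i. C1 i)"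
    proof
      fix a assume a: "a \<in> A"
      then have "a \<in> (\<Union>i. C i)" using C(1) by (rule subsetD [rotated, OF UnI1])
      then obtain i where "a \<in> C i" by (rule UN_E)
      from mem_C1 [OF a this] show "a \<in> (\<Union>i. C1 i)" by (rule UN_I [OF UNIV_I])
    qed
    have "hausdorff_pre \<delta> d A + hausdorff_pre \<delta> d B
        \<le> (\<Sum>i. hausdorff_content d (C1 i)) + (\<Sum>i. hausdorff_content d (C2 i))"
      by (intro add_mono hausdorff_pre_le A B) (use C(2) \<delta> in \<open>auto simp: C1_def C2_def\<close>)
    also have "\<dots> = (\<Sum>i. hausdorff_content d (C1 i) + hausdorff_content d (C2 i))"
      by (rule suminf_add) auto
    also have "\<dots> = (\<Sum>i. hausdorff_content d (C i))"
      by (rule suminf_cong) (simp add: C1_def C2_def)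
    finally show "hausdorff_pre \<delta> d A + hausdorff_pre \<delta> d B \<le> (\<Sum>i. hausdorff_content d (C i))" .
  qed
  have "hausdorff_pre \<delta>1 d A + hausdorff_pre \<delta>2 d B \<le> hausdorff_outer d (A \<union> B)"
    if "0 < \<delta>1" "0 < \<delta>2" for \<delta>1 \<delta>2
  proof -
    \<comment> \<open>The suprema defining the two outer measures run over independent meshes; both
      are dominated by a common finer mesh below \<open>r\<close>.\<close>
    define \<delta> where "\<delta> = min (r/2) (min \<delta>1 \<delta>2)"
    have \<delta>: "0 < \<delta>" "\<delta> < r" "\<delta> \<le> \<delta>1" "\<delta> \<le> \<delta>2" using that assms by (auto simp: \<delta>_def)
    have "hausdorff_pre \<delta>1 d A + hausdorff_pre \<delta>2 d B \<le> hausdorff_pre \<delta> d A + hausdorff_pre \<delta> d B"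
      by (intro add_mono hausdorff_pre_antimono \<delta>)
    also have "\<dots> \<le> hausdorff_outer d (A \<union> B)"
      using pre [OF \<delta>(1,2)] hausdorff_pre_le_outer [OF \<delta>(1)] by (rule order_trans)
    finally show ?thesis .
  qed
  then show ?thesis
    unfolding hausdorff_outer_SUP [of d A] hausdorff_outer_SUP [of d B]
    by (subst ennreal_SUP_add_left [symmetric], simp, intro SUP_least,
        subst ennreal_SUP_add_right, simp, intro SUP_least) simp
qed

text \<open>Each set has positive distance from the earlier ones, with a bound that may shrink with
  \<open>j\<close>; shells accumulating at a closed set offer no more than that.\<close>

lemma hausdorff_outer_separated_sum:
  fixes R :: "nat \<Rightarrow> 'a::metric_space set"
  assumes "\<And>j. j < m \<Longrightarrow> \<exists>r>0. \<forall>i<j. \<forall>a\<in>R i. \<forall>b\<in>R j. r \<le> dist a b"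
  shows "(\<Sum>j<m. hausdorff_outer d (R j)) \<le> hausdorff_outer d (\<Union>j<m. R j)"
  using assms
proof (induction m)
  case (Suc m)
  obtain r where "r > 0" "\<forall>i<m. \<forall>a\<in>R i. \<forall>b\<in>R m. r \<le> dist a b" using Suc.prems by blast
  then have "hausdorff_outer d (\<Union>j<m. R j) + hausdorff_outer d (R m) \<le> hausdorff_outer d ((\<Union>j<m. R j) \<union> R m)"
    by (intro hausdorff_outer_separated [of r]) auto
  moreover have "(\<Union>j<m. R j) \<union> R m = (\<Union>j<Suc m. R j)" by (auto simp: less_Suc_eq)
  moreover have "(\<Sum>j<m. hausdorff_outer d (R j)) \<le> hausdorff_outer d (\<Union>j<m. R j)"
    using Suc by simp
  ultimately show ?case
    unfolding sum.lessThan_Suc by (metis (no_types) add_right_mono order_trans)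
qed simp

text \<open>
  Caratheodory's criterion. The part of \<open>T\<close> outside a closed set \<open>F\<close> is exhausted by sets at positive
  distance from \<open>F\<close>; the shells left over at stage \<open>n\<close> form two families of mutually separated sets,
  so that their outer measures are summable and the tail tends to \<open>0\<close>.
\<close>

lemma hausdorff_outer_closed_split:
  fixes F T :: "'a::metric_space set"
  assumes "closed F"
  shows "hausdorff_outer d (T \<inter> F) + hausdorff_outer d (T - F) \<le> hausdorff_outer d T"
proof (cases "F = {} \<or> hausdorff_outer d T = top")
  case True then show ?thesis by auto
next
  case False
  then have "F \<noteq> {}" and fin: "hausdorff_outer d T < top" by (auto simp: less_top)
  let ?H = "hausdorff_outer d"
  define \<rho> where "\<rho> n = 1 / real (Suc n)" for n
  have \<rho>: "0 < \<rho> n" "\<rho> (Suc n) < \<rho> n" for n by (auto simp: \<rho>_def field_simps)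
  have \<rho>_mono: "\<rho> n \<le> \<rho> m" if "m \<le> n" for m n using that by (auto simp: \<rho>_def field_simps)
  define S where "S n = {x \<in> T. \<rho> n \<le> infdist x F}" for n
  define R where "R n = {x \<in> T. \<rho> (Suc n) \<le> infdist x F \<and> infdist x F < \<rho> n}" for n
  have sep: "\<rho> (Suc i) - \<rho> j \<le> dist a b" if "a \<in> R i" "b \<in> R j" for a b i j
  proof -
    have "infdist a F \<le> infdist b F + dist a b" by (rule infdist_triangle)
    with that show ?thesis by (auto simp: R_def)
  qed
  have RT: "?H (\<Union>j<m. R (2 * j + c)) \<le> ?H T" for m c
    by (rule hausdorff_outer_mono) (auto simp: R_def)
  have half: "(\<Sum>j<m. ?H (R (2 * j + c))) \<le> ?H T" for m c
  proof (rule order_trans [OF hausdorff_outer_separated_sum RT])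
    fix j
    show "\<exists>r>0. \<forall>i<j. \<forall>a\<in>R (2 * i + c). \<forall>b\<in>R (2 * j + c). r \<le> dist a b"
    proof (cases j)
      case (Suc j')
      \<comment> \<open>Two shells of equal parity have the shell \<open>R (2 * j' + c + 1)\<close>
        between them; their distance is at least its width.\<close>
      let ?r = "\<rho> (2 * j' + c + 1) - \<rho> (2 * j' + c + 2)"
      have "?r \<le> dist a b" if "i < j" "a \<in> R (2 * i + c)" "b \<in> R (2 * j + c)" for i a b
        using sep [OF that(2,3)] \<rho>_mono [of "Suc (2 * i + c)" "2 * j' + c + 1"] that(1) Suc by simp
      moreover have "?r > 0" using \<rho>(2) [of "2 * j' + c + 1"] by simp
      ultimately show ?thesis by blast
    qed (auto intro: zero_less_one)
  qed
  have "(\<Sum>n<m. ?H (R n)) \<le> 2 * ?H T" for m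
  proof -
    have "(\<Sum>n<m. ?H (R n)) \<le> (\<Sum>n<2*m. ?H (R n))"
      by (rule sum_mono2) auto
    also have "\<dots> = (\<Sum>j<m. ?H (R (2 * j + 0))) + (\<Sum>j<m. ?H (R (2 * j + 1)))"
      by (induction m) (auto simp: algebra_simps)
    also have "\<dots> \<le> ?H T + ?H T" by (intro add_mono half)
    finally show ?thesis by (simp add: mult_2)
  qed
  then have "(\<Sum>n. ?H (R n)) \<le> 2 * ?H T"
    by (simp add: suminf_le_const)
  then have fins: "(\<Sum>n. ?H (R n)) < top"
    by (rule le_less_trans) (use fin in \<open>simp add: ennreal_mult_less_top\<close>)
  then have finR: "?H (R n) < top" for n by (rule ennreal_suminf_lessD)
  define h where "h n = enn2real (?H (R n))" for n
  have h: "?H (R n) = ennreal (h n)" "0 \<le> h n" for n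
    using finR [of n] by (auto simp: h_def less_top)
  have "summable h"
    by (rule summable_suminf_not_top) (use fins h(2) in \<open>auto simp: h(1) [symmetric]\<close>)
  show ?thesis
  proof (rule ennreal_le_epsilon)
    fix e :: real assume "0 < e"
    then obtain N where N: "norm (\<Sum>i. h (i + N)) < e"
      using suminf_exist_split [OF _ \<open>summable h\<close>] by blast
    have "T - F \<subseteq> S N \<union> (\<Union>i. R (i + N))"
    proof
      fix x assume x: "x \<in> T - F"
      then have pos: "infdist x F > 0"
        using assms \<open>F \<noteq> {}\<close> by (metis DiffE in_closed_iff_infdist_zero infdist_nonneg less_eq_real_def)
      show "x \<in> S N \<union> (\<Union>i. R (i + N))"
      proof (cases "\<rho> N \<le> infdist x F")
        case False
        obtain n where n: "\<rho> n < infdist x F"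
          using reals_Archimedean [OF pos] by (auto simp: \<rho>_def inverse_eq_divide)
        \<comment> \<open>The first threshold not exceeding the distance, so \<open>x\<close> lies
          in the shell \<open>R (k - 1)\<close>; \<open>N < k\<close> makes this one of the shells
          from \<open>N\<close> on.\<close>
        define k where "k = (LEAST n. \<rho> n \<le> infdist x F)"
        have k: "\<rho> k \<le> infdist x F" unfolding k_def
          by (rule LeastI [where P="\<lambda>n. \<rho> n \<le> infdist x F", OF less_imp_le [OF n]])
        have "N < k" using False k \<rho>_mono [of k N] by force
        moreover have "infdist x F < \<rho> (k - 1)"
        proof (rule ccontr)
          assume "\<not> ?thesis"
          then have "\<rho> (k - 1) \<le> infdist x F" by simp
          then have "k \<le> k - 1" unfolding k_def
            by (rule Least_le [where P="\<lambda>n. \<rho> n \<le> infdist x F"])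
          then show False using \<open>N < k\<close> by simp
        qed
        ultimately have "x \<in> R ((k - 1 - N) + N)" using x k by (auto simp: R_def)
        then show ?thesis by blast
      qed (use x in \<open>auto simp: S_def\<close>)
    qed
    then have "?H (T - F) \<le> ?H (S N) + ?H (\<Union>i. R (i + N))"
      by (meson hausdorff_outer_mono hausdorff_outer_Un_le order_trans)
    also have "\<dots> \<le> ?H (S N) + (\<Sum>i. ?H (R (i + N)))"
      by (intro add_left_mono hausdorff_outer_countably_subadditive)
    also have "(\<Sum>i. ?H (R (i + N))) = ennreal (\<Sum>i. h (i + N))"
      unfolding h(1) by (rule suminf_ennreal2) (auto simp: h \<open>summable h\<close> summable_iff_shift)
    also have "\<dots> \<le> e" using N by (intro ennreal_leI) auto
    finally have 1: "?H (T - F) \<le> ?H (S N) + e" by (simp add: add_left_mono)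
    have "?H (T \<inter> F) + ?H (S N) \<le> ?H (T \<inter> F \<union> S N)"
    proof (rule hausdorff_outer_separated [OF \<rho>(1) [of N]])
      fix a b assume "a \<in> T \<inter> F" "b \<in> S N"
      then show "\<rho> N \<le> dist a b"
        using infdist_le [of a F b] by (auto simp: S_def dist_commute)
    qed
    also have "\<dots> \<le> ?H T" by (rule hausdorff_outer_mono) (auto simp: S_def)
    finally have 2: "?H (T \<inter> F) + ?H (S N) \<le> ?H T" .
    have "?H (T \<inter> F) + ?H (T - F) \<le> ?H (T \<inter> F) + (?H (S N) + e)" using 1 by (rule add_left_mono)
    also have "\<dots> = ?H (T \<inter> F) + ?H (S N) + e" by (simp add: add.assoc)
    also have "\<dots> \<le> ?H T + e" using 2 by (rule add_right_mono)
    finally show "?H (T \<inter> F) + ?H (T - F) \<le> ?H T + e" .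
  qed
qed

text \<open>The Caratheodory sigma-algebra of the outer measure contains the closed sets, hence the
  Borel sets. Only with this does \<open>measure_of\<close> in the definition of
  \<open>hausdorff_measure\<close> yield the outer measure and not the null measure.\<close>

lemma measure_space_hausdorff_outer:
  "measure_space UNIV (sets borel) (hausdorff_outer d :: 'a::metric_space set \<Rightarrow> ennreal)"
proof -
  let ?L = "lambda_system UNIV UNIV (hausdorff_outer d :: 'a set \<Rightarrow> ennreal)"
  interpret sigma_algebra UNIV "UNIV :: 'a set set"
    using sigma_algebra_Pow [of UNIV] by simp
  have "outer_measure_space UNIV (hausdorff_outer d :: 'a set \<Rightarrow> ennreal)"
    by (auto simp: outer_measure_space_def positive_def increasing_def countably_subadditive_def
        hausdorff_outer_mono hausdorff_outer_countably_subadditive)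
  then have L: "measure_space UNIV ?L (hausdorff_outer d)"
    by (rule caratheodory_lemma)
  have "F \<in> ?L" if "closed F" for F
  proof -
    have "hausdorff_outer d (T \<inter> F) + hausdorff_outer d (T - F) = hausdorff_outer d T" for T
    proof (rule antisym [OF hausdorff_outer_closed_split [OF that]])
      have "hausdorff_outer d T = hausdorff_outer d (T \<inter> F \<union> (T - F))"
        by (rule arg_cong [where f="hausdorff_outer d"]) blast
      then show "hausdorff_outer d T \<le> hausdorff_outer d (T \<inter> F) + hausdorff_outer d (T - F)"
        by (metis hausdorff_outer_Un_le)
    qed
    then show ?thesis by (auto simp: lambda_system_eq)
  qed
  then have "sigma_sets UNIV (Collect closed) \<subseteq> ?L"
    using L by (intro sigma_algebra.sigma_sets_subset) (auto simp: measure_space_def)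
  then have "sets borel \<subseteq> ?L"
    by (simp add: borel_eq_closed sets_measure_of)
  then show ?thesis
    by (rule measure_down [OF L sets.sigma_algebra_axioms [of borel, simplified]])
qed

lemma sets_hausdorff_measure [simp, measurable_cong]: "sets (hausdorff_measure d) = sets borel"
  unfolding hausdorff_measure_def using sets.sigma_sets_eq [of borel] by simp

lemma space_hausdorff_measure [simp]: "space (hausdorff_measure d) = UNIV"
  by (simp add: hausdorff_measure_def)

lemma emeasure_hausdorff_measure:
  assumes "A \<in> sets borel"
  shows "emeasure (hausdorff_measure d) A = hausdorff_outer d A"
proof (rule emeasure_measure_of [OF hausdorff_measure_def])
  show "sets borel \<subseteq> Pow UNIV" by simp
  show "positive (sets (hausdorff_measure d)) (hausdorff_outer d)"
    "countably_additive (sets (hausdorff_measure d)) (hausdorff_outer d)"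
    using measure_space_hausdorff_outer by (auto simp: measure_space_def)
qed (use assms in simp)

section \<open>Behaviour under Lipschitz maps and isometries\<close>

lemma hausdorff_content_image_le:
  fixes f :: "'a::real_normed_vector \<Rightarrow> 'b::real_normed_vector"
  assumes lip: "\<And>x y. x \<in> C \<Longrightarrow> y \<in> C \<Longrightarrow> norm (f x - f y) \<le> L * norm (x - y)"
    and "0 \<le> L" "bounded C"
  shows "bounded (f ` C)" "diameter (f ` C) \<le> L * diameter C"
    "hausdorff_content d (f ` C) \<le> ennreal (L ^ d) * hausdorff_content d C"
proof -
  have "norm (f x - f y) \<le> L * diameter C" if "x \<in> C" "y \<in> C" for x y
    using lip [OF that] diameter_bounded_bound [OF assms(3) that] assms(2)
    by (metis dist_norm mult_left_mono order_trans)
  then have le: "norm (u - v) \<le> L * diameter C" if "u \<in> f ` C" "v \<in> f ` C" for u v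
    using that by blast
  show "bounded (f ` C)"
    unfolding bounded_two_points dist_norm using le by blast
  show diam: "diameter (f ` C) \<le> L * diameter C"
    using assms diameter_ge_0 by (intro diameter_le le) auto
  have "(diameter (f ` C) / 2) ^ d \<le> L ^ d * (diameter C / 2) ^ d"
    unfolding power_mult_distrib [symmetric]
    by (rule power_mono) (use diam diameter_ge_0 [OF \<open>bounded (f ` C)\<close>] in auto)
  then have "unit_ball_vol d * (diameter (f ` C) / 2) ^ d \<le> unit_ball_vol d * (L ^ d * (diameter C / 2) ^ d)"
    by (intro mult_left_mono) auto
  then have "ennreal (unit_ball_vol d * (diameter (f ` C) / 2) ^ d)
      \<le> ennreal (L ^ d) * ennreal (unit_ball_vol d * (diameter C / 2) ^ d)"
    using \<open>0 \<le> L\<close> diameter_ge_0 [OF \<open>bounded C\<close>]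
    by (subst ennreal_mult [symmetric]) (auto simp: mult_ac intro!: ennreal_leI)
  then show "hausdorff_content d (f ` C) \<le> ennreal (L ^ d) * hausdorff_content d C"
    by (auto simp: hausdorff_content_def)
qed

text \<open>Covers are cut down to \<open>A\<close>, where the Lipschitz bound holds; a cover of
  mesh \<open>\<delta> / L\<close> is sent to one of mesh \<open>\<delta>\<close>.\<close>

lemma hausdorff_outer_lipschitz_image:
  fixes f :: "'a::real_normed_vector \<Rightarrow> 'b::real_normed_vector"
  assumes lip: "\<And>x y. x \<in> A \<Longrightarrow> y \<in> A \<Longrightarrow> norm (f x - f y) \<le> L * norm (x - y)" and "0 < L"
  shows "hausdorff_outer d (f ` A) \<le> ennreal (L ^ d) * hausdorff_outer d A"
  unfolding hausdorff_outer_SUP [of d "f ` A"]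
proof (rule SUP_least)
  fix \<delta> :: real assume "\<delta> \<in> {0<..}"
  then have \<delta>: "0 < \<delta>" by simp
  have "hausdorff_pre \<delta> d (f ` A) \<le> ennreal (L ^ d) * hausdorff_pre (\<delta> / L) d A"
  proof -
    have c: "ennreal (L ^ d) * ennreal (inverse (L ^ d)) = 1"
      using \<open>0 < L\<close> by (simp flip: ennreal_mult)
    \<comment> \<open>With the factor on the left, the right side is a bare infimum over covers, and
      it suffices to treat a single cover.\<close>
    have "ennreal (inverse (L ^ d)) * hausdorff_pre \<delta> d (f ` A) \<le> hausdorff_pre (\<delta> / L) d A"
      unfolding hausdorff_pre_def [of "\<delta> / L"]
    proof (rule INF_greatest, clarify)
      fix C :: "nat \<Rightarrow> 'a set"
      assume C: "A \<subseteq> (\<Union>i. C i)" "\<forall>i. bounded (C i) \<and> diameter (C i) \<le> \<delta> / L"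
      have bd: "bounded (C i \<inter> A)" for i using C(2) by (simp add: bounded_Int)
      have im: "bounded (f ` (C i \<inter> A))" "diameter (f ` (C i \<inter> A)) \<le> L * diameter (C i \<inter> A)"
        "hausdorff_content d (f ` (C i \<inter> A)) \<le> ennreal (L ^ d) * hausdorff_content d (C i \<inter> A)" for i
        by (rule hausdorff_content_image_le [where L=L]; use lip bd \<open>0 < L\<close> in auto)+
      have dle: "diameter (C i \<inter> A) \<le> diameter (C i)" for i
        using C(2) by (intro diameter_subset) auto
      have "hausdorff_pre \<delta> d (f ` A) \<le> (\<Sum>i. hausdorff_content d (f ` (C i \<inter> A)))"
      proof (rule hausdorff_pre_le)
        show "f ` A \<subseteq> (\<Union>i. f ` (C i \<inter> A))" using C(1) by blast
        show "bounded (f ` (C i \<inter> A))" for i by (rule im)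
        show "diameter (f ` (C i \<inter> A)) \<le> \<delta>" for i
        proof -
          have "L * diameter (C i \<inter> A) \<le> L * (\<delta> / L)"
            using dle [of i] C(2) \<open>0 < L\<close> by (intro mult_left_mono) (auto intro: order_trans)
          then show ?thesis using im(2) [of i] \<open>0 < L\<close> by simp
        qed
      qed
      also have "\<dots> \<le> (\<Sum>i. ennreal (L ^ d) * hausdorff_content d (C i))"
      proof (intro suminf_le allI)
        fix i
        have "hausdorff_content d (C i \<inter> A) \<le> hausdorff_content d (C i)"
          using dle [of i] diameter_ge_0 [OF bd]
          by (auto simp: hausdorff_content_def intro!: ennreal_leI mult_left_mono power_mono)
        then show "hausdorff_content d (f ` (C i \<inter> A)) \<le> ennreal (L ^ d) * hausdorff_content d (C i)"
          using im(3) [of i] by (meson mult_left_mono order_trans zero_le)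
      qed auto
      finally have "ennreal (inverse (L ^ d)) * hausdorff_pre \<delta> d (f ` A)
          \<le> ennreal (inverse (L ^ d)) * (ennreal (L ^ d) * (\<Sum>i. hausdorff_content d (C i)))"
        by (intro mult_left_mono) auto
      also have "\<dots> = (\<Sum>i. hausdorff_content d (C i))"
        using c by (simp add: mult.assoc [symmetric] mult.commute)
      finally show "ennreal (inverse (L ^ d)) * hausdorff_pre \<delta> d (f ` A) \<le> (\<Sum>i. hausdorff_content d (C i))" .
    qed
    then have "ennreal (L ^ d) * (ennreal (inverse (L ^ d)) * hausdorff_pre \<delta> d (f ` A))
        \<le> ennreal (L ^ d) * hausdorff_pre (\<delta> / L) d A"
      by (intro mult_left_mono) auto
    then show ?thesis by (simp add: c mult.assoc [symmetric])
  qed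
  also have "\<dots> \<le> ennreal (L ^ d) * hausdorff_outer d A"
    using \<delta> \<open>0 < L\<close> by (intro mult_left_mono hausdorff_pre_le_outer) auto
  finally show "hausdorff_pre \<delta> d (f ` A) \<le> ennreal (L ^ d) * hausdorff_outer d A" .
qed

lemma hausdorff_outer_isometry:
  fixes f :: "'a::real_normed_vector \<Rightarrow> 'b::real_normed_vector"
  assumes "\<And>x y. x \<in> A \<Longrightarrow> y \<in> A \<Longrightarrow> norm (f x - f y) = norm (x - y)"
  shows "hausdorff_outer d (f ` A) = hausdorff_outer d A"
proof (rule antisym)
  show "hausdorff_outer d (f ` A) \<le> hausdorff_outer d A"
    using hausdorff_outer_lipschitz_image [of A f 1 d] assms by simp
  have inj: "inj_on f A" using assms by (intro inj_onI) (metis eq_iff_diff_eq_0 norm_eq_zero)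
  then have "inv_into A f ` f ` A = A" by simp
  then show "hausdorff_outer d A \<le> hausdorff_outer d (f ` A)"
  proof -
    have "hausdorff_outer d (inv_into A f ` f ` A) \<le> ennreal (1 ^ d) * hausdorff_outer d (f ` A)"
      by (rule hausdorff_outer_lipschitz_image) (use assms inj in auto)
    then show ?thesis using \<open>inv_into A f ` f ` A = A\<close> by simp
  qed
qed

section \<open>Comparison of measures by local density and by translation invariance\<close>

text \<open>A substitute for differentiation of measures. Around each point, \<open>N\<close> is
  \<open>\<theta> x\<close> times \<open>M\<close> up to \<open>\<epsilon>\<close>, and
  \<open>\<theta>\<close> oscillates by less than \<open>\<epsilon>\<close>, whence the error
  \<open>2 * \<epsilon>\<close> per unit of \<open>M\<close>. Finitely many balls cover
  \<open>K\<close>, the errors add up to \<open>2 * \<epsilon>\<close> times the finite measure of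
  \<open>A\<close>, and \<open>\<epsilon>\<close> tends to 0.\<close>

lemma emeasure_eq_nn_integral_local_density:
  fixes N M :: "'a::euclidean_space measure" and \<theta> :: "'a \<Rightarrow> real"
  assumes sets [measurable_cong, simp]: "sets N = sets borel" "sets M = sets borel"
    and K: "compact K" and cont: "continuous_on K \<theta>" and nonneg: "\<And>x. x \<in> K \<Longrightarrow> 0 \<le> \<theta> x"
    and fin: "emeasure M K < \<infinity>"
    and loc: "\<And>x \<epsilon>. x \<in> K \<Longrightarrow> 0 < \<epsilon> \<Longrightarrow> \<exists>r>0. \<forall>A\<in>sets borel. A \<subseteq> K \<inter> ball x r \<longrightarrow>
        emeasure N A \<le> ennreal (\<theta> x + \<epsilon>) * emeasure M A \<and>
        ennreal (\<theta> x) * emeasure M A \<le> emeasure N A + ennreal \<epsilon> * emeasure M A"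
    and A: "A \<in> sets borel" "A \<subseteq> K"
  shows "emeasure N A = (\<integral>\<^sup>+x\<in>A. ennreal (\<theta> x) \<partial>M)"
proof -
  \<comment> \<open>Cut off outside \<open>K\<close>, the density becomes Borel measurable on the
    whole space.\<close>
  let ?\<theta> = "\<lambda>x. ennreal (\<theta> x) * indicator K x"
  have [measurable]: "K \<in> sets borel" using K by (simp add: borel_compact)
  have "(\<lambda>x. indicator K x *\<^sub>R \<theta> x) \<in> borel_measurable borel"
    by (rule borel_measurable_continuous_on_indicator) (use cont in auto)
  then have "(\<lambda>x. ennreal (indicator K x *\<^sub>R \<theta> x)) \<in> borel_measurable borel" by measurable
  moreover have "(\<lambda>x. ennreal (indicator K x *\<^sub>R \<theta> x)) = ?\<theta>" by (auto simp: indicator_def)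
  ultimately have \<theta>m [measurable]: "?\<theta> \<in> borel_measurable borel" by simp
  define I where "I A = (\<integral>\<^sup>+x\<in>A. ?\<theta> x \<partial>M)" for A
  have I_Un: "I (A \<union> B) = I A + I B" if "A \<in> sets borel" "B \<in> sets borel" "A \<inter> B = {}" for A B
    unfolding I_def using that
    by (subst nn_integral_add [symmetric], measurable) (auto intro!: nn_integral_cong simp: indicator_def)
  have main: "emeasure N A \<le> I A + ennreal (2 * \<epsilon>) * emeasure M A \<and> I A \<le> emeasure N A + ennreal (2 * \<epsilon>) * emeasure M A"
    if "0 < \<epsilon>" "A \<in> sets borel" "A \<subseteq> K" for \<epsilon> A
  proof -
    have "\<exists>r>0. (\<forall>A\<in>sets borel. A \<subseteq> K \<inter> ball x r \<longrightarrow>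
        emeasure N A \<le> ennreal (\<theta> x + \<epsilon>) * emeasure M A \<and>
        ennreal (\<theta> x) * emeasure M A \<le> emeasure N A + ennreal \<epsilon> * emeasure M A)
        \<and> (\<forall>y\<in>K \<inter> ball x r. \<bar>\<theta> y - \<theta> x\<bar> < \<epsilon>)" if xK: "x \<in> K" for x
    proof -
      obtain r1 where r1: "r1 > 0" "\<forall>A\<in>sets borel. A \<subseteq> K \<inter> ball x r1 \<longrightarrow>
        emeasure N A \<le> ennreal (\<theta> x + \<epsilon>) * emeasure M A \<and>
        ennreal (\<theta> x) * emeasure M A \<le> emeasure N A + ennreal \<epsilon> * emeasure M A"
        using loc [OF xK \<open>0 < \<epsilon>\<close>] by blast
      obtain r2 where r2: "r2 > 0" "\<forall>y\<in>K. dist y x < r2 \<longrightarrow> dist (\<theta> y) (\<theta> x) < \<epsilon>"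
        using cont xK \<open>0 < \<epsilon>\<close> unfolding continuous_on_iff by meson
      show ?thesis
      proof (intro exI [of _ "min r1 r2"] conjI ballI impI)
        fix A :: "'a set" assume A: "A \<in> sets borel" "A \<subseteq> K \<inter> ball x (min r1 r2)"
        have "ball x (min r1 r2) \<subseteq> ball x r1" by (rule subset_ball) simp
        then have "A \<subseteq> K \<inter> ball x r1" using A(2) by blast
        then show "emeasure N A \<le> ennreal (\<theta> x + \<epsilon>) * emeasure M A"
          "ennreal (\<theta> x) * emeasure M A \<le> emeasure N A + ennreal \<epsilon> * emeasure M A"
          using r1(2) A(1) by metis+
      next
        fix y assume "y \<in> K \<inter> ball x (min r1 r2)"
        then have "y \<in> K" "dist y x < r2" by (simp_all add: dist_commute)
        then show "\<bar>\<theta> y - \<theta> x\<bar> < \<epsilon>" using r2(2) by (simp add: dist_real_def)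
      qed (use r1(1) r2(1) in simp)
    qed
    then obtain r where r: "\<And>x. x \<in> K \<Longrightarrow> r x > 0"
      "\<And>x A. x \<in> K \<Longrightarrow> A \<in> sets borel \<Longrightarrow> A \<subseteq> K \<inter> ball x (r x) \<Longrightarrow>
        emeasure N A \<le> ennreal (\<theta> x + \<epsilon>) * emeasure M A \<and>
        ennreal (\<theta> x) * emeasure M A \<le> emeasure N A + ennreal \<epsilon> * emeasure M A"
      "\<And>x y. x \<in> K \<Longrightarrow> y \<in> K \<inter> ball x (r x) \<Longrightarrow> \<bar>\<theta> y - \<theta> x\<bar> < \<epsilon>"
      by metis
    have small: "emeasure N A \<le> I A + ennreal (2 * \<epsilon>) * emeasure M A \<and> I A \<le> emeasure N A + ennreal (2 * \<epsilon>) * emeasure M A"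
      if x: "x \<in> K" and A: "A \<in> sets borel" "A \<subseteq> K \<inter> ball x (r x)" for x A
    proof
      note [measurable] = A(1)
      have e2: "I A + ennreal (2 * \<epsilon>) * emeasure M A = (\<integral>\<^sup>+y\<in>A. (?\<theta> y + ennreal (2 * \<epsilon>)) \<partial>M)"
        unfolding I_def using A(1)
        by (subst nn_integral_cmult_indicator [symmetric], simp)
           (simp add: nn_integral_add [symmetric] distrib_right)
      have "emeasure N A \<le> ennreal (\<theta> x + \<epsilon>) * emeasure M A" using r(2) [OF x A] by simp
      also have "\<dots> = (\<integral>\<^sup>+y\<in>A. ennreal (\<theta> x + \<epsilon>) \<partial>M)"
        using A(1) by (simp add: nn_integral_cmult_indicator)
      also have "\<dots> \<le> (\<integral>\<^sup>+y\<in>A. (?\<theta> y + ennreal (2 * \<epsilon>)) \<partial>M)"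
      proof (rule nn_integral_mono)
        fix y
        show "ennreal (\<theta> x + \<epsilon>) * indicator A y \<le> (?\<theta> y + ennreal (2 * \<epsilon>)) * indicator A y"
        proof (cases "y \<in> A")
          case True
          then have y: "y \<in> K \<inter> ball x (r x)" using A(2) by (rule subsetD [rotated])
          have "\<bar>\<theta> y - \<theta> x\<bar> < \<epsilon>" "y \<in> K" using r(3) [OF x y] y by simp_all
          then show ?thesis using True nonneg [of y] \<open>0 < \<epsilon>\<close>
            by (auto simp: ennreal_plus [symmetric] simp del: ennreal_plus intro!: ennreal_leI)
        qed simp
      qed
      finally show "emeasure N A \<le> I A + ennreal (2 * \<epsilon>) * emeasure M A" by (simp add: e2)
      have "I A \<le> (\<integral>\<^sup>+y\<in>A. ennreal (\<theta> x + \<epsilon>) \<partial>M)"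
        unfolding I_def
      proof (rule nn_integral_mono)
        fix y
        show "?\<theta> y * indicator A y \<le> ennreal (\<theta> x + \<epsilon>) * indicator A y"
        proof (cases "y \<in> A")
          case True
          then have y: "y \<in> K \<inter> ball x (r x)" using A(2) by (rule subsetD [rotated])
          have "\<bar>\<theta> y - \<theta> x\<bar> < \<epsilon>" "y \<in> K" using r(3) [OF x y] y by simp_all
          then show ?thesis using True by (auto intro!: ennreal_leI)
        qed simp
      qed
      also have "\<dots> = ennreal (\<theta> x + \<epsilon>) * emeasure M A"
        using A(1) by (simp add: nn_integral_cmult_indicator)
      also have "\<dots> = ennreal (\<theta> x) * emeasure M A + ennreal \<epsilon> * emeasure M A"
        using nonneg [OF x] \<open>0 < \<epsilon>\<close> by (simp add: distrib_right)
      also have "\<dots> \<le> emeasure N A + ennreal \<epsilon> * emeasure M A + ennreal \<epsilon> * emeasure M A"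
        by (rule add_right_mono [OF conjunct2 [OF r(2) [OF x A]]])
      also have "\<dots> = emeasure N A + ennreal (2 * \<epsilon>) * emeasure M A"
      proof -
        have "ennreal (2 * \<epsilon>) = ennreal \<epsilon> + ennreal \<epsilon>"
          using ennreal_plus [of \<epsilon> \<epsilon>] \<open>0 < \<epsilon>\<close> by (simp del: ennreal_plus)
        then show ?thesis by (simp only: add.assoc distrib_right)
      qed
      finally show "I A \<le> emeasure N A + ennreal (2 * \<epsilon>) * emeasure M A" .
    qed
    have fin_union: "emeasure N A \<le> I A + ennreal (2 * \<epsilon>) * emeasure M A \<and> I A \<le> emeasure N A + ennreal (2 * \<epsilon>) * emeasure M A"
      if "finite X" "X \<subseteq> K" "A \<in> sets borel" "A \<subseteq> K" "A \<subseteq> (\<Union>x\<in>X. ball x (r x))" for X A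
      using that
    proof (induction X arbitrary: A)
      case empty
      then show ?case by (simp add: I_def)
    next
      case (insert x X)
      let ?A1 = "A \<inter> ball x (r x)" and ?A2 = "A - ball x (r x)"
      have s: "?A1 \<in> sets borel" "?A2 \<in> sets borel" using insert.prems(2) by simp_all
      have 1: "emeasure N ?A1 \<le> I ?A1 + ennreal (2 * \<epsilon>) * emeasure M ?A1 \<and> I ?A1 \<le> emeasure N ?A1 + ennreal (2 * \<epsilon>) * emeasure M ?A1"
      proof (rule small [of x, OF _ s(1)])
        show "x \<in> K" using insert.prems(1) by simp
        show "A \<inter> ball x (r x) \<subseteq> K \<inter> ball x (r x)" using insert.prems(3) by (rule Int_mono) simp
      qed
      have 2: "emeasure N ?A2 \<le> I ?A2 + ennreal (2 * \<epsilon>) * emeasure M ?A2 \<and> I ?A2 \<le> emeasure N ?A2 + ennreal (2 * \<epsilon>) * emeasure M ?A2"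
      proof (rule insert.IH [OF _ s(2)])
        show "A - ball x (r x) \<subseteq> (\<Union>x\<in>X. ball x (r x))" using insert.prems(4) by (simp add: Diff_subset_conv)
        show "X \<subseteq> K" using insert.prems(1) by simp
        show "A - ball x (r x) \<subseteq> K" using insert.prems(3) by (rule order_trans [OF Diff_subset])
      qed
      have A: "A = ?A1 \<union> ?A2" by blast
      have N: "emeasure N A = emeasure N ?A1 + emeasure N ?A2"
        by (subst A, rule plus_emeasure [symmetric]) (use s in auto)
      have M: "emeasure M A = emeasure M ?A1 + emeasure M ?A2"
        by (subst A, rule plus_emeasure [symmetric]) (use s in auto)
      have I: "I A = I ?A1 + I ?A2"
        by (subst A, rule I_Un) (use s in auto)
      show ?case
        unfolding N M I using add_mono [OF conjunct1 [OF 1] conjunct1 [OF 2]]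
          add_mono [OF conjunct2 [OF 1] conjunct2 [OF 2]]
        by (simp add: algebra_simps)
    qed
    obtain X where "finite X" "X \<subseteq> K" "K \<subseteq> (\<Union>x\<in>X. ball x (r x))"
      using K r(1) by (rule_tac compactE_image [of K K "\<lambda>x. ball x (r x)"]) auto
    then show ?thesis using that by (intro fin_union [of X]) auto
  qed
  have "emeasure M A < top"
    using emeasure_mono [OF A(2), of M] fin by (simp add: le_less_trans)
  then obtain m where m: "emeasure M A = ennreal m" "0 \<le> m"
    by (cases "emeasure M A") (auto simp: less_top)
  \<comment> \<open>The choice \<open>\<epsilon> = e / (2 * m + 1)\<close> makes the error at most
    \<open>e\<close>; the \<open>+ 1\<close> covers \<open>m = 0\<close>.\<close>
  have eps: "ennreal (2 * (e / (2 * m + 1))) * emeasure M A \<le> ennreal e" if "0 < e" for e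
  proof -
    have "2 * (e / (2 * m + 1)) * m \<le> e" using that m(2) by (simp add: field_simps)
    then show ?thesis using that m by (simp add: ennreal_mult [symmetric] ennreal_leI)
  qed
  have pos: "0 < e / (2 * m + 1)" if "0 < e" for e using that m(2) by simp
  have "emeasure N A = I A"
  proof (rule antisym; rule ennreal_le_epsilon)
    fix e :: real assume e: "0 < e"
    show "emeasure N A \<le> I A + ennreal e" "I A \<le> emeasure N A + ennreal e"
      using main [OF pos [OF e] A] add_left_mono [OF eps [OF e]] by (meson order_trans)+
  qed
  also have "I A = (\<integral>\<^sup>+x\<in>A. ennreal (\<theta> x) \<partial>M)"
    unfolding I_def using A(2) by (intro nn_integral_cong) (auto simp: indicator_def)
  finally show ?thesis .
qed

text \<open>The double integral of \<open>indicator A x * indicator B (x + y)\<close> is computed in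
  two ways. Integrating over \<open>y\<close> at once gives the left side. Shifting \<open>x\<close>
  by \<open>- y\<close> and then integrating \<open>indicator A (x - y)\<close> over
  \<open>y\<close>, by translation and reflection invariance of Lebesgue measure, gives the right
  side.\<close>

lemma translation_invariant_measure_unique:
  fixes M :: "'a::euclidean_space measure"
  assumes sets [measurable_cong, simp]: "sets M = sets borel" and "sigma_finite_measure M"
    and inv: "\<And>v. distr M borel (\<lambda>x. v + x) = M"
    and A [measurable]: "A \<in> sets borel" and B [measurable]: "B \<in> sets borel"
  shows "emeasure M A * emeasure lborel B = emeasure M B * emeasure lborel A"
proof -
  interpret M: sigma_finite_measure M by fact
  interpret pair_sigma_finite M lborel ..
  have [simp]: "space M = UNIV" using sets_eq_imp_space_eq [OF sets(1)] by simp
  have invM: "(\<integral>\<^sup>+x. f (v + x) \<partial>M) = (\<integral>\<^sup>+x. f x \<partial>M)" if [measurable]: "f \<in> borel_measurable borel" for f v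
    by (subst (2) inv [of v, symmetric]) (simp add: nn_integral_distr)
  have invL: "(\<integral>\<^sup>+y. f (v + y) \<partial>lborel) = (\<integral>\<^sup>+y. f y \<partial>lborel)"
    if [measurable]: "f \<in> borel_measurable borel" for f :: "'a \<Rightarrow> ennreal" and v
  proof -
    have "(\<integral>\<^sup>+y. f (v + y) \<partial>lborel) = (\<integral>\<^sup>+y. f y \<partial>distr lborel borel ((+) v))"
      by (simp add: nn_integral_distr)
    then show ?thesis by (simp add: lborel_distr_plus)
  qed
  have refL: "(\<integral>\<^sup>+y. f (v - y) \<partial>lborel) = (\<integral>\<^sup>+y. f y \<partial>lborel)"
    if [measurable]: "f \<in> borel_measurable borel" for f :: "'a \<Rightarrow> ennreal" and v
    by (subst (2) lborel_affine [of "- 1" v]) (auto simp: nn_integral_density nn_integral_distr)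
  have "emeasure M A * emeasure lborel B = (\<integral>\<^sup>+x. indicator A x * (\<integral>\<^sup>+y. indicator B (x + y) \<partial>lborel) \<partial>M)"
    using invL [of "indicator B"] by (simp add: nn_integral_multc)
  also have "\<dots> = (\<integral>\<^sup>+x. \<integral>\<^sup>+y. indicator A x * indicator B (x + y) \<partial>lborel \<partial>M)"
    by (intro nn_integral_cong) (simp add: nn_integral_cmult)
  also have "\<dots> = (\<integral>\<^sup>+y. \<integral>\<^sup>+x. indicator A x * indicator B (x + y) \<partial>M \<partial>lborel)"
    by (subst Fubini') auto
  also have "\<dots> = (\<integral>\<^sup>+y. \<integral>\<^sup>+x. indicator A (x - y) * indicator B x \<partial>M \<partial>lborel)"
  proof (rule nn_integral_cong)
    fix y
    show "(\<integral>\<^sup>+x. indicator A x * indicator B (x + y) \<partial>M) = (\<integral>\<^sup>+x. indicator A (x - y) * indicator B x \<partial>M)"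
      using invM [of "\<lambda>x. indicator A (x - y) * indicator B x" y] by (simp add: add.commute)
  qed
  also have "\<dots> = (\<integral>\<^sup>+x. \<integral>\<^sup>+y. indicator B x * indicator A (x - y) \<partial>lborel \<partial>M)"
    by (subst Fubini') (auto simp: mult.commute)
  also have "\<dots> = (\<integral>\<^sup>+x. indicator B x * emeasure lborel A \<partial>M)"
    by (intro nn_integral_cong) (simp add: nn_integral_cmult refL [of "indicator A"])
  also have "\<dots> = emeasure M B * emeasure lborel A"
    by (simp add: nn_integral_multc)
  finally show ?thesis .
qed

section \<open>Finiteness on bounded parts of hyperplanes\<close>

text \<open>The outer measure is defined with sequences of sets; a finite cover is padded with empty
  sets, which cost nothing.\<close>

lemma hausdorff_pre_finite_cover:
  assumes "finite I" "A \<subseteq> (\<Union>i\<in>I. C i)" "\<And>i. i \<in> I \<Longrightarrow> bounded (C i)"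
    "\<And>i. i \<in> I \<Longrightarrow> diameter (C i) \<le> \<delta>" "0 \<le> \<delta>"
  shows "hausdorff_pre \<delta> d A \<le> (\<Sum>i\<in>I. hausdorff_content d (C i))"
proof -
  obtain h where h: "bij_betw h {0..<card I} I" using ex_bij_betw_nat_finite [OF \<open>finite I\<close>] by blast
  define D where "D m = (if m < card I then C (h m) else {})" for m
  have hI: "h m \<in> I" if "m < card I" for m using h that by (auto simp: bij_betw_def)
  have "(\<Union>i\<in>I. C i) \<subseteq> (\<Union>m. D m)"
  proof
    fix x assume "x \<in> (\<Union>i\<in>I. C i)"
    then obtain i where i: "i \<in> I" "x \<in> C i" by blast
    moreover have "i \<in> h ` {0..<card I}" using i h by (simp add: bij_betw_def)
    ultimately obtain m where "m < card I" "i = h m" by auto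
    then have "x \<in> D m" using i by (simp add: D_def)
    then show "x \<in> (\<Union>m. D m)" by blast
  qed
  then have "hausdorff_pre \<delta> d A \<le> (\<Sum>m. hausdorff_content d (D m))"
    using assms hI by (intro hausdorff_pre_le) (auto simp: D_def)
  also have "\<dots> = (\<Sum>m\<in>{0..<card I}. hausdorff_content d (D m))"
    by (rule suminf_finite) (auto simp: D_def)
  also have "\<dots> = (\<Sum>m\<in>{0..<card I}. hausdorff_content d (C (h m)))"
    by (rule sum.cong) (auto simp: D_def)
  also have "\<dots> = (\<Sum>i\<in>I. hausdorff_content d (C i))"
    by (rule sum.reindex_bij_betw [OF h])
  finally show ?thesis .
qed

text \<open>The cube is cut into \<open>N ^ (CARD('n) - 1)\<close> cells of diameter at most
  \<open>n / N\<close>, so the bound \<open>b\<close> on the total content does not depend on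
  \<open>N\<close>.\<close>

lemma hausdorff_outer_coordinate_cube_finite:
  fixes i :: "'n::finite"
  shows "hausdorff_outer (CARD('n) - 1) {x :: real ^ 'n. x $ i = 0 \<and> (\<forall>j. 0 \<le> x $ j \<and> x $ j \<le> 1)} < top"
proof -
  let ?d = "CARD('n) - 1" and ?Q = "{x :: real ^ 'n. x $ i = 0 \<and> (\<forall>j. 0 \<le> x $ j \<and> x $ j \<le> 1)}"
  let ?n = "real CARD('n)"
  define b where "b = unit_ball_vol (real ?d) * (?n / 2) ^ ?d"
  have "hausdorff_pre \<delta> ?d ?Q \<le> ennreal b" if \<delta>: "0 < \<delta>" for \<delta>
  proof -
    obtain N :: nat where N: "?n / \<delta> < real N" using reals_Archimedean2 by blast
    then have N0: "real N > 0" using \<delta> by (meson divide_nonneg_pos le_less_trans of_nat_0_le_iff)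
    have N1: "?n / real N \<le> \<delta>" using N \<delta> N0 by (simp add: field_simps)
    let ?I = "PiE (UNIV - {i}) (\<lambda>_. {0..<N})"
    define C where "C k = {x :: real ^ 'n. x $ i = 0 \<and> (\<forall>j. j \<noteq> i \<longrightarrow> real (k j) / N \<le> x $ j \<and> x $ j \<le> (real (k j) + 1) / N)}"
      for k :: "'n \<Rightarrow> nat"
    have nrm: "norm (x - y) \<le> ?n / N" if "x \<in> C k" "y \<in> C k" for x y k
    proof -
      have "norm (x - y) \<le> (\<Sum>j\<in>UNIV. \<bar>(x - y) $ j\<bar>)" by (rule norm_le_l1_cart)
      also have "\<dots> \<le> (\<Sum>j\<in>(UNIV::'n set). 1 / N)"
      proof (rule sum_mono)
        fix j
        have "\<bar>x $ j - y $ j\<bar> \<le> (real (k j) + 1) / N - real (k j) / N" if "j \<noteq> i"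
        proof -
          have "real (k j) / N \<le> x $ j" "x $ j \<le> (real (k j) + 1) / N"
            "real (k j) / N \<le> y $ j" "y $ j \<le> (real (k j) + 1) / N"
            using that \<open>x \<in> C k\<close> \<open>y \<in> C k\<close> by (auto simp: C_def)
          then show ?thesis by linarith
        qed
        moreover have "(real (k j) + 1) / N - real (k j) / N = 1 / N" by (simp add: diff_divide_distrib [symmetric])
        moreover have "x $ i = 0" "y $ i = 0" using \<open>x \<in> C k\<close> \<open>y \<in> C k\<close> by (auto simp: C_def)
        ultimately show "\<bar>(x - y) $ j\<bar> \<le> 1 / N" by (cases "j = i") auto
      qed
      finally show ?thesis by simp
    qed
    have bd: "bounded (C k)" for k unfolding bounded_two_points dist_norm using nrm by blast
    have dm: "diameter (C k) \<le> ?n / N" for k by (rule diameter_le [OF _ nrm]) auto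
    have cover: "?Q \<subseteq> (\<Union>k\<in>?I. C k)"
    proof
      fix x assume x: "x \<in> ?Q"
      \<comment> \<open>The cap \<open>N - 1\<close> puts the points with a coordinate equal to 1
        into the last cell.\<close>
      define k where "k = (\<lambda>j\<in>UNIV - {i}. min (N - 1) (nat \<lfloor>real N * x $ j\<rfloor>))"
      have "k \<in> ?I" using N0 by (auto simp: k_def)
      moreover have "x \<in> C k"
      proof -
        have "real (k j) / N \<le> x $ j \<and> x $ j \<le> (real (k j) + 1) / N" if "j \<noteq> i" for j
        proof -
          have x01: "0 \<le> x $ j" "x $ j \<le> 1" using x by auto
          have f: "real (nat \<lfloor>real N * x $ j\<rfloor>) \<le> real N * x $ j" "real N * x $ j < real (nat \<lfloor>real N * x $ j\<rfloor>) + 1"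
            using x01 N0 by (auto simp: of_nat_nat)
          have le: "real N * x $ j \<le> real N" using x01 N0 by (simp add: mult_left_le)
          have "real (k j) \<le> real N * x $ j \<and> real N * x $ j \<le> real (k j) + 1"
            using f le that N0 by (auto simp: k_def min_def of_nat_diff)
          then show ?thesis using N0 by (simp add: field_simps)
        qed
        then show ?thesis using x by (auto simp: C_def)
      qed
      ultimately show "x \<in> (\<Union>k\<in>?I. C k)" by blast
    qed
    have "hausdorff_pre \<delta> ?d ?Q \<le> (\<Sum>k\<in>?I. hausdorff_content ?d (C k))"
      using cover bd dm N1 \<delta> by (intro hausdorff_pre_finite_cover) (auto intro: order_trans [OF dm N1] finite_PiE)
    also have "\<dots> \<le> (\<Sum>k\<in>?I. ennreal (unit_ball_vol (real ?d) * ((?n / N) / 2) ^ ?d))"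
      using dm diameter_ge_0 [OF bd]
      by (intro sum_mono) (auto simp: hausdorff_content_def intro!: ennreal_leI mult_left_mono power_mono divide_right_mono)
    also have "\<dots> = ennreal (real N ^ ?d * (unit_ball_vol (real ?d) * ((?n / N) / 2) ^ ?d))"
      by (simp add: card_PiE prod_constant card_Diff_singleton ennreal_of_nat_eq_real_of_nat ennreal_mult)
    also have "real N ^ ?d * (unit_ball_vol (real ?d) * ((?n / N) / 2) ^ ?d) = b"
      using N0 by (simp add: b_def power_divide field_simps)
    finally show ?thesis .
  qed
  then have "hausdorff_outer ?d ?Q \<le> ennreal b"
    unfolding hausdorff_outer_SUP by (intro SUP_least) auto
  then show ?thesis by (simp add: le_less_trans)
qed

lemma hausdorff_outer_hyperplane_finite:
  fixes e :: "real ^ 'n::finite"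
  assumes e: "norm e = 1" and "bounded B"
  shows "hausdorff_outer (CARD('n) - 1) ({x. x \<bullet> e = 0} \<inter> B) < top"
proof -
  let ?d = "CARD('n) - 1"
  obtain i :: 'n where True by simp
  let ?Q = "{x :: real ^ 'n. x $ i = 0 \<and> (\<forall>j. 0 \<le> x $ j \<and> x $ j \<le> 1)}"
  obtain R where R: "R > 0" "\<And>x. x \<in> B \<Longrightarrow> norm x \<le> R" using \<open>bounded B\<close> bounded_pos by metis
  have norm_axis_i: "norm (axis i 1 :: real ^ 'n) = 1" by (simp add: norm_eq_1 inner_axis_axis)
  obtain f :: "real ^ 'n \<Rightarrow> real ^ 'n" where f: "orthogonal_transformation f" "f (axis i 1) = e"
    by (rule orthogonal_transformation_exists_1 [OF norm_axis_i e])
  have lin: "linear f" using f(1) by (rule orthogonal_transformation_linear)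
  \<comment> \<open>\<open>o1\<close> centres the cube within the hyperplane: \<open>h\<close> maps
    the unit cube affinely onto the cube of half-width \<open>R\<close>, with coordinate
    \<open>i\<close> kept at 0, and then rotates.\<close>
  define o1 where "o1 = (\<chi> j. if j = i then 0 else (1::real))"
  define h where "h x = f ((2 * R) *\<^sub>R x - R *\<^sub>R o1)" for x
  have "{x. x \<bullet> e = 0} \<inter> B \<subseteq> h ` ?Q"
  proof
    fix x assume x: "x \<in> {x. x \<bullet> e = 0} \<inter> B"
    obtain y where y: "x = f y" using orthogonal_transformation_surj [OF f(1)] by auto
    have "norm y \<le> R" using R(2) x y orthogonal_transformation_norm [OF f(1)] by (metis IntE)
    have "f y \<bullet> f (axis i 1) = y \<bullet> axis i 1" using f(1) by (simp add: orthogonal_transformation_def)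
    then have "y $ i = 0" using x f(2) y by (simp add: inner_axis)
    have yj: "0 \<le> y $ j + R" "y $ j + R \<le> 2 * R" for j
      using component_le_norm_cart [of y j] \<open>norm y \<le> R\<close> by linarith+
    let ?z = "(1 / (2 * R)) *\<^sub>R (y + R *\<^sub>R o1)"
    have "0 \<le> ?z $ j \<and> ?z $ j \<le> 1" for j
      using yj [of j] R(1) by (cases "j = i") (simp_all add: o1_def \<open>y $ i = 0\<close>)
    moreover have "?z $ i = 0" by (simp add: o1_def \<open>y $ i = 0\<close>)
    ultimately have "?z \<in> ?Q" by blast
    moreover have "x = h ?z" using R(1) by (simp add: h_def y)
    ultimately show "x \<in> h ` ?Q" by (rule rev_image_eqI)
  qed
  then have "hausdorff_outer ?d ({x. x \<bullet> e = 0} \<inter> B) \<le> hausdorff_outer ?d (h ` ?Q)"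
    by (rule hausdorff_outer_mono)
  also have "\<dots> \<le> ennreal ((2 * R) ^ ?d) * hausdorff_outer ?d ?Q"
  proof (rule hausdorff_outer_lipschitz_image)
    fix x y
    have "h x - h y = f ((2 * R) *\<^sub>R (x - y))"
      by (simp add: h_def linear_diff [OF lin, symmetric] algebra_simps)
    then show "norm (h x - h y) \<le> 2 * R * norm (x - y)"
      using R(1) orthogonal_transformation_norm [OF f(1)] by simp
  qed (use R in simp)
  also have "\<dots> < top"
    using hausdorff_outer_coordinate_cube_finite [of i] by (simp add: ennreal_mult_less_top)
  finally show ?thesis .
qed

subsection \<open>Slicing Lebesgue measure by hyperplanes\<close>

text \<open>A density on the whole space rather than a measure on the hyperplane, so that it is a
  Borel measure to which products and translations of the ambient space apply.\<close>

definition hyperplane_measure :: "real ^ 'n::finite \<Rightarrow> (real ^ 'n) measure" where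
  "hyperplane_measure e = density (hausdorff_measure (CARD('n) - 1)) (indicator {x. x \<bullet> e = 0})"

text \<open>The product of the measure on the hyperplane orthogonal to \<open>e\<close> with length
  in direction \<open>e\<close>, carried over by addition. It is translation invariant, hence a
  multiple of Lebesgue measure.\<close>

definition slab_measure :: "real ^ 'n::finite \<Rightarrow> (real ^ 'n) measure" where
  "slab_measure e = distr (hyperplane_measure e \<Otimes>\<^sub>M lborel) borel (\<lambda>(x, t). x + t *\<^sub>R e)"

lemma sets_hyperplane_measure [simp, measurable_cong]: "sets (hyperplane_measure e) = sets borel"
  by (simp add: hyperplane_measure_def)

lemma space_hyperplane_measure [simp]: "space (hyperplane_measure e) = UNIV"
  by (simp add: hyperplane_measure_def)

lemma sets_slab_measure [simp, measurable_cong]: "sets (slab_measure e) = sets borel"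
  by (simp add: slab_measure_def)

lemma space_slab_measure [simp]: "space (slab_measure e) = UNIV"
  by (simp add: slab_measure_def)

lemma emeasure_hyperplane_measure:
  fixes e :: "real ^ 'n::finite"
  assumes [measurable]: "A \<in> sets borel"
  shows "emeasure (hyperplane_measure e) A = hausdorff_outer (CARD('n) - 1) {x \<in> A. x \<bullet> e = 0}"
proof -
  have "emeasure (hyperplane_measure e) A = (\<integral>\<^sup>+x. indicator {x. x \<bullet> e = 0} x * indicator A x \<partial>hausdorff_measure (CARD('n) - 1))"
    unfolding hyperplane_measure_def by (rule emeasure_density) auto
  also have "\<dots> = (\<integral>\<^sup>+x. indicator {x \<in> A. x \<bullet> e = 0} x \<partial>hausdorff_measure (CARD('n) - 1))"
    by (rule nn_integral_cong) (auto simp: indicator_def)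
  also have "\<dots> = hausdorff_outer (CARD('n) - 1) {x \<in> A. x \<bullet> e = 0}"
    by (subst nn_integral_indicator) (auto simp: emeasure_hausdorff_measure)
  finally show ?thesis .
qed

lemma sigma_finite_measure_bounded:
  fixes M :: "'a::euclidean_space measure"
  assumes "sets M = sets borel" "\<And>R. emeasure M (cball 0 R) < \<infinity>"
  shows "sigma_finite_measure M"
proof
  have sp: "space M = UNIV" using sets_eq_imp_space_eq [OF assms(1)] by simp
  have "\<exists>n. norm x \<le> real n" for x :: 'a by (rule real_arch_simple)
  then have "(\<Union>n. cball (0::'a) (real n)) = UNIV" by auto
  then show "\<exists>A. countable A \<and> A \<subseteq> sets M \<and> \<Union>A = space M \<and> (\<forall>a\<in>A. emeasure M a \<noteq> \<infinity>)"
    using assms sp by (intro exI [of _ "range (\<lambda>n. cball 0 (real n))"]) (auto simp: less_top)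
qed

lemma sigma_finite_hyperplane_measure:
  fixes e :: "real ^ 'n::finite"
  assumes "norm e = 1" shows "sigma_finite_measure (hyperplane_measure e)"
proof (rule sigma_finite_measure_bounded)
  fix R
  have "{x \<in> cball 0 R. x \<bullet> e = 0} = {x. x \<bullet> e = 0} \<inter> cball 0 R" by auto
  then show "emeasure (hyperplane_measure e) (cball 0 R) < \<infinity>"
    using hausdorff_outer_hyperplane_finite [OF assms, of "cball 0 R"]
    by (simp add: emeasure_hyperplane_measure)
qed simp

lemma slab_map_measurable [measurable]:
  fixes e :: "real ^ 'n::finite"
  shows "(\<lambda>(x, t). x + t *\<^sub>R e) \<in> measurable (hyperplane_measure e' \<Otimes>\<^sub>M lborel) borel"
  by measurable

context
  fixes e :: "real ^ 'n::finite"
  assumes e: "norm e = 1"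
begin

interpretation pair_sigma_finite "hyperplane_measure e" lborel
  using sigma_finite_hyperplane_measure [OF e] by (intro pair_sigma_finite.intro sigma_finite_lborel)

lemma slab_preimage_sets:
  assumes "A \<in> sets borel"
  shows "{(x, t). x + t *\<^sub>R e \<in> A} \<in> sets (hyperplane_measure e \<Otimes>\<^sub>M lborel)"
proof -
  have "(\<lambda>(x, t). x + t *\<^sub>R e) -` A \<inter> space (hyperplane_measure e \<Otimes>\<^sub>M lborel) \<in> sets (hyperplane_measure e \<Otimes>\<^sub>M lborel)"
    using assms by (rule measurable_sets [OF slab_map_measurable])
  then show ?thesis by (simp add: space_pair_measure vimage_def case_prod_unfold)
qed

lemma emeasure_slab_measure_pair:
  assumes "A \<in> sets borel"
  shows "emeasure (slab_measure e) A = emeasure (hyperplane_measure e \<Otimes>\<^sub>M lborel) {(x, t). x + t *\<^sub>R e \<in> A}"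
  unfolding slab_measure_def
  by (subst emeasure_distr [OF slab_map_measurable assms])
    (simp add: space_pair_measure vimage_def case_prod_unfold)

text \<open>Slices orthogonal to \<open>e\<close> come out in this order of integration;
  translations and rotations act on them as isometries, up to a shift of \<open>t\<close>.\<close>

lemma emeasure_slab_measure_1:
  assumes "A \<in> sets borel"
  shows "emeasure (slab_measure e) A = (\<integral>\<^sup>+t. hausdorff_outer (CARD('n) - 1) {x. x \<bullet> e = 0 \<and> x + t *\<^sub>R e \<in> A} \<partial>lborel)"
  unfolding emeasure_slab_measure_pair [OF assms]
proof (subst emeasure_pair_measure_alt2 [OF slab_preimage_sets [OF assms]], rule nn_integral_cong)
  fix t
  have "emeasure (hyperplane_measure e) {x. x + t *\<^sub>R e \<in> A}
      = hausdorff_outer (CARD('n) - 1) {x \<in> {x. x + t *\<^sub>R e \<in> A}. x \<bullet> e = 0}"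
    by (rule emeasure_hyperplane_measure) (use assms in measurable)
  moreover have "{x \<in> {x. x + t *\<^sub>R e \<in> A}. x \<bullet> e = 0} = {x. x \<bullet> e = 0 \<and> x + t *\<^sub>R e \<in> A}" by auto
  ultimately show "emeasure (hyperplane_measure e) ((\<lambda>x. (x, t)) -` {(x, t). x + t *\<^sub>R e \<in> A})
      = hausdorff_outer (CARD('n) - 1) {x. x \<bullet> e = 0 \<and> x + t *\<^sub>R e \<in> A}"
    by (simp add: vimage_def)
qed

lemma measurable_slab_section:
  assumes "A \<in> sets borel"
  shows "(\<lambda>t. hausdorff_outer (CARD('n) - 1) {x. x \<bullet> e = 0 \<and> x + t *\<^sub>R e \<in> A}) \<in> borel_measurable borel"
proof -
  have "(\<lambda>t. emeasure (hyperplane_measure e) ((\<lambda>x. (x, t)) -` {(x, t). x + t *\<^sub>R e \<in> A})) \<in> borel_measurable lborel"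
    by (rule measurable_emeasure_Pair2 [OF slab_preimage_sets [OF assms]])
  moreover have "emeasure (hyperplane_measure e) ((\<lambda>x. (x, t)) -` {(x, t). x + t *\<^sub>R e \<in> A})
      = hausdorff_outer (CARD('n) - 1) {x. x \<bullet> e = 0 \<and> x + t *\<^sub>R e \<in> A}" for t
  proof -
    have "emeasure (hyperplane_measure e) {x. x + t *\<^sub>R e \<in> A}
        = hausdorff_outer (CARD('n) - 1) {x \<in> {x. x + t *\<^sub>R e \<in> A}. x \<bullet> e = 0}"
      by (rule emeasure_hyperplane_measure) (use assms in measurable)
    moreover have "{x \<in> {x. x + t *\<^sub>R e \<in> A}. x \<bullet> e = 0} = {x. x \<bullet> e = 0 \<and> x + t *\<^sub>R e \<in> A}" by auto
    ultimately show ?thesis by (simp add: vimage_def)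
  qed
  ultimately show ?thesis by simp
qed

text \<open>By lines parallel to \<open>e\<close> instead: this is how a prism is measured along its
  edges.\<close>

lemma emeasure_slab_measure_2:
  assumes "A \<in> sets borel"
  shows "emeasure (slab_measure e) A = (\<integral>\<^sup>+x. emeasure lborel {t. x + t *\<^sub>R e \<in> A} \<partial>hyperplane_measure e)"
  unfolding emeasure_slab_measure_pair [OF assms]
  by (subst lborel.emeasure_pair_measure_alt [OF slab_preimage_sets [OF assms]]) (simp add: vimage_def)

lemma slab_measure_cball_finite: "emeasure (slab_measure e) (cball 0 R) < \<infinity>"
proof -
  let ?d = "CARD('n) - 1"
  let ?b = "hausdorff_outer ?d ({x. x \<bullet> e = 0} \<inter> cball 0 R)"
  have sub: "{x. x \<bullet> e = 0 \<and> x + t *\<^sub>R e \<in> cball 0 R} \<subseteq> (if \<bar>t\<bar> \<le> R then {x. x \<bullet> e = 0} \<inter> cball 0 R else {})" for t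
  proof
    fix x assume "x \<in> {x. x \<bullet> e = 0 \<and> x + t *\<^sub>R e \<in> cball 0 R}"
    then have x: "x \<bullet> e = 0" "norm (x + t *\<^sub>R e) \<le> R" by auto
    have "(norm (x + t *\<^sub>R e))\<^sup>2 = (norm x)\<^sup>2 + t\<^sup>2"
      unfolding power2_norm_eq_inner
      using x(1) e by (simp add: inner_add_left inner_add_right inner_commute norm_eq_1 power2_eq_square)
    then have "(norm x)\<^sup>2 \<le> (norm (x + t *\<^sub>R e))\<^sup>2" "\<bar>t\<bar>\<^sup>2 \<le> (norm (x + t *\<^sub>R e))\<^sup>2" by simp_all
    then have "norm x \<le> norm (x + t *\<^sub>R e)" "\<bar>t\<bar> \<le> norm (x + t *\<^sub>R e)"
      by (meson norm_ge_zero power2_le_imp_le)+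
    then show "x \<in> (if \<bar>t\<bar> \<le> R then {x. x \<bullet> e = 0} \<inter> cball 0 R else {})" using x by auto
  qed
  have "emeasure (slab_measure e) (cball 0 R) \<le> (\<integral>\<^sup>+t. ?b * indicator {- R..R} t \<partial>lborel)"
  proof (subst emeasure_slab_measure_1, simp, rule nn_integral_mono)
    fix t
    show "hausdorff_outer ?d {x. x \<bullet> e = 0 \<and> x + t *\<^sub>R e \<in> cball 0 R} \<le> ?b * indicator {- R..R} t"
    proof (cases "\<bar>t\<bar> \<le> R")
      case True
      then show ?thesis using hausdorff_outer_mono [OF sub [of t], of ?d] by (auto simp: indicator_def)
    next
      case False
      then show ?thesis using hausdorff_outer_mono [OF sub [of t], of ?d] by simp
    qed
  qed
  also have "\<dots> = ?b * emeasure lborel {- R..R}" by (rule nn_integral_cmult_indicator) simp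
  also have "\<dots> < \<infinity>"
  proof -
    have "emeasure lborel {- R..R} < top" by (cases "- R \<le> R") auto
    then show ?thesis
      using hausdorff_outer_hyperplane_finite [OF e, of "cball 0 R"] by (simp add: ennreal_mult_less_top)
  qed
  finally show ?thesis .
qed

text \<open>Split \<open>v\<close> into \<open>w\<close> in the hyperplane and
  \<open>s *\<^sub>R e\<close>: \<open>w\<close> moves each slice isometrically and \<open>s\<close>
  shifts the parameter of the slices.\<close>

lemma slab_measure_translation: "distr (slab_measure e) borel (\<lambda>x. v + x) = slab_measure e"
proof (rule measure_eqI)
  fix A assume "A \<in> sets (distr (slab_measure e) borel (\<lambda>x. v + x))"
  then have A [measurable]: "A \<in> sets borel" by simp
  let ?d = "CARD('n) - 1"
  define s where "s = v \<bullet> e"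
  define w where "w = v - s *\<^sub>R e"
  have w: "w \<bullet> e = 0" using e by (simp add: w_def s_def inner_diff_left norm_eq_1)
  have [measurable]: "(\<lambda>x. v + x) \<in> borel_measurable (borel :: (real ^ 'n) measure)" by measurable
  have A': "{x. v + x \<in> A} \<in> sets borel" by measurable
  \<comment> \<open>The shape \<open>s + 1 * t\<close> is that of
    \<open>nn_integral_real_affine\<close> with factor 1.\<close>
  have sec: "hausdorff_outer ?d {x. x \<bullet> e = 0 \<and> x + t *\<^sub>R e \<in> {x. v + x \<in> A}}
      = hausdorff_outer ?d {x. x \<bullet> e = 0 \<and> x + (s + 1 * t) *\<^sub>R e \<in> A}" for t
  proof -
    have "{x. x \<bullet> e = 0 \<and> x + (s + 1 * t) *\<^sub>R e \<in> A} = (\<lambda>x. w + x) ` {x. x \<bullet> e = 0 \<and> x + t *\<^sub>R e \<in> {x. v + x \<in> A}}"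
      (is "?L = _ ` ?R")
    proof (intro set_eqI iffI)
      fix x assume "x \<in> ?L"
      then have "x - w \<in> ?R" using w by (auto simp: inner_diff_left w_def algebra_simps)
      then show "x \<in> (\<lambda>x. w + x) ` ?R" by (rule rev_image_eqI) simp
    qed (use w in \<open>auto simp: inner_add_left w_def algebra_simps\<close>)
    then show ?thesis by (simp only: hausdorff_outer_isometry [of ?R "\<lambda>x. w + x"] add_diff_cancel_left)
  qed
  have "emeasure (distr (slab_measure e) borel (\<lambda>x. v + x)) A = emeasure (slab_measure e) {x. v + x \<in> A}"
    by (subst emeasure_distr) (auto simp: vimage_def)
  also have "\<dots> = (\<integral>\<^sup>+t. hausdorff_outer ?d {x. x \<bullet> e = 0 \<and> x + (s + 1 * t) *\<^sub>R e \<in> A} \<partial>lborel)"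
    unfolding emeasure_slab_measure_1 [OF A'] sec ..
  also have "\<dots> = emeasure (slab_measure e) A"
    unfolding emeasure_slab_measure_1 [OF A]
    using nn_integral_real_affine [OF measurable_slab_section [OF A], of 1 s] by simp
  finally show "emeasure (distr (slab_measure e) borel (\<lambda>x. v + x)) A = emeasure (slab_measure e) A" .
qed simp

text \<open>Uniqueness of translation-invariant measures, calibrated on the unit ball.\<close>

lemma slab_measure_density:
  assumes c: "emeasure (slab_measure e) (cball 0 1) = ennreal c * emeasure lborel (cball (0 :: real ^ 'n) 1)"
  shows "slab_measure e = density lborel (\<lambda>_. ennreal c)"
proof (rule measure_eqI)
  fix A assume "A \<in> sets (slab_measure e)"
  then have A: "A \<in> sets borel" by simp
  let ?u = "emeasure lborel (cball (0 :: real ^ 'n) 1)"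
  have u: "?u \<noteq> 0" "?u \<noteq> top"
    using emeasure_cball [of 1 "0 :: real ^ 'n"] less_imp_neq [OF unit_ball_vol_pos [of "real CARD('n)"]] by simp_all
  have "emeasure (slab_measure e) A * ?u = emeasure (slab_measure e) (cball 0 1) * emeasure lborel A"
    by (rule translation_invariant_measure_unique)
      (use A slab_measure_translation slab_measure_cball_finite in \<open>auto intro!: sigma_finite_measure_bounded\<close>)
  then have "?u * emeasure (slab_measure e) A = ?u * (ennreal c * emeasure lborel A)"
    by (simp add: c mult_ac)
  then have "emeasure (slab_measure e) A = ennreal c * emeasure lborel A"
    using u by (simp add: ennreal_mult_cancel_left)
  then show "emeasure (slab_measure e) A = emeasure (density lborel (\<lambda>_. ennreal c)) A"
    using A by (simp add: emeasure_density_const)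
qed simp

end

section \<open>Independence of the direction\<close>

text \<open>Rotating \<open>e\<close> to \<open>e'\<close> maps the slices of the ball isometrically
  onto each other. The ball is the calibrating set, so the constants of all directions
  agree.\<close>

lemma slab_measure_rotate:
  fixes e e' :: "real ^ 'n::finite"
  assumes "norm e = 1" "norm e' = 1"
  shows "emeasure (slab_measure e) (cball 0 1) = emeasure (slab_measure e') (cball 0 1)"
proof -
  obtain f :: "real ^ 'n \<Rightarrow> real ^ 'n" where f: "orthogonal_transformation f" "f e = e'"
    by (rule orthogonal_transformation_exists_1 [OF assms])
  have lin: "linear f" using f(1) by (rule orthogonal_transformation_linear)
  have inner: "f x \<bullet> f y = x \<bullet> y" for x y using f(1) by (simp add: orthogonal_transformation_def)
  have *: "{x. x \<bullet> e' = 0 \<and> x + t *\<^sub>R e' \<in> cball 0 1} = f ` {x. x \<bullet> e = 0 \<and> x + t *\<^sub>R e \<in> cball 0 1}" for t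
  proof -
    have n: "norm (f x + t *\<^sub>R e') = norm (x + t *\<^sub>R e)" for x
      using orthogonal_transformation_norm [OF f(1), of "x + t *\<^sub>R e"]
      by (simp add: linear_add [OF lin] linear_cmul [OF lin] f(2))
    have "x \<in> f ` {x. x \<bullet> e = 0 \<and> x + t *\<^sub>R e \<in> cball 0 1}" if "x \<bullet> e' = 0" "norm (x + t *\<^sub>R e') \<le> 1" for x
    proof -
      obtain y where "x = f y" using orthogonal_transformation_surj [OF f(1)] by auto
      then show ?thesis using that n [of y] inner [of y e] f(2) by auto
    qed
    moreover have "f x \<bullet> e' = x \<bullet> e" for x using inner [of x e] f(2) by simp
    ultimately show ?thesis using n by auto
  qed
  have "hausdorff_outer (CARD('n) - 1) {x. x \<bullet> e' = 0 \<and> x + t *\<^sub>R e' \<in> cball 0 1}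
      = hausdorff_outer (CARD('n) - 1) {x. x \<bullet> e = 0 \<and> x + t *\<^sub>R e \<in> cball 0 1}" for t
    unfolding * by (rule hausdorff_outer_isometry)
      (metis lin linear_diff orthogonal_transformation_norm [OF f(1)])
  then show ?thesis
    by (simp add: emeasure_slab_measure_1 [OF assms(1)] emeasure_slab_measure_1 [OF assms(2)])
qed

lemma slab_measure_eq_density:
  "\<exists>c\<ge>0. \<forall>e :: real ^ 'n::finite. norm e = 1 \<longrightarrow> slab_measure e = density lborel (\<lambda>_. ennreal c)"
proof -
  obtain e0 :: "real ^ 'n" where e0: "norm e0 = 1" using vector_choose_size [of 1] by auto
  let ?u = "emeasure lborel (cball (0 :: real ^ 'n) 1)"
  have u: "?u \<noteq> 0" "?u \<noteq> top"
    using emeasure_cball [of 1 "0 :: real ^ 'n"] less_imp_neq [OF unit_ball_vol_pos [of "real CARD('n)"]] by simp_all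
  define c where "c = enn2real (emeasure (slab_measure e0) (cball 0 1) / ?u)"
  have "emeasure (slab_measure e0) (cball 0 1) < top"
    using slab_measure_cball_finite [OF e0] by simp
  then have "emeasure (slab_measure e0) (cball 0 1) / ?u < top"
    using u by (simp add: ennreal_divide_eq_top_iff less_top [symmetric])
  then have "ennreal c * ?u = emeasure (slab_measure e0) (cball 0 1)"
    using u by (simp add: c_def ennreal_divide_times mult_divide_eq_ennreal ennreal_mult_divide_eq less_top)
  note c = this
  show ?thesis
  proof (intro exI conjI allI impI)
    show "0 \<le> c" by (simp add: c_def)
    fix e :: "real ^ 'n" assume e: "norm e = 1"
    show "slab_measure e = density lborel (\<lambda>_. ennreal c)"
      by (rule slab_measure_density [OF e]) (simp only: c slab_measure_rotate [OF e e0])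
  qed
qed

text \<open>The number \<open>c\<close> for which Hausdorff measure times length is \<open>c\<close>
  times volume. It is chosen for all directions at once, as the comparison of two directions
  requires.\<close>

definition slab_factor :: "'n::finite itself \<Rightarrow> real" where
  "slab_factor _ = (SOME c. 0 \<le> c \<and>
     (\<forall>e :: real ^ 'n. norm e = 1 \<longrightarrow> slab_measure e = density lborel (\<lambda>_. ennreal c)))"

lemma slab_factor_properties:
  "0 \<le> slab_factor TYPE('n::finite) \<and>
    (\<forall>e :: real ^ 'n. norm e = 1 \<longrightarrow> slab_measure e = density lborel (\<lambda>_. ennreal (slab_factor TYPE('n))))"
  unfolding slab_factor_def by (rule someI_ex [OF slab_measure_eq_density])

lemmas slab_factor_nonneg = slab_factor_properties [THEN conjunct1]

lemmas slab_measure_slab_factor = slab_factor_properties [THEN conjunct2, rule_format]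

lemma integral_lborel_slab:
  fixes e :: "real ^ 'n::finite" and F :: "real ^ 'n \<Rightarrow> real"
  assumes e: "norm e = 1" and F: "integrable lborel F"
  shows "slab_factor TYPE('n) * (\<integral>x. F x \<partial>lborel)
      = (\<integral>x. (\<integral>t. F (x + t *\<^sub>R e) \<partial>lborel) \<partial>hyperplane_measure e)"
proof -
  interpret pair_sigma_finite "hyperplane_measure e" lborel
    using sigma_finite_hyperplane_measure [OF e] by (intro pair_sigma_finite.intro sigma_finite_lborel)
  have [measurable]: "F \<in> borel_measurable borel" using F by simp
  note eq = slab_measure_slab_factor [OF e]
  have "integrable (slab_measure e) F"
    unfolding eq using F by (subst integrable_density) (auto simp: slab_factor_nonneg)
  then have int: "integrable (hyperplane_measure e \<Otimes>\<^sub>M lborel) (\<lambda>z. F (case z of (x, t) \<Rightarrow> x + t *\<^sub>R e))"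
    unfolding slab_measure_def by (subst (asm) integrable_distr_eq) auto
  have "slab_factor TYPE('n) * (\<integral>x. F x \<partial>lborel) = (\<integral>x. F x \<partial>slab_measure e)"
    unfolding eq by (subst integral_density) (auto simp: slab_factor_nonneg)
  also have "\<dots> = (\<integral>z. F (case z of (x, t) \<Rightarrow> x + t *\<^sub>R e) \<partial>(hyperplane_measure e \<Otimes>\<^sub>M lborel))"
    unfolding slab_measure_def by (subst integral_distr) auto
  also have "\<dots> = (\<integral>x. (\<integral>t. F (x + t *\<^sub>R e) \<partial>lborel) \<partial>hyperplane_measure e)"
    using integral_fst' [OF int] by simp
  finally show ?thesis .
qed

text \<open>
  Both sides are the volume of the oblique prism \<open>A + [0, 1] e\<close>, once sliced along \<open>e\<close> and once along
  \<open>\<nu>\<close>.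
\<close>

lemma hausdorff_outer_oblique_projection:
  fixes e \<nu> :: "real ^ 'n::finite"
  assumes e: "norm e = 1" and \<nu>: "norm \<nu> = 1" and pos: "e \<bullet> \<nu> > 0"
    and A [measurable]: "A \<in> sets borel" and sub: "A \<subseteq> {x. x \<bullet> \<nu> = 0}"
  shows "hausdorff_outer (CARD('n) - 1) {x. x \<bullet> e = 0 \<and> x - ((x \<bullet> \<nu>) / (e \<bullet> \<nu>)) *\<^sub>R e \<in> A}
      = ennreal (e \<bullet> \<nu>) * hausdorff_outer (CARD('n) - 1) A"
proof -
  let ?d = "CARD('n) - 1"
  let ?\<Phi> = "\<lambda>x. x - ((x \<bullet> \<nu>) / (e \<bullet> \<nu>)) *\<^sub>R e"
  have [measurable]: "?\<Phi> \<in> borel_measurable borel" by measurable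
  have \<nu>\<nu>: "\<nu> \<bullet> \<nu> = 1" using \<nu> by (simp add: norm_eq_1)
  \<comment> \<open>\<open>?\<Phi>\<close> projects along \<open>e\<close> onto the hyperplane
    orthogonal to \<open>\<nu>\<close>, so each line parallel to \<open>e\<close> meets the prism in
    an interval of length 1 or not at all.\<close>
  define Q where "Q = {z. ?\<Phi> z \<in> A \<and> (z \<bullet> \<nu>) / (e \<bullet> \<nu>) \<in> {0..1}}"
  have Q [measurable]: "Q \<in> sets borel" unfolding Q_def by measurable
  have \<Phi>: "?\<Phi> (x + t *\<^sub>R e) = ?\<Phi> x" for x t
    using pos by (simp add: inner_add_left add_divide_distrib algebra_simps)
  have q: "((x + t *\<^sub>R e) \<bullet> \<nu>) / (e \<bullet> \<nu>) = (x \<bullet> \<nu>) / (e \<bullet> \<nu>) + t" for x t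
    using pos by (simp add: inner_add_left add_divide_distrib)
  have \<Phi>A: "{x. ?\<Phi> x \<in> A} \<in> sets borel" by measurable
  have "emeasure (slab_measure e) Q = (\<integral>\<^sup>+x. emeasure lborel {t. x + t *\<^sub>R e \<in> Q} \<partial>hyperplane_measure e)"
    by (rule emeasure_slab_measure_2 [OF e Q])
  also have "\<dots> = (\<integral>\<^sup>+x. indicator {x. ?\<Phi> x \<in> A} x \<partial>hyperplane_measure e)"
  proof (rule nn_integral_cong)
    fix x
    have "{t. x + t *\<^sub>R e \<in> Q} = (if ?\<Phi> x \<in> A then {- ((x \<bullet> \<nu>) / (e \<bullet> \<nu>)) .. 1 - (x \<bullet> \<nu>) / (e \<bullet> \<nu>)} else {})"
    proof -
      have "x + t *\<^sub>R e \<in> Q \<longleftrightarrow> ?\<Phi> x \<in> A \<and> (x \<bullet> \<nu>) / (e \<bullet> \<nu>) + t \<in> {0..1}" for t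
        by (simp only: Q_def mem_Collect_eq \<Phi>) (simp only: q)
      note mem = this
      show ?thesis
      proof (cases "?\<Phi> x \<in> A")
        case True
        then have "x + t *\<^sub>R e \<in> Q \<longleftrightarrow> t \<in> {- ((x \<bullet> \<nu>) / (e \<bullet> \<nu>)) .. 1 - (x \<bullet> \<nu>) / (e \<bullet> \<nu>)}" for t
          by (simp only: mem simp_thms atLeastAtMost_iff) linarith
        then show ?thesis using True by (simp only: if_True Collect_mem_eq)
      next
        case False
        then show ?thesis by (simp only: mem simp_thms if_False empty_def)
      qed
    qed
    then show "emeasure lborel {t. x + t *\<^sub>R e \<in> Q} = indicator {x. ?\<Phi> x \<in> A} x"
      by (simp add: indicator_def)
  qed
  also have "\<dots> = hausdorff_outer ?d {x. x \<bullet> e = 0 \<and> ?\<Phi> x \<in> A}"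
  proof -
    have "{x \<in> {x. ?\<Phi> x \<in> A}. x \<bullet> e = 0} = {x. x \<bullet> e = 0 \<and> ?\<Phi> x \<in> A}" by auto
    then show ?thesis using \<Phi>A by (simp add: emeasure_hyperplane_measure)
  qed
  finally have 1: "emeasure (slab_measure e) Q = hausdorff_outer ?d {x. x \<bullet> e = 0 \<and> ?\<Phi> x \<in> A}" .
  have sec: "hausdorff_outer ?d {x. x \<bullet> \<nu> = 0 \<and> x + t *\<^sub>R \<nu> \<in> Q} = hausdorff_outer ?d A * indicator {0..e \<bullet> \<nu>} t" for t
  proof -
    \<comment> \<open>At height \<open>t\<close> along \<open>\<nu>\<close> the slice of the prism
      is \<open>A\<close> translated by \<open>- w\<close>. The heights range over
      \<open>[0, e \<bullet> \<nu>]\<close>, which is where the cosine comes from.\<close>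
    define w where "w = t *\<^sub>R \<nu> - (t / (e \<bullet> \<nu>)) *\<^sub>R e"
    have w: "w \<bullet> \<nu> = 0" using pos \<nu>\<nu> by (simp add: w_def inner_diff_left)
    have t: "t / (e \<bullet> \<nu>) \<in> {0..1} \<longleftrightarrow> t \<in> {0..e \<bullet> \<nu>}" using pos by (auto simp: divide_simps)
    have "x \<bullet> \<nu> = 0 \<and> x + t *\<^sub>R \<nu> \<in> Q \<longleftrightarrow> t \<in> {0..e \<bullet> \<nu>} \<and> w + x \<in> A" for x
    proof (cases "x \<bullet> \<nu> = 0")
      case True
      then have "(x + t *\<^sub>R \<nu>) \<bullet> \<nu> = t" using \<nu>\<nu> by (simp add: inner_add_left)
      then show ?thesis unfolding Q_def using True t by (auto simp: w_def algebra_simps)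
    next
      case False
      then have "(w + x) \<bullet> \<nu> \<noteq> 0" using w by (simp add: inner_add_left)
      then show ?thesis using False sub by auto
    qed
    then have "{x. x \<bullet> \<nu> = 0 \<and> x + t *\<^sub>R \<nu> \<in> Q} = (if t \<in> {0..e \<bullet> \<nu>} then {x. w + x \<in> A} else {})" by auto
    moreover have "hausdorff_outer ?d {x. w + x \<in> A} = hausdorff_outer ?d A"
    proof -
      have "A = (\<lambda>x. w + x) ` {x. w + x \<in> A}" by (auto intro!: image_eqI [of _ _ "_ - w"])
      then show ?thesis
        using hausdorff_outer_isometry [of "{x. w + x \<in> A}" "\<lambda>x. w + x" ?d] by simp
    qed
    ultimately show ?thesis by simp
  qed
  have "emeasure (slab_measure \<nu>) Q = (\<integral>\<^sup>+t. hausdorff_outer ?d A * indicator {0..e \<bullet> \<nu>} t \<partial>lborel)"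
    unfolding emeasure_slab_measure_1 [OF \<nu> Q] sec ..
  also have "\<dots> = hausdorff_outer ?d A * ennreal (e \<bullet> \<nu>)"
    using pos by (subst nn_integral_cmult_indicator) auto
  finally have 2: "emeasure (slab_measure \<nu>) Q = hausdorff_outer ?d A * ennreal (e \<bullet> \<nu>)" .
  show ?thesis
    using 1 2 slab_measure_slab_factor [OF e] slab_measure_slab_factor [OF \<nu>] by (simp add: mult.commute)
qed

subsection \<open>Projecting a hypersurface to a hyperplane\<close>

text \<open>The inverse of \<open>h\<close> on the image of \<open>K\<close>, set to 0 elsewhere so
  as to become a total Borel function when \<open>K\<close> is compact and \<open>h\<close>
  continuous.\<close>

definition image_section :: "'a::real_vector set \<Rightarrow> ('a \<Rightarrow> 'b) \<Rightarrow> 'b \<Rightarrow> 'a" where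
  "image_section K h z = indicator (h ` K) z *\<^sub>R inv_into K h z"

lemma image_section_eq: "inj_on h K \<Longrightarrow> x \<in> K \<Longrightarrow> image_section K h (h x) = x"
  by (simp add: image_section_def)

context
  fixes K :: "'a::euclidean_space set" and h :: "'a \<Rightarrow> 'b::euclidean_space"
  assumes K: "compact K" and h: "continuous_on K h" and inj: "inj_on h K"
begin

lemma compact_image_borel: "h ` K \<in> sets borel"
  by (rule borel_compact [OF compact_continuous_image [OF h K]])

lemma image_section_measurable: "image_section K h \<in> borel_measurable borel"
  unfolding image_section_def [abs_def]
  by (rule borel_measurable_continuous_on_indicator [OF compact_image_borel])
    (rule continuous_on_inv [OF h K], simp add: inj)

lemma image_Int_eq: "h ` (A \<inter> K) = {z \<in> h ` K. image_section K h z \<in> A}"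
  using image_section_eq [OF inj] by fastforce

lemma image_Int_borel:
  assumes [measurable]: "A \<in> sets borel" shows "h ` (A \<inter> K) \<in> sets borel"
proof -
  note [measurable] = compact_image_borel image_section_measurable
  have "{z \<in> h ` K. image_section K h z \<in> A} = h ` K \<inter> {z. image_section K h z \<in> A}" by blast
  also have "\<dots> \<in> sets borel" by measurable
  finally show ?thesis unfolding image_Int_eq .
qed

lemma image_borel: "A \<in> sets borel \<Longrightarrow> A \<subseteq> K \<Longrightarrow> h ` A \<in> sets borel"
  using image_Int_borel [of A] by (simp add: Int_absorb2)

text \<open>\<open>N\<close> is the Hausdorff measure of the image, pulled back to \<open>K\<close>
  by the section. The hypothesis \<open>loc\<close> says that \<open>N\<close> is locally
  \<open>\<theta>\<close> times Hausdorff measure, so \<open>\<theta>\<close> is its density, and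
  the claim is the change of variables for \<open>N\<close>.\<close>

lemma integral_hausdorff_image:
  fixes \<theta> \<phi> :: "'a \<Rightarrow> real"
  assumes \<theta>: "continuous_on K \<theta>" "\<And>x. x \<in> K \<Longrightarrow> 0 \<le> \<theta> x"
    and fin: "emeasure (hausdorff_measure d) K < \<infinity>"
    and loc: "\<And>x \<epsilon>. x \<in> K \<Longrightarrow> 0 < \<epsilon> \<Longrightarrow> \<exists>r>0. \<forall>A\<in>sets borel. A \<subseteq> K \<inter> ball x r \<longrightarrow>
        hausdorff_outer d (h ` A) \<le> ennreal (\<theta> x + \<epsilon>) * hausdorff_outer d A \<and>
        ennreal (\<theta> x) * hausdorff_outer d A \<le> hausdorff_outer d (h ` A) + ennreal \<epsilon> * hausdorff_outer d A"
    and \<phi> [measurable]: "\<phi> \<in> borel_measurable borel"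
  shows "(LINT z:h ` K|hausdorff_measure d. \<phi> (image_section K h z)) = (LINT x:K|hausdorff_measure d. \<phi> x * \<theta> x)"
proof -
  let ?s = "image_section K h" and ?H = "hausdorff_measure d :: 'a measure"
  note [measurable] = compact_image_borel image_section_measurable
  have Kb [measurable]: "K \<in> sets borel" by (rule borel_compact [OF K])
  define N where "N = distr (density (hausdorff_measure d) (indicator (h ` K))) borel ?s"
  have setsN: "sets N = sets borel" by (simp add: N_def)
  have N: "emeasure N A = hausdorff_outer d (h ` (A \<inter> K))" if A [measurable]: "A \<in> sets borel" for A
  proof -
    have "emeasure N A = emeasure (density (hausdorff_measure d) (indicator (h ` K))) {z. ?s z \<in> A}"
      unfolding N_def by (subst emeasure_distr) (auto simp: vimage_def)
    also have "\<dots> = (\<integral>\<^sup>+z. indicator (h ` K) z * indicator {z. ?s z \<in> A} z \<partial>hausdorff_measure d)"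
      by (rule emeasure_density) auto
    also have "\<dots> = (\<integral>\<^sup>+z. indicator (h ` (A \<inter> K)) z \<partial>hausdorff_measure d)"
      unfolding image_Int_eq by (rule nn_integral_cong) (auto simp: indicator_def)
    also have "\<dots> = hausdorff_outer d (h ` (A \<inter> K))"
      using image_Int_borel [OF A] by (simp add: emeasure_hausdorff_measure)
    finally show ?thesis .
  qed
  have Nsub: "emeasure N A = hausdorff_outer d (h ` A)" if "A \<in> sets borel" "A \<subseteq> K" for A
    using N [OF that(1)] that(2) by (simp add: Int_absorb2)
  have dens: "emeasure N A = (\<integral>\<^sup>+x\<in>A. ennreal (\<theta> x) \<partial>?H)" if A: "A \<in> sets borel" "A \<subseteq> K" for A
  proof (rule emeasure_eq_nn_integral_local_density [OF setsN sets_hausdorff_measure K \<theta> fin _ A])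
    fix x and \<epsilon> :: real assume "x \<in> K" "0 < \<epsilon>"
    from loc [OF this] obtain r where r: "r > 0" "\<And>A. A \<in> sets borel \<Longrightarrow> A \<subseteq> K \<inter> ball x r \<Longrightarrow>
        hausdorff_outer d (h ` A) \<le> ennreal (\<theta> x + \<epsilon>) * hausdorff_outer d A \<and>
        ennreal (\<theta> x) * hausdorff_outer d A \<le> hausdorff_outer d (h ` A) + ennreal \<epsilon> * hausdorff_outer d A" by blast
    show "\<exists>r>0. \<forall>A\<in>sets borel. A \<subseteq> K \<inter> ball x r \<longrightarrow>
        emeasure N A \<le> ennreal (\<theta> x + \<epsilon>) * emeasure ?H A \<and>
        ennreal (\<theta> x) * emeasure ?H A \<le> emeasure N A + ennreal \<epsilon> * emeasure ?H A"
    proof (intro exI [of _ r] conjI ballI impI r(1))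
      fix B assume B: "B \<in> sets borel" "B \<subseteq> K \<inter> ball x r"
      then have BK: "B \<subseteq> K" by blast
      show "emeasure N B \<le> ennreal (\<theta> x + \<epsilon>) * emeasure ?H B"
        "ennreal (\<theta> x) * emeasure ?H B \<le> emeasure N B + ennreal \<epsilon> * emeasure ?H B"
        using r(2) [OF B] by (simp_all add: Nsub [OF B(1) BK] emeasure_hausdorff_measure [OF B(1)])
    qed
  qed
  have \<theta>m: "(\<lambda>x. indicator K x *\<^sub>R \<theta> x) \<in> borel_measurable borel"
    by (rule borel_measurable_continuous_on_indicator [OF Kb \<theta>(1)])
  have N_eq: "N = density ?H (\<lambda>x. ennreal (indicator K x *\<^sub>R \<theta> x))"
  proof (rule measure_eqI)
    fix A assume "A \<in> sets N"
    then have A [measurable]: "A \<in> sets borel" by (simp add: setsN)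
    have AK: "A \<inter> K \<in> sets borel" by measurable
    have "emeasure N A = emeasure N (A \<inter> K)" by (simp add: N [OF A] N [OF AK])
    also have "\<dots> = (\<integral>\<^sup>+x\<in>A \<inter> K. ennreal (\<theta> x) \<partial>?H)" by (rule dens [OF AK]) simp
    also have "\<dots> = (\<integral>\<^sup>+x\<in>A. ennreal (indicator K x *\<^sub>R \<theta> x) \<partial>?H)"
      by (rule nn_integral_cong) (simp add: indicator_def)
    also have "\<dots> = emeasure (density ?H (\<lambda>x. ennreal (indicator K x *\<^sub>R \<theta> x))) A"
      using \<theta>m by (intro emeasure_density [symmetric]) auto
    finally show "emeasure N A = emeasure (density ?H (\<lambda>x. ennreal (indicator K x *\<^sub>R \<theta> x))) A" .
  qed (simp add: setsN)
  have ind: "density (hausdorff_measure d) (indicator (h ` K)) = density (hausdorff_measure d) (\<lambda>x. ennreal (indicator (h ` K) x))"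
    by (rule arg_cong [where f="density _"]) (simp add: fun_eq_iff ennreal_indicator)
  have "(LINT z:h ` K|hausdorff_measure d. \<phi> (?s z)) = (\<integral>z. \<phi> (?s z) \<partial>density (hausdorff_measure d) (indicator (h ` K)))"
    unfolding ind set_lebesgue_integral_def by (subst integral_density) auto
  also have "\<dots> = (\<integral>x. \<phi> x \<partial>N)"
    unfolding N_def by (subst integral_distr) auto
  also have "\<dots> = (\<integral>x. (indicator K x *\<^sub>R \<theta> x) *\<^sub>R \<phi> x \<partial>?H)"
    unfolding N_eq
  proof (rule integral_density)
    show "AE x in ?H. 0 \<le> indicator K x *\<^sub>R \<theta> x"
      using \<theta>(2) by (intro AE_I2) (simp add: indicator_def)
  qed (use \<theta>m in auto)
  also have "\<dots> = (LINT x:K|?H. \<phi> x * \<theta> x)"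
    unfolding set_lebesgue_integral_def by (rule Bochner_Integration.integral_cong) (simp_all add: mult_ac)
  finally show ?thesis .
qed

end

text \<open>Translates Lipschitz constants \<open>1 + \<delta>\<close> and
  \<open>1 - \<delta>\<close>, raised to the dimension, into the additive error of the local density
  comparison.\<close>

lemma power_near_one:
  fixes \<kappa> \<epsilon> :: real
  assumes "0 < \<epsilon>" "0 < \<kappa>"
  shows "\<exists>\<delta>. 0 < \<delta> \<and> \<delta> < 1 \<and> \<kappa> * (1 + \<delta>) ^ d \<le> \<kappa> + \<epsilon> \<and> \<kappa> \<le> \<kappa> * (1 - \<delta>) ^ d + \<epsilon>"
proof -
  have "((\<lambda>\<delta>. \<kappa> * (1 + \<delta>) ^ d) \<longlongrightarrow> \<kappa> * (1 + 0) ^ d) (at_right 0)"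
    "((\<lambda>\<delta>. \<kappa> * (1 - \<delta>) ^ d) \<longlongrightarrow> \<kappa> * (1 - 0) ^ d) (at_right 0)"
    by (intro tendsto_intros)+
  then have lim: "((\<lambda>\<delta>. \<kappa> * (1 + \<delta>) ^ d) \<longlongrightarrow> \<kappa>) (at_right 0)" "((\<lambda>\<delta>. \<kappa> * (1 - \<delta>) ^ d) \<longlongrightarrow> \<kappa>) (at_right 0)"
    by simp_all
  have "\<forall>\<^sub>F \<delta> in at_right 0. \<kappa> * (1 + \<delta>) ^ d < \<kappa> + \<epsilon>" "\<forall>\<^sub>F \<delta> in at_right 0. \<kappa> - \<epsilon> < \<kappa> * (1 - \<delta>) ^ d"
    using order_tendstoD(2) [OF lim(1), of "\<kappa> + \<epsilon>"] order_tendstoD(1) [OF lim(2), of "\<kappa> - \<epsilon>"] assms by simp_all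
  moreover have "\<forall>\<^sub>F \<delta> in at_right 0. \<delta> \<in> {0::real<..<1}"
    by (rule eventually_at_right_real) simp
  ultimately have "\<forall>\<^sub>F \<delta> in at_right 0. \<delta> \<in> {0::real<..<1} \<and> \<kappa> * (1 + \<delta>) ^ d < \<kappa> + \<epsilon> \<and> \<kappa> - \<epsilon> < \<kappa> * (1 - \<delta>) ^ d"
    by eventually_elim blast
  then obtain \<delta> where "\<delta> \<in> {0::real<..<1} \<and> \<kappa> * (1 + \<delta>) ^ d < \<kappa> + \<epsilon> \<and> \<kappa> - \<epsilon> < \<kappa> * (1 - \<delta>) ^ d"
    using eventually_happens' [OF trivial_limit_at_right_real] by blast
  then show ?thesis by (intro exI [of _ \<delta>]) auto
qed

section \<open>Surfaces that are graphs over a hyperplane\<close>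

definition hyperplane_proj :: "'a::real_inner \<Rightarrow> 'a \<Rightarrow> 'a" where
  "hyperplane_proj e x = x - (x \<bullet> e) *\<^sub>R e"

lemma hyperplane_proj_inner: "norm e = 1 \<Longrightarrow> hyperplane_proj e x \<bullet> e = 0"
  by (simp add: hyperplane_proj_def inner_diff_left norm_eq_1)

lemma continuous_on_hyperplane_proj [continuous_intros]: "continuous_on S (hyperplane_proj e)"
  unfolding hyperplane_proj_def by (intro continuous_intros)

lemma hyperplane_proj_measurable [measurable]:
  fixes e :: "'a::euclidean_space"
  shows "hyperplane_proj e \<in> borel_measurable borel"
  by (rule borel_measurable_continuous_onI) (rule continuous_on_hyperplane_proj)

text \<open>\<open>flat\<close> expresses tangency in the strict sense, uniformly for all pairs of
  points near \<open>x\<close>; bi-Lipschitz estimates need pairs, not just comparison with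
  \<open>x\<close>. Together with \<open>inj\<close> and the transversality of \<open>\<nu>\<close>
  it makes \<open>K\<close> a graph over the hyperplane orthogonal to \<open>e\<close>.\<close>

locale projectable_surface =
  fixes K :: "(real ^ 'n::finite) set" and e :: "real ^ 'n" and \<nu> :: "real ^ 'n \<Rightarrow> real ^ 'n"
  assumes K: "compact K" and e: "norm e = 1"
    and \<nu>: "continuous_on K \<nu>" "\<And>x. x \<in> K \<Longrightarrow> norm (\<nu> x) = 1" "\<And>x. x \<in> K \<Longrightarrow> 0 < e \<bullet> \<nu> x"
    and flat: "\<And>x \<epsilon>. x \<in> K \<Longrightarrow> 0 < \<epsilon> \<Longrightarrow>
        \<exists>r>0. \<forall>y\<in>K \<inter> ball x r. \<forall>z\<in>K \<inter> ball x r. \<bar>(y - z) \<bullet> \<nu> x\<bar> \<le> \<epsilon> * norm (y - z)"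
    and inj: "inj_on (hyperplane_proj e) K"
begin

abbreviation "\<pi> \<equiv> hyperplane_proj e"

text \<open>The projection along \<open>e\<close> onto the hyperplane orthogonal to
  \<open>\<nu> x\<close>. The projection \<open>\<pi>\<close> has the same fibres, the lines
  parallel to \<open>e\<close>, so each of the two determines the other.\<close>

definition \<Phi> :: "real ^ 'n \<Rightarrow> real ^ 'n \<Rightarrow> real ^ 'n" where
  "\<Phi> x y = y - ((y \<bullet> \<nu> x) / (e \<bullet> \<nu> x)) *\<^sub>R e"

lemma \<Phi>_orthogonal: "x \<in> K \<Longrightarrow> \<Phi> x y \<bullet> \<nu> x = 0"
  using \<nu>(3) [of x] by (simp add: \<Phi>_def inner_diff_left)

lemma \<Phi>_\<pi>: "x \<in> K \<Longrightarrow> \<Phi> x (\<pi> y) = \<Phi> x y"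
  using \<nu>(3) [of x]
  by (simp add: \<Phi>_def hyperplane_proj_def inner_diff_left diff_divide_distrib algebra_simps)

lemma \<pi>_\<Phi>: "\<pi> (\<Phi> x y) = \<pi> y"
  using e by (simp add: \<Phi>_def hyperplane_proj_def inner_diff_left norm_eq_1 algebra_simps)

lemma \<Phi>_id: "y \<bullet> \<nu> x = 0 \<Longrightarrow> \<Phi> x y = y"
  by (simp add: \<Phi>_def)

lemma \<pi>_id: "y \<bullet> e = 0 \<Longrightarrow> \<pi> y = y"
  by (simp add: hyperplane_proj_def)

text \<open>\<open>\<Phi> x\<close> changes \<open>y - z\<close> by a multiple of \<open>e\<close>
  of length \<open>\<bar>(y - z) \<bullet> \<nu> x\<bar> / (e \<bullet> \<nu> x)\<close>, which
  \<open>flat\<close> makes small against \<open>norm (y - z)\<close>.\<close>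

lemma \<Phi>_near_isometry:
  assumes x: "x \<in> K" and \<delta>: "0 < \<delta>"
  shows "\<exists>r>0. \<forall>y\<in>K \<inter> ball x r. \<forall>z\<in>K \<inter> ball x r.
    norm (\<Phi> x y - \<Phi> x z) \<le> (1 + \<delta>) * norm (y - z) \<and> (1 - \<delta>) * norm (y - z) \<le> norm (\<Phi> x y - \<Phi> x z)"
proof -
  let ?\<kappa> = "e \<bullet> \<nu> x"
  have \<kappa>: "0 < ?\<kappa>" using \<nu>(3) x by simp
  obtain r where r: "r > 0" "\<And>y z. y \<in> K \<inter> ball x r \<Longrightarrow> z \<in> K \<inter> ball x r \<Longrightarrow>
      \<bar>(y - z) \<bullet> \<nu> x\<bar> \<le> (\<delta> * ?\<kappa>) * norm (y - z)"
    using flat [OF x, of "\<delta> * ?\<kappa>"] \<kappa> \<delta> by (metis mult_pos_pos)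
  have "norm (\<Phi> x y - \<Phi> x z) \<le> (1 + \<delta>) * norm (y - z) \<and> (1 - \<delta>) * norm (y - z) \<le> norm (\<Phi> x y - \<Phi> x z)"
    if "y \<in> K \<inter> ball x r" "z \<in> K \<inter> ball x r" for y z
  proof -
    let ?w = "(((y - z) \<bullet> \<nu> x) / ?\<kappa>) *\<^sub>R e"
    have eq: "\<Phi> x y - \<Phi> x z = (y - z) - ?w"
      by (simp add: \<Phi>_def inner_diff_left diff_divide_distrib algebra_simps)
    have "norm ?w = \<bar>(y - z) \<bullet> \<nu> x\<bar> / ?\<kappa>" using e \<kappa> by simp
    also have "\<dots> \<le> \<delta> * norm (y - z)"
      using r(2) [OF that] \<kappa> by (simp add: divide_le_eq mult_ac)
    finally have w: "norm ?w \<le> \<delta> * norm (y - z)" .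
    have "norm (y - z - ?w) \<le> norm (y - z) + norm ?w" by (rule norm_triangle_ineq4)
    moreover have "norm (y - z) - norm ?w \<le> norm (y - z - ?w)" by (rule norm_triangle_ineq2)
    ultimately show ?thesis using w unfolding eq by (simp add: algebra_simps)
  qed
  then show ?thesis using r(1) by blast
qed

lemma hausdorff_outer_\<Phi>:
  assumes x: "x \<in> K" and \<delta>: "0 < \<delta>" "\<delta> < 1"
  shows "\<exists>r>0. \<forall>A. A \<subseteq> K \<inter> ball x r \<longrightarrow>
    hausdorff_outer (CARD('n) - 1) (\<Phi> x ` A) \<le> ennreal ((1 + \<delta>) ^ (CARD('n) - 1)) * hausdorff_outer (CARD('n) - 1) A \<and>
    ennreal ((1 - \<delta>) ^ (CARD('n) - 1)) * hausdorff_outer (CARD('n) - 1) A \<le> hausdorff_outer (CARD('n) - 1) (\<Phi> x ` A)"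
proof -
  obtain r where r: "r > 0" "\<And>y z. y \<in> K \<inter> ball x r \<Longrightarrow> z \<in> K \<inter> ball x r \<Longrightarrow>
    norm (\<Phi> x y - \<Phi> x z) \<le> (1 + \<delta>) * norm (y - z) \<and> (1 - \<delta>) * norm (y - z) \<le> norm (\<Phi> x y - \<Phi> x z)"
    using \<Phi>_near_isometry [OF x \<delta>(1)] by blast
  have "hausdorff_outer (CARD('n) - 1) (\<Phi> x ` A) \<le> ennreal ((1 + \<delta>) ^ (CARD('n) - 1)) * hausdorff_outer (CARD('n) - 1) A \<and>
    ennreal ((1 - \<delta>) ^ (CARD('n) - 1)) * hausdorff_outer (CARD('n) - 1) A \<le> hausdorff_outer (CARD('n) - 1) (\<Phi> x ` A)"
    if A: "A \<subseteq> K \<inter> ball x r" for A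
  proof
    have le: "norm (\<Phi> x y - \<Phi> x z) \<le> (1 + \<delta>) * norm (y - z)" "(1 - \<delta>) * norm (y - z) \<le> norm (\<Phi> x y - \<Phi> x z)"
      if "y \<in> A" "z \<in> A" for y z
      using r(2) [OF subsetD [OF A that(1)] subsetD [OF A that(2)]] by simp_all
    show "hausdorff_outer (CARD('n) - 1) (\<Phi> x ` A) \<le> ennreal ((1 + \<delta>) ^ (CARD('n) - 1)) * hausdorff_outer (CARD('n) - 1) A"
      by (rule hausdorff_outer_lipschitz_image) (use le \<delta> in simp_all)
    have inj: "inj_on (\<Phi> x) A"
    proof (rule inj_onI)
      fix y z assume "y \<in> A" "z \<in> A" "\<Phi> x y = \<Phi> x z"
      then have "(1 - \<delta>) * norm (y - z) \<le> 0" using le(2) [of y z] by simp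
      then show "y = z" using \<delta> by (simp add: mult_le_0_iff)
    qed
    have "hausdorff_outer (CARD('n) - 1) (inv_into A (\<Phi> x) ` \<Phi> x ` A) \<le> ennreal ((1 / (1 - \<delta>)) ^ (CARD('n) - 1)) * hausdorff_outer (CARD('n) - 1) (\<Phi> x ` A)"
    proof (rule hausdorff_outer_lipschitz_image)
      fix u v assume "u \<in> \<Phi> x ` A" "v \<in> \<Phi> x ` A"
      then obtain y z where "y \<in> A" "z \<in> A" "u = \<Phi> x y" "v = \<Phi> x z" by blast
      then show "norm (inv_into A (\<Phi> x) u - inv_into A (\<Phi> x) v) \<le> 1 / (1 - \<delta>) * norm (u - v)"
        using le(2) [of y z] \<delta> inj by (simp add: inv_into_f_f divide_simps mult.commute)
    qed (use \<delta> in simp)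
    then have "hausdorff_outer (CARD('n) - 1) A \<le> ennreal ((1 / (1 - \<delta>)) ^ (CARD('n) - 1)) * hausdorff_outer (CARD('n) - 1) (\<Phi> x ` A)"
      using inj by simp
    then have "ennreal ((1 - \<delta>) ^ (CARD('n) - 1)) * hausdorff_outer (CARD('n) - 1) A
        \<le> ennreal ((1 - \<delta>) ^ (CARD('n) - 1)) * (ennreal ((1 / (1 - \<delta>)) ^ (CARD('n) - 1)) * hausdorff_outer (CARD('n) - 1) (\<Phi> x ` A))"
      by (rule mult_left_mono) simp
    also have "\<dots> = hausdorff_outer (CARD('n) - 1) (\<Phi> x ` A)"
    proof -
      have "(1 - \<delta>) ^ (CARD('n) - 1) * (1 / (1 - \<delta>)) ^ (CARD('n) - 1) = 1"
        using \<delta> by (simp add: power_mult_distrib [symmetric])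
      then have "ennreal ((1 - \<delta>) ^ (CARD('n) - 1)) * ennreal ((1 / (1 - \<delta>)) ^ (CARD('n) - 1)) = 1"
        using \<delta> by (simp only: ennreal_mult [symmetric] zero_le_power divide_nonneg_nonneg zero_le_one diff_ge_0_iff_ge less_imp_le ennreal_1)
      then show ?thesis by (simp only: mult.assoc [symmetric] mult_1)
    qed
    finally show "ennreal ((1 - \<delta>) ^ (CARD('n) - 1)) * hausdorff_outer (CARD('n) - 1) A \<le> hausdorff_outer (CARD('n) - 1) (\<Phi> x ` A)" .
  qed
  then show ?thesis using r(1) by blast
qed

text \<open>Near each point the surface is compared, with \<open>\<delta> = 1/2\<close>, to a
  bounded part of a hyperplane, whose measure is finite; compactness does the rest.\<close>

lemma emeasure_surface_finite: "emeasure (hausdorff_measure (CARD('n) - 1)) K < \<infinity>"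
proof -
  have "\<exists>r>0. \<forall>A. A \<subseteq> K \<inter> ball x r \<longrightarrow> hausdorff_outer (CARD('n) - 1) A < top" if x: "x \<in> K" for x
  proof -
    obtain r where r: "r > 0" "\<And>A. A \<subseteq> K \<inter> ball x r \<Longrightarrow>
        ennreal ((1 - 1/2) ^ (CARD('n) - 1)) * hausdorff_outer (CARD('n) - 1) A \<le> hausdorff_outer (CARD('n) - 1) (\<Phi> x ` A)"
      using hausdorff_outer_\<Phi> [OF x, of "1/2"] by auto
    have "hausdorff_outer (CARD('n) - 1) A < top" if A: "A \<subseteq> K \<inter> ball x r" for A
    proof -
      have "continuous_on K (\<Phi> x)" unfolding \<Phi>_def by (intro continuous_intros) (use \<nu>(3) x in force)
      then have "bounded (\<Phi> x ` K)" using K compact_continuous_image compact_imp_bounded by blast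
      then have "hausdorff_outer (CARD('n) - 1) ({y. y \<bullet> \<nu> x = 0} \<inter> \<Phi> x ` K) < top"
        by (rule hausdorff_outer_hyperplane_finite [OF \<nu>(2) [OF x]])
      moreover have "\<Phi> x ` A \<subseteq> {y. y \<bullet> \<nu> x = 0} \<inter> \<Phi> x ` K" using A \<Phi>_orthogonal [OF x] by blast
      ultimately have "hausdorff_outer (CARD('n) - 1) (\<Phi> x ` A) < top"
        by (meson hausdorff_outer_mono le_less_trans)
      then have "ennreal ((1 - 1/2) ^ (CARD('n) - 1)) * hausdorff_outer (CARD('n) - 1) A < top" using r(2) [OF A] by (rule le_less_trans [rotated])
      then show ?thesis by (auto simp: ennreal_mult_less_top)
    qed
    then show ?thesis using r(1) by blast
  qed
  then obtain r where r: "\<And>x. x \<in> K \<Longrightarrow> r x > 0" "\<And>x A. x \<in> K \<Longrightarrow> A \<subseteq> K \<inter> ball x (r x) \<Longrightarrow> hausdorff_outer (CARD('n) - 1) A < top"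
    by metis
  obtain X where X: "X \<subseteq> K" "finite X" "K \<subseteq> (\<Union>x\<in>X. ball x (r x))"
    using r(1) by (rule_tac compactE_image [OF K, of K "\<lambda>x. ball x (r x)"]) auto
  have "hausdorff_outer (CARD('n) - 1) (\<Union>x\<in>X'. K \<inter> ball x (r x)) < top" if "finite X'" "X' \<subseteq> K" for X'
    using that
  proof (induction X')
    case (insert x X')
    have "hausdorff_outer (CARD('n) - 1) (K \<inter> ball x (r x) \<union> (\<Union>x\<in>X'. K \<inter> ball x (r x)))
        \<le> hausdorff_outer (CARD('n) - 1) (K \<inter> ball x (r x)) + hausdorff_outer (CARD('n) - 1) (\<Union>x\<in>X'. K \<inter> ball x (r x))"
      by (rule hausdorff_outer_Un_le)
    also have "\<dots> < top" using insert r(2) [of x "K \<inter> ball x (r x)"] by simp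
    finally show ?case by simp
  qed simp
  moreover have "K \<subseteq> (\<Union>x\<in>X. K \<inter> ball x (r x))" using X(3) by blast
  ultimately have "hausdorff_outer (CARD('n) - 1) K < top" using X by (meson hausdorff_outer_mono le_less_trans)
  then show ?thesis using K by (simp add: emeasure_hausdorff_measure borel_compact)
qed

abbreviation "sec \<equiv> image_section K \<pi>"

lemma compact_\<pi>_image: "compact (\<pi> ` K)"
  by (rule compact_continuous_image [OF continuous_on_hyperplane_proj K])

lemma sec_\<pi>: "x \<in> K \<Longrightarrow> sec (\<pi> x) = x"
  by (rule image_section_eq [OF inj])

lemma sec_measurable [measurable]: "sec \<in> borel_measurable borel"
  by (rule image_section_measurable [OF K continuous_on_hyperplane_proj inj])

text \<open>\<open>\<pi>\<close> factors through \<open>\<Phi> x\<close>, so the flat image of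
  \<open>A\<close> under \<open>\<Phi> x\<close> has the same shadow as \<open>A\<close>, and the
  oblique projection formula applies to it. The flat image is Borel because it is cut out of its
  hyperplane by a preimage under \<open>\<pi>\<close>.\<close>

lemma hausdorff_outer_\<pi>_\<Phi>:
  assumes x: "x \<in> K" and A: "A \<in> sets borel" "A \<subseteq> K"
  shows "hausdorff_outer (CARD('n) - 1) (\<pi> ` A) = ennreal (e \<bullet> \<nu> x) * hausdorff_outer (CARD('n) - 1) (\<Phi> x ` A)"
proof -
  have \<pi>A [measurable]: "\<pi> ` A \<in> sets borel"
    using image_borel [OF K continuous_on_hyperplane_proj inj A] .
  have "\<Phi> x ` A = {y. y \<bullet> \<nu> x = 0} \<inter> {y. \<pi> y \<in> \<pi> ` A}"
  proof (intro set_eqI iffI)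
    fix y assume "y \<in> \<Phi> x ` A"
    then show "y \<in> {y. y \<bullet> \<nu> x = 0} \<inter> {y. \<pi> y \<in> \<pi> ` A}" using \<Phi>_orthogonal [OF x] \<pi>_\<Phi> by auto
  next
    fix y assume y: "y \<in> {y. y \<bullet> \<nu> x = 0} \<inter> {y. \<pi> y \<in> \<pi> ` A}"
    then obtain a where a: "a \<in> A" "\<pi> y = \<pi> a" by blast
    have "y = \<Phi> x (\<pi> y)" using y by (simp add: \<Phi>_\<pi> [OF x] \<Phi>_id)
    also have "\<dots> = \<Phi> x a" using a(2) \<Phi>_\<pi> [OF x] by simp
    finally show "y \<in> \<Phi> x ` A" using a(1) by blast
  qed
  moreover have "{y. y \<bullet> \<nu> x = 0} \<inter> {y. \<pi> y \<in> \<pi> ` A} \<in> sets borel" by measurable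
  ultimately have \<Phi>A: "\<Phi> x ` A \<in> sets borel" by (simp only:)
  have "\<pi> ` A = {z. z \<bullet> e = 0 \<and> \<Phi> x z \<in> \<Phi> x ` A}"
  proof (intro set_eqI iffI)
    fix z assume "z \<in> \<pi> ` A"
    then show "z \<in> {z. z \<bullet> e = 0 \<and> \<Phi> x z \<in> \<Phi> x ` A}" using hyperplane_proj_inner [OF e] \<Phi>_\<pi> [OF x] by auto
  next
    fix z assume "z \<in> {z. z \<bullet> e = 0 \<and> \<Phi> x z \<in> \<Phi> x ` A}"
    then obtain a where a: "a \<in> A" "\<Phi> x z = \<Phi> x a" "z \<bullet> e = 0" by blast
    have "z = \<pi> (\<Phi> x z)" using a(3) by (simp add: \<pi>_\<Phi> \<pi>_id)
    also have "\<dots> = \<pi> a" using a(2) \<pi>_\<Phi> by simp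
    finally show "z \<in> \<pi> ` A" using a(1) by blast
  qed
  moreover have "hausdorff_outer (CARD('n) - 1) {z. z \<bullet> e = 0 \<and> \<Phi> x z \<in> \<Phi> x ` A} = ennreal (e \<bullet> \<nu> x) * hausdorff_outer (CARD('n) - 1) (\<Phi> x ` A)"
    unfolding \<Phi>_def [of x _, symmetric]
    using hausdorff_outer_oblique_projection [OF e \<nu>(2) [OF x] \<nu>(3) [OF x] \<Phi>A] \<Phi>_orthogonal [OF x]
    by (auto simp: \<Phi>_def)
  ultimately show ?thesis by (simp only:)
qed

text \<open>The local factor is \<open>e \<bullet> \<nu> x\<close> as in the flat case, up to the
  powers of \<open>1 + \<delta>\<close> and \<open>1 - \<delta>\<close> by which
  \<open>\<Phi> x\<close> distorts the measure.\<close>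

lemma integral_surface_projection:
  fixes \<phi> :: "real ^ 'n \<Rightarrow> real"
  assumes \<phi>: "\<phi> \<in> borel_measurable borel"
  shows "(LINT z:\<pi> ` K|hausdorff_measure (CARD('n) - 1). \<phi> (sec z)) = (LINT x:K|hausdorff_measure (CARD('n) - 1). \<phi> x * (e \<bullet> \<nu> x))"
proof (rule integral_hausdorff_image [OF K continuous_on_hyperplane_proj inj _ _ emeasure_surface_finite _ \<phi>])
  show "continuous_on K (\<lambda>x. e \<bullet> \<nu> x)" by (intro continuous_intros \<nu>)
  show "0 \<le> e \<bullet> \<nu> x" if "x \<in> K" for x using \<nu>(3) [OF that] by simp
  fix x and \<epsilon> :: real assume x: "x \<in> K" and \<epsilon>: "0 < \<epsilon>"
  let ?\<kappa> = "e \<bullet> \<nu> x"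
  have \<kappa>: "0 < ?\<kappa>" using \<nu>(3) [OF x] .
  obtain \<delta> where \<delta>: "0 < \<delta>" "\<delta> < 1" "?\<kappa> * (1 + \<delta>) ^ (CARD('n) - 1) \<le> ?\<kappa> + \<epsilon>" "?\<kappa> \<le> ?\<kappa> * (1 - \<delta>) ^ (CARD('n) - 1) + \<epsilon>"
    using power_near_one [OF \<epsilon> \<kappa>] by blast
  obtain r where r: "r > 0" "\<And>A. A \<subseteq> K \<inter> ball x r \<Longrightarrow>
      hausdorff_outer (CARD('n) - 1) (\<Phi> x ` A) \<le> ennreal ((1 + \<delta>) ^ (CARD('n) - 1)) * hausdorff_outer (CARD('n) - 1) A \<and>
      ennreal ((1 - \<delta>) ^ (CARD('n) - 1)) * hausdorff_outer (CARD('n) - 1) A \<le> hausdorff_outer (CARD('n) - 1) (\<Phi> x ` A)"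
    using hausdorff_outer_\<Phi> [OF x \<delta>(1,2)] by blast
  show "\<exists>r>0. \<forall>A\<in>sets borel. A \<subseteq> K \<inter> ball x r \<longrightarrow>
        hausdorff_outer (CARD('n) - 1) (\<pi> ` A) \<le> ennreal (?\<kappa> + \<epsilon>) * hausdorff_outer (CARD('n) - 1) A \<and>
        ennreal ?\<kappa> * hausdorff_outer (CARD('n) - 1) A \<le> hausdorff_outer (CARD('n) - 1) (\<pi> ` A) + ennreal \<epsilon> * hausdorff_outer (CARD('n) - 1) A"
  proof (intro exI conjI ballI impI)
    fix B assume B: "B \<in> sets borel" "B \<subseteq> K \<inter> ball x r"
    have BK: "B \<subseteq> K" using B(2) by blast
    note N = hausdorff_outer_\<pi>_\<Phi> [OF x B(1) BK]
    have "ennreal ?\<kappa> * hausdorff_outer (CARD('n) - 1) (\<Phi> x ` B) \<le> ennreal ?\<kappa> * (ennreal ((1 + \<delta>) ^ (CARD('n) - 1)) * hausdorff_outer (CARD('n) - 1) B)"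
      by (rule mult_left_mono [OF conjunct1 [OF r(2) [OF B(2)]]]) simp
    also have "\<dots> = ennreal (?\<kappa> * (1 + \<delta>) ^ (CARD('n) - 1)) * hausdorff_outer (CARD('n) - 1) B"
      using \<kappa> \<delta> by (simp add: ennreal_mult mult.assoc)
    also have "\<dots> \<le> ennreal (?\<kappa> + \<epsilon>) * hausdorff_outer (CARD('n) - 1) B"
      by (rule mult_right_mono [OF ennreal_leI [OF \<delta>(3)]]) simp
    finally show "hausdorff_outer (CARD('n) - 1) (\<pi> ` B) \<le> ennreal (?\<kappa> + \<epsilon>) * hausdorff_outer (CARD('n) - 1) B"
      unfolding N .
    have "ennreal ?\<kappa> * hausdorff_outer (CARD('n) - 1) B \<le> ennreal (?\<kappa> * (1 - \<delta>) ^ (CARD('n) - 1) + \<epsilon>) * hausdorff_outer (CARD('n) - 1) B"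
      by (rule mult_right_mono [OF ennreal_leI [OF \<delta>(4)]]) simp
    also have "\<dots> = ennreal ?\<kappa> * (ennreal ((1 - \<delta>) ^ (CARD('n) - 1)) * hausdorff_outer (CARD('n) - 1) B) + ennreal \<epsilon> * hausdorff_outer (CARD('n) - 1) B"
      using \<kappa> \<delta> \<epsilon> by (simp add: ennreal_mult mult.assoc distrib_right)
    also have "\<dots> \<le> ennreal ?\<kappa> * hausdorff_outer (CARD('n) - 1) (\<Phi> x ` B) + ennreal \<epsilon> * hausdorff_outer (CARD('n) - 1) B"
      by (rule add_right_mono [OF mult_left_mono [OF conjunct2 [OF r(2) [OF B(2)]]]]) simp
    finally show "ennreal ?\<kappa> * hausdorff_outer (CARD('n) - 1) B \<le> hausdorff_outer (CARD('n) - 1) (\<pi> ` B) + ennreal \<epsilon> * hausdorff_outer (CARD('n) - 1) B"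
      unfolding N .
  qed (rule r(1))
qed

end

subsection \<open>The divergence theorem for domains with \<open>C\<^sup>1\<close> boundary\<close>

lemma has_vector_derivative_along_line:
  assumes "(f has_derivative f') (at (p + t *\<^sub>R v))"
  shows "((\<lambda>s. f (p + s *\<^sub>R v)) has_vector_derivative f' v) (at t)"
proof -
  interpret bounded_linear f' by (rule has_derivative_bounded_linear [OF assms])
  have "((\<lambda>s. p + s *\<^sub>R v) has_derivative (\<lambda>s. s *\<^sub>R v)) (at t)"
    by (auto intro!: derivative_eq_intros)
  from has_derivative_compose [OF this assms] show ?thesis
    by (simp add: has_vector_derivative_def scaleR)
qed

section \<open>Local defining functions\<close>

definition defining_function ::
    "'a::real_inner set \<Rightarrow> 'a set \<Rightarrow> ('a \<Rightarrow> real) \<Rightarrow> ('a \<Rightarrow> 'a) \<Rightarrow> bool" where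
  "defining_function V W \<rho> G \<longleftrightarrow> open W \<and> (\<forall>y\<in>W. (\<rho> has_derivative (\<lambda>h. G y \<bullet> h)) (at y)) \<and>
     continuous_on W G \<and> (\<forall>y\<in>W. G y \<noteq> 0) \<and> V \<inter> W = {y \<in> W. \<rho> y < 0}"

lemma defining_function_line:
  assumes "defining_function V W \<rho> G" "p + t *\<^sub>R v \<in> W"
  shows "((\<lambda>s. \<rho> (p + s *\<^sub>R v)) has_real_derivative G (p + t *\<^sub>R v) \<bullet> v) (at t)"
  using has_vector_derivative_along_line [of \<rho> _ p t v] assms
  unfolding defining_function_def has_real_derivative_iff_has_vector_derivative by blast

lemma defining_function_mvt:
  assumes def: "defining_function V W \<rho> G" and C: "convex C" "C \<subseteq> W" "y \<in> C" "z \<in> C"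
  shows "\<exists>\<xi>\<in>C. \<rho> y - \<rho> z = G \<xi> \<bullet> (y - z)"
proof -
  have inC: "z + t *\<^sub>R (y - z) \<in> C" if "0 \<le> t" "t \<le> 1" for t
  proof -
    have "z + t *\<^sub>R (y - z) = (1 - t) *\<^sub>R z + t *\<^sub>R y" by (simp add: algebra_simps)
    then show ?thesis using convexD [OF C(1) C(4) C(3), of "1 - t" t] that by simp
  qed
  have "\<exists>t\<in>{0<..<1}. \<rho> (z + 1 *\<^sub>R (y - z)) - \<rho> (z + 0 *\<^sub>R (y - z)) = (1 - 0) * (G (z + t *\<^sub>R (y - z)) \<bullet> (y - z))"
  proof -
    have "\<exists>t>0. t < 1 \<and> \<rho> (z + 1 *\<^sub>R (y - z)) - \<rho> (z + 0 *\<^sub>R (y - z)) = (1 - 0) * (G (z + t *\<^sub>R (y - z)) \<bullet> (y - z))"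
    proof (rule MVT2 [of 0 1 "\<lambda>t. \<rho> (z + t *\<^sub>R (y - z))"])
      fix t :: real assume "0 \<le> t" "t \<le> 1"
      then have "z + t *\<^sub>R (y - z) \<in> W" using inC C(2) by blast
      then show "((\<lambda>t. \<rho> (z + t *\<^sub>R (y - z))) has_real_derivative G (z + t *\<^sub>R (y - z)) \<bullet> (y - z)) (at t)"
        by (rule defining_function_line [OF def])
    qed simp
    then show ?thesis by auto
  qed
  then obtain t where "t \<in> {0<..<1}" "\<rho> y - \<rho> z = G (z + t *\<^sub>R (y - z)) \<bullet> (y - z)" by auto
  then show ?thesis using inC by (intro bexI [of _ "z + t *\<^sub>R (y - z)"]) auto
qed

lemma defining_function_continuous:
  assumes "defining_function V W \<rho> G" shows "continuous_on W \<rho>"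
  using assms unfolding defining_function_def
  by (meson continuous_at_imp_continuous_on has_derivative_continuous)

text \<open>The point is that zeros of \<open>\<rho>\<close> are limits of points of
  \<open>V\<close>: since \<open>G y\<close> is not 0, moving from \<open>y\<close> along
  \<open>- G y\<close> makes \<open>\<rho>\<close> negative. In the other direction continuity of
  \<open>\<rho>\<close> suffices.\<close>

lemma frontier_defining_function:
  assumes "open V" and def: "defining_function V W \<rho> G" and y: "y \<in> W"
  shows "y \<in> frontier V \<longleftrightarrow> \<rho> y = 0"
proof -
  have W: "open W" and VW: "V \<inter> W = {y \<in> W. \<rho> y < 0}" and G: "G y \<noteq> 0"
    using def y by (auto simp: defining_function_def)
  have cont: "isCont \<rho> y"
    using defining_function_continuous [OF def] W y by (simp add: continuous_on_eq_continuous_at)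
  have fr: "y \<in> frontier V \<longleftrightarrow> y \<notin> V \<and> y \<in> closure V"
    using \<open>open V\<close> by (auto simp: frontier_def interior_open)
  show ?thesis
  proof
    assume "y \<in> frontier V"
    then have "y \<notin> V" "y \<in> closure V" using fr by auto
    then have "\<rho> y \<ge> 0" using VW y by fastforce
    moreover have "\<not> \<rho> y > 0"
    proof
      assume "\<rho> y > 0"
      then have "\<forall>\<^sub>F z in at y. \<rho> z > 0" using cont unfolding isCont_def by (rule order_tendstoD(1) [rotated])
      then have "\<forall>\<^sub>F z in nhds y. \<rho> z > 0" using \<open>\<rho> y > 0\<close> by (auto simp: eventually_nhds_conv_at)
      moreover have "\<forall>\<^sub>F z in nhds y. z \<in> W" using W y by (rule eventually_nhds_in_open)
      ultimately have "\<forall>\<^sub>F z in nhds y. z \<notin> V" by eventually_elim (use VW in force)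
      then obtain S where "open S" "y \<in> S" "\<forall>z\<in>S. z \<notin> V" unfolding eventually_nhds by blast
      then have "S \<inter> closure V = {}" using open_Int_closure_eq_empty [of S V] by blast
      then show False using \<open>y \<in> closure V\<close> \<open>y \<in> S\<close> by blast
    qed
    ultimately show "\<rho> y = 0" by simp
  next
    assume \<rho>: "\<rho> y = 0"
    have "((\<lambda>s. \<rho> (y + s *\<^sub>R (- G y))) has_real_derivative - (G y \<bullet> G y)) (at 0)"
      using defining_function_line [OF def, of y 0 "- G y"] y by simp
    moreover have "- (G y \<bullet> G y) < 0" using G by simp
    ultimately have "\<exists>d>0. \<forall>h>0. h < d \<longrightarrow> \<rho> (y + (0 + h) *\<^sub>R (- G y)) < \<rho> (y + 0 *\<^sub>R (- G y))"
      by (rule DERIV_neg_dec_right)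
    then obtain d where d: "d > 0" "\<And>h. 0 < h \<Longrightarrow> h < d \<Longrightarrow> \<rho> (y + h *\<^sub>R (- G y)) < 0"
      unfolding scaleR_zero_left add_0_left add_0_right \<rho> by blast
    have "y \<in> closure V"
    proof (rule closure_approachable [THEN iffD2], intro allI impI)
      fix \<epsilon> :: real assume \<epsilon>: "0 < \<epsilon>"
      obtain b where b: "b > 0" "ball y b \<subseteq> W" using W y open_contains_ball by blast
      \<comment> \<open>Small enough for \<open>\<rho>\<close> to be negative, for staying in the
        ball of radius \<open>b\<close> inside \<open>W\<close>, and for the distance
        \<open>\<epsilon>\<close>.\<close>
      define h where "h = min (d / 2) (min \<epsilon> b / (2 * norm (G y)))"
      have h: "0 < h" "h < d" using d(1) \<epsilon> b(1) G by (auto simp: h_def)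
      have "h \<le> min \<epsilon> b / (2 * norm (G y))" by (simp add: h_def)
      then have "h * norm (G y) \<le> min \<epsilon> b / 2" using G by (simp add: field_simps)
      moreover have "min \<epsilon> b / 2 < min \<epsilon> b" using \<epsilon> b(1) by (simp add: min_def)
      ultimately have lt: "h * norm (G y) < min \<epsilon> b" by (rule le_less_trans)
      have dist: "dist (y + h *\<^sub>R (- G y)) y = h * norm (G y)" using h by (simp add: dist_norm)
      have "y + h *\<^sub>R (- G y) \<in> ball y b" using lt dist dist_commute [of y] by (simp only: mem_ball min_less_iff_conj)
      then have "y + h *\<^sub>R (- G y) \<in> W" using b(2) by blast
      then have "y + h *\<^sub>R (- G y) \<in> V" using d(2) [OF h] VW by blast
      then show "\<exists>z\<in>V. dist z y < \<epsilon>" using lt dist by (intro bexI [of _ "y + h *\<^sub>R (- G y)"]) auto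
    qed
    moreover have "y \<notin> V"
    proof
      assume "y \<in> V"
      then have "y \<in> {y \<in> W. \<rho> y < 0}" using VW y by blast
      then show False using \<rho> by simp
    qed
    ultimately show "y \<in> frontier V" using fr by simp
  qed
qed

lemma norm_orthogonal_sum:
  assumes "w \<bullet> e = 0" "norm e = 1"
  shows "norm w \<le> norm (w + s *\<^sub>R e)" "\<bar>s\<bar> \<le> norm (w + s *\<^sub>R e)"
proof -
  have "(norm (w + s *\<^sub>R e))\<^sup>2 = (norm w)\<^sup>2 + \<bar>s\<bar>\<^sup>2"
    using assms unfolding power2_norm_eq_inner
    by (simp add: inner_add_left inner_add_right inner_commute norm_eq_1 power2_eq_square)
  then have "(norm w)\<^sup>2 \<le> (norm (w + s *\<^sub>R e))\<^sup>2" "\<bar>s\<bar>\<^sup>2 \<le> (norm (w + s *\<^sub>R e))\<^sup>2" by simp_all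
  then show "norm w \<le> norm (w + s *\<^sub>R e)" "\<bar>s\<bar> \<le> norm (w + s *\<^sub>R e)"
    by (meson norm_ge_zero power2_le_imp_le)+
qed

text \<open>
  Integrating \<open>\<partial>\<^sub>e \<phi>\<close> over \<open>V\<close> along the lines parallel to \<open>e\<close> leaves the values of \<open>\<phi>\<close> at the points where
  these lines leave \<open>V\<close>.
\<close>

lemma gauss_green_local_direction:
  fixes V :: "(real ^ 'n::finite) set"
  assumes "open V" and def: "defining_function V W \<rho> G" and x0: "x0 \<in> W" "x0 \<in> frontier V"
    and e: "norm e = 1" "0 < e \<bullet> G x0"
    and \<nu>: "\<And>y. y \<in> W \<Longrightarrow> y \<in> frontier V \<Longrightarrow> \<nu> y = G y /\<^sub>R norm (G y)"
  shows "\<exists>r>0. cball x0 r \<subseteq> W \<and> emeasure (hausdorff_measure (CARD('n) - 1)) (frontier V \<inter> cball x0 r) < \<infinity> \<and>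
    (\<forall>\<phi> \<phi>'. (\<forall>y\<in>W. (\<phi> has_derivative \<phi>' y) (at y)) \<longrightarrow> continuous_on W (\<lambda>y. \<phi>' y e) \<longrightarrow>
       (\<forall>y. y \<notin> ball x0 r \<longrightarrow> \<phi> y = 0 \<and> \<phi>' y e = 0) \<longrightarrow>
       (LINT x:frontier V|hausdorff_measure (CARD('n) - 1). \<phi> x * (e \<bullet> \<nu> x))
         = slab_factor TYPE('n) * (LINT y:V|lborel. \<phi>' y e))"
proof -
  let ?H = "hausdorff_measure (CARD('n) - 1) :: (real ^ 'n) measure"
  have W: "open W" and VW: "V \<inter> W = {y \<in> W. \<rho> y < 0}" and contG: "continuous_on W G"
    and G0: "\<And>y. y \<in> W \<Longrightarrow> G y \<noteq> 0"
    using def by (auto simp: defining_function_def)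
  have fr: "y \<in> frontier V \<longleftrightarrow> \<rho> y = 0" if "y \<in> W" for y
    by (rule frontier_defining_function [OF \<open>open V\<close> def that])
  obtain R where R: "R > 0" "cball x0 R \<subseteq> W" "\<And>y. y \<in> cball x0 R \<Longrightarrow> 0 < e \<bullet> G y"
  proof -
    have "continuous_on W (\<lambda>y. e \<bullet> G y)" by (intro continuous_intros contG)
    then have "open (W \<inter> (\<lambda>y. e \<bullet> G y) -` {0<..})" using W by (rule continuous_open_preimage) simp
    moreover have "x0 \<in> W \<inter> (\<lambda>y. e \<bullet> G y) -` {0<..}" using x0(1) e(2) by simp
    ultimately obtain R where "R > 0" "cball x0 R \<subseteq> W \<inter> (\<lambda>y. e \<bullet> G y) -` {0<..}"
      using open_contains_cball by blast
    moreover from this have "\<And>y. y \<in> cball x0 R \<Longrightarrow> 0 < e \<bullet> G y" "cball x0 R \<subseteq> W" by blast+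
    ultimately show ?thesis by (intro that)
  qed
  \<comment> \<open>Within the ball \<open>\<rho>\<close> increases strictly along \<open>e\<close>,
    so each line parallel to \<open>e\<close> leaves \<open>V\<close> at most once there; this also
    makes the projection injective on the boundary.\<close>
  have mono: "\<rho> (p + s *\<^sub>R e) < \<rho> (p + t *\<^sub>R e)"
    if "s < t" and s: "p + s *\<^sub>R e \<in> cball x0 R" and t: "p + t *\<^sub>R e \<in> cball x0 R" for p s t
  proof -
    obtain \<xi> where \<xi>: "\<xi> \<in> cball x0 R" "\<rho> (p + t *\<^sub>R e) - \<rho> (p + s *\<^sub>R e) = G \<xi> \<bullet> ((p + t *\<^sub>R e) - (p + s *\<^sub>R e))"
      using defining_function_mvt [OF def convex_cball R(2) t s] by blast
    have "(p + t *\<^sub>R e) - (p + s *\<^sub>R e) = (t - s) *\<^sub>R e" by (simp add: algebra_simps)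
    then have "\<rho> (p + t *\<^sub>R e) - \<rho> (p + s *\<^sub>R e) = (t - s) * (e \<bullet> G \<xi>)"
      using \<xi>(2) by (simp add: inner_commute)
    also have "\<dots> > 0" using R(3) [OF \<xi>(1)] that(1) by simp
    finally show ?thesis by simp
  qed
  \<comment> \<open>Half the radius, so that the cylinder around \<open>x0\<close> of radius and
    half-length \<open>\<delta>\<close> stays in the ball of radius \<open>R\<close>.\<close>
  define \<delta> where "\<delta> = R / 2"
  have \<delta>: "0 < \<delta>" using R(1) by (simp add: \<delta>_def)
  have dist_line: "dist x0 (x0 + w + t *\<^sub>R e) = norm (w + t *\<^sub>R e)" for w t
    using norm_minus_cancel [of "w + t *\<^sub>R e"] by (simp add: dist_norm)
  have in_cyl: "x0 + w + t *\<^sub>R e \<in> cball x0 R" if "norm w \<le> \<delta>" "\<bar>t\<bar> \<le> \<delta>" for w t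
  proof -
    have "norm (w + t *\<^sub>R e) \<le> norm w + norm (t *\<^sub>R e)" by (rule norm_triangle_ineq)
    also have "\<dots> \<le> R" using that e(1) by (simp add: \<delta>_def)
    finally show ?thesis by (simp only: mem_cball dist_line)
  qed
  have \<rho>x0: "\<rho> x0 = 0" using fr x0 by simp
  have ends: "\<rho> (x0 - \<delta> *\<^sub>R e) < 0" "0 < \<rho> (x0 + \<delta> *\<^sub>R e)"
    using mono [of "- \<delta>" 0 x0] mono [of 0 \<delta> x0] in_cyl [of 0 "- \<delta>"] in_cyl [of 0 \<delta>] in_cyl [of 0 0] \<delta> \<rho>x0 by simp_all
  have cont\<rho>: "continuous_on W \<rho>" by (rule defining_function_continuous [OF def])
  have "open (W \<inter> \<rho> -` {..<0})" "open (W \<inter> \<rho> -` {0<..})"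
    using cont\<rho> W by (auto intro: continuous_open_preimage)
  moreover have "x0 - \<delta> *\<^sub>R e \<in> W \<inter> \<rho> -` {..<0}" "x0 + \<delta> *\<^sub>R e \<in> W \<inter> \<rho> -` {0<..}"
    using ends R(2) in_cyl [of 0 "- \<delta>"] in_cyl [of 0 \<delta>] \<delta> by auto
  ultimately obtain r1 r2 where r12: "r1 > 0" "ball (x0 - \<delta> *\<^sub>R e) r1 \<subseteq> W \<inter> \<rho> -` {..<0}"
    "r2 > 0" "ball (x0 + \<delta> *\<^sub>R e) r2 \<subseteq> W \<inter> \<rho> -` {0<..}"
    by (meson open_contains_ball)
  \<comment> \<open>Small enough that on every line at distance at most \<open>r\<close> from the
    axis \<open>\<rho>\<close> is negative at parameter \<open>- \<delta>\<close> and positive at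
    \<open>\<delta>\<close>, and that the support ball lies strictly between these ends.\<close>
  define r where "r = min \<delta> (min r1 r2) / 2"
  have r: "0 < r" "r < \<delta>" "r < r1" "r < r2" using \<delta> r12 by (auto simp: r_def min_def)
  have rR: "cball x0 r \<subseteq> cball x0 R" using r R(1) by (auto simp: \<delta>_def)
  have end_neg: "\<rho> (x0 + w + (- \<delta>) *\<^sub>R e) < 0" if "norm w \<le> r" for w
  proof -
    have "x0 + w + (- \<delta>) *\<^sub>R e \<in> ball (x0 - \<delta> *\<^sub>R e) r1" using that r by (simp add: dist_norm)
    then show ?thesis using r12(2) by blast
  qed
  have end_pos: "0 < \<rho> (x0 + w + \<delta> *\<^sub>R e)" if "norm w \<le> r" for w
  proof -
    have "x0 + w + \<delta> *\<^sub>R e \<in> ball (x0 + \<delta> *\<^sub>R e) r2" using that r by (simp add: dist_norm)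
    then show ?thesis using r12(4) by blast
  qed
  have exit: "\<exists>\<tau>. \<bar>\<tau>\<bar> < \<delta> \<and> \<rho> (x0 + w + \<tau> *\<^sub>R e) = 0 \<and> (\<forall>t. \<bar>t\<bar> \<le> \<delta> \<longrightarrow> (\<rho> (x0 + w + t *\<^sub>R e) < 0 \<longleftrightarrow> t < \<tau>) \<and> (\<rho> (x0 + w + t *\<^sub>R e) = 0 \<longrightarrow> t = \<tau>))"
    if w: "norm w \<le> r" for w
  proof -
    have wd: "norm w \<le> \<delta>" using w r by simp
    have "continuous_on {- \<delta>..\<delta>} (\<lambda>t. \<rho> (x0 + w + t *\<^sub>R e))"
    proof (rule continuous_on_compose2 [OF cont\<rho>])
      show "(\<lambda>t. x0 + w + t *\<^sub>R e) ` {- \<delta>..\<delta>} \<subseteq> W"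
        using subsetD [OF R(2) in_cyl [OF wd]] by auto
    qed (intro continuous_intros)
    then obtain \<tau> where \<tau>: "- \<delta> \<le> \<tau>" "\<tau> \<le> \<delta>" "\<rho> (x0 + w + \<tau> *\<^sub>R e) = 0"
      using IVT' [of "\<lambda>t. \<rho> (x0 + w + t *\<^sub>R e)" "- \<delta>" 0 \<delta>] end_neg [OF w] end_pos [OF w] \<delta> by force
    have "\<tau> \<noteq> - \<delta>" "\<tau> \<noteq> \<delta>" using \<tau>(3) end_neg [OF w] end_pos [OF w] by auto
    then have \<tau>d: "\<bar>\<tau>\<bar> < \<delta>" using \<tau> by simp
    have lt: "t < \<tau> \<Longrightarrow> \<rho> (x0 + w + t *\<^sub>R e) < 0" "\<tau> < t \<Longrightarrow> 0 < \<rho> (x0 + w + t *\<^sub>R e)" if "\<bar>t\<bar> \<le> \<delta>" for t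
      using mono [of t \<tau> "x0 + w"] mono [of \<tau> t "x0 + w"] in_cyl [OF wd that] in_cyl [OF wd, of \<tau>] \<tau>d \<tau>(3) by simp_all
    show ?thesis
    proof (intro exI [of _ \<tau>] conjI allI impI)
      fix t assume t: "\<bar>t\<bar> \<le> \<delta>"
      show "\<rho> (x0 + w + t *\<^sub>R e) < 0 \<longleftrightarrow> t < \<tau>" using lt [OF t] \<tau>(3) by (metis less_asym linorder_less_linear)
      show "t = \<tau>" if "\<rho> (x0 + w + t *\<^sub>R e) = 0" using lt [OF t] that by (metis less_irrefl linorder_less_linear)
    qed (use \<tau>d \<tau>(3) in simp_all)
  qed
  define K where "K = frontier V \<inter> cball x0 r"
  have KW: "K \<subseteq> W" using rR R(2) by (auto simp: K_def)
  have K\<rho>: "\<rho> y = 0" if "y \<in> K" for y using that KW fr [of y] by (auto simp: K_def)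
  have KR: "K \<subseteq> cball x0 R" using rR by (auto simp: K_def)
  have \<nu>K: "\<nu> y = G y /\<^sub>R norm (G y)" if "y \<in> K" for y using \<nu> [of y] that KW by (auto simp: K_def)
  interpret K: projectable_surface K e \<nu>
  proof
    show "compact K" unfolding K_def by (intro closed_Int_compact) auto
    show "norm e = 1" by (rule e)
    have "continuous_on K (\<lambda>y. G y /\<^sub>R norm (G y))"
      by (intro continuous_intros continuous_on_subset [OF contG KW]) (use G0 KW in auto)
    then show "continuous_on K \<nu>" by (rule continuous_on_cong [THEN iffD1, rotated 2]) (simp_all add: \<nu>K)
    show "norm (\<nu> x) = 1" if "x \<in> K" for x using \<nu>K [OF that] G0 [OF subsetD [OF KW that]] by simp
    show "0 < e \<bullet> \<nu> x" if "x \<in> K" for x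
      using \<nu>K [OF that] R(3) [OF subsetD [OF KR that]] G0 [OF subsetD [OF KW that]] by simp
    show "inj_on (hyperplane_proj e) K"
    proof (rule inj_onI, rule ccontr)
      fix x y assume x: "x \<in> K" and y: "y \<in> K" and eq: "hyperplane_proj e x = hyperplane_proj e y" and "x \<noteq> y"
      let ?p = "hyperplane_proj e x"
      have xp: "x = ?p + (x \<bullet> e) *\<^sub>R e" by (simp add: hyperplane_proj_def)
      have yp: "y = ?p + (y \<bullet> e) *\<^sub>R e" unfolding eq by (simp add: hyperplane_proj_def)
      have "x \<bullet> e \<noteq> y \<bullet> e" using xp yp \<open>x \<noteq> y\<close> by metis
      then consider "x \<bullet> e < y \<bullet> e" | "y \<bullet> e < x \<bullet> e" by linarith
      then show False
      proof cases
        case 1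
        then show False
          using mono [OF 1, of ?p] subsetD [OF KR x] subsetD [OF KR y] K\<rho> [OF x] K\<rho> [OF y]
          unfolding xp [symmetric] yp [symmetric] by simp
      next
        case 2
        then show False
          using mono [OF 2, of ?p] subsetD [OF KR x] subsetD [OF KR y] K\<rho> [OF x] K\<rho> [OF y]
          unfolding xp [symmetric] yp [symmetric] by simp
      qed
    qed
    \<comment> \<open>Tangency: for two zeros of \<open>\<rho>\<close> near \<open>x\<close> the
      mean value theorem makes the difference orthogonal to \<open>G\<close> at a nearby point, and
      \<open>G\<close> is continuous.\<close>
    fix x and \<epsilon> :: real assume x: "x \<in> K" and \<epsilon>: "0 < \<epsilon>"
    have xW: "x \<in> W" using x KW by auto
    have Gx: "0 < norm (G x)" using G0 [OF xW] by simp
    have "isCont G x" using contG W xW by (simp add: continuous_on_eq_continuous_at)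
    then obtain s where s: "s > 0" "\<And>y. dist y x < s \<Longrightarrow> dist (G y) (G x) < \<epsilon> * norm (G x)"
      unfolding continuous_at_eps_delta using \<epsilon> Gx by (metis mult_pos_pos)
    obtain b where b: "b > 0" "ball x b \<subseteq> W" using W xW open_contains_ball by blast
    show "\<exists>r>0. \<forall>y\<in>K \<inter> ball x r. \<forall>z\<in>K \<inter> ball x r. \<bar>(y - z) \<bullet> \<nu> x\<bar> \<le> \<epsilon> * norm (y - z)"
    proof (intro exI [of _ "min s b"] conjI ballI)
      show "0 < min s b" using s b by simp
      fix y z assume y: "y \<in> K \<inter> ball x (min s b)" and z: "z \<in> K \<inter> ball x (min s b)"
      have "ball x (min s b) \<subseteq> W" using b(2) by auto
      then obtain \<xi> where \<xi>: "\<xi> \<in> ball x (min s b)" "\<rho> y - \<rho> z = G \<xi> \<bullet> (y - z)"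
        using defining_function_mvt [OF def convex_ball, of x "min s b" y z] y z by blast
      have "G \<xi> \<bullet> (y - z) = 0" using \<xi>(2) K\<rho> y z by simp
      then have "G x \<bullet> (y - z) = (G x - G \<xi>) \<bullet> (y - z)" by (simp add: inner_diff_left)
      then have "\<bar>G x \<bullet> (y - z)\<bar> \<le> norm (G x - G \<xi>) * norm (y - z)" using Cauchy_Schwarz_ineq2 by metis
      also have "\<dots> \<le> (\<epsilon> * norm (G x)) * norm (y - z)"
        using s(2) [of \<xi>] \<xi>(1) by (intro mult_right_mono) (auto simp: dist_norm norm_minus_commute)
      finally have "\<bar>G x \<bullet> (y - z)\<bar> / norm (G x) \<le> \<epsilon> * norm (y - z)" using Gx by (simp add: divide_le_eq mult_ac)
      moreover have "(y - z) \<bullet> \<nu> x = (G x \<bullet> (y - z)) / norm (G x)"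
        by (simp add: \<nu>K [OF x] inner_commute divide_inverse mult.commute)
      ultimately show "\<bar>(y - z) \<bullet> \<nu> x\<bar> \<le> \<epsilon> * norm (y - z)" by (simp add: abs_divide)
    qed
  qed
  show ?thesis
  proof (intro exI [of _ r] conjI allI impI)
    show "0 < r" "cball x0 r \<subseteq> W" using r rR R(2) by auto
    show "emeasure ?H (frontier V \<inter> cball x0 r) < \<infinity>"
      using K.emeasure_surface_finite by (simp add: K_def)
    fix \<phi> :: "real ^ 'n \<Rightarrow> real" and \<phi>'
    assume d\<phi>: "\<forall>y\<in>W. (\<phi> has_derivative \<phi>' y) (at y)" and cont\<phi>': "continuous_on W (\<lambda>y. \<phi>' y e)"
      and supp: "\<forall>y. y \<notin> ball x0 r \<longrightarrow> \<phi> y = 0 \<and> \<phi>' y e = 0"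
    have rW: "cball x0 r \<subseteq> W" using rR R(2) by auto
    have cont\<phi>: "continuous_on W \<phi>"
      using d\<phi> by (meson continuous_at_imp_continuous_on has_derivative_continuous)
    have supp_ind: "indicator (cball x0 r) y *\<^sub>R \<phi> y = \<phi> y" "indicator (cball x0 r) y *\<^sub>R \<phi>' y e = \<phi>' y e" for y
      using supp ball_subset_cball [of x0 r] by (auto simp: indicator_def)
    have "(\<lambda>y. indicator (cball x0 r) y *\<^sub>R \<phi> y) \<in> borel_measurable borel"
      by (rule borel_measurable_continuous_on_indicator [OF _ continuous_on_subset [OF cont\<phi> rW]]) simp
    then have \<phi>m [measurable]: "\<phi> \<in> borel_measurable borel" by (simp only: supp_ind)
    have "integrable lborel (\<lambda>y. indicator (cball x0 r) y *\<^sub>R \<phi>' y e)"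
      by (rule borel_integrable_compact [OF _ continuous_on_subset [OF cont\<phi>' rW]]) simp
    then have "integrable lborel (\<lambda>y. \<phi>' y e)" by (simp only: supp_ind)
    then have intF: "integrable lborel (\<lambda>y. indicator V y *\<^sub>R \<phi>' y e)"
      by (rule integrable_mult_indicator [rotated]) (use \<open>open V\<close> in simp)
    have far: "\<phi> (x0 + w + s *\<^sub>R e) = 0 \<and> \<phi>' (x0 + w + s *\<^sub>R e) e = 0" if "w \<bullet> e = 0" "r \<le> norm w \<or> r \<le> \<bar>s\<bar>" for w s
    proof -
      have "r \<le> norm (w + s *\<^sub>R e)" using norm_orthogonal_sum [OF that(1) e(1), of s] that(2) by linarith
      then have "x0 + w + s *\<^sub>R e \<notin> ball x0 r" by (simp only: mem_ball dist_line not_less)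
      then show ?thesis using supp by blast
    qed
    \<comment> \<open>The integral along one line is the value of \<open>\<phi>\<close> at the exit
      point; for a line that misses \<open>K\<close> both sides are 0.\<close>
    have inner: "(\<integral>t. indicator V (x + t *\<^sub>R e) *\<^sub>R \<phi>' (x + t *\<^sub>R e) e \<partial>lborel) = indicator (K.\<pi> ` K) x *\<^sub>R \<phi> (K.sec x)"
      if x: "x \<bullet> e = 0" for x
    proof -
      define w where "w = x - hyperplane_proj e x0"
      have w: "w \<bullet> e = 0" using x hyperplane_proj_inner [OF e(1)] by (simp add: w_def inner_diff_left)
      have line: "x + (x0 \<bullet> e + s) *\<^sub>R e = x0 + w + s *\<^sub>R e" for s
        by (simp add: w_def hyperplane_proj_def algebra_simps)
      have proj: "K.\<pi> (x0 + w + s *\<^sub>R e) = x" for s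
        using w e(1) by (simp add: hyperplane_proj_def w_def inner_add_left norm_eq_1 inner_diff_left x algebra_simps)
      have point: "\<exists>s. q = x0 + w + s *\<^sub>R e \<and> \<bar>s\<bar> \<le> norm (q - x0)" if "K.\<pi> q = x" for q
      proof (intro exI conjI)
        have "q = x + (q \<bullet> e) *\<^sub>R e" using that by (simp add: hyperplane_proj_def algebra_simps)
        then show q: "q = x0 + w + (q \<bullet> e - x0 \<bullet> e) *\<^sub>R e"
          by (simp add: w_def hyperplane_proj_def algebra_simps)
        have "q - x0 = w + (q \<bullet> e - x0 \<bullet> e) *\<^sub>R e" using q by (simp add: algebra_simps)
        then show "\<bar>q \<bullet> e - x0 \<bullet> e\<bar> \<le> norm (q - x0)" using norm_orthogonal_sum(2) [OF w e(1)] by metis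
      qed
      define g where "g s = indicator V (x0 + w + s *\<^sub>R e) *\<^sub>R \<phi>' (x0 + w + s *\<^sub>R e) e" for s
      have shift: "(\<integral>t. indicator V (x + t *\<^sub>R e) *\<^sub>R \<phi>' (x + t *\<^sub>R e) e \<partial>lborel) = (\<integral>s. g s \<partial>lborel)"
        by (subst lborel_integral_real_affine [of 1 _ "x0 \<bullet> e"]) (simp_all add: line g_def [abs_def])
      show ?thesis
      proof (cases "norm w < r")
        case False
        then have "g s = 0" for s using far [OF w] by (simp add: g_def)
        then have "(\<integral>s. g s \<partial>lborel) = 0" by simp
        moreover have "\<phi> (K.sec x) = 0" if "x \<in> K.\<pi> ` K"
        proof -
          from that obtain q where q: "q \<in> K" "x = K.\<pi> q" by blast
          then obtain s where "q = x0 + w + s *\<^sub>R e" using point [of q] by auto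
          then show ?thesis using far [OF w, of s] False K.sec_\<pi> [OF q(1)] q(2) by simp
        qed
        ultimately show ?thesis unfolding shift by (simp add: indicator_def)
      next
        case True
        then obtain \<tau> where \<tau>: "\<bar>\<tau>\<bar> < \<delta>" "\<rho> (x0 + w + \<tau> *\<^sub>R e) = 0"
          "\<And>t. \<bar>t\<bar> \<le> \<delta> \<Longrightarrow> \<rho> (x0 + w + t *\<^sub>R e) < 0 \<longleftrightarrow> t < \<tau>"
          "\<And>t. \<bar>t\<bar> \<le> \<delta> \<Longrightarrow> \<rho> (x0 + w + t *\<^sub>R e) = 0 \<Longrightarrow> t = \<tau>"
          using exit [of w] by auto
        define p where "p = x0 + w + \<tau> *\<^sub>R e"
        have cylW: "x0 + w + s *\<^sub>R e \<in> W" if "\<bar>s\<bar> \<le> \<delta>" for s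
          using in_cyl [OF _ that, of w] True r R(2) by auto
        define h where "h s = indicator {- \<delta>..\<tau>} s *\<^sub>R \<phi>' (x0 + w + s *\<^sub>R e) e" for s
        have "continuous_on {- \<delta>..\<tau>} (\<lambda>s. \<phi>' (x0 + w + s *\<^sub>R e) e)"
          by (rule continuous_on_compose2 [OF cont\<phi>']) (use cylW \<tau>(1) in \<open>auto intro!: continuous_intros\<close>)
        note cont_line = this
        have hm [measurable]: "h \<in> borel_measurable borel"
          unfolding h_def by (rule borel_measurable_continuous_on_indicator [OF _ cont_line]) simp
        have gh: "g s = indicator {..<\<tau>} s *\<^sub>R h s" for s
        proof (cases "\<bar>s\<bar> \<le> \<delta>")
          case True
          then have "x0 + w + s *\<^sub>R e \<in> V \<longleftrightarrow> s < \<tau>" using \<tau>(3) [OF True] cylW [OF True] VW by blast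
          then show ?thesis using True by (auto simp: g_def h_def indicator_def)
        next
          case False
          then have "\<phi>' (x0 + w + s *\<^sub>R e) e = 0" using far [OF w, of s] r by auto
          then show ?thesis by (simp add: g_def h_def)
        qed
        \<comment> \<open>\<open>g\<close> and \<open>h\<close> differ at most at the exit parameter
          \<open>\<tau>\<close>, a null set; \<open>h\<close> lives on a closed interval, as the
          fundamental theorem of calculus requires.\<close>
        have "(\<integral>s. g s \<partial>lborel) = (\<integral>s. h s \<partial>lborel)"
        proof (rule integral_cong_AE)
          show "g \<in> borel_measurable lborel" unfolding gh [abs_def] by measurable
          have "AE s in lborel. s \<noteq> \<tau>" by (rule AE_lborel_singleton)
          then show "AE s in lborel. g s = h s"
          proof eventually_elim
            case (elim s)
            then show ?case unfolding gh by (auto simp: h_def indicator_def)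
          qed
        qed simp
        also have "\<dots> = \<phi> (x0 + w + \<tau> *\<^sub>R e) - \<phi> (x0 + w + (- \<delta>) *\<^sub>R e)"
          unfolding h_def
        proof (rule integral_FTC_Icc [OF _ _ cont_line])
          show "- \<delta> \<le> \<tau>" using \<tau>(1) by simp
          fix s assume "- \<delta> \<le> s" "s \<le> \<tau>"
          then have "x0 + w + s *\<^sub>R e \<in> W" using cylW \<tau>(1) by simp
          then have "(\<phi> has_derivative \<phi>' (x0 + w + s *\<^sub>R e)) (at (x0 + w + s *\<^sub>R e))" using d\<phi> by blast
          from has_vector_derivative_along_line [OF this]
          show "((\<lambda>s. \<phi> (x0 + w + s *\<^sub>R e)) has_vector_derivative \<phi>' (x0 + w + s *\<^sub>R e) e) (at s within {- \<delta>..\<tau>})"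
            by (rule has_vector_derivative_at_within)
        qed
        also have "\<dots> = \<phi> p" using far [OF w, of "- \<delta>"] r by (simp add: p_def)
        finally have int: "(\<integral>s. g s \<partial>lborel) = \<phi> p" .
        have pW: "p \<in> W" using cylW [of \<tau>] \<tau>(1) by (simp add: p_def)
        show ?thesis
        proof (cases "p \<in> cball x0 r")
          case True
          then have "p \<in> K" using fr [OF pW] \<tau>(2) by (simp add: K_def p_def)
          moreover have "K.\<pi> p = x" unfolding p_def by (rule proj)
          ultimately have "x \<in> K.\<pi> ` K" "K.sec x = p" using K.sec_\<pi> [of p] by auto
          then show ?thesis unfolding shift int by simp
        next
          \<comment> \<open>The exit point lies outside the closed ball, where \<open>\<phi>\<close>
            vanishes; uniqueness of the exit keeps the line from meeting \<open>K\<close>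
            elsewhere.\<close>
          case False
          have "x \<notin> K.\<pi> ` K"
          proof
            assume "x \<in> K.\<pi> ` K"
            then obtain q where q: "q \<in> K" "K.\<pi> q = x" by blast
            obtain s where s: "q = x0 + w + s *\<^sub>R e" "\<bar>s\<bar> \<le> norm (q - x0)" using point [OF q(2)] by blast
            have "norm (q - x0) \<le> r" using q(1) by (simp add: K_def dist_norm norm_minus_commute)
            then have "s = \<tau>" using \<tau>(4) [of s] s K\<rho> [OF q(1)] r by simp
            then have "q = p" using s(1) by (simp add: p_def)
            then show False using q(1) False by (simp add: K_def)
          qed
          moreover have "\<phi> p = 0" using False supp ball_subset_cball by blast
          ultimately show ?thesis unfolding shift int by simp
        qed
      qed
    qed
    have \<pi>K: "K.\<pi> ` K \<in> sets borel" by (rule borel_compact [OF K.compact_\<pi>_image])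
    have "slab_factor TYPE('n) * (LINT y:V|lborel. \<phi>' y e)
        = (\<integral>x. (\<integral>t. indicator V (x + t *\<^sub>R e) *\<^sub>R \<phi>' (x + t *\<^sub>R e) e \<partial>lborel) \<partial>hyperplane_measure e)"
      unfolding set_lebesgue_integral_def by (rule integral_lborel_slab [OF e(1) intF])
    also have "\<dots> = (\<integral>x. indicator (K.\<pi> ` K) x *\<^sub>R \<phi> (K.sec x) \<partial>hyperplane_measure e)"
    proof (rule integral_cong_AE)
      show "(\<lambda>x. \<integral>t. indicator V (x + t *\<^sub>R e) *\<^sub>R \<phi>' (x + t *\<^sub>R e) e \<partial>lborel) \<in> borel_measurable (hyperplane_measure e)"
      proof -
        have [measurable]: "(\<lambda>y. indicator V y *\<^sub>R \<phi>' y e) \<in> borel_measurable borel" using intF by simp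
        show ?thesis by measurable
      qed
      show "(\<lambda>x. indicator (K.\<pi> ` K) x *\<^sub>R \<phi> (K.sec x)) \<in> borel_measurable (hyperplane_measure e)"
        using \<pi>K by measurable
      have "AE x in hyperplane_measure e. x \<bullet> e = 0"
        unfolding hyperplane_measure_def by (subst AE_density) (auto simp: indicator_def)
      then show "AE x in hyperplane_measure e. (\<integral>t. indicator V (x + t *\<^sub>R e) *\<^sub>R \<phi>' (x + t *\<^sub>R e) e \<partial>lborel)
          = indicator (K.\<pi> ` K) x *\<^sub>R \<phi> (K.sec x)"
        by eventually_elim (rule inner)
    qed
    also have "\<dots> = (\<integral>x. indicator {x. x \<bullet> e = 0} x *\<^sub>R (indicator (K.\<pi> ` K) x *\<^sub>R \<phi> (K.sec x)) \<partial>?H)"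
    proof -
      have ind: "hyperplane_measure e = density ?H (\<lambda>x. ennreal (indicator {x. x \<bullet> e = 0} x))"
        unfolding hyperplane_measure_def
        by (rule arg_cong [where f="density _"]) (simp add: fun_eq_iff ennreal_indicator)
      show ?thesis unfolding ind using \<pi>K by (subst integral_density) auto
    qed
    also have "\<dots> = (LINT z:K.\<pi> ` K|?H. \<phi> (K.sec z))"
      unfolding set_lebesgue_integral_def
      by (rule Bochner_Integration.integral_cong) (auto simp: indicator_def hyperplane_proj_inner [OF e(1)])
    also have "\<dots> = (LINT x:K|?H. \<phi> x * (e \<bullet> \<nu> x))"
      by (rule K.integral_surface_projection) simp
    also have "\<dots> = (LINT x:frontier V|?H. \<phi> x * (e \<bullet> \<nu> x))"
      unfolding set_lebesgue_integral_def K_def using supp ball_subset_cball [of x0 r]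
      by (intro Bochner_Integration.integral_cong) (auto simp: indicator_def)
    finally show "(LINT x:frontier V|?H. \<phi> x * (e \<bullet> \<nu> x)) = slab_factor TYPE('n) * (LINT y:V|lborel. \<phi>' y e)" ..
  qed
qed

section \<open>Calculus of continuously differentiable functions and cut-offs\<close>

text \<open>The derivative is the canonical \<open>frechet_derivative\<close> and its continuity is
  stated direction by direction, so that regularity is a property of the function alone, without a
  witness to carry along.\<close>

definition C1_fun :: "'a::real_normed_vector set \<Rightarrow> ('a \<Rightarrow> real) \<Rightarrow> bool" where
  "C1_fun S f \<longleftrightarrow> (\<forall>y\<in>S. f differentiable (at y)) \<and>
     (\<forall>h. continuous_on S (\<lambda>y. frechet_derivative f (at y) h))"

lemma C1_funI:
  assumes d: "\<And>y. y \<in> S \<Longrightarrow> (f has_derivative f' y) (at y)" and c: "\<And>h. continuous_on S (\<lambda>y. f' y h)"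
  shows "C1_fun S f"
proof -
  have "frechet_derivative f (at y) = f' y" if "y \<in> S" for y
    using frechet_derivative_at [OF d [OF that]] by simp
  then have "continuous_on S (\<lambda>y. frechet_derivative f (at y) h)" for h
    by (intro continuous_on_cong [THEN iffD1, OF refl _ c [of h]]) simp
  then show ?thesis using d unfolding C1_fun_def differentiable_def by blast
qed

lemma C1_fun_has_derivative:
  "C1_fun S f \<Longrightarrow> y \<in> S \<Longrightarrow> (f has_derivative frechet_derivative f (at y)) (at y)"
  by (simp add: C1_fun_def frechet_derivative_works [symmetric])

lemma C1_fun_derivative_continuous:
  "C1_fun S f \<Longrightarrow> continuous_on S (\<lambda>y. frechet_derivative f (at y) h)"
  by (simp add: C1_fun_def)

lemma C1_fun_continuous: "C1_fun S f \<Longrightarrow> continuous_on S f"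
  by (meson C1_fun_has_derivative continuous_at_imp_continuous_on has_derivative_continuous)

lemma C1_fun_Un: "open S \<Longrightarrow> open T \<Longrightarrow> C1_fun S f \<Longrightarrow> C1_fun T f \<Longrightarrow> C1_fun (S \<union> T) f"
  unfolding C1_fun_def by (auto intro: continuous_on_open_Un)

lemma C1_fun_const: "C1_fun S (\<lambda>_. c)"
  by (rule C1_funI [where f'="\<lambda>_ _. 0"]) auto

lemma C1_fun_add: "C1_fun S f \<Longrightarrow> C1_fun S g \<Longrightarrow> C1_fun S (\<lambda>x. f x + g x)"
  by (rule C1_funI [where f'="\<lambda>y h. frechet_derivative f (at y) h + frechet_derivative g (at y) h"])
    (auto intro!: has_derivative_add C1_fun_has_derivative continuous_on_add C1_fun_derivative_continuous)

lemma C1_fun_mult: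
  assumes "C1_fun S f" "C1_fun S g" shows "C1_fun S (\<lambda>x. f x * g x)"
proof (rule C1_funI)
  show "((\<lambda>x. f x * g x) has_derivative (\<lambda>h. f y * frechet_derivative g (at y) h + frechet_derivative f (at y) h * g y)) (at y)"
    if "y \<in> S" for y
    by (rule has_derivative_mult [OF C1_fun_has_derivative [OF assms(1) that] C1_fun_has_derivative [OF assms(2) that]])
  show "continuous_on S (\<lambda>y. f y * frechet_derivative g (at y) h + frechet_derivative f (at y) h * g y)" for h
    by (intro continuous_intros C1_fun_derivative_continuous C1_fun_continuous assms)
qed

lemma C1_fun_sum: "(\<And>i. i \<in> I \<Longrightarrow> C1_fun S (f i)) \<Longrightarrow> C1_fun S (\<lambda>x. \<Sum>i\<in>I. f i x)"
  by (induction I rule: infinite_finite_induct) (auto intro: C1_fun_const C1_fun_add)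

lemma C1_fun_compose_real:
  assumes f: "C1_fun S f" and g: "\<And>x. x \<in> S \<Longrightarrow> (g has_real_derivative g' (f x)) (at (f x))"
    and g': "continuous_on (f ` S) g'"
  shows "C1_fun S (\<lambda>x. g (f x))"
proof (rule C1_funI)
  fix y assume y: "y \<in> S"
  show "((\<lambda>x. g (f x)) has_derivative (\<lambda>h. g' (f y) * frechet_derivative f (at y) h)) (at y)"
    using has_derivative_compose [OF C1_fun_has_derivative [OF f y] g [OF y, unfolded has_field_derivative_def]]
    by simp
next
  fix h
  show "continuous_on S (\<lambda>y. g' (f y) * frechet_derivative f (at y) h)"
    by (intro continuous_on_mult C1_fun_derivative_continuous [OF f]
        continuous_on_compose2 [OF g' C1_fun_continuous [OF f]]) auto
qed

lemma C1_fun_minus: "C1_fun S f \<Longrightarrow> C1_fun S (\<lambda>x. - f x)"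
  using C1_fun_mult [OF C1_fun_const [of S "- 1"], of f] by simp

lemma C1_fun_diff: "C1_fun S f \<Longrightarrow> C1_fun S g \<Longrightarrow> C1_fun S (\<lambda>x. f x - g x)"
  using C1_fun_add [OF _ C1_fun_minus, of S f g] by simp

lemma C1_fun_inverse:
  assumes "C1_fun S f" "\<And>x. x \<in> S \<Longrightarrow> f x \<noteq> 0" shows "C1_fun S (\<lambda>x. inverse (f x))"
  by (rule C1_fun_compose_real [OF assms(1), where g'="\<lambda>t. - (inverse t * inverse t)"])
    (auto intro!: continuous_intros derivative_eq_intros simp: assms(2) power2_eq_square)

lemma C1_fun_inner_self: "C1_fun S (\<lambda>x::'a::real_inner. (x - a) \<bullet> (x - a))"
  by (rule C1_funI [where f'="\<lambda>y h. 2 * ((y - a) \<bullet> h)"])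
    (auto intro!: derivative_eq_intros continuous_intros simp: inner_commute)

text \<open>Squaring smooths the corner of the positive part at 0. This elementary function supplies
  the bumps of the partition of unity and keeps its denominator positive.\<close>

lemma has_real_derivative_square_positive_part:
  "((\<lambda>t::real. (max 0 t)\<^sup>2) has_real_derivative 2 * max 0 t) (at t)"
proof -
  consider "t > 0" | "t < 0" | "t = 0" by linarith
  then show ?thesis
  proof cases
    case 1
    have "((\<lambda>t::real. t\<^sup>2) has_real_derivative 2 * t) (at t)" by (auto intro!: derivative_eq_intros)
    then have "((\<lambda>t. (max 0 t)\<^sup>2) has_real_derivative 2 * t) (at t)"
      by (rule has_field_derivative_transform_within_open [where S="{0<..}"]) (use 1 in \<open>auto simp: max_def\<close>)
    then show ?thesis using 1 by (simp add: max_def)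
  next
    case 2
    have "((\<lambda>t::real. 0) has_real_derivative 0) (at t)" by simp
    then have "((\<lambda>t. (max 0 t)\<^sup>2) has_real_derivative 0) (at t)"
      by (rule has_field_derivative_transform_within_open [where S="{..<0}"]) (use 2 in \<open>auto simp: max_def\<close>)
    then show ?thesis using 2 by (simp add: max_def)
  next
    case 3
    have "((\<lambda>h::real. ((max 0 (0 + h))\<^sup>2 - (max 0 0)\<^sup>2) / h) \<longlongrightarrow> 0) (at 0)"
    proof (rule Lim_null_comparison [where g="\<lambda>h. \<bar>h\<bar>"])
      show "\<forall>\<^sub>F h in at 0. norm (((max 0 (0 + h))\<^sup>2 - (max 0 0)\<^sup>2) / h) \<le> \<bar>h::real\<bar>"
        by (rule always_eventually) (auto simp: max_def power2_eq_square)
      show "((\<lambda>h::real. \<bar>h\<bar>) \<longlongrightarrow> 0) (at 0)" by (rule tendsto_eq_intros | simp)+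
    qed
    then show ?thesis using 3 by (simp add: DERIV_def)
  qed
qed

lemma C1_fun_square_positive_part: "C1_fun S f \<Longrightarrow> C1_fun S (\<lambda>x. (max 0 (f x))\<^sup>2)"
  by (rule C1_fun_compose_real [where g'="\<lambda>t. 2 * max 0 t"])
    (auto intro!: has_real_derivative_square_positive_part continuous_intros)

text \<open>The function is 0 off \<open>C\<close>, so \<open>S\<close> and the complement of
  \<open>C\<close> are two open sets that cover the space and on which it is continuously
  differentiable.\<close>

lemma C1_fun_zero_outside:
  assumes "C1_fun S f" "open S" "closed C" "C \<subseteq> S" "\<And>y. y \<notin> C \<Longrightarrow> f y = 0"
  shows "C1_fun UNIV f"
proof -
  have "C1_fun (- C) f"
  proof (rule C1_funI [where f'="\<lambda>_ _. 0"])
    fix y assume y: "y \<in> - C"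
    show "(f has_derivative (\<lambda>_. 0)) (at y)"
      by (rule has_derivative_transform_within_open [of "\<lambda>_. 0" _ y UNIV "- C"]) (use assms y in auto)
  qed auto
  then have "C1_fun (S \<union> - C) f" using assms by (intro C1_fun_Un) auto
  moreover have "S \<union> - C = UNIV" using assms(4) by blast
  ultimately show ?thesis by simp
qed

lemma frechet_derivative_eq_zero_outside:
  assumes "\<And>y. y \<notin> C \<Longrightarrow> f y = 0" "closed C" "y \<notin> C"
  shows "frechet_derivative f (at y) = (\<lambda>_. 0)"
proof -
  have "(f has_derivative (\<lambda>_. 0)) (at y)"
    by (rule has_derivative_transform_within_open [of "\<lambda>_. 0" _ y UNIV "- C"]) (use assms in auto)
  then show ?thesis using frechet_derivative_at by metis
qed

lemma set_integrable_continuous_compact: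
  fixes f :: "'a::euclidean_space \<Rightarrow> 'b::euclidean_space"
  assumes sets: "sets M = sets borel" and K: "compact K" "emeasure M K < \<infinity>" and f: "continuous_on K f"
  shows "set_integrable M K f"
proof -
  have Kb: "K \<in> sets borel" using K by (simp add: borel_compact)
  obtain B where B: "\<And>x. x \<in> K \<Longrightarrow> norm (f x) \<le> B"
    using compact_imp_bounded [OF compact_continuous_image [OF f K(1)]] unfolding bounded_iff by blast
  have "(\<lambda>x. indicator K x *\<^sub>R f x) \<in> borel_measurable borel"
    by (rule borel_measurable_continuous_on_indicator [OF Kb f])
  then have "(\<lambda>x. indicator K x *\<^sub>R f x) \<in> borel_measurable M" using measurable_cong_sets [OF sets refl] by blast
  then show ?thesis
    unfolding set_integrable_def
    by (rule integrableI_bounded_set [where A=K and B=B, rotated])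
      (use Kb sets K(2) B in \<open>auto simp: indicator_def\<close>)
qed

section \<open>From local to global divergence theorem\<close>

locale C1_domain =
  fixes V :: "(real ^ 'n::finite) set" and \<nu> :: "real ^ 'n \<Rightarrow> real ^ 'n"
  assumes V: "open V" "bounded V"
    and bdry: "\<And>x. x \<in> frontier V \<Longrightarrow> \<exists>W \<rho> G. x \<in> W \<and> defining_function V W \<rho> G \<and>
      (\<forall>y\<in>W \<inter> frontier V. \<nu> y = G y /\<^sub>R norm (G y))"
begin

abbreviation "H \<equiv> (hausdorff_measure (CARD('n) - 1) :: (real ^ 'n) measure)"

lemma compact_frontier_V: "compact (frontier V)"
  using V by (simp add: compact_frontier_bounded)

text \<open>Locally \<open>\<nu>\<close> is a normalised gradient. Continuity makes the boundary
  integrands integrable.\<close>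

lemma continuous_on_normal: "continuous_on (frontier V) \<nu>"
  unfolding continuous_on_def
proof
  fix x assume x: "x \<in> frontier V"
  then obtain W \<rho> G where W: "x \<in> W" "defining_function V W \<rho> G"
    "\<And>y. y \<in> W \<inter> frontier V \<Longrightarrow> \<nu> y = G y /\<^sub>R norm (G y)" using bdry [OF x] by blast
  have o: "open W" and G0: "\<And>y. y \<in> W \<Longrightarrow> G y \<noteq> 0" and cG: "continuous_on W G"
    using W(2) by (auto simp: defining_function_def)
  have "isCont G x" using cG o W(1) by (simp add: continuous_on_eq_continuous_at)
  then have "((\<lambda>y. G y /\<^sub>R norm (G y)) \<longlongrightarrow> G x /\<^sub>R norm (G x)) (at x)"
    using G0 [OF W(1)] unfolding isCont_def by (intro tendsto_intros) auto
  then have "((\<lambda>y. G y /\<^sub>R norm (G y)) \<longlongrightarrow> \<nu> x) (at x within frontier V)"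
    using W(3) [of x] W(1) x by (simp add: tendsto_within_subset [OF _ subset_UNIV])
  moreover have "\<forall>\<^sub>F y in at x within frontier V. G y /\<^sub>R norm (G y) = \<nu> y"
  proof -
    have "\<forall>\<^sub>F y in at x within frontier V. y \<in> W"
      using o W(1) by (rule eventually_at_topological [THEN iffD2, OF exI, OF conjI, OF _ conjI]) simp
    moreover have "\<forall>\<^sub>F y in at x within frontier V. y \<in> frontier V" by (simp add: eventually_at_filter)
    ultimately show ?thesis by eventually_elim (use W(3) in auto)
  qed
  ultimately show "(\<nu> \<longlongrightarrow> \<nu> x) (at x within frontier V)" by (rule Lim_transform_eventually)
qed

text \<open>The gradient itself is a transversal direction, and finiteness is part of the local
  statement for it.\<close>

lemma frontier_finite_local:
  assumes "x \<in> frontier V" shows "\<exists>r>0. emeasure H (frontier V \<inter> cball x r) < \<infinity>"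
proof -
  obtain W \<rho> G where W: "x \<in> W" "defining_function V W \<rho> G"
    "\<And>y. y \<in> W \<inter> frontier V \<Longrightarrow> \<nu> y = G y /\<^sub>R norm (G y)" using bdry [OF assms] by blast
  have "G x \<noteq> 0" using W by (auto simp: defining_function_def)
  then have e: "norm (G x /\<^sub>R norm (G x)) = 1" "0 < (G x /\<^sub>R norm (G x)) \<bullet> G x" by (auto simp: dot_square_norm)
  show ?thesis
    using gauss_green_local_direction [OF V(1) W(2,1) assms e, of \<nu>] W(3) by blast
qed

lemma emeasure_frontier_finite: "emeasure H (frontier V) < \<infinity>"
proof -
  obtain r where r: "\<And>x. x \<in> frontier V \<Longrightarrow> 0 < r x"
    "\<And>x. x \<in> frontier V \<Longrightarrow> emeasure H (frontier V \<inter> cball x (r x)) < \<infinity>"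
    using frontier_finite_local by metis
  obtain X where X: "X \<subseteq> frontier V" "finite X" "frontier V \<subseteq> (\<Union>x\<in>X. ball x (r x))"
    using r(1) by (rule_tac compactE_image [OF compact_frontier_V, of "frontier V" "\<lambda>x. ball x (r x)"]) auto
  have "frontier V \<subseteq> (\<Union>x\<in>X. frontier V \<inter> cball x (r x))"
  proof
    fix y assume y: "y \<in> frontier V"
    then obtain x where "x \<in> X" "y \<in> ball x (r x)" using X(3) by blast
    then show "y \<in> (\<Union>x\<in>X. frontier V \<inter> cball x (r x))" using y ball_subset_cball by blast
  qed
  then have "emeasure H (frontier V) \<le> emeasure H (\<Union>x\<in>X. frontier V \<inter> cball x (r x))"
    by (rule emeasure_mono) (use X(2) in \<open>auto intro!: sets.finite_UN borel_closed\<close>)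
  also have "\<dots> \<le> (\<Sum>x\<in>X. emeasure H (frontier V \<inter> cball x (r x)))"
    by (rule emeasure_subadditive_finite) (use X(2) in \<open>auto intro!: borel_closed\<close>)
  also have "\<dots> < \<infinity>"
  proof -
    have "\<forall>x\<in>X. emeasure H (frontier V \<inter> cball x (r x)) < top" using r(2) X(1) by auto
    then show ?thesis using X(2) by (induction X rule: infinite_finite_induct) auto
  qed
  finally show ?thesis .
qed

lemma boundary_integrable:
  assumes "continuous_on (frontier V) f"
  shows "set_integrable H (frontier V) (f :: real ^ 'n \<Rightarrow> real)"
  by (rule set_integrable_continuous_compact [OF sets_hausdorff_measure compact_frontier_V emeasure_frontier_finite assms])

lemma interior_integrable:
  assumes "continuous_on (closure V) f"
  shows "set_integrable lborel V (f :: real ^ 'n \<Rightarrow> real)"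
proof -
  have c: "compact (closure V)" using V(2) by (simp add: compact_closure)
  have "set_integrable lborel (closure V) f"
    by (rule set_integrable_continuous_compact [OF _ c _ assms])
      (use emeasure_compact_finite [OF c] in \<open>auto simp: less_top\<close>)
  then show ?thesis by (rule set_integrable_subset) (use V(1) closure_subset in auto)
qed

text \<open>The divergence theorem for the field \<open>\<phi>\<close> times a constant vector
  \<open>v\<close>. It is linear in \<open>v\<close>, which allows passing from transversal
  directions to the coordinate axes.\<close>

definition flux_identity :: "(real ^ 'n \<Rightarrow> real) \<Rightarrow> real ^ 'n \<Rightarrow> bool" where
  "flux_identity \<phi> v \<longleftrightarrow> (LINT x:frontier V|H. \<phi> x * (v \<bullet> \<nu> x))
     = slab_factor TYPE('n) * (LINT y:V|lborel. frechet_derivative \<phi> (at y) v)"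

lemma flux_integrable:
  assumes "C1_fun UNIV \<phi>"
  shows "set_integrable H (frontier V) (\<lambda>x. \<phi> x * (v \<bullet> \<nu> x))"
    "set_integrable lborel V (\<lambda>y. frechet_derivative \<phi> (at y) v)"
proof -
  have "continuous_on (frontier V) \<phi>" by (rule continuous_on_subset [OF C1_fun_continuous [OF assms]]) simp
  then show "set_integrable H (frontier V) (\<lambda>x. \<phi> x * (v \<bullet> \<nu> x))"
    by (intro boundary_integrable continuous_intros continuous_on_normal)
  show "set_integrable lborel V (\<lambda>y. frechet_derivative \<phi> (at y) v)"
    by (intro interior_integrable continuous_on_subset [OF C1_fun_derivative_continuous [OF assms]]) simp
qed

lemma frechet_derivative_linear:
  assumes "C1_fun UNIV \<phi>" shows "linear (frechet_derivative \<phi> (at y))"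
  using C1_fun_has_derivative [OF assms UNIV_I] by (rule has_derivative_linear)

lemma flux_identity_combine:
  assumes C: "C1_fun UNIV \<phi>" and "flux_identity \<phi> v" "flux_identity \<phi> w"
  shows "flux_identity \<phi> (a *\<^sub>R v + b *\<^sub>R w)"
proof -
  have "(LINT x:frontier V|H. \<phi> x * ((a *\<^sub>R v + b *\<^sub>R w) \<bullet> \<nu> x))
      = (LINT x:frontier V|H. a * (\<phi> x * (v \<bullet> \<nu> x)) + b * (\<phi> x * (w \<bullet> \<nu> x)))"
    unfolding set_lebesgue_integral_def
    by (rule Bochner_Integration.integral_cong) (simp_all add: inner_add_left algebra_simps)
  also have "\<dots> = a * (LINT x:frontier V|H. \<phi> x * (v \<bullet> \<nu> x)) + b * (LINT x:frontier V|H. \<phi> x * (w \<bullet> \<nu> x))"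
    using flux_integrable(1) [OF C] by (subst set_integral_add) (auto intro: set_integrable_mult_right)
  also have "\<dots> = slab_factor TYPE('n) * (a * (LINT y:V|lborel. frechet_derivative \<phi> (at y) v)
      + b * (LINT y:V|lborel. frechet_derivative \<phi> (at y) w))"
    using assms(2,3) by (simp add: flux_identity_def algebra_simps)
  also have "a * (LINT y:V|lborel. frechet_derivative \<phi> (at y) v) + b * (LINT y:V|lborel. frechet_derivative \<phi> (at y) w)
      = (LINT y:V|lborel. a * frechet_derivative \<phi> (at y) v + b * frechet_derivative \<phi> (at y) w)"
    using flux_integrable(2) [OF C] by (subst set_integral_add) (auto intro: set_integrable_mult_right)
  also have "\<dots> = (LINT y:V|lborel. frechet_derivative \<phi> (at y) (a *\<^sub>R v + b *\<^sub>R w))"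
    by (simp add: linear_add [OF frechet_derivative_linear [OF C]] linear_cmul [OF frechet_derivative_linear [OF C]])
  finally show ?thesis by (simp add: flux_identity_def)
qed

text \<open>The local result covers only directions with positive component along the gradient. The
  unit gradient \<open>u\<close> and its tilts \<open>u + (1/2) *\<^sub>R axis i 1\<close> are such,
  and the axes are combinations of them.\<close>

lemma flux_identity_boundary:
  assumes x0: "x0 \<in> frontier V"
  shows "\<exists>r>0. \<forall>\<phi>. C1_fun UNIV \<phi> \<longrightarrow> (\<forall>y. y \<notin> cball x0 r \<longrightarrow> \<phi> y = 0) \<longrightarrow> (\<forall>i. flux_identity \<phi> (axis i 1))"
proof -
  obtain W \<rho> G where W: "x0 \<in> W" "defining_function V W \<rho> G"
    "\<And>y. y \<in> W \<inter> frontier V \<Longrightarrow> \<nu> y = G y /\<^sub>R norm (G y)" using bdry [OF x0] by blast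
  have G0: "G x0 \<noteq> 0" using W by (auto simp: defining_function_def)
  have dir: "\<exists>r>0. \<forall>\<phi>. C1_fun UNIV \<phi> \<longrightarrow> (\<forall>y. y \<notin> cball x0 r \<longrightarrow> \<phi> y = 0) \<longrightarrow> flux_identity \<phi> e"
    if e: "norm e = 1" "0 < e \<bullet> G x0" for e
  proof -
    obtain r where r: "0 < r" "\<And>\<phi> \<phi>'. (\<forall>y\<in>W. (\<phi> has_derivative \<phi>' y) (at y)) \<Longrightarrow> continuous_on W (\<lambda>y. \<phi>' y e) \<Longrightarrow>
       (\<forall>y. y \<notin> ball x0 r \<longrightarrow> \<phi> y = 0 \<and> \<phi>' y e = 0) \<Longrightarrow>
       (LINT x:frontier V|H. \<phi> x * (e \<bullet> \<nu> x)) = slab_factor TYPE('n) * (LINT y:V|lborel. \<phi>' y e)"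
      using gauss_green_local_direction [OF V(1) W(2,1) x0 e, of \<nu>] W(3) by blast
    \<comment> \<open>Confining the support to radius \<open>r / 2\<close> makes
      \<open>\<phi>\<close> and its derivative both vanish outside the open ball of radius
      \<open>r\<close>.\<close>
    have "flux_identity \<phi> e" if C: "C1_fun UNIV \<phi>" and z: "\<And>y. y \<notin> cball x0 (r / 2) \<Longrightarrow> \<phi> y = 0" for \<phi>
      unfolding flux_identity_def
    proof (rule r(2))
      show "\<forall>y\<in>W. (\<phi> has_derivative frechet_derivative \<phi> (at y)) (at y)"
        using C1_fun_has_derivative [OF C] by blast
      show "continuous_on W (\<lambda>y. frechet_derivative \<phi> (at y) e)"
        by (rule continuous_on_subset [OF C1_fun_derivative_continuous [OF C]]) simp
      have "y \<notin> cball x0 (r / 2)" if "y \<notin> ball x0 r" for y using that r(1) by simp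
      then show "\<forall>y. y \<notin> ball x0 r \<longrightarrow> \<phi> y = 0 \<and> frechet_derivative \<phi> (at y) e = 0"
        using z frechet_derivative_eq_zero_outside [of "cball x0 (r / 2)" \<phi>] by simp
    qed
    then show ?thesis using r(1) by (intro exI [of _ "r / 2"]) auto
  qed
  define u where "u = G x0 /\<^sub>R norm (G x0)"
  have u: "norm u = 1" "0 < u \<bullet> G x0" and Gu: "G x0 = norm (G x0) *\<^sub>R u"
    using G0 by (auto simp: u_def dot_square_norm)
  \<comment> \<open>The coordinates of the unit vector \<open>u\<close> are at most 1 in modulus, so
    tilting by half an axis leaves \<open>w i \<bullet> u \<ge> 1/2\<close>.\<close>
  define w where "w i = u + (1/2) *\<^sub>R axis i 1" for i
  have wu: "w i \<bullet> u > 0" for i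
  proof -
    have "\<bar>u $ i\<bar> \<le> 1" using component_le_norm_cart [of u i] u(1) by simp
    then show ?thesis using u(1) by (simp add: w_def inner_add_left inner_axis' norm_eq_1)
  qed
  define e where "e i = w i /\<^sub>R norm (w i)" for i
  have w0: "w i \<noteq> 0" for i using wu [of i] by auto
  have e: "norm (e i) = 1" "0 < e i \<bullet> G x0" for i
  proof -
    show "norm (e i) = 1" using w0 [of i] by (simp add: e_def)
    have "w i \<bullet> G x0 = norm (G x0) * (w i \<bullet> u)" using Gu by (metis inner_scaleR_right)
    then have "0 < w i \<bullet> G x0" using wu [of i] G0 by simp
    then show "0 < e i \<bullet> G x0" using w0 [of i] by (simp add: e_def)
  qed
  have ax: "axis i 1 = (2 * norm (w i)) *\<^sub>R e i + (- 2) *\<^sub>R u" for i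
    using w0 [of i] by (simp add: e_def) (simp add: w_def algebra_simps)
  obtain r0 where r0: "0 < r0" "\<And>\<phi>. C1_fun UNIV \<phi> \<Longrightarrow> (\<forall>y. y \<notin> cball x0 r0 \<longrightarrow> \<phi> y = 0) \<Longrightarrow> flux_identity \<phi> u"
    using dir [OF u] by blast
  have "\<forall>i. \<exists>r>0. \<forall>\<phi>. C1_fun UNIV \<phi> \<longrightarrow> (\<forall>y. y \<notin> cball x0 r \<longrightarrow> \<phi> y = 0) \<longrightarrow> flux_identity \<phi> (e i)"
    using dir [OF e] by blast
  then obtain r1 where r1: "\<And>i. 0 < r1 i"
    "\<And>i \<phi>. C1_fun UNIV \<phi> \<Longrightarrow> (\<forall>y. y \<notin> cball x0 (r1 i) \<longrightarrow> \<phi> y = 0) \<Longrightarrow> flux_identity \<phi> (e i)"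
    by metis
  define r where "r = Min (insert r0 (range r1))"
  have r: "0 < r" "r \<le> r0" using r0(1) r1(1) by (auto simp: r_def)
  have r_le: "r \<le> r1 i" for i unfolding r_def by (rule Min_le) auto
  show ?thesis
  proof (intro exI [of _ r] conjI allI impI)
    fix \<phi> i assume C: "C1_fun UNIV \<phi>" and z: "\<forall>y. y \<notin> cball x0 r \<longrightarrow> \<phi> y = 0"
    have "flux_identity \<phi> u" using z r(2) by (intro r0(2) [OF C]) simp
    moreover have "flux_identity \<phi> (e i)" using z r_le [of i] by (intro r1(2) [OF C]) simp
    ultimately show "flux_identity \<phi> (axis i 1)"
      unfolding ax by (intro flux_identity_combine [OF C])
  qed (rule r(1))
qed

text \<open>Along each line the fundamental theorem of calculus gives 0. The factor belongs to the
  claim because the decomposition into lines computes this product and not the integral by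
  itself.\<close>

lemma integral_frechet_derivative_compact_support:
  fixes e :: "real ^ 'n"
  assumes C: "C1_fun UNIV \<phi>" and z: "\<And>y. y \<notin> cball x0 r \<Longrightarrow> \<phi> y = 0" and e: "norm e = 1"
  shows "slab_factor TYPE('n) * (\<integral>y. frechet_derivative \<phi> (at y) e \<partial>lborel) = 0"
proof -
  let ?D = "\<lambda>y. frechet_derivative \<phi> (at y) e"
  have D0: "?D y = 0" if "y \<notin> cball x0 r" for y
    using frechet_derivative_eq_zero_outside [OF z closed_cball that] by simp
  have "integrable lborel (\<lambda>y. indicator (cball x0 r) y *\<^sub>R ?D y)"
    by (rule borel_integrable_compact) (auto intro: continuous_on_subset [OF C1_fun_derivative_continuous [OF C]])
  moreover have "indicator (cball x0 r) y *\<^sub>R ?D y = ?D y" for y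
    using D0 [of y] by (cases "y \<in> cball x0 r") simp_all
  ultimately have int: "integrable lborel ?D" by (simp only:)
  have "(\<integral>t. ?D (x + t *\<^sub>R e) \<partial>lborel) = 0" for x
  proof -
    define B where "B = norm (x - x0) + \<bar>r\<bar> + 1"
    have out: "x + t *\<^sub>R e \<notin> cball x0 r" if "B \<le> \<bar>t\<bar>" for t
    proof -
      have "\<bar>t\<bar> = norm (t *\<^sub>R e)" using e by simp
      also have "\<dots> \<le> norm (x + t *\<^sub>R e - x0) + norm (x - x0)"
        using norm_triangle_ineq4 [of "x + t *\<^sub>R e - x0" "x - x0"] by simp
      finally show ?thesis using that by (simp add: B_def dist_norm norm_minus_commute)
    qed
    have B: "0 < B" by (simp add: B_def add_nonneg_pos)
    have cl: "continuous_on {- B..B} (\<lambda>t. ?D (x + t *\<^sub>R e))"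
      by (rule continuous_on_compose2 [OF C1_fun_derivative_continuous [OF C]]) (auto intro!: continuous_intros)
    have "(\<integral>t. ?D (x + t *\<^sub>R e) \<partial>lborel) = (\<integral>t. indicator {- B..B} t *\<^sub>R ?D (x + t *\<^sub>R e) \<partial>lborel)"
    proof (rule Bochner_Integration.integral_cong)
      fix t
      show "?D (x + t *\<^sub>R e) = indicator {- B..B} t *\<^sub>R ?D (x + t *\<^sub>R e)"
        using D0 [OF out [of t]] by (cases "B \<le> \<bar>t\<bar>") (auto simp: indicator_def)
    qed simp
    also have "\<dots> = \<phi> (x + B *\<^sub>R e) - \<phi> (x + (- B) *\<^sub>R e)"
    proof (rule integral_FTC_Icc [OF _ _ cl])
      fix t
      show "((\<lambda>t. \<phi> (x + t *\<^sub>R e)) has_vector_derivative ?D (x + t *\<^sub>R e)) (at t within {- B..B})"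
        by (rule has_vector_derivative_at_within [OF has_vector_derivative_along_line [OF C1_fun_has_derivative [OF C UNIV_I]]])
    qed (use B in simp)
    also have "\<dots> = 0" using z [OF out [of B]] z [OF out [of "- B"]] B by simp
    finally show ?thesis .
  qed
  then show ?thesis using integral_lborel_slab [OF e int] by simp
qed

lemma flux_identity_interior:
  assumes "cball x0 r \<subseteq> V" and C: "C1_fun UNIV \<phi>" and z: "\<And>y. y \<notin> cball x0 r \<Longrightarrow> \<phi> y = 0"
  shows "flux_identity \<phi> (axis i 1)"
proof -
  have "y \<notin> cball x0 r" if "y \<in> frontier V" for y
    using that assms(1) V(1) by (auto simp: frontier_def interior_open)
  then have "(LINT x:frontier V|H. \<phi> x * (axis i 1 \<bullet> \<nu> x)) = (LINT x:frontier V|H. 0)"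
    using z unfolding set_lebesgue_integral_def
    by (intro Bochner_Integration.integral_cong) (auto simp: indicator_def)
  moreover have "(LINT y:V|lborel. frechet_derivative \<phi> (at y) (axis i 1)) = (\<integral>y. frechet_derivative \<phi> (at y) (axis i 1) \<partial>lborel)"
    unfolding set_lebesgue_integral_def
  proof (rule Bochner_Integration.integral_cong)
    fix y
    show "indicator V y *\<^sub>R frechet_derivative \<phi> (at y) (axis i 1) = frechet_derivative \<phi> (at y) (axis i 1)"
    proof (cases "y \<in> V")
      case False
      then have "y \<notin> cball x0 r" using assms(1) by blast
      from frechet_derivative_eq_zero_outside [OF z _ this] False show ?thesis by simp
    qed simp
  qed simp
  moreover have "slab_factor TYPE('n) * (\<integral>y. frechet_derivative \<phi> (at y) (axis i 1) \<partial>lborel) = 0"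
    by (rule integral_frechet_derivative_compact_support [OF C z]) (auto simp: norm_eq_1 inner_axis_axis)
  ultimately show ?thesis by (simp add: flux_identity_def)
qed

text \<open>Partition of unity: around every point of the closure the flux identity holds for
  functions of small support, and the components of \<open>Y\<close> are cut into such
  pieces.\<close>

theorem gauss_green:
  assumes U: "open U" "closure V \<subseteq> U" and Y: "\<And>j. C1_fun U (\<lambda>y. Y y $ j)"
  shows "(LINT x:frontier V|H. Y x \<bullet> \<nu> x)
      = slab_factor TYPE('n) * (LINT y:V|lborel. \<Sum>j\<in>UNIV. frechet_derivative (\<lambda>y. Y y $ j) (at y) (axis j 1))"
proof -
  have cV: "compact (closure V)" using V(2) by (simp add: compact_closure)
  have "\<exists>r>0. cball x r \<subseteq> U \<and> (\<forall>\<phi>. C1_fun UNIV \<phi> \<longrightarrow> (\<forall>y. y \<notin> cball x r \<longrightarrow> \<phi> y = 0) \<longrightarrow> (\<forall>i. flux_identity \<phi> (axis i 1)))"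
    if x: "x \<in> closure V" for x
  proof -
    obtain s where s: "0 < s" "cball x s \<subseteq> U" using U x open_contains_cball by blast
    obtain t where t: "0 < t" "\<And>\<phi> i. C1_fun UNIV \<phi> \<Longrightarrow> (\<forall>y. y \<notin> cball x t \<longrightarrow> \<phi> y = 0) \<Longrightarrow> flux_identity \<phi> (axis i 1)"
    proof (cases "x \<in> V")
      case True
      then obtain t where "0 < t" "cball x t \<subseteq> V" using V(1) open_contains_cball by blast
      then show ?thesis using flux_identity_interior [of x t] that [of t] by blast
    next
      case False
      then have "x \<in> frontier V" using x V(1) by (simp add: frontier_def interior_open)
      then show ?thesis using flux_identity_boundary that by blast
    qed
    have sub: "cball x (min s t) \<subseteq> cball x s" "cball x (min s t) \<subseteq> cball x t" by auto
    show ?thesis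
      by (intro exI [of _ "min s t"]) (use s t sub in \<open>auto simp: not_le\<close>)
  qed
  then obtain r where r: "\<And>x. x \<in> closure V \<Longrightarrow> 0 < r x" "\<And>x. x \<in> closure V \<Longrightarrow> cball x (r x) \<subseteq> U"
    "\<And>x \<phi> i. x \<in> closure V \<Longrightarrow> C1_fun UNIV \<phi> \<Longrightarrow> (\<forall>y. y \<notin> cball x (r x) \<longrightarrow> \<phi> y = 0) \<Longrightarrow> flux_identity \<phi> (axis i 1)"
    by metis
  obtain X where X: "X \<subseteq> closure V" "finite X" "closure V \<subseteq> (\<Union>x\<in>X. ball x (r x))"
    using r(1) by (rule_tac compactE_image [OF cV, of "closure V" "\<lambda>x. ball x (r x)"]) auto
  \<comment> \<open>A bump that is positive on the open ball of radius \<open>r x\<close> and 0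
    outside it.\<close>
  define b where "b x y = (max 0 ((r x)\<^sup>2 - (y - x) \<bullet> (y - x)))\<^sup>2" for x y
  have b0: "b x y = 0" if "x \<in> X" "y \<notin> cball x (r x)" for x y
  proof -
    have "r x < norm (y - x)" using that(2) by (simp add: dist_norm norm_minus_commute)
    moreover have "0 < r x" using that(1) X(1) r(1) by blast
    ultimately have "(r x)\<^sup>2 < (norm (y - x))\<^sup>2" by (intro power_strict_mono) auto
    then show ?thesis by (simp add: b_def power2_norm_eq_inner)
  qed
  have bpos: "b x y > 0" if "y \<in> ball x (r x)" for x y
  proof -
    have "norm (y - x) < r x" using that by (simp add: dist_norm norm_minus_commute)
    then have "(norm (y - x))\<^sup>2 < (r x)\<^sup>2" by (intro power_strict_mono) auto
    then show ?thesis by (simp add: b_def power2_norm_eq_inner max_def)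
  qed
  have bC: "C1_fun S (b x)" for S x
    unfolding b_def by (intro C1_fun_square_positive_part C1_fun_diff C1_fun_const C1_fun_inner_self)
  define S where "S y = (\<Sum>x\<in>X. b x y)" for y
  have S0: "0 \<le> S y" for y unfolding S_def by (intro sum_nonneg) (simp add: b_def)
  have SC: "C1_fun T S" for T unfolding S_def [abs_def] by (intro C1_fun_sum bC)
  have Spos: "0 < S y" if "y \<in> closure V" for y
  proof -
    obtain x where "x \<in> X" "y \<in> ball x (r x)" using X(3) \<open>y \<in> closure V\<close> by blast
    then have "0 < b x y" "b x y \<le> S y"
      using bpos X(2) unfolding S_def by (auto intro!: member_le_sum simp: b_def)
    then show ?thesis by simp
  qed
  obtain m where m: "0 < m" "\<And>y. y \<in> closure V \<Longrightarrow> m \<le> S y"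
  proof (cases "closure V = {}")
    case False
    then obtain y0 where "y0 \<in> closure V" "\<forall>y\<in>closure V. S y0 \<le> S y"
      using continuous_attains_inf [OF cV _ C1_fun_continuous [OF SC]] by blast
    then show ?thesis using Spos that [of "S y0"] by blast
  qed (use that [of 1] in auto)
  \<comment> \<open>Equal to the sum \<open>S\<close> where \<open>S y \<ge> m\<close>, hence on the
    closure of \<open>V\<close>, but positive everywhere, so that dividing by it preserves
    differentiability also where all bumps vanish.\<close>
  define den where "den y = S y + (max 0 (m - S y))\<^sup>2" for y
  have den_pos: "den y > 0" for y
  proof (cases "S y = 0")
    case False
    then show ?thesis using S0 [of y] by (simp add: den_def add_pos_nonneg)
  qed (use m(1) in \<open>simp add: den_def\<close>)
  have den0: "den y \<noteq> 0" for y using den_pos [of y] by simp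
  have denC: "C1_fun T den" for T
    unfolding den_def [abs_def] by (intro C1_fun_add C1_fun_square_positive_part C1_fun_diff C1_fun_const SC)
  have den_eq: "den y = S y" if "y \<in> closure V" for y using m(2) [OF that] by (simp add: den_def)
  define \<phi> where "\<phi> x j y = b x y * (Y y $ j * inverse (den y))" for x j y
  have \<phi>0: "\<phi> x j y = 0" if "x \<in> X" "y \<notin> cball x (r x)" for x j y using b0 [OF that] by (simp add: \<phi>_def)
  have \<phi>C: "C1_fun UNIV (\<phi> x j)" if x: "x \<in> X" for x j
  proof (rule C1_fun_zero_outside [where C="cball x (r x)"])
    show "C1_fun U (\<phi> x j)" unfolding \<phi>_def [abs_def]
      by (intro C1_fun_mult bC Y C1_fun_inverse denC den0)
    show "cball x (r x) \<subseteq> U" using r(2) x X(1) by blast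
  qed (use U(1) \<phi>0 [OF x] in auto)
  have flux: "flux_identity (\<phi> x j) (axis i 1)" if "x \<in> X" for x j i
    by (rule r(3) [of x]) (use \<phi>C \<phi>0 that X(1) in auto)
  have sum\<phi>: "(\<Sum>x\<in>X. \<phi> x j y) = Y y $ j" if "y \<in> closure V" for j y
  proof -
    have "(\<Sum>x\<in>X. \<phi> x j y) = S y * (Y y $ j * inverse (den y))" by (simp add: \<phi>_def S_def sum_distrib_right)
    then show ?thesis using den_eq [OF that] Spos [OF that] by simp
  qed
  have sumD: "(\<Sum>x\<in>X. frechet_derivative (\<phi> x j) (at y) h) = frechet_derivative (\<lambda>y. Y y $ j) (at y) h" if y: "y \<in> V" for j y h
  proof -
    have "((\<lambda>y. \<Sum>x\<in>X. \<phi> x j y) has_derivative (\<lambda>h. \<Sum>x\<in>X. frechet_derivative (\<phi> x j) (at y) h)) (at y)"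
      by (intro has_derivative_sum C1_fun_has_derivative [OF \<phi>C]) auto
    then have "((\<lambda>y. Y y $ j) has_derivative (\<lambda>h. \<Sum>x\<in>X. frechet_derivative (\<phi> x j) (at y) h)) (at y)"
    proof (rule has_derivative_transform_within_open [OF _ V(1) y])
      fix z assume "z \<in> V"
      then show "(\<Sum>x\<in>X. \<phi> x j z) = Y z $ j" using sum\<phi> closure_subset by blast
    qed
    from frechet_derivative_at [OF this] show ?thesis by metis
  qed
  have ax: "axis j 1 \<bullet> \<nu> x = \<nu> x $ j" for j x by (simp add: inner_axis')
  have "(LINT x:frontier V|H. Y x \<bullet> \<nu> x) = (LINT x:frontier V|H. \<Sum>j\<in>UNIV. \<Sum>z\<in>X. \<phi> z j x * (axis j 1 \<bullet> \<nu> x))"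
    unfolding set_lebesgue_integral_def
  proof (rule Bochner_Integration.integral_cong)
    fix x
    have "Y x \<bullet> \<nu> x = (\<Sum>j\<in>UNIV. \<Sum>z\<in>X. \<phi> z j x * (axis j 1 \<bullet> \<nu> x))" if "x \<in> frontier V"
    proof -
      have "x \<in> closure V" using that by (simp add: frontier_def)
      then show ?thesis
        unfolding ax by (simp add: sum_distrib_right [symmetric] sum\<phi>) (simp add: inner_vec_def)
    qed
    then show "indicator (frontier V) x *\<^sub>R (Y x \<bullet> \<nu> x)
        = indicator (frontier V) x *\<^sub>R (\<Sum>j\<in>UNIV. \<Sum>z\<in>X. \<phi> z j x * (axis j 1 \<bullet> \<nu> x))"
      by (simp add: indicator_def)
  qed simp
  also have "\<dots> = (\<Sum>j\<in>UNIV. \<Sum>z\<in>X. (LINT x:frontier V|H. \<phi> z j x * (axis j 1 \<bullet> \<nu> x)))"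
  proof -
    have 1: "set_integrable H (frontier V) (\<lambda>x. \<phi> z j x * (axis j 1 \<bullet> \<nu> x))" if "z \<in> X" for z j
      by (rule flux_integrable(1) [OF \<phi>C [OF that]])
    then show ?thesis
      unfolding set_lebesgue_integral_def set_integrable_def scaleR_sum_right
      by (subst Bochner_Integration.integral_sum; intro sum.cong Bochner_Integration.integral_sum Bochner_Integration.integrable_sum refl) auto
  qed
  also have "\<dots> = slab_factor TYPE('n) * (\<Sum>j\<in>UNIV. \<Sum>z\<in>X. (LINT y:V|lborel. frechet_derivative (\<phi> z j) (at y) (axis j 1)))"
    using flux unfolding flux_identity_def by (simp add: sum_distrib_left)
  also have "(\<Sum>j\<in>UNIV. \<Sum>z\<in>X. (LINT y:V|lborel. frechet_derivative (\<phi> z j) (at y) (axis j 1)))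
      = (LINT y:V|lborel. \<Sum>j\<in>UNIV. \<Sum>z\<in>X. frechet_derivative (\<phi> z j) (at y) (axis j 1))"
  proof -
    have 1: "set_integrable lborel V (\<lambda>y. frechet_derivative (\<phi> z j) (at y) (axis j 1))" if "z \<in> X" for z j
      by (rule flux_integrable(2) [OF \<phi>C [OF that]])
    then show ?thesis
      unfolding set_lebesgue_integral_def set_integrable_def scaleR_sum_right
      by (subst Bochner_Integration.integral_sum; intro sum.cong Bochner_Integration.integral_sum [symmetric] Bochner_Integration.integrable_sum refl) auto
  qed
  also have "\<dots> = (LINT y:V|lborel. \<Sum>j\<in>UNIV. frechet_derivative (\<lambda>y. Y y $ j) (at y) (axis j 1))"
    unfolding set_lebesgue_integral_def
    by (rule Bochner_Integration.integral_cong) (auto simp: sumD indicator_def)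
  finally show ?thesis .
qed

end

subsection \<open>Stereographic projection\<close>

text \<open>Moving along the gradient corrects the error \<open>o(t)\<close> of the straight line in direction \<open>\<tau>\<close>.\<close>

lemma tangent_curve_exists:
  fixes y :: "'a::euclidean_space"
  assumes def: "defining_function V W \<rho> G" and y: "y \<in> W" "\<rho> y = 0" and \<tau>: "G y \<bullet> \<tau> = 0"
  shows "\<exists>\<gamma>. \<gamma> 0 = y \<and> (\<forall>\<^sub>F t in nhds 0. \<gamma> t \<in> W \<and> \<rho> (\<gamma> t) = 0) \<and> (\<gamma> has_vector_derivative \<tau>) (at (0::real))"
proof -
  let ?g = "G y"
  have W: "open W" and G0: "?g \<noteq> 0" and contG: "continuous_on W G"
    using def y by (auto simp: defining_function_def)
  have gg: "0 < ?g \<bullet> ?g" using G0 by simp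
  \<comment> \<open>On a ball around \<open>y\<close> the derivative of \<open>\<rho>\<close> along
    \<open>?g\<close> stays above half its value at \<open>y\<close>, so \<open>\<rho>\<close> grows
    at a definite rate in that direction.\<close>
  have "continuous_on W (\<lambda>z. G z \<bullet> ?g)" by (intro continuous_intros contG)
  then have "open (W \<inter> (\<lambda>z. G z \<bullet> ?g) -` {?g \<bullet> ?g / 2<..})" using W by (rule continuous_open_preimage) simp
  moreover have "y \<in> W \<inter> (\<lambda>z. G z \<bullet> ?g) -` {?g \<bullet> ?g / 2<..}" using y(1) gg by simp
  ultimately obtain b where b: "0 < b" "ball y b \<subseteq> W \<inter> (\<lambda>z. G z \<bullet> ?g) -` {?g \<bullet> ?g / 2<..}"
    by (meson open_contains_ball)
  have bW: "ball y b \<subseteq> W" using b(2) by blast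
  have grow: "s * (?g \<bullet> ?g) / 2 \<le> \<rho> (z + s *\<^sub>R ?g) - \<rho> z"
    if "0 \<le> s" and z: "z \<in> ball y b" and zs: "z + s *\<^sub>R ?g \<in> ball y b" for z s
  proof -
    obtain \<xi> where \<xi>: "\<xi> \<in> ball y b" "\<rho> (z + s *\<^sub>R ?g) - \<rho> z = G \<xi> \<bullet> ((z + s *\<^sub>R ?g) - z)"
      using defining_function_mvt [OF def convex_ball bW zs z] by blast
    have "?g \<bullet> ?g / 2 \<le> G \<xi> \<bullet> ?g" using subsetD [OF b(2) \<xi>(1)] by simp
    then have "s * (?g \<bullet> ?g / 2) \<le> s * (G \<xi> \<bullet> ?g)" using that(1) by (rule mult_left_mono)
    then show ?thesis using \<xi>(2) by simp
  qed
  \<comment> \<open>By that rate, a step of length parameter \<open>E t\<close> along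
    \<open>?g\<close>, forwards or backwards, suffices to compensate the value of
    \<open>\<rho>\<close> on the straight line.\<close>
  define E where "E t = 2 * \<bar>\<rho> (y + t *\<^sub>R \<tau>)\<bar> / (?g \<bullet> ?g)" for t
  have E0: "0 \<le> E t" for t using gg by (simp add: E_def)
  have corr: "\<exists>s. \<bar>s\<bar> \<le> E t \<and> \<rho> (y + t *\<^sub>R \<tau> + s *\<^sub>R ?g) = 0"
    if small: "norm (t *\<^sub>R \<tau>) + E t * norm ?g < b" for t
  proof -
    let ?z = "y + t *\<^sub>R \<tau>"
    have in_b: "?z + s *\<^sub>R ?g \<in> ball y b" if "\<bar>s\<bar> \<le> E t" for s
    proof -
      have "norm (t *\<^sub>R \<tau> + s *\<^sub>R ?g) \<le> norm (t *\<^sub>R \<tau>) + norm (s *\<^sub>R ?g)" by (rule norm_triangle_ineq)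
      also have "norm (s *\<^sub>R ?g) \<le> E t * norm ?g" using that by (simp add: mult_right_mono)
      finally have "norm (t *\<^sub>R \<tau> + s *\<^sub>R ?g) < b" using small by simp
      moreover have "dist y (?z + s *\<^sub>R ?g) = norm (t *\<^sub>R \<tau> + s *\<^sub>R ?g)"
        using norm_minus_cancel [of "t *\<^sub>R \<tau> + s *\<^sub>R ?g"] by (simp add: dist_norm)
      ultimately show ?thesis by simp
    qed
    have zb: "?z \<in> ball y b" using in_b [of 0] E0 by simp
    have Eg: "E t * (?g \<bullet> ?g) / 2 = \<bar>\<rho> ?z\<bar>" using G0 by (simp add: E_def)
    have up: "0 \<le> \<rho> (?z + E t *\<^sub>R ?g)"
      using grow [OF E0 zb in_b, of t] E0 [of t] Eg by simp
    have "\<rho> (?z + (- E t) *\<^sub>R ?g) \<le> 0"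
      using grow [OF E0 in_b, of "- E t" t] E0 [of t] zb Eg by simp
    moreover have "continuous_on {- E t..E t} (\<lambda>s. \<rho> (?z + s *\<^sub>R ?g))"
    proof (rule continuous_on_compose2 [OF defining_function_continuous [OF def]])
      show "(\<lambda>s. ?z + s *\<^sub>R ?g) ` {- E t..E t} \<subseteq> W"
        using subsetD [OF bW in_b] by auto
    qed (intro continuous_intros)
    ultimately obtain s where "- E t \<le> s" "s \<le> E t" "\<rho> (?z + s *\<^sub>R ?g) = 0"
      using IVT' [of "\<lambda>s. \<rho> (?z + s *\<^sub>R ?g)" "- E t" 0 "E t"] up E0 [of t] by auto
    then show ?thesis by (intro exI [of _ s]) auto
  qed
  \<comment> \<open>The default 0 keeps \<open>\<bar>\<sigma> t\<bar> \<le> E t\<close> valid for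
    all \<open>t\<close>.\<close>
  define \<sigma> where "\<sigma> t = (if norm (t *\<^sub>R \<tau>) + E t * norm ?g < b
      then SOME s. \<bar>s\<bar> \<le> E t \<and> \<rho> (y + t *\<^sub>R \<tau> + s *\<^sub>R ?g) = 0 else 0)" for t
  have \<sigma>: "\<bar>\<sigma> t\<bar> \<le> E t" "\<rho> (y + t *\<^sub>R \<tau> + \<sigma> t *\<^sub>R ?g) = 0"
    if "norm (t *\<^sub>R \<tau>) + E t * norm ?g < b" for t
    using someI_ex [OF corr [OF that]] that by (simp_all add: \<sigma>_def)
  have \<sigma>E: "\<bar>\<sigma> t\<bar> \<le> E t" for t
    using \<sigma>(1) [of t] E0 [of t] by (cases "norm (t *\<^sub>R \<tau>) + E t * norm ?g < b") (simp_all add: \<sigma>_def)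
  define \<gamma> where "\<gamma> t = y + t *\<^sub>R \<tau> + \<sigma> t *\<^sub>R ?g" for t
  have E00: "E 0 = 0" using y(2) by (simp add: E_def)
  then have \<sigma>0: "\<sigma> 0 = 0" using \<sigma>E [of 0] by simp
  have d\<rho>: "((\<lambda>t. \<rho> (y + t *\<^sub>R \<tau>)) has_real_derivative 0) (at 0)"
    using defining_function_line [OF def, of y 0 \<tau>] y(1) \<tau> by simp
  then have lim: "((\<lambda>t. \<rho> (y + t *\<^sub>R \<tau>) / t) \<longlongrightarrow> 0) (at 0)"
    using y(2) by (simp add: DERIV_def)
  have contE: "isCont E 0"
    unfolding E_def using DERIV_isCont [OF d\<rho>] gg by (intro continuous_intros) auto
  have "isCont (\<lambda>t. norm (t *\<^sub>R \<tau>) + E t * norm ?g) 0" by (intro continuous_intros contE)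
  then have "((\<lambda>t. norm (t *\<^sub>R \<tau>) + E t * norm ?g) \<longlongrightarrow> norm ((0::real) *\<^sub>R \<tau>) + E 0 * norm ?g) (nhds 0)"
    unfolding isCont_def
    by (rule tendsto_at_iff_tendsto_nhds [of "\<lambda>t. norm (t *\<^sub>R \<tau>) + E t * norm ?g" 0, THEN iffD1])
  then have "((\<lambda>t. norm (t *\<^sub>R \<tau>) + E t * norm ?g) \<longlongrightarrow> 0) (nhds 0)" by (simp add: E00)
  then have small: "\<forall>\<^sub>F t in nhds 0. norm (t *\<^sub>R \<tau>) + E t * norm ?g < b"
    using b(1) by (rule order_tendstoD(2))
  have "\<gamma> t \<in> W \<and> \<rho> (\<gamma> t) = 0" if "norm (t *\<^sub>R \<tau>) + E t * norm ?g < b" for t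
  proof -
    have "norm (t *\<^sub>R \<tau> + \<sigma> t *\<^sub>R ?g) \<le> norm (t *\<^sub>R \<tau>) + norm (\<sigma> t *\<^sub>R ?g)" by (rule norm_triangle_ineq)
    also have "norm (\<sigma> t *\<^sub>R ?g) \<le> E t * norm ?g" using \<sigma>E by (simp add: mult_right_mono)
    finally have "norm (t *\<^sub>R \<tau> + \<sigma> t *\<^sub>R ?g) < b" using that by simp
    moreover have "dist y (\<gamma> t) = norm (t *\<^sub>R \<tau> + \<sigma> t *\<^sub>R ?g)"
      using norm_minus_cancel [of "t *\<^sub>R \<tau> + \<sigma> t *\<^sub>R ?g"] by (simp add: dist_norm \<gamma>_def)
    ultimately have "\<gamma> t \<in> ball y b" by simp
    then show ?thesis using subsetD [OF bW] \<sigma>(2) [OF that] by (simp add: \<gamma>_def)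
  qed
  then have ev: "\<forall>\<^sub>F t in nhds 0. \<gamma> t \<in> W \<and> \<rho> (\<gamma> t) = 0"
    using small by (rule eventually_mono [rotated])
  \<comment> \<open>\<open>\<sigma> t\<close> is bounded by a multiple of
    \<open>\<rho> (y + t *\<^sub>R \<tau>)\<close>, which is o(t) because \<open>\<tau>\<close> is
    orthogonal to the gradient; so the correction does not change the velocity.\<close>
  have "((\<lambda>t. \<sigma> t / t) \<longlongrightarrow> 0) (at 0)"
  proof (rule Lim_null_comparison)
    show "\<forall>\<^sub>F t in at 0. norm (\<sigma> t / t) \<le> 2 / (?g \<bullet> ?g) * \<bar>\<rho> (y + t *\<^sub>R \<tau>) / t\<bar>"
    proof (rule always_eventually, rule allI)
      fix t
      have "norm (\<sigma> t / t) = \<bar>\<sigma> t\<bar> / \<bar>t\<bar>" by (simp add: abs_divide)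
      also have "\<dots> \<le> E t / \<bar>t\<bar>" using \<sigma>E by (simp add: divide_right_mono)
      also have "\<dots> = 2 / (?g \<bullet> ?g) * \<bar>\<rho> (y + t *\<^sub>R \<tau>) / t\<bar>" by (simp add: E_def abs_divide)
      finally show "norm (\<sigma> t / t) \<le> 2 / (?g \<bullet> ?g) * \<bar>\<rho> (y + t *\<^sub>R \<tau>) / t\<bar>" .
    qed
    show "((\<lambda>t. 2 / (?g \<bullet> ?g) * \<bar>\<rho> (y + t *\<^sub>R \<tau>) / t\<bar>) \<longlongrightarrow> 0) (at 0)"
      using tendsto_mult_right_zero [OF tendsto_rabs_zero [OF lim], of "2 / (?g \<bullet> ?g)"] by simp
  qed
  then have "(\<sigma> has_real_derivative 0) (at 0)" by (simp add: DERIV_def \<sigma>0)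
  then have "(\<sigma> has_vector_derivative 0) (at 0)" by (simp add: has_real_derivative_iff_has_vector_derivative)
  from bounded_linear.has_vector_derivative [OF bounded_linear_scaleR_left this, of ?g]
  have "((\<lambda>t. \<sigma> t *\<^sub>R ?g) has_vector_derivative 0) (at 0)" by simp
  moreover have "((\<lambda>t. y + t *\<^sub>R \<tau>) has_vector_derivative \<tau>) (at 0)"
    by (auto intro!: derivative_eq_intros)
  ultimately have "(\<gamma> has_vector_derivative \<tau> + 0) (at 0)"
    unfolding \<gamma>_def [abs_def] by (rule has_vector_derivative_add [rotated])
  then show ?thesis using ev by (intro exI [of _ \<gamma>]) (simp add: \<gamma>_def [of 0] \<sigma>0)
qed

text \<open>\<open>J\<close> identifies the parameter space isometrically with the hyperplane
  orthogonal to the pole \<open>p\<close>. The pole is left free because it has to avoid the closure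
  of the domain.\<close>

locale stereographic =
  fixes J :: "real ^ 'n::finite \<Rightarrow> real ^ ('n option)" and p :: "real ^ ('n option)"
  assumes J: "linear J" and J_inner: "\<And>x y. J x \<bullet> J y = x \<bullet> y" and J_pole: "\<And>x. J x \<bullet> p = 0"
    and pole: "norm p = 1" and J_surj: "\<And>x. x \<bullet> p = 0 \<Longrightarrow> \<exists>y. x = J y"
begin

lemma pp: "p \<bullet> p = 1" using pole by (simp add: norm_eq_1)

lemma pole_J: "p \<bullet> J x = 0" using J_pole by (simp add: inner_commute)

lemmas J_simps = J_inner J_pole pole_J pp inner_add_left inner_add_right inner_diff_left inner_diff_right
  inner_scaleR_left inner_scaleR_right

text \<open>The conformal factor of inverse stereographic projection.\<close>

definition lam :: "real ^ 'n \<Rightarrow> real" where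
  "lam y = 2 / (1 + y \<bullet> y)"

text \<open>Inverse stereographic projection: the point \<open>p + lam y *\<^sub>R (J y - p)\<close>
  on the line through the pole and \<open>J y\<close>.\<close>

definition sig :: "real ^ 'n \<Rightarrow> real ^ ('n option)" where
  "sig y = lam y *\<^sub>R J y + (1 - lam y) *\<^sub>R p"

text \<open>\<open>frame y\<close> is the differential of \<open>sig\<close> at \<open>y\<close> divided by the conformal factor.\<close>

definition frame :: "real ^ 'n \<Rightarrow> real ^ 'n \<Rightarrow> real ^ ('n option)" where
  "frame y h = J h - (lam y * (y \<bullet> h)) *\<^sub>R (J y - p)"

text \<open>The transpose of \<open>frame y\<close>; it inverts \<open>frame y\<close> on the
  tangent space and kills the radial direction \<open>sig y\<close>.\<close>

definition coframe :: "real ^ 'n \<Rightarrow> real ^ ('n option) \<Rightarrow> real ^ 'n" where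
  "coframe y x = (\<chi> j. frame y (axis j 1) \<bullet> x)"

lemma denom_pos: "0 < 1 + y \<bullet> (y :: real ^ 'n)"
  by (simp add: add_pos_nonneg)

lemma lam_pos: "0 < lam y" using denom_pos by (simp add: lam_def)

lemma lam_norm: "lam y * (y \<bullet> y) = 2 - lam y"
  using denom_pos [of y] by (simp add: lam_def field_simps)

lemma sig_inner: "sig y \<bullet> sig z = lam y * lam z * (y \<bullet> z) + (1 - lam y) * (1 - lam z)"
  by (simp add: sig_def J_simps)

lemma norm_sig: "norm (sig y) = 1"
proof -
  have "sig y \<bullet> sig y = lam y * (lam y * (y \<bullet> y)) + (1 - lam y) * (1 - lam y)" by (simp add: sig_inner)
  also have "\<dots> = 1" unfolding lam_norm by (simp add: algebra_simps)
  finally show ?thesis by (simp add: norm_eq_1)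
qed

lemma sig_pole: "sig y \<bullet> p = 1 - lam y"
  by (simp add: sig_def J_simps)

text \<open>Exact conformality at finite distance: it gives injectivity, and near \<open>y\<close>
  two-sided Lipschitz bounds with constants close to \<open>lam y\<close>.\<close>

lemma sig_distance: "(norm (sig y - sig z))\<^sup>2 = lam y * lam z * (norm (y - z))\<^sup>2"
proof -
  have s: "sig y \<bullet> sig y = 1" "sig z \<bullet> sig z = 1" using norm_sig by (simp_all add: norm_eq_1 [symmetric])
  have "(norm (sig y - sig z))\<^sup>2 = 2 - 2 * (sig y \<bullet> sig z)"
    by (simp add: power2_norm_eq_inner inner_diff_left inner_diff_right s inner_commute [of "sig z" "sig y"])
  also have "\<dots> = lam z * (2 - lam y) + lam y * (2 - lam z) - 2 * lam y * lam z * (y \<bullet> z)"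
    by (simp add: sig_inner algebra_simps)
  also have "\<dots> = lam z * (lam y * (y \<bullet> y)) + lam y * (lam z * (z \<bullet> z)) - 2 * lam y * lam z * (y \<bullet> z)"
    by (simp only: lam_norm)
  also have "\<dots> = lam y * lam z * (norm (y - z))\<^sup>2"
    by (simp add: power2_norm_eq_inner inner_diff_left inner_diff_right inner_commute [of z y] algebra_simps)
  finally show ?thesis .
qed

lemma inj_sig: "inj_on sig S"
proof (rule inj_onI)
  fix y z assume "sig y = sig z"
  then have "lam y * lam z * (norm (y - z))\<^sup>2 = 0" using sig_distance [of y z] by simp
  then show "y = z" using lam_pos [of y] lam_pos [of z] by simp
qed

lemma J_scale: "J (c *\<^sub>R x) = c *\<^sub>R J x" by (rule linear_cmul [OF J])

lemma J_add: "J (x + y) = J x + J y" by (rule linear_add [OF J])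

text \<open>The preimage is the stereographic projection \<open>v / (1 - s)\<close>, where
  \<open>s\<close> is the component of \<open>x\<close> along the pole and \<open>v\<close> the part
  orthogonal to it.\<close>

lemma sig_surj:
  assumes "norm x = 1" "x \<noteq> p" shows "\<exists>y. x = sig y"
proof -
  define s where "s = x \<bullet> p"
  have xx: "x \<bullet> x = 1" using assms(1) by (simp add: norm_eq_1)
  have "(x - s *\<^sub>R p) \<bullet> p = 0" by (simp add: inner_diff_left s_def pp)
  then obtain v where v: "x - s *\<^sub>R p = J v" using J_surj by blast
  then have xv: "x = J v + s *\<^sub>R p" by (simp add: algebra_simps)
  have vs: "v \<bullet> v + s * s = 1" using xx unfolding xv by (simp add: J_simps)
  have "s \<noteq> 1"
  proof
    assume "s = 1"
    then have "v = 0" using vs by simp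
    then have "x = p" using xv \<open>s = 1\<close> linear_0 [OF J] by simp
    then show False using assms(2) by simp
  qed
  moreover have "s \<le> 1" using norm_cauchy_schwarz [of x p] assms(1) pole by (simp add: s_def)
  ultimately have s1: "0 < 1 - s" by simp
  define y where "y = (1 / (1 - s)) *\<^sub>R v"
  have "1 + y \<bullet> y = 2 / (1 - s)"
  proof -
    have "y \<bullet> y = (1 - s * s) / ((1 - s) * (1 - s))" using vs by (simp add: y_def algebra_simps)
    also have "\<dots> = (1 + s) / (1 - s)" using s1 by (simp add: divide_simps) (simp add: algebra_simps)
    finally have "(y \<bullet> y) * (1 - s) = 1 + s" using s1 by simp
    then have "(1 + y \<bullet> y) * (1 - s) = 2" by (simp add: distrib_right)
    then show ?thesis using s1 by (simp add: nonzero_eq_divide_eq)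
  qed
  then have l: "lam y = 1 - s" using s1 by (simp add: lam_def)
  have "sig y = x" unfolding sig_def l using s1 by (simp add: y_def J_scale xv)
  then show ?thesis by blast
qed

lemma J_bounded_linear: "bounded_linear J" using J by (rule linear_conv_bounded_linear [THEN iffD1])

lemma lam_pow_has_derivative:
  "((\<lambda>y. lam y ^ m) has_derivative (\<lambda>h. - real m * lam y ^ (m + 1) * (y \<bullet> h))) (at y)"
proof -
  have ne: "1 + y \<bullet> y \<noteq> 0" using denom_pos [of y] by simp
  have d: "(lam has_derivative (\<lambda>h. - (lam y ^ 2 * (y \<bullet> h)))) (at y)"
    unfolding lam_def [abs_def] using ne
    by (auto intro!: derivative_eq_intros simp: fun_eq_iff power2_eq_square inner_commute divide_simps)
  show ?thesis
  proof (cases m)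
    case (Suc k)
    have "((\<lambda>y. lam y ^ m) has_derivative (\<lambda>h. real m * - (lam y ^ 2 * (y \<bullet> h)) * lam y ^ (m - 1))) (at y)"
      by (rule has_derivative_power [OF d, THEN has_derivative_eq_rhs]) (simp add: fun_eq_iff)
    then show ?thesis by (rule has_derivative_eq_rhs) (simp add: fun_eq_iff Suc power2_eq_square algebra_simps)
  qed simp
qed

lemma lam_has_derivative: "(lam has_derivative (\<lambda>h. - (lam y ^ 2) * (y \<bullet> h))) (at y)"
  using lam_pow_has_derivative [of 1 y] by (simp add: power2_eq_square)

lemma sig_has_derivative: "(sig has_derivative (\<lambda>h. lam y *\<^sub>R frame y h)) (at y)"
  unfolding sig_def [abs_def]
  by (rule has_derivative_eq_rhs, (rule derivative_intros lam_has_derivative bounded_linear_imp_has_derivative [OF J_bounded_linear])+)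
    (simp add: fun_eq_iff frame_def algebra_simps power2_eq_square)

lemma continuous_on_lam [continuous_intros]: "continuous_on S lam"
  by (meson continuous_at_imp_continuous_on has_derivative_continuous lam_has_derivative)

lemma continuous_on_sig [continuous_intros]: "continuous_on S sig"
  by (meson continuous_at_imp_continuous_on has_derivative_continuous sig_has_derivative)

lemma linear_frame: "linear (frame y)"
  by (rule linearI) (simp_all add: frame_def J_add J_scale inner_add_right algebra_simps)

lemma frame_inner: "frame y h \<bullet> frame y k = h \<bullet> k"
proof -
  have "frame y h \<bullet> frame y k = h \<bullet> k - lam y * (y \<bullet> k) * (h \<bullet> y) - lam y * (y \<bullet> h) * (y \<bullet> k)
      + lam y * (y \<bullet> h) * (y \<bullet> k) * (lam y * (y \<bullet> y) + lam y)"
    by (simp add: frame_def J_simps algebra_simps)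
  then show ?thesis by (simp add: lam_norm inner_commute [of h y] algebra_simps)
qed

lemma frame_sig: "frame y h \<bullet> sig y = 0"
proof -
  have "frame y h \<bullet> sig y = lam y * (y \<bullet> h) * (2 - lam y - lam y * (y \<bullet> y))"
    by (simp add: frame_def sig_def J_simps inner_commute [of h y] algebra_simps)
  then show ?thesis by (simp add: lam_norm)
qed

lemma coframe_inner: "coframe y x \<bullet> h = frame y h \<bullet> x"
proof -
  have "frame y h = (\<Sum>j\<in>UNIV. h $ j *\<^sub>R frame y (axis j 1))"
  proof -
    have "h = (\<Sum>j\<in>UNIV. h $ j *\<^sub>R axis j 1)" using basis_expansion [of h] by (simp add: scalar_mult_eq_scaleR)
    then have "frame y h = frame y (\<Sum>j\<in>UNIV. h $ j *\<^sub>R axis j 1)" by (rule arg_cong)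
    also have "\<dots> = (\<Sum>j\<in>UNIV. frame y (h $ j *\<^sub>R axis j 1))" by (rule linear_sum [OF linear_frame])
    finally show ?thesis by (simp only: linear_cmul [OF linear_frame])
  qed
  then have "frame y h \<bullet> x = (\<Sum>j\<in>UNIV. h $ j * (frame y (axis j 1) \<bullet> x))" by (simp add: inner_sum_left)
  also have "\<dots> = coframe y x \<bullet> h" by (simp add: coframe_def inner_vec_def mult.commute)
  finally show ?thesis by simp
qed

lemma frame_surj:
  assumes "x \<bullet> sig y = 0" shows "\<exists>h. x = frame y h"
proof -
  define s where "s = x \<bullet> p"
  have "(x - s *\<^sub>R p) \<bullet> p = 0" by (simp add: inner_diff_left s_def pp)
  then obtain v where v: "x - s *\<^sub>R p = J v" using J_surj by blast
  then have xv: "x = J v + s *\<^sub>R p" by (simp add: algebra_simps)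
  have t: "lam y * (v \<bullet> y) + (1 - lam y) * s = 0" using assms unfolding xv sig_def by (simp add: J_simps algebra_simps)
  have "lam y * (y \<bullet> (v + s *\<^sub>R y)) = lam y * (v \<bullet> y) + s * (lam y * (y \<bullet> y))"
    by (simp add: inner_add_right inner_commute [of y v] algebra_simps)
  also have "\<dots> = s" using t by (simp add: lam_norm algebra_simps)
  finally have "frame y (v + s *\<^sub>R y) = J v + s *\<^sub>R J y - s *\<^sub>R (J y - p)" by (simp add: frame_def J_add J_scale)
  then have "x = frame y (v + s *\<^sub>R y)" unfolding xv by (simp add: algebra_simps)
  then show ?thesis by blast
qed

lemma coframe_frame: "coframe y (frame y h) = h"
proof (rule vector_eq_ldot [THEN iffD1], rule allI)
  show "k \<bullet> coframe y (frame y h) = k \<bullet> h" for k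
    by (simp add: inner_commute [of k "coframe y (frame y h)"] coframe_inner frame_inner inner_commute [of h k])
qed

lemma frame_coframe: "x \<bullet> sig y = 0 \<Longrightarrow> frame y (coframe y x) = x"
  using frame_surj coframe_frame by metis

lemma norm_frame: "norm (frame y h) = norm h"
  by (simp add: norm_eq_sqrt_inner frame_inner)

text \<open>The columns of an orthogonal matrix whose rows are \<open>sig y\<close> and \<open>frame y e\<^sub>j\<close> are orthonormal.\<close>

lemma frame_completeness:
  "(\<Sum>j\<in>UNIV. frame y (axis j 1) $ a * frame y (axis j 1) $ b) = (if a = b then 1 else 0) - sig y $ a * sig y $ b"
proof -
  define A :: "real ^ ('n option) ^ ('n option)" where
    "A = (\<chi> i. case i of None \<Rightarrow> sig y | Some j \<Rightarrow> frame y (axis j 1))"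
  have ss: "sig y \<bullet> sig y = 1" using norm_sig by (simp add: norm_eq_1 [symmetric])
  have "A ** transpose A = mat 1"
  proof -
    have sf: "sig y \<bullet> frame y h = 0" for h using frame_sig [of y h] by (simp add: inner_commute)
    have "A $ i \<bullet> A $ k = (if i = k then 1 else 0)" for i k
      by (auto simp: A_def ss frame_sig sf frame_inner inner_axis_axis split: option.splits)
    then show ?thesis
      by (simp add: vec_eq_iff matrix_matrix_mult_def transpose_def mat_def inner_vec_def)
  qed
  then have "transpose A ** A = mat 1" by (simp add: matrix_left_right_inverse)
  then have "(transpose A ** A) $ a $ b = mat 1 $ a $ b" by simp
  then have "(\<Sum>i\<in>UNIV. A $ i $ a * A $ i $ b) = (if a = b then 1 else 0)"
    by (simp add: matrix_matrix_mult_def transpose_def mat_def)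
  moreover have "(\<Sum>i\<in>UNIV. A $ i $ a * A $ i $ b) = A $ None $ a * A $ None $ b + (\<Sum>j\<in>UNIV. A $ Some j $ a * A $ Some j $ b)"
    by (simp add: UNIV_option_conv sum.reindex)
  ultimately show ?thesis by (simp add: A_def)
qed

lemma sum_frame_diagonal:
  "(\<Sum>j\<in>UNIV. real d * lam y ^ (d + 1) * (y $ j) * (J (axis j 1)) $ a) = real d * lam y ^ (d + 1) * J y $ a"
proof -
  have "J y = (\<Sum>j\<in>UNIV. y $ j *\<^sub>R J (axis j 1))"
  proof -
    have "y = (\<Sum>j\<in>UNIV. y $ j *\<^sub>R axis j 1)" using basis_expansion [of y] by (simp add: scalar_mult_eq_scaleR)
    then have "J y = J (\<Sum>j\<in>UNIV. y $ j *\<^sub>R axis j 1)" by (rule arg_cong)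
    also have "\<dots> = (\<Sum>j\<in>UNIV. J (y $ j *\<^sub>R axis j 1))" by (rule linear_sum [OF J])
    finally show ?thesis by (simp only: linear_cmul [OF J])
  qed
  then have "J y $ a = (\<Sum>j\<in>UNIV. y $ j * J (axis j 1) $ a)" by simp
  then show ?thesis by (simp add: sum_distrib_left mult.assoc)
qed

text \<open>\<open>div (lam\<^sup>d frame\<^sup>T e\<^sub>a) = - n lam\<^sup>n sig\<^sub>a\<close> with \<open>d = n - 1\<close>: the coordinate functions are spherical harmonics of degree \<open>1\<close>.\<close>

lemma frame_component_has_derivative:
  "((\<lambda>y. lam y ^ d * frame y v $ a) has_derivative
     (\<lambda>h. - real d * lam y ^ (d + 1) * (y \<bullet> h) * J v $ a + real (d + 1) * lam y ^ (d + 2) * (y \<bullet> h) * (y \<bullet> v) * (J y - p) $ a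
       - lam y ^ (d + 1) * (h \<bullet> v) * (J y - p) $ a - lam y ^ (d + 1) * (y \<bullet> v) * J h $ a)) (at y)"
proof -
  have dJ: "((\<lambda>y. J y $ a) has_derivative (\<lambda>h. J h $ a)) (at y)"
    by (rule bounded_linear.has_derivative [OF bounded_linear_vec_nth bounded_linear_imp_has_derivative [OF J_bounded_linear]])
  have eq: "(\<lambda>y. lam y ^ d * frame y v $ a) = (\<lambda>y. lam y ^ d * J v $ a - lam y ^ (d + 1) * ((y \<bullet> v) * (J y $ a - p $ a)))"
    by (simp add: fun_eq_iff frame_def algebra_simps)
  show ?thesis unfolding eq
    by (rule has_derivative_eq_rhs, (rule derivative_intros lam_pow_has_derivative dJ)+)
      (simp add: fun_eq_iff algebra_simps)
qed

lemma frame_divergence: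
  assumes d: "d = CARD('n) - 1"
  shows "(\<Sum>j\<in>UNIV. frechet_derivative (\<lambda>y. lam y ^ d * frame y (axis j 1) $ a) (at y) (axis j 1))
    = - real CARD('n) * lam y ^ CARD('n) * sig y $ a"
proof -
  have n: "CARD('n) = d + 1" using d by simp
  have ax: "y \<bullet> axis j 1 = y $ j" "axis j (1::real) \<bullet> axis j 1 = 1" for j by (simp_all add: inner_axis inner_axis_axis)
  have D: "frechet_derivative (\<lambda>y. lam y ^ d * frame y (axis j 1) $ a) (at y) (axis j 1)
    = - (real d * lam y ^ (d + 1) * y $ j * J (axis j 1) $ a) + real (d + 1) * lam y ^ (d + 2) * (J y - p) $ a * (y $ j * y $ j)
       - lam y ^ (d + 1) * (J y - p) $ a - lam y ^ (d + 1) * (y $ j * J (axis j 1) $ a)" for j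
    unfolding frechet_derivative_at [OF frame_component_has_derivative, symmetric] ax by (simp add: algebra_simps)
  have s1: "(\<Sum>j\<in>UNIV. y $ j * J (axis j 1) $ a) = J y $ a"
    using sum_frame_diagonal [of 1 y a] lam_pos [of y] by (simp add: sum_distrib_left [symmetric] mult.assoc)
  have s2: "(\<Sum>j\<in>UNIV. y $ j * y $ j) = y \<bullet> y" by (simp add: inner_vec_def)
  have "(\<Sum>j\<in>UNIV. frechet_derivative (\<lambda>y. lam y ^ d * frame y (axis j 1) $ a) (at y) (axis j 1))
    = - (real d * lam y ^ (d + 1) * J y $ a) + real (d + 1) * lam y ^ (d + 2) * (J y - p) $ a * (y \<bullet> y)
       - real CARD('n) * (lam y ^ (d + 1) * (J y - p) $ a) - lam y ^ (d + 1) * J y $ a"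
    unfolding D sum.distrib sum_subtractf sum_negf sum_frame_diagonal sum_distrib_left [symmetric] s1 s2 by simp
  also have "real (d + 1) * lam y ^ (d + 2) * (J y - p) $ a * (y \<bullet> y) = real (d + 1) * lam y ^ (d + 1) * (J y - p) $ a * (lam y * (y \<bullet> y))"
    by (simp add: algebra_simps)
  also have "\<dots> = real (d + 1) * lam y ^ (d + 1) * (J y - p) $ a * (2 - lam y)"
    by (simp only: lam_norm)
  also have "- (real d * lam y ^ (d + 1) * J y $ a) + real (d + 1) * lam y ^ (d + 1) * (J y - p) $ a * (2 - lam y)
       - real CARD('n) * (lam y ^ (d + 1) * (J y - p) $ a) - lam y ^ (d + 1) * J y $ a
     = - real CARD('n) * lam y ^ CARD('n) * sig y $ a"
    unfolding n by (simp add: sig_def algebra_simps)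
  finally show ?thesis .
qed

end

section \<open>Domains on the sphere in stereographic coordinates\<close>

lemma sphere_boundary_iff:
  assumes "openin (top_of_set (sphere 0 1)) V"
  shows "x \<in> sphere_boundary V \<longleftrightarrow> x \<in> closure V \<and> x \<notin> V"
proof -
  have sub: "V \<subseteq> sphere 0 1" using openin_subset [OF assms] by simp
  have "closure V \<subseteq> sphere 0 1" using sub by (rule closure_minimal) simp
  moreover have "(top_of_set (sphere 0 1)) interior_of V = V" using assms by (simp add: interior_of_eq)
  moreover have "(top_of_set (sphere 0 1)) closure_of V = sphere 0 1 \<inter> closure V"
    using sub by (simp add: closure_of_subtopology Int_absorb1)
  ultimately show ?thesis unfolding sphere_boundary_def frontier_of_def by blast
qed

locale stereographic_domain = stereographic J p
  for J :: "real ^ 'n::finite \<Rightarrow> real ^ ('n option)" and p +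
  fixes V :: "(real ^ ('n option)) set" and \<nu> :: "real ^ ('n option) \<Rightarrow> real ^ ('n option)"
  assumes V_open: "openin (top_of_set (sphere 0 1)) V" and p_out: "p \<notin> closure V"
    and V_C1: "C1_boundary V"
    and normal: "\<And>x. x \<in> sphere_boundary V \<Longrightarrow> outward_unit_normal V x (\<nu> x)"
begin

definition V' :: "(real ^ 'n) set" where "V' = {y. sig y \<in> V}"

text \<open>The normal is transported by the isometry \<open>coframe\<close>, without the conformal
  factor of the differential, and therefore keeps length 1.\<close>

definition \<nu>' :: "real ^ 'n \<Rightarrow> real ^ 'n" where "\<nu>' y = coframe y (\<nu> (sig y))"

lemma lam_nonzero: "lam y \<noteq> 0" using lam_pos [of y] by simp

lemma V_sphere: "V \<subseteq> sphere 0 1" using openin_subset [OF V_open] by simp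

lemma closure_V_sphere: "closure V \<subseteq> sphere 0 1"
  using V_sphere by (rule closure_minimal) simp

lemma open_V': "open V'"
proof -
  obtain O' where "open O'" and VO: "V = sphere 0 1 \<inter> O'" using V_open by (auto simp: openin_open)
  have "V' = sig -` O'" unfolding V'_def unfolding VO using norm_sig by auto
  then show ?thesis using \<open>open O'\<close> by (simp add: open_vimage continuous_on_sig)
qed

text \<open>The squared distance of \<open>sig y\<close> from the pole is \<open>2 * lam y\<close>,
  so staying at distance \<open>b\<close> from the pole bounds \<open>1 + y \<bullet> y\<close> by
  \<open>4 / b\<^sup>2\<close>.\<close>

lemma bounded_V': "bounded V'"
proof -
  have "open (- closure V)" "p \<in> - closure V" using p_out by auto
  then obtain b where b: "0 < b" "ball p b \<subseteq> - closure V" by (meson open_contains_ball)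
  have "norm y \<le> 4 / b\<^sup>2" if "y \<in> V'" for y
  proof -
    have "sig y \<notin> ball p b" using that b(2) closure_subset [of V] unfolding V'_def by blast
    then have "b \<le> norm (sig y - p)" by (simp add: dist_norm norm_minus_commute)
    then have "b\<^sup>2 \<le> (norm (sig y - p))\<^sup>2" using b(1) by (intro power_mono) auto
    also have "\<dots> = 2 * lam y"
    proof -
      have "sig y \<bullet> sig y = 1" using norm_sig by (simp add: norm_eq_1 [symmetric])
      then show ?thesis
        by (simp add: power2_norm_eq_inner inner_diff_left inner_diff_right inner_commute [of p "sig y"] sig_pole pp)
    qed
    finally have "b\<^sup>2 * (1 + y \<bullet> y) \<le> 4" using denom_pos [of y] by (simp add: lam_def pos_le_divide_eq)
    moreover have "norm y \<le> 1 + y \<bullet> y"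
    proof -
      have "0 \<le> (norm y - 1 / 2)\<^sup>2" by simp
      then have "norm y \<le> (norm y)\<^sup>2 + 1 / 4" by (simp add: power2_diff power_divide)
      then show ?thesis by (simp add: power2_norm_eq_inner)
    qed
    then have "b\<^sup>2 * norm y \<le> b\<^sup>2 * (1 + y \<bullet> y)" by (intro mult_left_mono) auto
    ultimately have "b\<^sup>2 * norm y \<le> 4" by (rule order_trans [rotated])
    then show ?thesis using b(1) by (simp add: pos_le_divide_eq mult.commute)
  qed
  then show ?thesis unfolding bounded_iff by blast
qed

lemma sig_closure: "y \<in> closure V' \<Longrightarrow> sig y \<in> closure V"
proof -
  have "sig ` closure V' \<subseteq> closure V"
    by (rule image_closure_subset [OF continuous_on_sig]) (use closure_subset in \<open>auto simp: V'_def\<close>)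
  then show "y \<in> closure V' \<Longrightarrow> sig y \<in> closure V" by blast
qed

lemma sig_frontier: "y \<in> frontier V' \<Longrightarrow> sig y \<in> sphere_boundary V"
  using sig_closure open_V' unfolding sphere_boundary_iff [OF V_open]
  by (auto simp: frontier_def interior_open V'_def)

text \<open>The outward normal is specified by tangent curves and a geodesic, the flat theory by a
  gradient; this reconciles the two. Boundary curves with every tangential velocity force
  \<open>\<nu>'\<close> to be a multiple \<open>c\<close> of the gradient, and the geodesic that
  leaves \<open>V\<close> excludes \<open>c < 0\<close>.\<close>

lemma pull_back_defining_function:
  assumes x0: "sig y0 \<in> sphere_boundary V"
  shows "\<exists>W' \<rho>' G'. y0 \<in> W' \<and> defining_function V' W' \<rho>' G' \<and> \<rho>' y0 = 0 \<and>
     (\<forall>y\<in>W' \<inter> frontier V'. \<nu>' y = G' y /\<^sub>R norm (G' y))"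
proof -
  from bspec [OF V_C1 [unfolded C1_boundary_def] x0] obtain W \<rho> G where W: "open W" "sig y0 \<in> W"
    and d\<rho>': "\<forall>y\<in>W. (\<rho> has_derivative (\<lambda>h. G y \<bullet> h)) (at y)" and contG: "continuous_on W G"
    and Gx: "G (sig y0) \<notin> span {sig y0}" and VW: "V \<inter> W = {y \<in> sphere 0 1 \<inter> W. \<rho> y < 0}"
    by (elim exE conjE) (rule that; assumption)
  note d\<rho> = bspec [OF d\<rho>']
  define G' where "G' y = lam y *\<^sub>R coframe y (G (sig y))" for y
  define W1 where "W1 = sig -` W"
  have W1: "open W1" unfolding W1_def by (rule open_vimage [OF W(1) continuous_on_sig])
  have contG': "continuous_on W1 G'"
  proof -
    have cJ: "continuous_on S J" for S by (rule linear_continuous_on [OF J_bounded_linear])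
    have "continuous_on W1 (\<lambda>y. G (sig y))"
      by (rule continuous_on_compose2 [OF contG continuous_on_sig]) (auto simp: W1_def)
    then show ?thesis unfolding G'_def coframe_def frame_def
      by (intro continuous_intros continuous_on_vec_lambda continuous_on_lam cJ)
  qed
  \<comment> \<open>The condition that \<open>G'\<close> is not 0 still leaves a neighbourhood of
    \<open>y0\<close>, since at \<open>sig y0\<close> the gradient \<open>G\<close> has a component
    tangent to the sphere.\<close>
  define W' where "W' = W1 \<inter> G' -` (- {0})"
  have W'W: "sig y \<in> W" if "y \<in> W'" for y using that by (simp add: W'_def W1_def)
  have G'0: "G' y0 \<noteq> 0"
  proof
    assume "G' y0 = 0"
    then have cf: "coframe y0 (G (sig y0)) = 0" using lam_pos [of y0] by (simp add: G'_def)
    let ?x = "sig y0" and ?g = "G (sig y0)"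
    have xx: "?x \<bullet> ?x = 1" using norm_sig by (simp add: norm_eq_1 [symmetric])
    have "(?g - (?g \<bullet> ?x) *\<^sub>R ?x) \<bullet> ?x = 0" by (simp add: inner_diff_left xx)
    then obtain h where h: "?g - (?g \<bullet> ?x) *\<^sub>R ?x = frame y0 h" using frame_surj by blast
    have "frame y0 h \<bullet> frame y0 h = frame y0 h \<bullet> ?g - (?g \<bullet> ?x) * (frame y0 h \<bullet> ?x)"
      by (subst (2) h [symmetric]) (simp add: inner_diff_right)
    also have "\<dots> = frame y0 h \<bullet> ?g" by (simp add: frame_sig)
    also have "\<dots> = 0" by (simp add: coframe_inner [symmetric] cf)
    finally have "frame y0 h = 0" by simp
    then have "?g = (?g \<bullet> ?x) *\<^sub>R ?x" using h by simp
    then have "?g \<in> span {?x}" by (metis span_base span_scale singletonI)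
    then show False using Gx by simp
  qed
  have y0: "y0 \<in> W'" using W(2) G'0 by (simp add: W'_def W1_def)
  have oW': "open W'" unfolding W'_def by (rule continuous_open_preimage [OF contG' W1]) auto
  have def: "defining_function V' W' (\<lambda>y. \<rho> (sig y)) G'"
    unfolding defining_function_def
  proof (intro conjI ballI)
    show "open W'" by (rule oW')
    show "continuous_on W' G'" by (rule continuous_on_subset [OF contG']) (simp add: W'_def)
    show "V' \<inter> W' = {y \<in> W'. \<rho> (sig y) < 0}"
    proof (intro set_eqI)
      fix y
      have "sig y \<in> V \<longleftrightarrow> \<rho> (sig y) < 0" if "y \<in> W'"
      proof -
        have "sig y \<in> sphere 0 1 \<inter> W" using W'W [OF that] norm_sig by simp
        then show ?thesis using VW by blast
      qed
      then show "y \<in> V' \<inter> W' \<longleftrightarrow> y \<in> {y \<in> W'. \<rho> (sig y) < 0}" by (auto simp: V'_def)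
    qed
    fix y assume y: "y \<in> W'"
    show "G' y \<noteq> 0" using y by (simp add: W'_def)
    have "((\<lambda>y. \<rho> (sig y)) has_derivative (\<lambda>h. G (sig y) \<bullet> (lam y *\<^sub>R frame y h))) (at y)"
      by (rule has_derivative_compose [OF sig_has_derivative d\<rho> [OF W'W [OF y]]])
    then show "((\<lambda>y. \<rho> (sig y)) has_derivative (\<lambda>h. G' y \<bullet> h)) (at y)"
      by (rule has_derivative_eq_rhs) (simp add: fun_eq_iff G'_def coframe_inner inner_commute [of "G (sig y)"])
  qed
  \<comment> \<open>Shown on the sphere, from \<open>sig y0\<close> being a limit of points of
    \<open>V\<close> outside \<open>V\<close>, because \<open>y0\<close> is not yet known to lie in
    the frontier of \<open>V'\<close>.\<close>
  have \<rho>0: "\<rho> (sig y0) = 0"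
  proof -
    have cl: "sig y0 \<in> closure V" "sig y0 \<notin> V" using x0 by (simp_all add: sphere_boundary_iff [OF V_open])
    have "sig y0 \<in> sphere 0 1 \<inter> W" using W(2) norm_sig by simp
    then have "\<not> \<rho> (sig y0) < 0" using cl(2) VW by blast
    moreover have "\<rho> (sig y0) \<le> 0"
    proof -
      obtain x where x: "\<And>n. x n \<in> V" "x \<longlonglongrightarrow> sig y0" using cl(1) by (auto simp: closure_sequential)
      have "isCont \<rho> (sig y0)" using d\<rho> [OF W(2)] by (rule has_derivative_continuous)
      then have "(\<lambda>n. \<rho> (x n)) \<longlonglongrightarrow> \<rho> (sig y0)" using x(2) by (rule isCont_tendsto_compose)
      moreover have "\<forall>\<^sub>F n in sequentially. x n \<in> W" using x(2) W by (rule topological_tendstoD)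
      then have "\<forall>\<^sub>F n in sequentially. \<rho> (x n) \<le> 0"
      proof eventually_elim
        case (elim n)
        then have "x n \<in> V \<inter> W" using x(1) by simp
        then show ?case unfolding VW by simp
      qed
      ultimately show ?thesis by (rule tendsto_upperbound) simp
    qed
    ultimately show ?thesis by simp
  qed
  have "\<nu>' y = G' y /\<^sub>R norm (G' y)" if y: "y \<in> W'" "y \<in> frontier V'" for y
  proof -
    let ?n = "\<nu>' y" and ?g = "G' y" and ?x = "sig y"
    have xb: "?x \<in> sphere_boundary V" by (rule sig_frontier [OF y(2)])
    have out: "norm (\<nu> ?x) = 1" "\<nu> ?x \<bullet> ?x = 0" "\<And>\<tau>. \<tau> \<in> tangent_vectors (sphere_boundary V) ?x \<Longrightarrow> \<nu> ?x \<bullet> \<tau> = 0"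
      "\<forall>\<^sub>F t in at_right 0. cos t *\<^sub>R ?x + sin t *\<^sub>R \<nu> ?x \<notin> V"
      using normal [OF xb] by (auto simp: outward_unit_normal_def)
    have fn: "frame y ?n = \<nu> ?x" unfolding \<nu>'_def by (rule frame_coframe [OF out(2)])
    have nn: "norm ?n = 1" using norm_frame [of y ?n] fn out(1) by simp
    have g0: "?g \<noteq> 0" using y(1) by (simp add: W'_def)
    have \<rho>y: "\<rho> ?x = 0" by (rule iffD1 [OF frontier_defining_function [OF open_V' def y(1)] y(2)])
    have orth: "?n \<bullet> \<tau> = 0" if \<tau>: "?g \<bullet> \<tau> = 0" for \<tau>
    proof -
      obtain \<gamma> where \<gamma>: "\<gamma> 0 = y" "\<forall>\<^sub>F t in nhds 0. \<gamma> t \<in> W' \<and> \<rho> (sig (\<gamma> t)) = 0"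
        "(\<gamma> has_vector_derivative \<tau>) (at (0::real))"
        using tangent_curve_exists [OF def y(1) _ \<tau>] \<rho>y by blast
      have "((\<lambda>t. sig (\<gamma> t)) has_vector_derivative lam y *\<^sub>R frame y \<tau>) (at 0)"
        using vector_derivative_diff_chain_within [OF \<gamma>(3), of sig "\<lambda>h. lam y *\<^sub>R frame y h"] sig_has_derivative [of y] \<gamma>(1)
        by (simp add: comp_def has_derivative_at_withinI)
      moreover have "\<forall>\<^sub>F t in nhds 0. sig (\<gamma> t) \<in> sphere_boundary V"
        using \<gamma>(2)
      proof eventually_elim
        case (elim t)
        then have "\<gamma> t \<in> frontier V'" using frontier_defining_function [OF open_V' def, of "\<gamma> t"] by simp
        then show ?case by (rule sig_frontier)
      qed
      ultimately have "lam y *\<^sub>R frame y \<tau> \<in> tangent_vectors (sphere_boundary V) ?x"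
        unfolding tangent_vectors_def using \<gamma>(1) by (intro CollectI exI [of _ "\<lambda>t. sig (\<gamma> t)"]) simp
      then have "\<nu> ?x \<bullet> (lam y *\<^sub>R frame y \<tau>) = 0" by (rule out(3))
      then have "frame y ?n \<bullet> frame y \<tau> = 0" using fn lam_pos [of y] by simp
      then show ?thesis by (simp add: frame_inner)
    qed
    \<comment> \<open>The component along \<open>?g\<close> is split off; the remainder is
      tangential, hence orthogonal to \<open>?n\<close> as well as to \<open>?g\<close>, and so to
      itself.\<close>
    define c where "c = (?n \<bullet> ?g) / (?g \<bullet> ?g)"
    have gg: "?g \<bullet> ?g > 0" using g0 by simp
    have t0: "?g \<bullet> (?n - c *\<^sub>R ?g) = 0" using gg by (simp add: c_def inner_diff_right inner_commute)
    have "(?n - c *\<^sub>R ?g) \<bullet> (?n - c *\<^sub>R ?g) = ?n \<bullet> (?n - c *\<^sub>R ?g) - c * (?g \<bullet> (?n - c *\<^sub>R ?g))"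
      by (simp add: inner_diff_left)
    also have "\<dots> = 0" using orth [OF t0] t0 by simp
    finally have ncg: "?n = c *\<^sub>R ?g" by simp
    \<comment> \<open>For \<open>c < 0\<close> the function \<open>\<rho>\<close> would decrease
      along the geodesic in direction \<open>\<nu>\<close>, which would then enter
      \<open>V\<close>.\<close>
    have "\<not> c < 0"
    proof
      assume c: "c < 0"
      let ?c = "\<lambda>t. cos t *\<^sub>R ?x + sin t *\<^sub>R \<nu> ?x"
      have "(?c has_vector_derivative \<nu> ?x) (at 0)"
        by (auto intro!: derivative_eq_intros)
      then have "((\<lambda>t. \<rho> (?c t)) has_vector_derivative G ?x \<bullet> \<nu> ?x) (at 0)"
        using vector_derivative_diff_chain_within [of ?c "\<nu> ?x" 0 UNIV \<rho> "\<lambda>h. G ?x \<bullet> h"] d\<rho> [OF W'W [OF y(1)]]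
        by (simp add: comp_def has_derivative_at_withinI)
      moreover have "G ?x \<bullet> \<nu> ?x = c * (?g \<bullet> ?g) / lam y"
      proof -
        have "G ?x \<bullet> \<nu> ?x = coframe y (G ?x) \<bullet> ?n" by (simp add: coframe_inner fn inner_commute [of "G ?x"])
        also have "\<dots> = (?g \<bullet> ?n) / lam y" using lam_pos [of y] by (simp add: G'_def)
        also have "\<dots> = c * (?g \<bullet> ?g) / lam y" by (subst ncg) simp
        finally show ?thesis .
      qed
      ultimately have "((\<lambda>t. \<rho> (?c t)) has_real_derivative c * (?g \<bullet> ?g) / lam y) (at 0)"
        by (simp add: has_real_derivative_iff_has_vector_derivative)
      moreover have "c * (?g \<bullet> ?g) / lam y < 0" using c gg lam_pos [of y] by (simp add: divide_neg_pos mult_neg_pos)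
      ultimately have "\<exists>d>0. \<forall>h>0. h < d \<longrightarrow> \<rho> (?c (0 + h)) < \<rho> (?c 0)" by (rule DERIV_neg_dec_right)
      then obtain d where d: "0 < d" "\<And>h. 0 < h \<Longrightarrow> h < d \<Longrightarrow> \<rho> (?c h) < 0" using \<rho>y by auto
      have "\<forall>\<^sub>F t in at_right 0. t \<in> {0<..<d}" by (rule eventually_at_right_real [OF d(1)])
      moreover have "\<forall>\<^sub>F t in at_right 0. ?c t \<in> W"
      proof -
        have "((\<lambda>t. ?c t) \<longlongrightarrow> cos 0 *\<^sub>R ?x + sin 0 *\<^sub>R \<nu> ?x) (at_right 0)" by (intro tendsto_intros)
        then have "(?c \<longlongrightarrow> ?x) (at_right 0)" by simp
        then show ?thesis using W(1) W'W [OF y(1)] by (rule topological_tendstoD)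
      qed
      ultimately have "\<forall>\<^sub>F t in at_right (0::real). False"
        using out(4)
      proof eventually_elim
        case (elim t)
        have "?c t \<bullet> ?c t = 1"
        proof -
          have "?x \<bullet> ?x = 1" "\<nu> ?x \<bullet> \<nu> ?x = 1" using norm_sig out(1) by (simp_all add: norm_eq_1 [symmetric])
          then have "?c t \<bullet> ?c t = (cos t)\<^sup>2 + (sin t)\<^sup>2"
            using out(2) by (simp add: inner_add_left inner_add_right inner_commute [of ?x "\<nu> ?x"] power2_eq_square)
          then show ?thesis by simp
        qed
        then have "?c t \<in> sphere 0 1 \<inter> W" using elim by (simp add: norm_eq_1)
        then have "?c t \<in> V" using d(2) [of t] elim VW by auto
        then show ?case using elim by simp
      qed
      then show False by simp
    qed
    moreover have "\<bar>c\<bar> * norm ?g = 1" using nn ncg by (metis norm_scaleR)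
    ultimately have "c * norm ?g = 1" by simp
    then have "c = inverse (norm ?g)" using g0 by (simp add: field_simps)
    then show ?thesis using ncg by simp
  qed
  then show ?thesis
    using y0 def \<rho>0 by (intro exI [of _ W'] exI [of _ "\<lambda>y. \<rho> (sig y)"] exI [of _ G']) simp
qed

text \<open>Continuity of \<open>sig\<close> gives one direction. For the other, zeros of the pulled
  back defining function are frontier points of \<open>V'\<close>.\<close>

lemma frontier_iff: "y \<in> frontier V' \<longleftrightarrow> sig y \<in> sphere_boundary V"
proof
  assume "sig y \<in> sphere_boundary V"
  from pull_back_defining_function [OF this] obtain W' \<rho>' G'
    where "y \<in> W'" "defining_function V' W' \<rho>' G'" "\<rho>' y = 0" by blast
  then show "y \<in> frontier V'" using frontier_defining_function [OF open_V'] by blast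
qed (rule sig_frontier)

lemma sig_image_frontier: "sig ` frontier V' = sphere_boundary V"
proof
  show "sphere_boundary V \<subseteq> sig ` frontier V'"
  proof
    fix x assume x: "x \<in> sphere_boundary V"
    then have "x \<in> closure V" by (simp add: sphere_boundary_iff [OF V_open])
    then have "norm x = 1" "x \<noteq> p" using closure_V_sphere p_out by auto
    then obtain y where "x = sig y" using sig_surj by blast
    then show "x \<in> sig ` frontier V'" using x frontier_iff by blast
  qed
qed (use sig_frontier in blast)

sublocale flat: C1_domain V' \<nu>'
proof
  show "open V'" "bounded V'" by (rule open_V', rule bounded_V')
  fix x assume "x \<in> frontier V'"
  from pull_back_defining_function [OF sig_frontier [OF this]]
  show "\<exists>W \<rho> G. x \<in> W \<and> defining_function V' W \<rho> G \<and> (\<forall>y\<in>W \<inter> frontier V'. \<nu>' y = G y /\<^sub>R norm (G y))"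
    by blast
qed

text \<open>By \<open>sig_distance\<close> and continuity of \<open>lam\<close>, the map
  \<open>sig\<close> stretches all distances near \<open>x\<close> by factors between
  \<open>la\<close> and \<open>lb\<close>, both close to \<open>lam x\<close>.\<close>

lemma sig_hausdorff_local:
  assumes x: "x \<in> K" and \<epsilon>: "0 < \<epsilon>"
  shows "\<exists>r>0. \<forall>A\<in>sets borel. A \<subseteq> K \<inter> ball x r \<longrightarrow>
        hausdorff_outer d (sig ` A) \<le> ennreal (lam x ^ d + \<epsilon>) * hausdorff_outer d A \<and>
        ennreal (lam x ^ d) * hausdorff_outer d A \<le> hausdorff_outer d (sig ` A) + ennreal \<epsilon> * hausdorff_outer d A"
proof -
  have l: "0 < lam x" "0 < lam x ^ d" using lam_pos by auto
  obtain \<delta> where \<delta>: "0 < \<delta>" "\<delta> < 1" "lam x ^ d * (1 + \<delta>) ^ d \<le> lam x ^ d + \<epsilon>" "lam x ^ d \<le> lam x ^ d * (1 - \<delta>) ^ d + \<epsilon>"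
    using power_near_one [OF \<epsilon> l(2)] by blast
  have "isCont lam x" using continuous_on_lam [of UNIV] by (simp add: continuous_on_eq_continuous_at)
  then obtain r where r: "0 < r" "\<And>y. dist y x < r \<Longrightarrow> dist (lam y) (lam x) < \<delta> * lam x"
    unfolding continuous_at_eps_delta using \<delta>(1) l(1) by (metis mult_pos_pos)
  define la where "la = (1 - \<delta>) * lam x"
  define lb where "lb = (1 + \<delta>) * lam x"
  have near: "la \<le> lam y" "lam y \<le> lb" if "y \<in> ball x r" for y
    using r(2) [of y] that by (auto simp: la_def lb_def dist_real_def dist_commute algebra_simps)
  have ab: "0 < la" "0 < lb" using \<delta> l by (auto simp: la_def lb_def)
  have lip: "norm (sig y - sig z) \<le> lb * norm (y - z)" "la * norm (y - z) \<le> norm (sig y - sig z)"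
    if "y \<in> ball x r" "z \<in> ball x r" for y z
  proof -
    have "lam y * lam z \<le> lb * lb"
      by (rule mult_mono [OF near(2) [OF that(1)] near(2) [OF that(2)]]) (use ab lam_pos [of z] in auto)
    then have "lam y * lam z * (norm (y - z))\<^sup>2 \<le> lb * lb * (norm (y - z))\<^sup>2" by (rule mult_right_mono) simp
    then have "(norm (sig y - sig z))\<^sup>2 \<le> (lb * norm (y - z))\<^sup>2"
      by (simp only: sig_distance power_mult_distrib [of lb] power2_eq_square [of lb])
    then show "norm (sig y - sig z) \<le> lb * norm (y - z)" by (rule power2_le_imp_le) (use ab in simp)
    have "la * la \<le> lam y * lam z"
      by (rule mult_mono [OF near(1) [OF that(1)] near(1) [OF that(2)]]) (use ab lam_pos [of y] in auto)
    then have "la * la * (norm (y - z))\<^sup>2 \<le> lam y * lam z * (norm (y - z))\<^sup>2" by (rule mult_right_mono) simp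
    then have "(la * norm (y - z))\<^sup>2 \<le> (norm (sig y - sig z))\<^sup>2"
      by (simp only: sig_distance power_mult_distrib [of la] power2_eq_square [of la])
    then show "la * norm (y - z) \<le> norm (sig y - sig z)" by (rule power2_le_imp_le) simp
  qed
  show ?thesis
  proof (intro exI [of _ r] conjI ballI impI r(1))
    fix A :: "(real ^ 'n) set" assume "A \<subseteq> K \<inter> ball x r"
    then have A: "A \<subseteq> ball x r" by blast
    have "hausdorff_outer d (sig ` A) \<le> ennreal (lb ^ d) * hausdorff_outer d A"
      by (rule hausdorff_outer_lipschitz_image [OF lip(1) ab(2)]) (use A in blast)+
    also have "\<dots> \<le> ennreal (lam x ^ d + \<epsilon>) * hausdorff_outer d A"
      using \<delta>(3) by (intro mult_right_mono ennreal_leI) (simp_all add: lb_def power_mult_distrib mult.commute)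
    finally show "hausdorff_outer d (sig ` A) \<le> ennreal (lam x ^ d + \<epsilon>) * hausdorff_outer d A" .
    have "hausdorff_outer d (inv_into A sig ` sig ` A) \<le> ennreal ((1 / la) ^ d) * hausdorff_outer d (sig ` A)"
    proof (rule hausdorff_outer_lipschitz_image)
      fix u v assume "u \<in> sig ` A" "v \<in> sig ` A"
      then obtain y z where yz: "y \<in> A" "z \<in> A" "u = sig y" "v = sig z" by blast
      have "la * norm (y - z) \<le> norm (sig y - sig z)" using lip(2) [of y z] yz A by blast
      then have "norm (y - z) \<le> 1 / la * norm (sig y - sig z)" using ab(1) by (simp add: pos_le_divide_eq mult.commute)
      then show "norm (inv_into A sig u - inv_into A sig v) \<le> 1 / la * norm (u - v)"
        using yz by (simp add: inv_into_f_f [OF inj_sig])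
    qed (rule divide_pos_pos [OF zero_less_one ab(1)])
    then have le: "hausdorff_outer d A \<le> ennreal ((1 / la) ^ d) * hausdorff_outer d (sig ` A)"
      by (simp add: inj_sig)
    have inv: "ennreal (la ^ d) * ennreal ((1 / la) ^ d) = 1"
    proof -
      have "la ^ d * (1 / la) ^ d = 1" unfolding power_mult_distrib [symmetric] using ab(1) by simp
      then show ?thesis using ab(1) by (subst ennreal_mult [symmetric]) (auto simp del: power_mult_distrib)
    qed
    have "ennreal (lam x ^ d) * hausdorff_outer d A \<le> ennreal (la ^ d + \<epsilon>) * hausdorff_outer d A"
      using \<delta>(4) by (intro mult_right_mono ennreal_leI) (simp_all add: la_def power_mult_distrib mult.commute)
    also have "\<dots> = ennreal (la ^ d) * hausdorff_outer d A + ennreal \<epsilon> * hausdorff_outer d A"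
      using ab \<epsilon> by (simp add: distrib_right)
    also have "\<dots> \<le> ennreal (la ^ d) * (ennreal ((1 / la) ^ d) * hausdorff_outer d (sig ` A)) + ennreal \<epsilon> * hausdorff_outer d A"
      by (rule add_right_mono [OF mult_left_mono [OF le]]) simp
    also have "\<dots> = hausdorff_outer d (sig ` A) + ennreal \<epsilon> * hausdorff_outer d A"
      by (simp only: mult.assoc [symmetric] inv mult_1)
    finally show "ennreal (lam x ^ d) * hausdorff_outer d A \<le> hausdorff_outer d (sig ` A) + ennreal \<epsilon> * hausdorff_outer d A" .
  qed
qed

lemma integral_sphere_boundary:
  assumes \<phi>: "\<phi> \<in> borel_measurable borel"
  shows "(LINT x:sphere_boundary V|hausdorff_measure (CARD('n) - 1). \<phi> (image_section (frontier V') sig x))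
    = (LINT y:frontier V'|hausdorff_measure (CARD('n) - 1). \<phi> y * lam y ^ (CARD('n) - 1))"
  unfolding sig_image_frontier [symmetric]
  by (rule integral_hausdorff_image [OF flat.compact_frontier_V continuous_on_sig inj_sig _ _ flat.emeasure_frontier_finite sig_hausdorff_local \<phi>])
    (use lam_pos in \<open>auto intro!: continuous_intros simp: less_imp_le\<close>)

lemma C1_fun_frame_component: "C1_fun S (\<lambda>y. lam y ^ d * frame y v $ a)"
proof (rule C1_funI)
  show "((\<lambda>y. lam y ^ d * frame y v $ a) has_derivative
     (\<lambda>h. - real d * lam y ^ (d + 1) * (y \<bullet> h) * J v $ a + real (d + 1) * lam y ^ (d + 2) * (y \<bullet> h) * (y \<bullet> v) * (J y - p) $ a
       - lam y ^ (d + 1) * (h \<bullet> v) * (J y - p) $ a - lam y ^ (d + 1) * (y \<bullet> v) * J h $ a)) (at y)" for y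
    by (rule frame_component_has_derivative)
  have cJ: "continuous_on S J" by (rule linear_continuous_on [OF J_bounded_linear])
  show "continuous_on S (\<lambda>y. - real d * lam y ^ (d + 1) * (y \<bullet> h) * J v $ a + real (d + 1) * lam y ^ (d + 2) * (y \<bullet> h) * (y \<bullet> v) * (J y - p) $ a
       - lam y ^ (d + 1) * (h \<bullet> v) * (J y - p) $ a - lam y ^ (d + 1) * (y \<bullet> v) * J h $ a)" for h
    by (intro continuous_intros continuous_on_lam cJ)
qed

text \<open>\<open>Y\<close> is the pull-back of \<open>F\<close> that preserves flux; its factor
  \<open>lam ^ (n - 1)\<close> is that of the surface measure. The divergence of \<open>Y\<close> is
  \<open>lam ^ n\<close> times the sum of \<open>div F\<close>, minus the radial derivative of
  \<open>F\<close> paired with \<open>x\<close>, minus \<open>n (x \<bullet> F x)\<close>, and the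
  hypotheses make this 0.\<close>

lemma flux_vanishes:
  assumes \<Omega>: "open \<Omega>" "closure V \<subseteq> \<Omega>"
    and F: "\<And>a. C1_fun \<Omega> (\<lambda>x. F x $ a)"
    and radial: "\<And>x a. x \<in> V \<Longrightarrow> frechet_derivative (\<lambda>x. F x $ a) (at x) x = 0"
    and div: "\<And>x. x \<in> V \<Longrightarrow> (\<Sum>a\<in>UNIV. frechet_derivative (\<lambda>x. F x $ a) (at x) (axis a 1)) = real CARD('n) * (x \<bullet> F x)"
  shows "(LINT x:sphere_boundary V|hausdorff_measure (CARD('n) - 1). F x \<bullet> \<nu> x) = 0"
proof -
  let ?d = "CARD('n) - 1"
  have n: "CARD('n) = ?d + 1" by (simp add: Suc_leI)
  define U where "U = sig -` \<Omega>"
  have U: "open U" unfolding U_def by (rule open_vimage [OF \<Omega>(1) continuous_on_sig])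
  have VU: "closure V' \<subseteq> U" using sig_closure \<Omega>(2) by (auto simp: U_def)
  define Y where "Y y = lam y ^ ?d *\<^sub>R coframe y (F (sig y))" for y
  let ?c = "\<lambda>j a y. lam y ^ ?d * frame y (axis j 1) $ a"
  have Yj: "(\<lambda>y. Y y $ j) = (\<lambda>y. \<Sum>a\<in>UNIV. ?c j a y * F (sig y) $ a)" for j
    by (simp add: fun_eq_iff Y_def coframe_def inner_vec_def sum_distrib_left mult.assoc)
  have dF: "((\<lambda>y. F (sig y) $ a) has_derivative (\<lambda>h. \<Sum>b\<in>UNIV. lam y * frame y h $ b * frechet_derivative (\<lambda>x. F x $ a) (at (sig y)) (axis b 1))) (at y)"
    if y: "y \<in> U" for a y
  proof -
    have d: "((\<lambda>x. F x $ a) has_derivative frechet_derivative (\<lambda>x. F x $ a) (at (sig y))) (at (sig y))"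
      by (rule C1_fun_has_derivative [OF F]) (use y in \<open>simp add: U_def\<close>)
    have lin: "linear (frechet_derivative (\<lambda>x. F x $ a) (at (sig y)))" by (rule has_derivative_linear [OF d])
    have "frechet_derivative (\<lambda>x. F x $ a) (at (sig y)) (lam y *\<^sub>R frame y h)
        = (\<Sum>b\<in>UNIV. lam y * frame y h $ b * frechet_derivative (\<lambda>x. F x $ a) (at (sig y)) (axis b 1))" for h
    proof -
      have "frame y h = (\<Sum>b\<in>UNIV. frame y h $ b *\<^sub>R axis b 1)"
        using basis_expansion [of "frame y h"] by (simp add: scalar_mult_eq_scaleR)
      then have "frechet_derivative (\<lambda>x. F x $ a) (at (sig y)) (frame y h)
          = frechet_derivative (\<lambda>x. F x $ a) (at (sig y)) (\<Sum>b\<in>UNIV. frame y h $ b *\<^sub>R axis b 1)"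
        by (rule arg_cong)
      also have "\<dots> = (\<Sum>b\<in>UNIV. frame y h $ b * frechet_derivative (\<lambda>x. F x $ a) (at (sig y)) (axis b 1))"
        by (simp add: linear_sum [OF lin] linear_cmul [OF lin])
      finally show ?thesis by (simp add: linear_cmul [OF lin] sum_distrib_left mult.assoc)
    qed
    then show ?thesis using has_derivative_compose [OF sig_has_derivative d] by simp
  qed
  have FC: "C1_fun U (\<lambda>y. F (sig y) $ a)" for a
  proof (rule C1_funI [OF dF])
    fix h
    have cJ: "continuous_on U J" by (rule linear_continuous_on [OF J_bounded_linear])
    have "continuous_on U (\<lambda>y. frechet_derivative (\<lambda>x. F x $ a) (at (sig y)) (axis b 1))" for b
      by (rule continuous_on_compose2 [OF C1_fun_derivative_continuous [OF F] continuous_on_sig]) (auto simp: U_def)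
    then show "continuous_on U (\<lambda>y. \<Sum>b\<in>UNIV. lam y * frame y h $ b * frechet_derivative (\<lambda>x. F x $ a) (at (sig y)) (axis b 1))"
      unfolding frame_def by (intro continuous_intros continuous_on_lam cJ)
  qed
  have YC: "C1_fun U (\<lambda>y. Y y $ j)" for j
    unfolding Yj by (intro C1_fun_sum C1_fun_mult C1_fun_frame_component FC)
  have divY: "(\<Sum>j\<in>UNIV. frechet_derivative (\<lambda>y. Y y $ j) (at y) (axis j 1)) = 0" if y: "y \<in> V'" for y
  proof -
    have yU: "y \<in> U" using y VU closure_subset by blast
    let ?x = "sig y"
    have xV: "?x \<in> V" using y by (simp add: V'_def)
    let ?D = "\<lambda>a b. frechet_derivative (\<lambda>x. F x $ a) (at ?x) (axis b 1)"
    let ?f = "\<lambda>j a. frame y (axis j 1) $ a"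
    have rad: "(\<Sum>b\<in>UNIV. ?x $ b * ?D a b) = 0" for a
    proof -
      have d: "((\<lambda>x. F x $ a) has_derivative frechet_derivative (\<lambda>x. F x $ a) (at ?x)) (at ?x)"
        by (rule C1_fun_has_derivative [OF F]) (use yU in \<open>simp add: U_def\<close>)
      have lin: "linear (frechet_derivative (\<lambda>x. F x $ a) (at ?x))" by (rule has_derivative_linear [OF d])
      have "?x = (\<Sum>b\<in>UNIV. ?x $ b *\<^sub>R axis b 1)"
        using basis_expansion [of ?x] by (simp add: scalar_mult_eq_scaleR)
      then have "frechet_derivative (\<lambda>x. F x $ a) (at ?x) ?x
          = frechet_derivative (\<lambda>x. F x $ a) (at ?x) (\<Sum>b\<in>UNIV. ?x $ b *\<^sub>R axis b 1)"
        by (rule arg_cong)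
      also have "\<dots> = (\<Sum>b\<in>UNIV. ?x $ b * ?D a b)" by (simp add: linear_sum [OF lin] linear_cmul [OF lin])
      finally show ?thesis using radial [OF xV, of a] by simp
    qed
    have "frechet_derivative (\<lambda>y. Y y $ j) (at y) (axis j 1)
      = (\<Sum>a\<in>UNIV. ?c j a y * (\<Sum>b\<in>UNIV. lam y * ?f j b * ?D a b) + frechet_derivative (?c j a) (at y) (axis j 1) * F ?x $ a)" for j
    proof -
      have "((\<lambda>y. Y y $ j) has_derivative (\<lambda>h. \<Sum>a\<in>UNIV. ?c j a y * (\<Sum>b\<in>UNIV. lam y * frame y h $ b * ?D a b)
          + frechet_derivative (?c j a) (at y) h * F ?x $ a)) (at y)"
        unfolding Yj by (intro has_derivative_sum has_derivative_mult dF [OF yU] C1_fun_has_derivative [OF C1_fun_frame_component UNIV_I])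
      from frechet_derivative_at [OF this, symmetric] show ?thesis by (simp only:)
    qed
    then have "(\<Sum>j\<in>UNIV. frechet_derivative (\<lambda>y. Y y $ j) (at y) (axis j 1))
      = (\<Sum>j\<in>UNIV. \<Sum>a\<in>UNIV. ?c j a y * (\<Sum>b\<in>UNIV. lam y * ?f j b * ?D a b))
        + (\<Sum>j\<in>UNIV. \<Sum>a\<in>UNIV. frechet_derivative (?c j a) (at y) (axis j 1) * F ?x $ a)"
      by (simp add: sum.distrib)
    also have "(\<Sum>j\<in>UNIV. \<Sum>a\<in>UNIV. frechet_derivative (?c j a) (at y) (axis j 1) * F ?x $ a)
      = (\<Sum>a\<in>UNIV. (\<Sum>j\<in>UNIV. frechet_derivative (?c j a) (at y) (axis j 1)) * F ?x $ a)"
      by (subst sum.swap) (simp add: sum_distrib_right)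
    also have "\<dots> = (\<Sum>a\<in>UNIV. - real CARD('n) * lam y ^ CARD('n) * ?x $ a * F ?x $ a)"
      by (simp only: frame_divergence [OF refl])
    also have "\<dots> = - real CARD('n) * lam y ^ CARD('n) * (?x \<bullet> F ?x)"
      by (simp add: inner_vec_def sum_distrib_left mult.assoc sum_negf)
    also have "(\<Sum>j\<in>UNIV. \<Sum>a\<in>UNIV. ?c j a y * (\<Sum>b\<in>UNIV. lam y * ?f j b * ?D a b))
      = (\<Sum>a\<in>UNIV. \<Sum>b\<in>UNIV. lam y ^ CARD('n) * ((\<Sum>j\<in>UNIV. ?f j a * ?f j b) * ?D a b))"
    proof -
      have "lam y ^ CARD('n) = lam y ^ (?d + 1)" by (rule arg_cong [OF n])
      then have l: "lam y ^ CARD('n) = lam y ^ ?d * lam y" by (simp only: power_add power_one_right)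
      have "(\<Sum>j\<in>UNIV. \<Sum>a\<in>UNIV. ?c j a y * (\<Sum>b\<in>UNIV. lam y * ?f j b * ?D a b))
        = (\<Sum>j\<in>UNIV. \<Sum>a\<in>UNIV. \<Sum>b\<in>UNIV. lam y ^ CARD('n) * (?f j a * ?f j b * ?D a b))"
        unfolding l by (simp add: sum_distrib_left mult_ac)
      also have "\<dots> = (\<Sum>a\<in>UNIV. \<Sum>j\<in>UNIV. \<Sum>b\<in>UNIV. lam y ^ CARD('n) * (?f j a * ?f j b * ?D a b))"
        by (rule sum.swap)
      also have "\<dots> = (\<Sum>a\<in>UNIV. \<Sum>b\<in>UNIV. \<Sum>j\<in>UNIV. lam y ^ CARD('n) * (?f j a * ?f j b * ?D a b))"
        by (rule sum.cong [OF refl]) (rule sum.swap)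
      finally show ?thesis by (simp add: sum_distrib_left sum_distrib_right)
    qed
    \<comment> \<open>Completeness of the frame: the trace over tangent directions is the full trace
      minus the contribution of the direction \<open>sig y\<close>, which \<open>rad\<close>
      removes.\<close>
    also have "\<dots> = lam y ^ CARD('n) * ((\<Sum>a\<in>UNIV. \<Sum>b\<in>UNIV. (if a = b then 1 else 0) * ?D a b) - (\<Sum>a\<in>UNIV. ?x $ a * (\<Sum>b\<in>UNIV. ?x $ b * ?D a b)))"
      unfolding frame_completeness by (simp add: sum_distrib_left left_diff_distrib right_diff_distrib sum_subtractf mult.assoc)
    also have "(\<Sum>a\<in>UNIV. \<Sum>b\<in>UNIV. (if a = b then 1 else 0) * ?D a b) = (\<Sum>a\<in>UNIV. ?D a a)"
      by (simp add: if_distrib [of "\<lambda>c. c * _"] cong: if_cong)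
    finally show ?thesis using div [OF xV] by (simp add: rad)
  qed
  have "(LINT y:frontier V'|hausdorff_measure ?d. Y y \<bullet> \<nu>' y)
      = slab_factor TYPE('n) * (LINT y:V'|lborel. \<Sum>j\<in>UNIV. frechet_derivative (\<lambda>y. Y y $ j) (at y) (axis j 1))"
    by (rule flat.gauss_green [OF U VU YC])
  also have "(LINT y:V'|lborel. \<Sum>j\<in>UNIV. frechet_derivative (\<lambda>y. Y y $ j) (at y) (axis j 1)) = (LINT y:V'|lborel. 0)"
    unfolding set_lebesgue_integral_def
    by (rule Bochner_Integration.integral_cong) (auto simp: divY indicator_def)
  finally have 0: "(LINT y:frontier V'|hausdorff_measure ?d. Y y \<bullet> \<nu>' y) = 0" by simp
  have Y\<nu>: "Y y \<bullet> \<nu>' y = (F (sig y) \<bullet> \<nu> (sig y)) * lam y ^ ?d" if "y \<in> frontier V'" for y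
  proof -
    have "\<nu> (sig y) \<bullet> sig y = 0" using normal [OF sig_frontier [OF that]] by (simp add: outward_unit_normal_def)
    then have "frame y (\<nu>' y) = \<nu> (sig y)" unfolding \<nu>'_def by (rule frame_coframe)
    then show ?thesis by (simp add: Y_def coframe_inner inner_commute [of "F (sig y)"] mult.commute)
  qed
  \<comment> \<open>The flux density in flat coordinates. Dividing by the surface factor and cutting
    off outside the frontier gives a Borel function on the whole space, as the change of variables
    demands.\<close>
  define \<phi> where "\<phi> y = indicator (frontier V') y *\<^sub>R ((Y y \<bullet> \<nu>' y) / lam y ^ ?d)" for y
  have Kb: "frontier V' \<in> sets borel" by (rule borel_compact [OF flat.compact_frontier_V])
  have "continuous_on (frontier V') Y"
  proof -
    have "continuous_on (frontier V') (\<lambda>y. Y y $ j)" for j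
      by (rule continuous_on_subset [OF C1_fun_continuous [OF YC]]) (use VU in \<open>auto simp: frontier_def\<close>)
    then have "continuous_on (frontier V') (\<lambda>y. \<chi> j. Y y $ j)" by (rule continuous_on_vec_lambda)
    then show ?thesis by simp
  qed
  then have "continuous_on (frontier V') (\<lambda>y. (Y y \<bullet> \<nu>' y) / lam y ^ ?d)"
    by (intro continuous_on_divide continuous_on_inner continuous_on_power flat.continuous_on_normal
        continuous_on_lam ballI power_not_zero lam_nonzero)
  then have \<phi>m: "\<phi> \<in> borel_measurable borel" unfolding \<phi>_def [abs_def]
    by (rule borel_measurable_continuous_on_indicator [OF Kb])
  have \<phi>: "\<phi> y = F (sig y) \<bullet> \<nu> (sig y)" if "y \<in> frontier V'" for y
    using that lam_pos [of y] by (simp add: \<phi>_def Y\<nu>)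
  have "(LINT x:sphere_boundary V|hausdorff_measure ?d. F x \<bullet> \<nu> x)
      = (LINT x:sphere_boundary V|hausdorff_measure ?d. \<phi> (image_section (frontier V') sig x))"
    unfolding set_lebesgue_integral_def
  proof (rule Bochner_Integration.integral_cong)
    fix x
    have "F x \<bullet> \<nu> x = \<phi> (image_section (frontier V') sig x)" if x: "x \<in> sphere_boundary V"
    proof -
      obtain y where y: "y \<in> frontier V'" "x = sig y" using x sig_image_frontier by blast
      then show ?thesis using \<phi> [OF y(1)] by (simp add: image_section_eq [OF inj_sig])
    qed
    then show "indicator (sphere_boundary V) x *\<^sub>R (F x \<bullet> \<nu> x)
        = indicator (sphere_boundary V) x *\<^sub>R \<phi> (image_section (frontier V') sig x)"
      by (simp add: indicator_def)
  qed simp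
  also have "\<dots> = (LINT y:frontier V'|hausdorff_measure ?d. \<phi> y * lam y ^ ?d)"
    by (rule integral_sphere_boundary [OF \<phi>m])
  also have "\<dots> = (LINT y:frontier V'|hausdorff_measure ?d. Y y \<bullet> \<nu>' y)"
    unfolding set_lebesgue_integral_def
    by (rule Bochner_Integration.integral_cong) (simp_all add: \<phi> Y\<nu> indicator_def)
  finally show ?thesis using 0 by simp
qed

end

section \<open>The choice of the pole\<close>

text \<open>The standard embedding, with coordinate \<open>None\<close> set to 0, followed by a
  rotation that takes \<open>axis None 1\<close> to \<open>p\<close>.\<close>

lemma stereographic_exists:
  fixes p :: "real ^ ('n::finite option)"
  assumes p: "norm p = 1"
  shows "\<exists>J :: real ^ 'n \<Rightarrow> _. stereographic J p"
proof -
  have "norm (axis None 1 :: real ^ ('n option)) = 1" by (simp add: norm_eq_1 inner_axis_axis)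
  then obtain R :: "real ^ ('n option) \<Rightarrow> real ^ ('n option)" where R: "orthogonal_transformation R" "R (axis None 1) = p"
    by (rule orthogonal_transformation_exists_1 [OF _ p])
  have lin: "linear R" using R(1) by (rule orthogonal_transformation_linear)
  have inner: "R x \<bullet> R y = x \<bullet> y" for x y using R(1) by (simp add: orthogonal_transformation_def)
  define I :: "real ^ 'n \<Rightarrow> real ^ ('n option)" where "I y = (\<chi> i. case i of None \<Rightarrow> 0 | Some j \<Rightarrow> y $ j)" for y
  have linI: "linear I"
    by (rule linearI) (auto simp: I_def vec_eq_iff split: option.splits)
  have I_inner: "I x \<bullet> I y = x \<bullet> y" for x y
    by (simp add: I_def inner_vec_def UNIV_option_conv sum.reindex)
  have I_axis: "I x \<bullet> axis None 1 = 0" for x by (simp add: I_def inner_axis)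
  have "stereographic (R \<circ> I) p"
  proof (rule stereographic.intro)
    show "linear (R \<circ> I)" by (rule linear_compose [OF linI lin])
    show "(R \<circ> I) x \<bullet> (R \<circ> I) y = x \<bullet> y" for x y by (simp add: inner I_inner)
    show "(R \<circ> I) x \<bullet> p = 0" for x unfolding R(2) [symmetric] by (simp add: inner I_axis)
    show "norm p = 1" by (rule p)
    fix x assume x: "x \<bullet> p = 0"
    obtain z where z: "x = R z" using orthogonal_transformation_surj [OF R(1)] by auto
    have "z $ None = 0" using x unfolding z R(2) [symmetric] by (simp add: inner inner_axis)
    then have "z = I (\<chi> j. z $ Some j)" by (auto simp: I_def vec_eq_iff split: option.splits)
    then have "R z = R (I (\<chi> j. z $ Some j))" by (rule arg_cong)
    then show "\<exists>y. x = (R \<circ> I) y" unfolding z comp_def by (rule exI)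
  qed
  then show ?thesis by blast
qed

text \<open>If \<open>V\<close> were dense in the sphere, \<open>\<rho>\<close> could not be
  positive at points of the sphere near \<open>x\<close>. But \<open>\<rho> x \<ge> 0\<close>, and
  \<open>\<rho>\<close> increases along the great circle in the direction of the tangential part of
  the gradient, which is not 0.\<close>

lemma exterior_point_exists:
  fixes V :: "(real ^ 'a::finite) set"
  assumes V: "openin (top_of_set (sphere 0 1)) V" "C1_boundary V" and x: "x \<in> sphere_boundary V"
    and normal: "outward_unit_normal V x \<nu>"
  shows "\<exists>p. norm p = 1 \<and> p \<notin> closure V"
proof (rule ccontr)
  assume dense: "\<not> ?thesis"
  from bspec [OF V(2) [unfolded C1_boundary_def] x] obtain W \<rho> G where W: "open W" "x \<in> W"
    and d\<rho>': "\<forall>y\<in>W. (\<rho> has_derivative (\<lambda>h. G y \<bullet> h)) (at y)"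
    and Gx: "G x \<notin> span {x}" and VW: "V \<inter> W = {y \<in> sphere 0 1 \<inter> W. \<rho> y < 0}"
    by (elim exE conjE) (rule that; assumption)
  note d\<rho> = bspec [OF d\<rho>']
  have xcl: "x \<in> closure V" "x \<notin> V" using x by (simp_all add: sphere_boundary_iff [OF V(1)])
  have "V \<subseteq> sphere 0 1" using openin_subset [OF V(1)] by simp
  then have "closure V \<subseteq> sphere 0 1" by (rule closure_minimal) simp
  then have nx: "norm x = 1" using xcl by auto
  then have xx: "x \<bullet> x = 1" by (simp add: norm_eq_1)
  have contW: "continuous_on W \<rho>"
    using d\<rho> by (meson continuous_at_imp_continuous_on has_derivative_continuous)
  have pos: False if y: "y \<in> W" "norm y = 1" "0 < \<rho> y" for y
  proof -
    have "open (W \<inter> \<rho> -` {0<..})" using contW W(1) by (rule continuous_open_preimage) simp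
    moreover have "(W \<inter> \<rho> -` {0<..}) \<inter> V = {}" using VW by force
    ultimately have "(W \<inter> \<rho> -` {0<..}) \<inter> closure V = {}" by (simp add: open_Int_closure_eq_empty)
    then show False using y dense by auto
  qed
  define w where "w = G x - (G x \<bullet> x) *\<^sub>R x"
  have "w \<noteq> 0"
  proof
    assume "w = 0"
    then have "G x = (G x \<bullet> x) *\<^sub>R x" by (simp add: w_def)
    then have "G x \<in> span {x}" by (metis span_base span_scale singletonI)
    then show False using Gx by simp
  qed
  have wx: "w \<bullet> x = 0" by (simp add: w_def inner_diff_left xx)
  have Gw: "G x \<bullet> w = w \<bullet> w" using wx by (simp add: w_def inner_diff_left inner_diff_right inner_commute algebra_simps)
  define u where "u = w /\<^sub>R norm w"
  have nu: "norm u = 1" using \<open>w \<noteq> 0\<close> by (simp add: u_def)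
  have uu: "u \<bullet> u = 1" using nu by (simp only: norm_eq_1)
  have ux: "u \<bullet> x = 0" "x \<bullet> u = 0" using wx by (simp_all add: u_def inner_commute)
  define c where "c t = cos t *\<^sub>R x + sin t *\<^sub>R u" for t
  have nc: "norm (c t) = 1" for t
  proof -
    have "c t \<bullet> c t = (cos t)\<^sup>2 + (sin t)\<^sup>2"
      using xx uu ux by (simp add: c_def inner_add_left inner_add_right power2_eq_square)
    then show ?thesis by (simp add: norm_eq_1)
  qed
  have c0: "c 0 = x" by (simp add: c_def)
  have dc: "(c has_vector_derivative u) (at 0)"
    unfolding c_def [abs_def] by (auto intro!: derivative_eq_intros)
  have "((\<lambda>t. \<rho> (c t)) has_vector_derivative G x \<bullet> u) (at 0)"
    using vector_derivative_diff_chain_within [OF dc, of \<rho> "\<lambda>h. G x \<bullet> h"] d\<rho> [OF W(2)] c0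
    by (simp add: comp_def has_derivative_at_withinI)
  moreover have "0 < G x \<bullet> u" using \<open>w \<noteq> 0\<close> Gw by (simp add: u_def)
  ultimately have "\<exists>d>0. \<forall>h>0. h < d \<longrightarrow> \<rho> (c 0) < \<rho> (c (0 + h))"
    by (intro DERIV_pos_inc_right) (auto simp: has_real_derivative_iff_has_vector_derivative)
  then obtain d where d: "0 < d" "\<And>h. 0 < h \<Longrightarrow> h < d \<Longrightarrow> \<rho> x < \<rho> (c h)" using c0 by auto
  have "\<not> \<rho> x < 0" using xcl(2) VW W(2) nx by auto
  have "\<forall>\<^sub>F t in at_right 0. t \<in> {0<..<d}" by (rule eventually_at_right_real [OF d(1)])
  moreover have "\<forall>\<^sub>F t in at_right 0. c t \<in> W"
  proof -
    have "isCont c 0" by (rule has_vector_derivative_continuous [OF dc])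
    then have "(c \<longlongrightarrow> x) (at_right 0)" unfolding isCont_def c0 by (rule tendsto_within_subset) simp
    then show ?thesis using W by (rule topological_tendstoD)
  qed
  ultimately have "\<forall>\<^sub>F t in at_right (0::real). False"
  proof eventually_elim
    case (elim t)
    then show ?case using pos [OF _ nc, of t] d(2) [of t] \<open>\<not> \<rho> x < 0\<close> by simp
  qed
  then show False by simp
qed

theorem sphere_flux_vanishes:
  fixes V :: "(real ^ ('n::finite option)) set" and F :: "real ^ ('n option) \<Rightarrow> real ^ ('n option)"
  assumes V: "openin (top_of_set (sphere 0 1)) V" "C1_boundary V"
    and normal: "\<And>x. x \<in> sphere_boundary V \<Longrightarrow> outward_unit_normal V x (\<nu> x)"
    and F: "open \<Omega>" "closure V \<subseteq> \<Omega>" "\<And>a. C1_fun \<Omega> (\<lambda>x. F x $ a)"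
      "\<And>x a. x \<in> V \<Longrightarrow> frechet_derivative (\<lambda>x. F x $ a) (at x) x = 0"
      "\<And>x. x \<in> V \<Longrightarrow> (\<Sum>a\<in>UNIV. frechet_derivative (\<lambda>x. F x $ a) (at x) (axis a 1)) = real CARD('n) * (x \<bullet> F x)"
  shows "(LINT x:sphere_boundary V|hausdorff_measure (CARD('n) - 1). F x \<bullet> \<nu> x) = 0"
\<comment> \<open>Without boundary points there may be no room for a pole, as when \<open>V\<close>
  is the whole sphere; then the integral is over the empty set.\<close>
proof (cases "sphere_boundary V = {}")
  case False
  then obtain x where x: "x \<in> sphere_boundary V" by blast
  obtain p where p: "norm p = 1" "p \<notin> closure V"
    using exterior_point_exists [OF V x normal [OF x]] by blast
  obtain J :: "real ^ 'n \<Rightarrow> real ^ ('n option)" where "stereographic J p" using stereographic_exists [OF p(1)] by blast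
  then interpret stereographic J p .
  interpret stereographic_domain J p V \<nu> by unfold_locales (use V normal p in auto)
  show ?thesis by (rule flux_vanishes [OF F])
qed (simp add: set_lebesgue_integral_def)

subsection \<open>Interpolation of homogeneous polynomials\<close>

lemma real_polynomial_function_poly:
  fixes q :: "real \<Rightarrow> real"
  assumes "real_polynomial_function q" shows "\<exists>P. q = poly P"
proof -
  obtain a n where q: "q = (\<lambda>x. \<Sum>i\<le>n. a i * x ^ i)" using real_polynomial_function_imp_sum [OF assms] by blast
  have "poly (\<Sum>i\<le>n. monom (a i) i) = q" by (simp add: q fun_eq_iff poly_sum poly_monom)
  then show ?thesis by blast
qed

text \<open>
  A homogeneous polynomial restricts to polynomials of at most its own degree on all lines:
  interchanging the roles of the two points on the line reflects the restriction.
\<close>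

lemma homogeneous_line_degree:
  fixes f :: "'a::euclidean_space \<Rightarrow> real"
  assumes f: "real_polynomial_function f" and hom: "\<And>t u. f (t *\<^sub>R u) = t ^ k * f u"
  shows "\<exists>P. degree P \<le> k \<and> (\<forall>t. f (u + t *\<^sub>R v) = poly P t)"
proof -
  have "real_polynomial_function (f \<circ> (\<lambda>t. u + t *\<^sub>R v))" "real_polynomial_function (f \<circ> (\<lambda>t. t *\<^sub>R u + v))"
    by (intro real_polynomial_function_compose f polynomial_function_add polynomial_function_const
        polynomial_function_bounded_linear bounded_linear_scaleR_left)+
  then obtain P R where P: "f \<circ> (\<lambda>t. u + t *\<^sub>R v) = poly P" and R: "f \<circ> (\<lambda>t. t *\<^sub>R u + v) = poly R"
    using real_polynomial_function_poly by meson
  have P': "f (u + t *\<^sub>R v) = poly P t" for t using fun_cong [OF P, of t] by simp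
  have R': "f (t *\<^sub>R u + v) = poly R t" for t using fun_cong [OF R, of t] by simp
  let ?m = "degree R"
  \<comment> \<open>For nonzero \<open>t\<close> homogeneity gives \<open>P(t) = t^k R(1/t)\<close>;
    multiplying by \<open>t\<close> to the degree of \<open>R\<close> turns this into an identity
    between polynomials.\<close>
  have eq: "poly (monom 1 ?m * P) t = poly (monom 1 k * reflect_poly R) t" if t: "t \<noteq> 0" for t
  proof -
    have "u + t *\<^sub>R v = t *\<^sub>R (inverse t *\<^sub>R u + v)" using t by (simp add: scaleR_add_right)
    then have "poly P t = t ^ k * poly R (inverse t)" unfolding P' [symmetric] R' [symmetric] using hom by metis
    moreover have "poly (reflect_poly R) t = t ^ ?m * poly R (inverse t)" by (rule poly_reflect_poly_nz [OF t])
    ultimately show ?thesis by (simp add: poly_monom)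
  qed
  have "monom 1 ?m * P = monom 1 k * reflect_poly R"
  proof (rule ccontr)
    assume "\<not> ?thesis"
    then have "finite {t. poly (monom 1 ?m * P - monom 1 k * reflect_poly R) t = 0}" by (intro poly_roots_finite) simp
    moreover have "- {0} \<subseteq> {t. poly (monom 1 ?m * P - monom 1 k * reflect_poly R) t = 0}" using eq by auto
    ultimately have "finite (- {0::real})" by (rule finite_subset [rotated])
    then have "finite (UNIV :: real set)" by (simp add: Compl_eq_Diff_UNIV)
    then show False by (simp add: infinite_UNIV_char_0)
  qed
  \<comment> \<open>\<open>reflect_poly R\<close> has degree at most \<open>?m\<close>, so the
    unknown degree of \<open>R\<close> cancels.\<close>
  then have "degree (monom 1 ?m * P) \<le> k + ?m"
    by (metis add_mono degree_mult_le degree_monom_le degree_reflect_poly_le order_trans)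
  then have "degree P \<le> k"
    by (cases "P = 0") (simp_all add: degree_mult_eq degree_monom_eq monom_eq_0_iff)
  then show ?thesis using P' by blast
qed

section \<open>Lagrange interpolation in several variables\<close>

definition lagrange_poly :: "nat \<Rightarrow> nat \<Rightarrow> real poly" where
  "lagrange_poly k i = (\<Prod>l\<in>{..k} - {i}. [: - real l / (real i - real l), 1 / (real i - real l) :])"

lemma lagrange_poly_node:
  assumes "i \<le> k" "j \<le> k"
  shows "poly (lagrange_poly k i) (real j) = (if i = j then 1 else 0)"
proof (cases "i = j")
  case True
  have "poly (lagrange_poly k i) (real j) = (\<Prod>l\<in>{..k} - {i}. 1)"
    unfolding lagrange_poly_def poly_prod True
    by (rule prod.cong) (auto simp: diff_divide_distrib [symmetric])
  then show ?thesis using True by simp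
next
  case False
  have "(\<Prod>l\<in>{..k} - {i}. poly [: - real l / (real i - real l), 1 / (real i - real l) :] (real j)) = 0"
    by (rule prod_zero) (use assms False in \<open>auto intro!: bexI [of _ j]\<close>)
  then show ?thesis using False by (simp add: lagrange_poly_def poly_prod)
qed

lemma degree_lagrange_poly:
  assumes "i \<le> k" shows "degree (lagrange_poly k i) \<le> k"
proof -
  have "degree (lagrange_poly k i) \<le> sum (degree \<circ> (\<lambda>l. [: - real l / (real i - real l), 1 / (real i - real l) :])) ({..k} - {i})"
    unfolding lagrange_poly_def by (rule degree_prod_sum_le) simp
  also have "\<dots> \<le> (\<Sum>l\<in>{..k} - {i}. 1)" by (rule sum_mono) simp
  also have "\<dots> = k" using assms by simp
  finally show ?thesis .
qed

lemma lagrange_interpolation: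
  assumes "degree P \<le> k"
  shows "poly P t = (\<Sum>i\<le>k. poly (lagrange_poly k i) t * poly P (real i))"
proof -
  let ?Q = "\<Sum>i\<le>k. smult (poly P (real i)) (lagrange_poly k i)"
  have "P = ?Q"
  proof (rule poly_eqI_degree [of "real ` {..k}"])
    fix x assume "x \<in> real ` {..k}"
    then obtain j where j: "j \<le> k" "x = real j" by auto
    have "poly ?Q x = (\<Sum>i\<le>k. poly P (real i) * (if i = j then 1 else 0))"
      unfolding poly_sum using j by (intro sum.cong) (auto simp: lagrange_poly_node)
    then show "poly P x = poly ?Q x" using j by (simp add: if_distrib cong: if_cong)
  next
    have c: "card (real ` {..k}) = k + 1" by (simp add: card_image inj_on_def)
    show "degree P < card (real ` {..k})" using assms c by simp
    have "degree ?Q \<le> k"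
      by (rule degree_sum_le) (use degree_lagrange_poly in \<open>auto intro: order_trans [OF degree_smult_le]\<close>)
    then show "degree ?Q < card (real ` {..k})" using c by simp
  qed
  then have "poly P t = poly ?Q t" by (rule arg_cong)
  then show ?thesis by (simp add: poly_sum mult.commute)
qed

text \<open>The consequence of homogeneity on which interpolation rests: along each coordinate
  direction the function is determined by its values at the nodes \<open>0, ..., k\<close>.\<close>

definition line_degree_le :: "nat \<Rightarrow> (real ^ 'n::finite \<Rightarrow> real) \<Rightarrow> bool" where
  "line_degree_le k g \<longleftrightarrow> (\<forall>u j. \<exists>P. degree P \<le> k \<and> (\<forall>t. g (u + t *\<^sub>R axis j 1) = poly P t))"

definition set_coord :: "real ^ 'n::finite \<Rightarrow> 'n \<Rightarrow> real \<Rightarrow> real ^ 'n" where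
  "set_coord u j c = u + (c - u $ j) *\<^sub>R axis j 1"

lemma set_coord_nth: "set_coord u j c $ i = (if i = j then c else u $ i)"
  by (simp add: set_coord_def axis_def)

lemma interpolate_coordinate:
  assumes "line_degree_le k g"
  shows "g u = (\<Sum>i\<le>k. poly (lagrange_poly k i) (u $ j) * g (set_coord u j (real i)))"
proof -
  obtain P where P: "degree P \<le> k" "\<And>t. g (set_coord u j 0 + t *\<^sub>R axis j 1) = poly P t"
    using assms unfolding line_degree_le_def by blast
  have s: "set_coord u j 0 + t *\<^sub>R axis j 1 = set_coord u j t" for t by (simp add: set_coord_def algebra_simps)
  have "g u = poly P (u $ j)" using P(2) [of "u $ j"] unfolding s by (simp add: set_coord_def)
  also have "\<dots> = (\<Sum>i\<le>k. poly (lagrange_poly k i) (u $ j) * poly P (real i))" by (rule lagrange_interpolation [OF P(1)])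
  finally show ?thesis unfolding P(2) [symmetric] s .
qed

lemma sum_list_concat_map:
  "sum_list (map f (concat (map h xs))) = (\<Sum>x\<leftarrow>xs. sum_list (map f (h x)))"
  by (induction xs) simp_all

lemma real_polynomial_function_poly_component:
  "real_polynomial_function (\<lambda>u :: real ^ 'n::finite. poly Q (u $ j))"
proof -
  have c: "real_polynomial_function (\<lambda>u :: real ^ 'n. u $ j)"
    by (rule real_polynomial_function.intros(1)) (rule bounded_linear_vec_nth)
  show ?thesis
    by (induction Q) (auto intro!: real_polynomial_function.intros(2-4) c)
qed

text \<open>Lagrange interpolation on a grid, one coordinate at a time. An entry
  \<open>(L, T)\<close> consists of a weight and of the substitution that replaces the coordinates
  in \<open>J\<close> by grid values. The list precedes the quantifier over \<open>g\<close>, so it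
  serves all functions at once.\<close>

lemma interpolate_coordinates:
  fixes J :: "'n::finite set"
  shows "\<exists>xs :: ((real ^ 'n \<Rightarrow> real) \<times> (real ^ 'n \<Rightarrow> real ^ 'n)) list.
    (\<forall>(L, T)\<in>set xs. real_polynomial_function L \<and> (\<forall>u v. \<forall>j\<in>J. T u $ j = T v $ j) \<and> (\<forall>u. \<forall>j. j \<notin> J \<longrightarrow> T u $ j = u $ j)) \<and>
    (\<forall>g. line_degree_le k g \<longrightarrow> (\<forall>u. g u = (\<Sum>(L, T)\<leftarrow>xs. L u * g (T u))))"
proof (induction J rule: finite_induct [OF finite])
  case 1
  show ?case
    by (rule exI [of _ "[(\<lambda>_. 1, \<lambda>u. u)]"]) (auto intro: real_polynomial_function.intros(2))
next
  case (2 j J)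
  then obtain xs :: "((real ^ 'n \<Rightarrow> real) \<times> (real ^ 'n \<Rightarrow> real ^ 'n)) list" where
    xs: "\<And>L T. (L, T) \<in> set xs \<Longrightarrow> real_polynomial_function L"
      "\<And>L T u v i. (L, T) \<in> set xs \<Longrightarrow> i \<in> J \<Longrightarrow> T u $ i = T v $ i"
      "\<And>L T u i. (L, T) \<in> set xs \<Longrightarrow> i \<notin> J \<Longrightarrow> T u $ i = u $ i"
    and g: "\<And>g u. line_degree_le k g \<Longrightarrow> g u = (\<Sum>(L, T)\<leftarrow>xs. L u * g (T u))"
    by fastforce
  \<comment> \<open>Every old entry is split into \<open>k + 1\<close> new ones by interpolating in
    coordinate \<open>j\<close> as well.\<close>
  define h where "h = (\<lambda>(L :: real ^ 'n \<Rightarrow> real, T :: real ^ 'n \<Rightarrow> real ^ 'n).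
    map (\<lambda>i. (\<lambda>u. L u * poly (lagrange_poly k i) (u $ j), \<lambda>u. set_coord (T u) j (real i))) [0..<Suc k])"
  show ?case
  proof (rule exI [of _ "concat (map h xs)"], intro conjI allI impI ballI)
    fix z assume "z \<in> set (concat (map h xs))"
    then obtain L T i where LT: "(L, T) \<in> set xs"
      and z: "z = (\<lambda>u. L u * poly (lagrange_poly k i) (u $ j), \<lambda>u. set_coord (T u) j (real i))"
      by (auto simp: h_def)
    show "case z of (L, T) \<Rightarrow> real_polynomial_function L \<and> (\<forall>u v. \<forall>i\<in>insert j J. T u $ i = T v $ i)
        \<and> (\<forall>u i. i \<notin> insert j J \<longrightarrow> T u $ i = u $ i)"
      unfolding z prod.case
    proof (intro conjI allI ballI impI)
      show "real_polynomial_function (\<lambda>u. L u * poly (lagrange_poly k i) (u $ j))"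
        by (intro real_polynomial_function.intros(4) xs(1) [OF LT] real_polynomial_function_poly_component)
      show "set_coord (T u) j (real i) $ i' = set_coord (T v) j (real i) $ i'" if "i' \<in> insert j J" for u v i'
        using xs(2) [OF LT, of i' u v] that by (auto simp: set_coord_nth)
      show "set_coord (T u) j (real i) $ i' = u $ i'" if "i' \<notin> insert j J" for u i'
        using xs(3) [OF LT, of i' u] that by (auto simp: set_coord_nth)
    qed
  next
    fix f :: "real ^ 'n \<Rightarrow> real" and u assume f: "line_degree_le k f"
    have step: "L u * f (T u) = (\<Sum>(L, T)\<leftarrow>h (L, T). L u * f (T u))" if LT: "(L, T) \<in> set xs" for L T
    proof -
      have "T u $ j = u $ j" by (rule xs(3) [OF LT]) (rule 2)
      then have "f (T u) = (\<Sum>i\<le>k. poly (lagrange_poly k i) (u $ j) * f (set_coord (T u) j (real i)))"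
        using interpolate_coordinate [OF f, of "T u" j] by simp
      also have "\<dots> = (\<Sum>i\<leftarrow>[0..<Suc k]. poly (lagrange_poly k i) (u $ j) * f (set_coord (T u) j (real i)))"
        by (simp only: interv_sum_list_conv_sum_set_nat set_upt atLeast0LessThan lessThan_Suc_atMost)
      finally show ?thesis
        by (simp add: h_def comp_def sum_list_const_mult [symmetric] mult.assoc distrib_left del: upt_Suc)
    qed
    have "f u = (\<Sum>(L, T)\<leftarrow>xs. L u * f (T u))" by (rule g [OF f])
    also have "\<dots> = (\<Sum>z\<leftarrow>xs. \<Sum>(L, T)\<leftarrow>h z. L u * f (T u))"
      by (intro arg_cong [where f=sum_list] map_cong refl) (use step in auto)
    also have "\<dots> = (\<Sum>(L, T)\<leftarrow>concat (map h xs). L u * f (T u))"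
      by (rule sum_list_concat_map [symmetric])
    finally show "f u = (\<Sum>(L, T)\<leftarrow>concat (map h xs). L u * f (T u))" .
  qed
qed

text \<open>With all coordinates replaced, each substitution is constant, and its value is the node
  \<open>a i\<close>. Weights and nodes are common to all \<open>p\<close>, so a polynomial
  depending on a parameter is governed by finitely many functions of that parameter.\<close>

lemma homogeneous_interpolation:
  "\<exists>(N :: nat) (L :: nat \<Rightarrow> real ^ 'n::finite \<Rightarrow> real) a. (\<forall>i<N. real_polynomial_function (L i)) \<and>
     (\<forall>p\<in>homogeneous_polys k. \<forall>u. p u = (\<Sum>i<N. L i u *\<^sub>R p (a i)))"
proof -
  obtain xs :: "((real ^ 'n \<Rightarrow> real) \<times> (real ^ 'n \<Rightarrow> real ^ 'n)) list" where
    xs: "\<forall>(L, T)\<in>set xs. real_polynomial_function L \<and> (\<forall>u v. \<forall>j\<in>UNIV. T u $ j = T v $ j) \<and> (\<forall>u. \<forall>j. j \<notin> UNIV \<longrightarrow> T u $ j = u $ j)"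
    and g: "\<And>g u. line_degree_le k g \<Longrightarrow> g u = (\<Sum>(L, T)\<leftarrow>xs. L u * g (T u))"
  proof -
    from interpolate_coordinates [of "UNIV :: 'n set" k] obtain xs :: "((real ^ 'n \<Rightarrow> real) \<times> (real ^ 'n \<Rightarrow> real ^ 'n)) list" where
      "\<forall>(L, T)\<in>set xs. real_polynomial_function L \<and> (\<forall>u v. \<forall>j\<in>UNIV. T u $ j = T v $ j) \<and> (\<forall>u. \<forall>j. j \<notin> UNIV \<longrightarrow> T u $ j = u $ j)"
      "\<forall>g. line_degree_le k g \<longrightarrow> (\<forall>u. g u = (\<Sum>(L, T)\<leftarrow>xs. L u * g (T u)))"
      by (elim exE conjE) (rule that; assumption)
    then show ?thesis by (intro that [of xs]) simp_all
  qed
  define L where "L i = fst (xs ! i)" for i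
  define a where "a i = snd (xs ! i) 0" for i
  have Lp: "real_polynomial_function (L i)" and Ta: "snd (xs ! i) u = a i" if "i < length xs" for i u
  proof -
    have "xs ! i \<in> set xs" using that by simp
    then have *: "real_polynomial_function (fst (xs ! i)) \<and> (\<forall>u v. \<forall>j\<in>UNIV. snd (xs ! i) u $ j = snd (xs ! i) v $ j)"
      using xs by (auto simp: case_prod_unfold)
    then show "real_polynomial_function (L i)" by (simp add: L_def)
    show "snd (xs ! i) u = a i" using * by (simp add: a_def vec_eq_iff)
  qed
  have "p u = (\<Sum>i<length xs. L i u *\<^sub>R p (a i))" if p: "p \<in> homogeneous_polys k" for p u
  proof (subst vec_eq_iff, rule allI)
    fix A
    have pp: "polynomial_function p" and hom: "\<And>t u. p (t *\<^sub>R u) = t ^ k *\<^sub>R p u"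
      using p by (auto simp: homogeneous_polys_def)
    have "real_polynomial_function ((\<lambda>x. x $ A) \<circ> p)"
      using pp bounded_linear_vec_nth unfolding polynomial_function_def by blast
    then have "real_polynomial_function (\<lambda>u. p u $ A)" by (simp add: comp_def)
    then have "line_degree_le k (\<lambda>u. p u $ A)"
      unfolding line_degree_le_def using homogeneous_line_degree [of "\<lambda>u. p u $ A" k] hom by simp
    then have "p u $ A = (\<Sum>(L, T)\<leftarrow>xs. L u * p (T u) $ A)" by (rule g)
    also have "\<dots> = (\<Sum>i<length xs. fst (xs ! i) u * p (snd (xs ! i) u) $ A)"
      by (simp add: sum_list_sum_nth case_prod_unfold atLeast0LessThan)
    also have "\<dots> = (\<Sum>i<length xs. L i u * p (a i) $ A)"
      by (rule sum.cong) (simp_all add: L_def Ta)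
    finally show "p u $ A = (\<Sum>i<length xs. L i u *\<^sub>R p (a i)) $ A" by simp
  qed
  then show ?thesis using Lp by (intro exI [of _ "length xs"] exI [of _ L] exI [of _ a]) simp
qed

subsection \<open>Clifford-valued polynomials\<close>

lemma bounded_bilinear_cl_mult: "bounded_bilinear ((\<odot>) :: 'a::{finite,linorder} clifford \<Rightarrow> _)"
  using bilinear_cl_mult bilinear_conv_bounded_bilinear by blast

interpretation cl: bounded_bilinear "(\<odot>) :: 'a::{finite,linorder} clifford \<Rightarrow> 'a clifford \<Rightarrow> 'a clifford"
  by (rule bounded_bilinear_cl_mult)

section \<open>Derivatives of polynomials and of Clifford products\<close>

lemma partial_deriv_eq: "(f has_derivative D) (at u) \<Longrightarrow> partial_deriv j f u = D (axis j 1)"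
  unfolding partial_deriv_def
  by (rule vector_derivative_at) (rule has_vector_derivative_along_line [of f D u 0, simplified])

text \<open>Symmetry of the second derivative is carried through the induction, so that for
  polynomials it is pure algebra. That \<open>D\<close> is polynomial in \<open>u\<close> again
  makes differentiation iterable.\<close>

lemma real_polynomial_second_derivative:
  assumes "real_polynomial_function (f :: 'a::real_normed_vector \<Rightarrow> real)"
  shows "\<exists>D D2. (\<forall>u. (f has_derivative D u) (at u)) \<and> (\<forall>u h. ((\<lambda>u. D u h) has_derivative D2 u h) (at u)) \<and>
    (\<forall>u h k. D2 u h k = D2 u k h) \<and> (\<forall>h. real_polynomial_function (\<lambda>u. D u h))"
  using assms
proof (induction rule: real_polynomial_function.induct)
  case (linear f)
  then show ?case
    by (intro exI [of _ "\<lambda>_. f"] exI [of _ "\<lambda>_ _ _. 0"])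
      (auto intro: bounded_linear_imp_has_derivative real_polynomial_function.intros)
next
  case (const c)
  show ?case
    by (intro exI [of _ "\<lambda>_ _. 0"] exI [of _ "\<lambda>_ _ _. 0"]) (auto intro: real_polynomial_function.intros)
next
  case (add f g)
  from add(3) obtain D D2 where f: "\<forall>u. (f has_derivative D u) (at u)" "\<forall>u h. ((\<lambda>u. D u h) has_derivative D2 u h) (at u)"
    "\<forall>u h k. D2 u h k = D2 u k h" "\<forall>h. real_polynomial_function (\<lambda>u. D u h)" by blast
  from add(4) obtain E E2 where g: "\<forall>u. (g has_derivative E u) (at u)" "\<forall>u h. ((\<lambda>u. E u h) has_derivative E2 u h) (at u)"
    "\<forall>u h k. E2 u h k = E2 u k h" "\<forall>h. real_polynomial_function (\<lambda>u. E u h)" by blast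
  show ?case
  proof (intro exI [of _ "\<lambda>u h. D u h + E u h"] exI [of _ "\<lambda>u h k. D2 u h k + E2 u h k"] conjI allI)
    show "D2 u h k + E2 u h k = D2 u k h + E2 u k h" for u h k
      by (simp only: f(3) [rule_format, of u h k] g(3) [rule_format, of u h k])
    show "((\<lambda>u. f u + g u) has_derivative (\<lambda>h. D u h + E u h)) (at u)" for u
      using f(1) g(1) by (intro has_derivative_add) auto
    show "((\<lambda>u. D u h + E u h) has_derivative (\<lambda>k. D2 u h k + E2 u h k)) (at u)" for u h
      using f(2) g(2) by (intro has_derivative_add) auto
    show "real_polynomial_function (\<lambda>u. D u h + E u h)" for h
      using f(4) g(4) by (intro real_polynomial_function.intros(3)) auto
  qed
next
  case (mult f g)
  from mult(3) obtain D D2 where f: "\<forall>u. (f has_derivative D u) (at u)" "\<forall>u h. ((\<lambda>u. D u h) has_derivative D2 u h) (at u)"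
    "\<forall>u h k. D2 u h k = D2 u k h" "\<forall>h. real_polynomial_function (\<lambda>u. D u h)" by blast
  from mult(4) obtain E E2 where g: "\<forall>u. (g has_derivative E u) (at u)" "\<forall>u h. ((\<lambda>u. E u h) has_derivative E2 u h) (at u)"
    "\<forall>u h k. E2 u h k = E2 u k h" "\<forall>h. real_polynomial_function (\<lambda>u. E u h)" by blast
  show ?case
  proof (intro exI [of _ "\<lambda>u h. f u * E u h + D u h * g u"]
      exI [of _ "\<lambda>u h k. (f u * E2 u h k + D u k * E u h) + (D u h * E u k + D2 u h k * g u)"] conjI allI)
    show "f u * E2 u h k + D u k * E u h + (D u h * E u k + D2 u h k * g u)
        = f u * E2 u k h + D u h * E u k + (D u k * E u h + D2 u k h * g u)" for u h k
      by (simp only: f(3) [rule_format, of u h k] g(3) [rule_format, of u h k] add_ac)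
    show "((\<lambda>u. f u * g u) has_derivative (\<lambda>h. f u * E u h + D u h * g u)) (at u)" for u
      using f(1) g(1) by (intro has_derivative_mult) auto
    show "((\<lambda>u. f u * E u h + D u h * g u) has_derivative (\<lambda>k. (f u * E2 u h k + D u k * E u h) + (D u h * E u k + D2 u h k * g u))) (at u)" for u h
      using f(1,2) g(1,2) by (intro has_derivative_add has_derivative_mult) auto
    show "real_polynomial_function (\<lambda>u. f u * E u h + D u h * g u)" for h
      using mult(1,2) f(4) g(4) by (intro real_polynomial_function.intros(3,4)) auto
  qed
qed

lemma has_derivative_vec_componentwise:
  fixes f :: "'a::real_normed_vector \<Rightarrow> real ^ 'b::finite"
  assumes "\<And>A. ((\<lambda>x. f x $ A) has_derivative (\<lambda>h. D h $ A)) (at x)"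
  shows "(f has_derivative D) (at x)"
  unfolding has_derivative_componentwise_within [of f D x UNIV]
  using assms by (auto simp: Basis_vec_def inner_axis)

lemma polynomial_function_component:
  fixes p :: "'a::real_normed_vector \<Rightarrow> real ^ 'b::finite"
  assumes "polynomial_function p" shows "real_polynomial_function (\<lambda>u. p u $ A)"
proof -
  have "real_polynomial_function ((\<lambda>x. x $ A) \<circ> p)"
    using assms bounded_linear_vec_nth unfolding polynomial_function_def by blast
  then show ?thesis by (simp add: comp_def)
qed

lemma polynomial_function_componentI:
  fixes p :: "'a::real_normed_vector \<Rightarrow> real ^ 'b::finite"
  assumes "\<And>A. real_polynomial_function (\<lambda>u. p u $ A)" shows "polynomial_function p"
  unfolding polynomial_function_iff_Basis_inner using assms by (auto simp: Basis_vec_def inner_axis)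

lemma polynomial_second_derivative:
  fixes p :: "'a::real_normed_vector \<Rightarrow> real ^ 'b::finite"
  assumes "polynomial_function p"
  shows "\<exists>D D2. (\<forall>u. (p has_derivative D u) (at u)) \<and> (\<forall>u h. ((\<lambda>u. D u h) has_derivative D2 u h) (at u)) \<and>
    (\<forall>u h k. D2 u h k = D2 u k h) \<and> (\<forall>h. polynomial_function (\<lambda>u. D u h))"
proof -
  have "\<forall>A. \<exists>D D2. (\<forall>u. ((\<lambda>u. p u $ A) has_derivative D u) (at u)) \<and> (\<forall>u h. ((\<lambda>u. D u h) has_derivative D2 u h) (at u)) \<and>
    (\<forall>u h k. D2 u h k = D2 u k h) \<and> (\<forall>h. real_polynomial_function (\<lambda>u. D u h))"
    using real_polynomial_second_derivative [OF polynomial_function_component [OF assms]] by blast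
  from choice [OF this] obtain D where "\<forall>A. \<exists>D2. (\<forall>u. ((\<lambda>u. p u $ A) has_derivative D A u) (at u)) \<and> (\<forall>u h. ((\<lambda>u. D A u h) has_derivative D2 u h) (at u)) \<and>
    (\<forall>u h k. D2 u h k = D2 u k h) \<and> (\<forall>h. real_polynomial_function (\<lambda>u. D A u h))" ..
  from choice [OF this] obtain D2 where "\<forall>A. (\<forall>u. ((\<lambda>u. p u $ A) has_derivative D A u) (at u)) \<and> (\<forall>u h. ((\<lambda>u. D A u h) has_derivative D2 A u h) (at u)) \<and>
    (\<forall>u h k. D2 A u h k = D2 A u k h) \<and> (\<forall>h. real_polynomial_function (\<lambda>u. D A u h))" ..
  then have D: "\<And>A u. ((\<lambda>u. p u $ A) has_derivative D A u) (at u)"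
    "\<And>A u h. ((\<lambda>u. D A u h) has_derivative D2 A u h) (at u)" "\<And>A u h k. D2 A u h k = D2 A u k h"
    "\<And>A h. real_polynomial_function (\<lambda>u. D A u h)" by simp_all
  show ?thesis
  proof (intro exI [of _ "\<lambda>u h. \<chi> A. D A u h"] exI [of _ "\<lambda>u h k. \<chi> A. D2 A u h k"] conjI allI)
    show "(p has_derivative (\<lambda>h. \<chi> A. D A u h)) (at u)" for u
      by (rule has_derivative_vec_componentwise) (simp add: D(1))
    show "((\<lambda>u. \<chi> A. D A u h) has_derivative (\<lambda>k. \<chi> A. D2 A u h k)) (at u)" for u h
      by (rule has_derivative_vec_componentwise) (simp add: D(2))
    show "polynomial_function (\<lambda>u. \<chi> A. D A u h)" for h
      by (rule polynomial_function_componentI) (simp add: D(4))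
    show "(\<chi> A. D2 A u h k) = (\<chi> A. D2 A u k h)" for u h k using D(3) by (simp add: vec_eq_iff)
  qed
qed

lemma polynomial_has_derivative:
  fixes p :: "'a::real_normed_vector \<Rightarrow> real ^ 'b::finite"
  assumes "polynomial_function p" shows "(p has_derivative frechet_derivative p (at u)) (at u)"
  using polynomial_second_derivative [OF assms] frechet_derivative_at by metis

lemma partial_deriv_frechet:
  fixes p :: "real ^ 'a::finite \<Rightarrow> real ^ 'b::finite"
  assumes "polynomial_function p" shows "partial_deriv j p u = frechet_derivative p (at u) (axis j 1)"
  by (rule partial_deriv_eq [OF polynomial_has_derivative [OF assms]])

lemma polynomial_partial_deriv:
  fixes p :: "real ^ 'a::finite \<Rightarrow> real ^ 'b::finite"
  assumes p: "polynomial_function p"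
  shows "polynomial_function (partial_deriv j p)"
    "partial_deriv i (partial_deriv j p) u = partial_deriv j (partial_deriv i p) u"
proof -
  obtain D D2 where D: "\<And>u. (p has_derivative D u) (at u)" "\<And>u h. ((\<lambda>u. D u h) has_derivative D2 u h) (at u)"
    "\<And>u h k. D2 u h k = D2 u k h" "\<And>h. polynomial_function (\<lambda>u. D u h)"
    using polynomial_second_derivative [OF p] by blast
  have pd: "partial_deriv j p = (\<lambda>u. D u (axis j 1))" for j using partial_deriv_eq [OF D(1)] by (simp add: fun_eq_iff)
  show "polynomial_function (partial_deriv j p)" unfolding pd by (rule D(4))
  show "partial_deriv i (partial_deriv j p) u = partial_deriv j (partial_deriv i p) u"
    unfolding pd partial_deriv_eq [OF D(2)] by (rule D(3))
qed

lemma polynomial_function_cl_mult: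
  fixes p q :: "'a::real_normed_vector \<Rightarrow> 'b::{finite,linorder} clifford"
  assumes "polynomial_function p" "polynomial_function q"
  shows "polynomial_function (\<lambda>u. p u \<odot> q u)"
proof (rule polynomial_function_componentI)
  fix C
  have eq: "(\<lambda>u. (p u \<odot> q u) $ C) = (\<lambda>u. \<Sum>A\<in>UNIV. \<Sum>B\<in>UNIV. p u $ A * q u $ B * (cl_sign A B * cl_basis (sym_diff A B) $ C))"
    by (simp add: cl_mult_def fun_eq_iff mult.assoc)
  show "real_polynomial_function (\<lambda>u. (p u \<odot> q u) $ C)"
    unfolding eq
    by (intro real_polynomial_function_sum real_polynomial_function.intros(2,4) polynomial_function_component assms) auto
qed

lemma partial_deriv_cl_mult:
  fixes p q :: "real ^ 'a::finite \<Rightarrow> 'b::{finite,linorder} clifford"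
  assumes "(p has_derivative D) (at u)" "(q has_derivative E) (at u)"
  shows "partial_deriv j (\<lambda>u. p u \<odot> q u) u = partial_deriv j p u \<odot> q u + p u \<odot> partial_deriv j q u"
  unfolding partial_deriv_eq [OF assms(1)] partial_deriv_eq [OF assms(2)] partial_deriv_eq [OF cl.FDERIV [OF assms]]
  by (simp add: add.commute)

lemma partial_deriv_linear:
  fixes p :: "real ^ 'a::finite \<Rightarrow> 'b::real_normed_vector"
  assumes "bounded_linear f" "(p has_derivative D) (at u)"
  shows "partial_deriv j (\<lambda>u. f (p u)) u = f (partial_deriv j p u)"
  unfolding partial_deriv_eq [OF assms(2)] partial_deriv_eq [OF bounded_linear.has_derivative [OF assms]] ..

lemma partial_deriv_add:
  assumes "(p has_derivative D) (at u)" "(q has_derivative E) (at u)"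
  shows "partial_deriv j (\<lambda>u. p u + q u) u = partial_deriv j p u + partial_deriv j q u"
  unfolding partial_deriv_eq [OF assms(1)] partial_deriv_eq [OF assms(2)] partial_deriv_eq [OF has_derivative_add [OF assms]] ..

lemma partial_deriv_sum:
  assumes "\<And>i. i \<in> I \<Longrightarrow> (p i has_derivative D i) (at u)"
  shows "partial_deriv j (\<lambda>u. \<Sum>i\<in>I. p i u) u = (\<Sum>i\<in>I. partial_deriv j (p i) u)"
proof -
  have "((\<lambda>u. \<Sum>i\<in>I. p i u) has_derivative (\<lambda>h. \<Sum>i\<in>I. D i h)) (at u)"
    by (rule has_derivative_sum) (rule assms)
  from partial_deriv_eq [OF this] show ?thesis by (simp add: partial_deriv_eq [OF assms])
qed

lemma partial_deriv_zero: "partial_deriv j (\<lambda>_. 0) u = 0"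
  using partial_deriv_eq [OF has_derivative_const [of 0]] by auto

lemma cl_gen_square: "cl_gen i \<odot> (cl_gen i \<odot> a) = - a"
proof -
  have "2 *\<^sub>R (cl_gen i \<odot> cl_gen i) = (- 2) *\<^sub>R cl_basis {}" using cl_gen_anticommute [of i i] by (simp add: scaleR_2)
  then have "(1 / 2) *\<^sub>R (2 *\<^sub>R (cl_gen i \<odot> cl_gen i)) = (1 / 2) *\<^sub>R ((- 2) *\<^sub>R cl_basis {})" by (rule arg_cong)
  then have "cl_gen i \<odot> cl_gen i = - cl_basis {}" by simp
  then have "(cl_gen i \<odot> cl_gen i) \<odot> a = - a" by (simp only: cl.minus_left cl_mult_one)
  then show ?thesis by (simp only: cl_mult_assoc)
qed

section \<open>The Dirac operator on polynomials and the Fischer decomposition\<close>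

definition left_dirac :: "('n::{finite,linorder}) cl_fun \<Rightarrow> 'n cl_fun" where
  "left_dirac p u = (\<Sum>j\<in>UNIV. cl_gen (Some j) \<odot> partial_deriv j p u)"

lemma bounded_linear_cl_vec_n: "bounded_linear (cl_vec_n :: real ^ 'n::finite \<Rightarrow> _)"
  unfolding cl_vec_n_def
  by (intro bounded_linear_sum bounded_linear_scaleR_const bounded_linear_vec_nth)

lemma cl_vec_n_scaleR: "cl_vec_n (c *\<^sub>R u) = c *\<^sub>R cl_vec_n u"
  by (rule linear_cmul [OF bounded_linear.linear [OF bounded_linear_cl_vec_n]])

lemma cl_vec_n_axis: "cl_vec_n (axis j 1) = cl_gen (Some j)"
  by (simp add: cl_vec_n_def axis_def if_distrib [of "\<lambda>c. c *\<^sub>R _"] cong: if_cong)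

lemma cl_gen_vec_n_anticommute:
  "cl_gen (Some j) \<odot> (cl_vec_n u \<odot> a) = - (cl_vec_n u \<odot> (cl_gen (Some j) \<odot> a)) - (2 * u $ j) *\<^sub>R a"
proof -
  have "cl_gen (Some j) \<odot> cl_vec_n u + cl_vec_n u \<odot> cl_gen (Some j)
      = (\<Sum>i\<in>UNIV. u $ i *\<^sub>R (cl_gen (Some j) \<odot> cl_gen (Some i) + cl_gen (Some i) \<odot> cl_gen (Some j)))"
    by (simp add: cl_vec_n_def cl.sum_left cl.sum_right cl_mult_bilinear sum.distrib scaleR_add_right)
  also have "\<dots> = (\<Sum>i\<in>UNIV. if i = j then (- 2 * u $ j) *\<^sub>R cl_basis {} else 0)"
    unfolding cl_gen_anticommute by (rule sum.cong) auto
  also have "\<dots> = (- 2 * u $ j) *\<^sub>R cl_basis {}" by simp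
  finally have "(cl_gen (Some j) \<odot> cl_vec_n u + cl_vec_n u \<odot> cl_gen (Some j)) \<odot> a = (- 2 * u $ j) *\<^sub>R a"
    by (simp only: cl_mult_bilinear cl_mult_one)
  then have "cl_gen (Some j) \<odot> (cl_vec_n u \<odot> a) + cl_vec_n u \<odot> (cl_gen (Some j) \<odot> a) = - ((2 * u $ j) *\<^sub>R a)"
    by (simp add: cl_mult_bilinear cl_mult_assoc)
  then show ?thesis by (simp add: eq_diff_eq add.commute [of _ "cl_vec_n u \<odot> _"] eq_neg_iff_add_eq_0 algebra_simps)
qed

lemma homogeneous_polysD:
  assumes "p \<in> homogeneous_polys k"
  shows "polynomial_function p" "p (t *\<^sub>R u) = t ^ k *\<^sub>R p u"
  using assms by (auto simp: homogeneous_polys_def)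

lemma euler_homogeneous:
  fixes p :: "('n::finite) cl_fun"
  assumes p: "p \<in> homogeneous_polys k"
  shows "(\<Sum>j\<in>UNIV. u $ j *\<^sub>R partial_deriv j p u) = real k *\<^sub>R p u"
proof -
  let ?D = "frechet_derivative p (at u)"
  have d: "(p has_derivative ?D) (at u)" by (rule polynomial_has_derivative [OF homogeneous_polysD(1) [OF p]])
  have lin: "linear ?D" by (rule has_derivative_linear [OF d])
  have "u = (\<Sum>j\<in>UNIV. u $ j *\<^sub>R axis j 1)" using basis_expansion [of u] by (simp add: scalar_mult_eq_scaleR)
  then have "?D u = ?D (\<Sum>j\<in>UNIV. u $ j *\<^sub>R axis j 1)" by (rule arg_cong)
  also have "\<dots> = (\<Sum>j\<in>UNIV. u $ j *\<^sub>R partial_deriv j p u)"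
    by (simp add: linear_sum [OF lin] linear_cmul [OF lin] partial_deriv_eq [OF d])
  finally have 1: "?D u = (\<Sum>j\<in>UNIV. u $ j *\<^sub>R partial_deriv j p u)" .
  have "((\<lambda>s. p (u + s *\<^sub>R u)) has_vector_derivative ?D u) (at 0)"
    by (rule has_vector_derivative_along_line) (use d in simp)
  moreover have "(\<lambda>s. p (u + s *\<^sub>R u)) = (\<lambda>s. (1 + s) ^ k *\<^sub>R p u)"
    using homogeneous_polysD(2) [OF p, of "1 + _" u] by (simp add: fun_eq_iff scaleR_add_left)
  moreover have "((\<lambda>s. (1 + s) ^ k *\<^sub>R p u) has_vector_derivative real k *\<^sub>R p u) (at 0)"
    by (auto intro!: derivative_eq_intros)
  ultimately have "?D u = real k *\<^sub>R p u" using vector_derivative_unique_at by metis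
  then show ?thesis using 1 by simp
qed

lemma homogeneous_zero_partial_deriv:
  assumes "p \<in> homogeneous_polys 0" shows "partial_deriv j p u = 0"
proof -
  have "p = (\<lambda>_. p 0)"
  proof
    fix u show "p u = p 0" using homogeneous_polysD(2) [OF assms, of 0 u] by simp
  qed
  then have "partial_deriv j p u = partial_deriv j (\<lambda>_. p 0) u" by (rule arg_cong)
  also have "\<dots> = 0" using partial_deriv_eq [OF has_derivative_const [of "p 0"]] by auto
  finally show ?thesis .
qed

lemma homogeneous_partial_deriv:
  fixes p :: "('n::finite) cl_fun"
  assumes p: "p \<in> homogeneous_polys (Suc k)" shows "partial_deriv j p \<in> homogeneous_polys k"
proof -
  have pp: "polynomial_function p" by (rule homogeneous_polysD(1) [OF p])
  have poly: "polynomial_function (partial_deriv j p)" by (rule polynomial_partial_deriv [OF pp])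
  have nz: "partial_deriv j p (t *\<^sub>R u) = t ^ k *\<^sub>R partial_deriv j p u" if t: "t \<noteq> 0" for t u
  proof -
    have "((\<lambda>v. p (t *\<^sub>R v)) has_derivative (\<lambda>h. frechet_derivative p (at (t *\<^sub>R u)) (t *\<^sub>R h))) (at u)"
      by (rule has_derivative_compose [of "\<lambda>v. t *\<^sub>R v" "\<lambda>h. t *\<^sub>R h", OF _ polynomial_has_derivative [OF pp]])
        (auto intro!: derivative_eq_intros)
    moreover have "((\<lambda>v. t ^ Suc k *\<^sub>R p v) has_derivative (\<lambda>h. t ^ Suc k *\<^sub>R frechet_derivative p (at u) h)) (at u)"
      by (rule has_derivative_scaleR_right [OF polynomial_has_derivative [OF pp]])
    moreover have "(\<lambda>v. p (t *\<^sub>R v)) = (\<lambda>v. t ^ Suc k *\<^sub>R p v)" using homogeneous_polysD(2) [OF p] by (simp add: fun_eq_iff)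
    ultimately have "(\<lambda>h. frechet_derivative p (at (t *\<^sub>R u)) (t *\<^sub>R h)) = (\<lambda>h. t ^ Suc k *\<^sub>R frechet_derivative p (at u) h)"
      using has_derivative_unique by metis
    from fun_cong [OF this, of "axis j 1"]
    have "t *\<^sub>R partial_deriv j p (t *\<^sub>R u) = t *\<^sub>R (t ^ k *\<^sub>R partial_deriv j p u)"
      by (simp add: partial_deriv_frechet [OF pp] linear_cmul [OF has_derivative_linear [OF polynomial_has_derivative [OF pp]]])
    then show ?thesis by (rule scaleR_left_imp_eq [OF t])
  qed
  have "partial_deriv j p (t *\<^sub>R u) = t ^ k *\<^sub>R partial_deriv j p u" for t u
  proof (cases "t = 0")
    \<comment> \<open>The scaling identity came from a division by \<open>t\<close>; at
      \<open>t = 0\<close> it is recovered by continuity, including the case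
      \<open>0 ^ 0 = 1\<close> for \<open>k = 0\<close>.\<close>
    case True
    have c: "isCont (partial_deriv j p) v" for v by (rule continuous_polymonial_function [OF poly])
    have "isCont (\<lambda>t. partial_deriv j p (t *\<^sub>R u) - t ^ k *\<^sub>R partial_deriv j p u) 0"
      by (intro continuous_intros isCont_o2 [OF _ c])
    then have "((\<lambda>t. partial_deriv j p (t *\<^sub>R u) - t ^ k *\<^sub>R partial_deriv j p u) \<longlongrightarrow> partial_deriv j p (0 *\<^sub>R u) - 0 ^ k *\<^sub>R partial_deriv j p u) (at 0)"
      by (simp only: isCont_def)
    moreover have "((\<lambda>t. partial_deriv j p (t *\<^sub>R u) - t ^ k *\<^sub>R partial_deriv j p u) \<longlongrightarrow> 0) (at 0)"
      by (rule tendsto_eventually) (auto simp: eventually_at_filter nz)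
    ultimately have "partial_deriv j p (0 *\<^sub>R u) - 0 ^ k *\<^sub>R partial_deriv j p u = 0"
      by (rule LIM_unique)
    then show ?thesis using True by simp
  qed (rule nz)
  then show ?thesis using poly by (simp add: homogeneous_polys_def)
qed

lemma homogeneous_polys_add:
  "p \<in> homogeneous_polys k \<Longrightarrow> q \<in> homogeneous_polys k \<Longrightarrow> (\<lambda>u. p u + q u) \<in> homogeneous_polys k"
  by (auto simp: homogeneous_polys_def scaleR_add_right)

lemma homogeneous_polys_scaleR: "p \<in> homogeneous_polys k \<Longrightarrow> (\<lambda>u. c *\<^sub>R p u) \<in> homogeneous_polys k"
  by (auto simp: homogeneous_polys_def)

lemma homogeneous_polys_sum:
  assumes "finite I" "\<And>i. i \<in> I \<Longrightarrow> p i \<in> homogeneous_polys k"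
  shows "(\<lambda>u. \<Sum>i\<in>I. p i u) \<in> homogeneous_polys k"
  using assms by (auto simp: homogeneous_polys_def scaleR_sum_right)

lemma homogeneous_polys_cl_mult_left:
  "p \<in> homogeneous_polys k \<Longrightarrow> (\<lambda>u. c \<odot> p u) \<in> homogeneous_polys (k :: nat)"
  for p :: "('n::{finite,linorder}) cl_fun"
  by (auto simp: homogeneous_polys_def cl_mult_bilinear intro!: polynomial_function_cl_mult)

lemma homogeneous_polys_vec_n_mult:
  "p \<in> homogeneous_polys k \<Longrightarrow> (\<lambda>u. cl_vec_n u \<odot> p u) \<in> homogeneous_polys (Suc k)"
  for p :: "('n::{finite,linorder}) cl_fun"
  using polynomial_function_cl_mult [OF polynomial_function_bounded_linear [OF bounded_linear_cl_vec_n], of p]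
  by (simp add: homogeneous_polys_def cl_mult_bilinear cl_vec_n_scaleR)

lemma left_dirac_homogeneous:
  assumes "p \<in> homogeneous_polys (Suc k)" shows "left_dirac p \<in> homogeneous_polys k"
  unfolding left_dirac_def [abs_def]
  by (intro homogeneous_polys_sum homogeneous_polys_cl_mult_left homogeneous_partial_deriv assms) simp

lemma left_dirac_diff:
  assumes "polynomial_function p" "polynomial_function q"
  shows "left_dirac (\<lambda>u. p u - q u) u = left_dirac p u - left_dirac q u"
proof -
  have d: "((\<lambda>u. p u - q u) has_derivative (\<lambda>h. frechet_derivative p (at u) h - frechet_derivative q (at u) h)) (at u)"
    by (intro has_derivative_diff polynomial_has_derivative assms)
  show ?thesis unfolding left_dirac_def partial_deriv_eq [OF d]
    by (simp add: partial_deriv_frechet [OF assms(1)] partial_deriv_frechet [OF assms(2)] cl.diff_right sum_subtractf)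
qed

lemma homogeneous_polys_diff:
  "p \<in> homogeneous_polys k \<Longrightarrow> q \<in> homogeneous_polys k \<Longrightarrow> (\<lambda>u. p u - q u) \<in> homogeneous_polys k"
  by (auto simp: homogeneous_polys_def scaleR_diff_right)

lemma left_dirac_scaleR:
  assumes "polynomial_function p" shows "left_dirac (\<lambda>u. c *\<^sub>R p u) u = c *\<^sub>R left_dirac p u"
  unfolding left_dirac_def
  by (simp add: partial_deriv_linear [OF bounded_linear_scaleR_right polynomial_has_derivative [OF assms]]
      cl_mult_bilinear scaleR_sum_right)

text \<open>Mixed partial derivatives are symmetric, so twice the double sum runs over
  anticommutators of the generators, and only the diagonal survives.\<close>

lemma left_dirac_square:
  fixes p :: "('n::{finite,linorder}) cl_fun"
  assumes p: "polynomial_function p"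
  shows "left_dirac (left_dirac p) u = - (\<Sum>j\<in>UNIV. partial_deriv j (partial_deriv j p) u)"
proof -
  let ?P = "\<lambda>i j. partial_deriv i (partial_deriv j p) u"
  have pd: "polynomial_function (partial_deriv j p)" for j by (rule polynomial_partial_deriv [OF p])
  have 1: "partial_deriv i (left_dirac p) u = (\<Sum>j\<in>UNIV. cl_gen (Some j) \<odot> ?P i j)" for i
  proof -
    have d: "((\<lambda>u. cl_gen (Some j) \<odot> partial_deriv j p u) has_derivative (\<lambda>h. cl_gen (Some j) \<odot> frechet_derivative (partial_deriv j p) (at u) h)) (at u)" for j
      by (rule bounded_linear.has_derivative [OF cl.bounded_linear_right polynomial_has_derivative [OF pd]])
    show ?thesis unfolding left_dirac_def [abs_def]
      by (subst partial_deriv_sum [OF d])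
        (simp add: partial_deriv_linear [OF cl.bounded_linear_right polynomial_has_derivative [OF pd]])
  qed
  define S where "S = (\<Sum>i\<in>UNIV. \<Sum>j\<in>UNIV. (cl_gen (Some i) \<odot> cl_gen (Some j)) \<odot> ?P i j)"
  have S: "left_dirac (left_dirac p) u = S"
    unfolding left_dirac_def [of "left_dirac p"] 1 S_def by (simp add: cl.sum_right cl_mult_assoc)
  have "S = (\<Sum>j\<in>UNIV. \<Sum>i\<in>UNIV. (cl_gen (Some i) \<odot> cl_gen (Some j)) \<odot> ?P i j)"
    unfolding S_def by (rule sum.swap)
  then have S': "S = (\<Sum>i\<in>UNIV. \<Sum>j\<in>UNIV. (cl_gen (Some j) \<odot> cl_gen (Some i)) \<odot> ?P i j)"
    by (simp only: polynomial_partial_deriv(2) [OF p, of _ _ u])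
  have "S + S = (\<Sum>i\<in>UNIV. \<Sum>j\<in>UNIV. (cl_gen (Some i) \<odot> cl_gen (Some j) + cl_gen (Some j) \<odot> cl_gen (Some i)) \<odot> ?P i j)"
    by (subst (2) S') (simp add: S_def sum.distrib cl_mult_bilinear)
  also have "\<dots> = (\<Sum>i\<in>UNIV. \<Sum>j\<in>UNIV. if i = j then (- 2) *\<^sub>R ?P i i else 0)"
    unfolding cl_gen_anticommute by (intro sum.cong refl) (auto simp: cl_mult_bilinear cl_mult_one)
  also have "\<dots> = (- 2) *\<^sub>R (\<Sum>i\<in>UNIV. ?P i i)" by (simp add: scaleR_sum_right)
  finally have "2 *\<^sub>R S = 2 *\<^sub>R (- (\<Sum>i\<in>UNIV. ?P i i))" by (simp add: scaleR_2)
  then show ?thesis unfolding S by (simp only: scaleR_cancel_left) simp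
qed

text \<open>The squares of the generators contribute \<open>- n q\<close>; moving \<open>e_j\<close>
  past \<open>u\<close> costs \<open>- 2 u_j\<close>, which summed against the derivatives is
  \<open>- 2 m q\<close> by Euler's identity.\<close>

lemma left_dirac_vec_n_mult:
  fixes q :: "('n::{finite,linorder}) cl_fun"
  assumes q: "q \<in> homogeneous_polys m"
  shows "left_dirac (\<lambda>u. cl_vec_n u \<odot> q u) u
    = - ((real CARD('n) + 2 * real m) *\<^sub>R q u) - cl_vec_n u \<odot> left_dirac q u"
proof -
  have dq: "(q has_derivative frechet_derivative q (at u)) (at u)"
    by (rule polynomial_has_derivative [OF homogeneous_polysD(1) [OF q]])
  have dv: "(cl_vec_n has_derivative cl_vec_n) (at u)" by (rule bounded_linear_imp_has_derivative [OF bounded_linear_cl_vec_n])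
  have pd: "partial_deriv j (\<lambda>u. cl_vec_n u \<odot> q u) u = cl_gen (Some j) \<odot> q u + cl_vec_n u \<odot> partial_deriv j q u" for j
    by (simp add: partial_deriv_cl_mult [OF dv dq] partial_deriv_eq [OF dv] cl_vec_n_axis)
  have "left_dirac (\<lambda>u. cl_vec_n u \<odot> q u) u
    = (\<Sum>j\<in>UNIV. - q u + (- (cl_vec_n u \<odot> (cl_gen (Some j) \<odot> partial_deriv j q u)) - (2 * u $ j) *\<^sub>R partial_deriv j q u))"
    unfolding left_dirac_def pd cl_mult_bilinear cl_gen_square cl_gen_vec_n_anticommute ..
  also have "\<dots> = - (real CARD('n) *\<^sub>R q u) - cl_vec_n u \<odot> left_dirac q u - 2 *\<^sub>R (\<Sum>j\<in>UNIV. u $ j *\<^sub>R partial_deriv j q u)"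
    by (simp add: sum.distrib sum_subtractf sum_negf left_dirac_def cl.sum_right scaleR_sum_right sum_constant_scaleR del: sum_constant)
  also have "\<dots> = - ((real CARD('n) + 2 * real m) *\<^sub>R q u) - cl_vec_n u \<odot> left_dirac q u"
    unfolding euler_homogeneous [OF q] by (simp add: algebra_simps)
  finally show ?thesis .
qed

lemma left_monogenic_iff:
  "p \<in> left_monogenic (int k) \<longleftrightarrow> p \<in> homogeneous_polys k \<and> (\<forall>u. left_dirac p u = 0)"
  by (simp add: left_monogenic_def left_dirac_def)

lemma left_monogenic_neg: "left_monogenic (int 0 - 1) = {\<lambda>u. 0}"
  by (simp add: left_monogenic_def)

lemma left_monogenic_Suc: "left_monogenic (int (Suc k) - 1) = left_monogenic (int k)"
  by simp

lemma harmonic_iff_dirac: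
  "p \<in> harmonic_polys k \<longleftrightarrow> p \<in> homogeneous_polys k \<and> (\<forall>u. left_dirac (left_dirac p) u = 0)"
  using left_dirac_square [of p] by (auto simp: harmonic_polys_def homogeneous_polysD(1))

lemma left_dirac_zero: "left_dirac (\<lambda>_. 0) u = 0"
  by (simp add: left_dirac_def partial_deriv_zero cl.zero_right)

lemma left_monogenic_harmonic:
  assumes "p \<in> left_monogenic (int k)" shows "p \<in> harmonic_polys k"
proof -
  have "left_dirac p = (\<lambda>_. 0)" using assms by (auto simp: left_monogenic_iff)
  then show ?thesis using assms by (simp add: harmonic_iff_dirac left_monogenic_iff left_dirac_zero)
qed

text \<open>With \<open>r = q - q'\<close>, applying the Dirac operator to
  \<open>u r = p' - p\<close> gives \<open>- (n + 2 m) r = 0\<close>.\<close>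

lemma fischer_unique:
  fixes p p' :: "('n::{finite,linorder}) cl_fun"
  assumes p: "p \<in> left_monogenic (int k)" "p' \<in> left_monogenic (int k)"
    and q: "q \<in> left_monogenic (int k - 1)" "q' \<in> left_monogenic (int k - 1)"
    and eq: "(\<lambda>u. p u + cl_vec_n u \<odot> q u) = (\<lambda>u. p' u + cl_vec_n u \<odot> q' u)"
  shows "p = p'"
proof (cases k)
  case 0
  have "q = (\<lambda>_. 0)" "q' = (\<lambda>_. 0)" using q unfolding 0 left_monogenic_neg by auto
  then show ?thesis using eq by (simp add: cl.zero_right)
next
  case (Suc m)
  define r where "r u = q u - q' u" for u
  have qm: "q \<in> homogeneous_polys m" "q' \<in> homogeneous_polys m" "\<And>u. left_dirac q u = 0" "\<And>u. left_dirac q' u = 0"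
    using q unfolding Suc left_monogenic_Suc left_monogenic_iff by auto
  have r: "r \<in> homogeneous_polys m" unfolding r_def [abs_def]
    by (intro homogeneous_polys_diff qm)
  have Dr: "left_dirac r u = 0" for u
    unfolding r_def [abs_def] left_dirac_diff [OF homogeneous_polysD(1) [OF qm(1)] homogeneous_polysD(1) [OF qm(2)]]
    by (simp add: qm)
  have pp: "polynomial_function p" "polynomial_function p'" "\<And>u. left_dirac p u = 0" "\<And>u. left_dirac p' u = 0"
    using p by (auto simp: left_monogenic_iff homogeneous_polysD(1))
  have "(\<lambda>u. cl_vec_n u \<odot> r u) = (\<lambda>u. p' u - p u)"
    using eq by (simp add: r_def fun_eq_iff cl_mult_bilinear cl.diff_right algebra_simps)
  then have "left_dirac (\<lambda>u. cl_vec_n u \<odot> r u) u = left_dirac (\<lambda>u. p' u - p u) u" for u by simp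
  then have "left_dirac (\<lambda>u. cl_vec_n u \<odot> r u) u = 0" for u
    unfolding left_dirac_diff [OF pp(2,1)] by (simp add: pp)
  then have "(real CARD('n) + 2 * real m) *\<^sub>R r u = 0" for u
    unfolding left_dirac_vec_n_mult [OF r] by (simp add: Dr cl.zero_right)
  moreover have "0 < real CARD('n) + 2 * real m" by (simp add: add_pos_nonneg)
  ultimately have "r u = 0" for u by (metis less_irrefl scaleR_eq_0_iff)
  then have "q = q'" by (simp add: r_def fun_eq_iff)
  then show ?thesis using eq by (simp add: fun_eq_iff)
qed

text \<open>The decomposition of \<open>h\<close> has \<open>q = - D h / (n + 2 k - 2)\<close>.\<close>

lemma fischer_exists:
  fixes h :: "('n::{finite,linorder}) cl_fun"
  assumes h: "h \<in> harmonic_polys k"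
  shows "\<exists>p\<in>left_monogenic (int k). \<exists>q\<in>left_monogenic (int k - 1). h = (\<lambda>u. p u + cl_vec_n u \<odot> q u)"
proof (cases k)
  case 0
  have h0: "h \<in> homogeneous_polys 0" using h 0 by (simp add: harmonic_polys_def)
  have "left_dirac h u = 0" for u
    unfolding left_dirac_def by (simp add: homogeneous_zero_partial_deriv [OF h0] cl.zero_right)
  then have "h \<in> left_monogenic (int k)" using h0 0 by (simp only: left_monogenic_iff) simp
  moreover have "(\<lambda>_. 0) \<in> left_monogenic (int k - 1)" unfolding 0 left_monogenic_neg by simp
  moreover have "h = (\<lambda>u. h u + cl_vec_n u \<odot> (\<lambda>_. 0) u)" by (simp add: cl.zero_right)
  ultimately show ?thesis by (intro bexI [of _ h] bexI [of _ "\<lambda>_. 0"])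
next
  case (Suc m)
  define c where "c = - 1 / (real CARD('n) + 2 * real m)"
  define q where "q u = c *\<^sub>R left_dirac h u" for u
  define p where "p u = h u - cl_vec_n u \<odot> q u" for u
  have hh: "h \<in> homogeneous_polys (Suc m)" "\<And>u. left_dirac (left_dirac h) u = 0"
    using h Suc by (auto simp: harmonic_iff_dirac)
  have Dh: "left_dirac h \<in> homogeneous_polys m" by (rule left_dirac_homogeneous [OF hh(1)])
  have q: "q \<in> homogeneous_polys m" unfolding q_def [abs_def] by (rule homogeneous_polys_scaleR [OF Dh])
  have Dq: "left_dirac q u = 0" for u
    unfolding q_def [abs_def] using hh(2) by (simp add: left_dirac_scaleR homogeneous_polysD(1) [OF Dh])
  have uq: "(\<lambda>u. cl_vec_n u \<odot> q u) \<in> homogeneous_polys (Suc m)" by (rule homogeneous_polys_vec_n_mult [OF q])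
  have p: "p \<in> homogeneous_polys (Suc m)" unfolding p_def [abs_def]
    by (intro homogeneous_polys_diff hh(1) uq)
  have "left_dirac p u = 0" for u
  proof -
    have "left_dirac p u = left_dirac h u - left_dirac (\<lambda>u. cl_vec_n u \<odot> q u) u"
      unfolding p_def [abs_def]
      by (rule left_dirac_diff [OF homogeneous_polysD(1) [OF hh(1)] homogeneous_polysD(1) [OF uq]])
    also have "\<dots> = left_dirac h u + (real CARD('n) + 2 * real m) *\<^sub>R q u"
      unfolding left_dirac_vec_n_mult [OF q] Dq by (simp only: cl.zero_right diff_zero diff_minus_eq_add)
    also have "\<dots> = left_dirac h u + ((real CARD('n) + 2 * real m) * c) *\<^sub>R left_dirac h u" by (simp add: q_def)
    also have "(real CARD('n) + 2 * real m) * c = - 1"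
    proof -
      have "0 < real CARD('n) + 2 * real m" by (simp add: add_pos_nonneg)
      then show ?thesis by (simp add: c_def)
    qed
    finally show ?thesis by simp
  qed
  then have "p \<in> left_monogenic (int k)" using p unfolding Suc left_monogenic_iff by simp
  moreover have "q \<in> left_monogenic (int k - 1)" using q Dq unfolding Suc left_monogenic_Suc left_monogenic_iff by simp
  moreover have "h = (\<lambda>u. p u + cl_vec_n u \<odot> q u)" by (simp add: p_def)
  ultimately show ?thesis by blast
qed

lemma left_proj_eqI:
  assumes "h \<in> harmonic_polys k" "p \<in> left_monogenic (int k)" "q \<in> left_monogenic (int k - 1)"
    "h = (\<lambda>u. p u + cl_vec_n u \<odot> q u)"
  shows "left_proj k h = p"
  unfolding left_proj_def
proof (rule the_equality)
  show "h \<in> harmonic_polys k \<and> p \<in> left_monogenic (int k) \<and> (\<exists>q\<in>left_monogenic (int k - 1). h = (\<lambda>u. p u + cl_vec_n u \<odot> q u))"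
    using assms by blast
  fix p' assume "h \<in> harmonic_polys k \<and> p' \<in> left_monogenic (int k) \<and> (\<exists>q\<in>left_monogenic (int k - 1). h = (\<lambda>u. p' u + cl_vec_n u \<odot> q u))"
  then obtain q' where q': "p' \<in> left_monogenic (int k)" "q' \<in> left_monogenic (int k - 1)" "h = (\<lambda>u. p' u + cl_vec_n u \<odot> q' u)" by blast
  show "p' = p" by (rule fischer_unique [OF q'(1) assms(2) q'(2) assms(3)]) (use q'(3) assms(4) in metis)
qed

lemma left_proj_decomposition:
  assumes "h \<in> harmonic_polys k"
  shows "left_proj k h \<in> left_monogenic (int k) \<and>
    (\<exists>q\<in>left_monogenic (int k - 1). h = (\<lambda>u. left_proj k h u + cl_vec_n u \<odot> q u))"
proof -
  obtain p q where pq: "p \<in> left_monogenic (int k)" "q \<in> left_monogenic (int k - 1)" "h = (\<lambda>u. p u + cl_vec_n u \<odot> q u)"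
    using fischer_exists [OF assms] by blast
  have "left_proj k h = p" by (rule left_proj_eqI [OF assms pq])
  then show ?thesis using pq by (intro conjI bexI [of _ q]) simp_all
qed

subsection \<open>Reversion\<close>

lemma bounded_linear_cl_reversion: "bounded_linear (cl_reversion :: 'a::{finite,linorder} clifford \<Rightarrow> _)"
  using cl_reversion_linear by (rule linear_conv_bounded_linear [THEN iffD1])

lemma cl_reversion_involution: "cl_reversion (cl_reversion a) = a"
  by (simp add: cl_reversion_def vec_eq_iff mult.assoc [symmetric] power_mult_distrib [symmetric])

lemma cl_reversion_gen: "cl_reversion (cl_gen i) = cl_gen i"
  by (simp add: cl_reversion_basis numeral_2_eq_2)

lemma cl_reversion_vec_n: "cl_reversion (cl_vec_n u) = cl_vec_n u"
  by (simp add: cl_vec_n_def linear_sum [OF cl_reversion_linear] linear_cmul [OF cl_reversion_linear] cl_reversion_gen)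

lemma cl_reversion_zero_iff: "cl_reversion a = 0 \<longleftrightarrow> a = 0"
  using cl_reversion_involution linear_0 [OF cl_reversion_linear] by metis

lemma polynomial_function_cl_reversion:
  fixes p :: "'a::real_normed_vector \<Rightarrow> 'b::{finite,linorder} clifford"
  assumes "polynomial_function p" shows "polynomial_function (\<lambda>u. cl_reversion (p u))"
  using polynomial_function_compose [OF assms polynomial_function_bounded_linear [OF bounded_linear_cl_reversion]]
  by (simp add: comp_def)

lemma homogeneous_polys_cl_reversion:
  fixes p :: "('n::{finite,linorder}) cl_fun"
  assumes "p \<in> homogeneous_polys k" shows "(\<lambda>u. cl_reversion (p u)) \<in> homogeneous_polys k"
  using assms by (simp add: homogeneous_polys_def polynomial_function_cl_reversion linear_cmul [OF cl_reversion_linear])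

lemma partial_deriv_cl_reversion:
  fixes p :: "('n::{finite,linorder}) cl_fun"
  assumes "polynomial_function p"
  shows "partial_deriv j (\<lambda>u. cl_reversion (p u)) u = cl_reversion (partial_deriv j p u)"
  by (rule partial_deriv_linear [OF bounded_linear_cl_reversion polynomial_has_derivative [OF assms]])

text \<open>Reversion reverses products and fixes the generators, so it exchanges the Dirac
  operators acting from the left and from the right. Statements on the right are obtained through
  this equivalence.\<close>

lemma right_monogenic_reversion:
  fixes p :: "('n::{finite,linorder}) cl_fun"
  shows "p \<in> right_monogenic k \<longleftrightarrow> (\<lambda>u. cl_reversion (p u)) \<in> left_monogenic k"
proof (cases "k < 0")
  case True
  have "p = (\<lambda>u. 0) \<longleftrightarrow> (\<lambda>u. cl_reversion (p u)) = (\<lambda>u. 0)" by (simp add: fun_eq_iff cl_reversion_zero_iff)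
  then show ?thesis using True by (simp add: left_monogenic_def right_monogenic_def)
next
  case False
  have hom: "p \<in> homogeneous_polys m \<longleftrightarrow> (\<lambda>u. cl_reversion (p u)) \<in> homogeneous_polys m" for m
    using homogeneous_polys_cl_reversion [of p m] homogeneous_polys_cl_reversion [of "\<lambda>u. cl_reversion (p u)" m]
    by (auto simp: cl_reversion_involution)
  have "(\<Sum>j\<in>UNIV. cl_gen (Some j) \<odot> partial_deriv j (\<lambda>u. cl_reversion (p u)) u)
      = cl_reversion (\<Sum>j\<in>UNIV. partial_deriv j p u \<odot> cl_gen (Some j))" if "polynomial_function p" for u
    by (simp add: partial_deriv_cl_reversion [OF that] linear_sum [OF cl_reversion_linear] cl_reversion_mult cl_reversion_gen)
  then show ?thesis
    using False hom [of "nat k"] homogeneous_polysD(1) [of p "nat k"]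
    by (auto simp: left_monogenic_def right_monogenic_def cl_reversion_zero_iff)
qed

lemma harmonic_polys_cl_reversion:
  fixes h :: "('n::{finite,linorder}) cl_fun"
  assumes h: "h \<in> harmonic_polys k" shows "(\<lambda>u. cl_reversion (h u)) \<in> harmonic_polys k"
proof -
  have hh: "h \<in> homogeneous_polys k" "polynomial_function h" using h by (auto simp: harmonic_polys_def homogeneous_polysD(1))
  have pd: "partial_deriv j (\<lambda>u. cl_reversion (h u)) = (\<lambda>u. cl_reversion (partial_deriv j h u))" for j
    using partial_deriv_cl_reversion [OF hh(2)] by (simp add: fun_eq_iff)
  have "(\<Sum>j\<in>UNIV. partial_deriv j (partial_deriv j (\<lambda>u. cl_reversion (h u))) u)
      = cl_reversion (\<Sum>j\<in>UNIV. partial_deriv j (partial_deriv j h) u)" for u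
    unfolding pd by (simp add: partial_deriv_cl_reversion [OF polynomial_partial_deriv(1) [OF hh(2)]] linear_sum [OF cl_reversion_linear])
  also have "\<dots> u = 0" for u using h by (simp add: harmonic_polys_def cl_reversion_zero_iff)
  finally show ?thesis using homogeneous_polys_cl_reversion [OF hh(1)] by (simp add: harmonic_polys_def)
qed

text \<open>The left and right decompositions correspond under reversion, which fixes
  \<open>cl_vec_n u\<close>; existence and uniqueness on the left thus serve on the right.\<close>

lemma right_proj_reversion:
  fixes h :: "('n::{finite,linorder}) cl_fun"
  assumes h: "h \<in> harmonic_polys k"
  shows "right_proj k (\<lambda>u. cl_reversion (h u)) = (\<lambda>u. cl_reversion (left_proj k h u))"
  unfolding right_proj_def
proof (rule the_equality)
  have rh: "(\<lambda>u. cl_reversion (h u)) \<in> harmonic_polys k" by (rule harmonic_polys_cl_reversion [OF h])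
  obtain q where q: "q \<in> left_monogenic (int k - 1)" and hq: "h = (\<lambda>u. left_proj k h u + cl_vec_n u \<odot> q u)"
    and p: "left_proj k h \<in> left_monogenic (int k)"
    using left_proj_decomposition [OF h] by blast
  have "(\<lambda>u. cl_reversion (left_proj k h u)) \<in> right_monogenic (int k)"
    using p by (simp add: right_monogenic_reversion cl_reversion_involution)
  moreover have "(\<lambda>u. cl_reversion (q u)) \<in> right_monogenic (int k - 1)"
    using q by (simp add: right_monogenic_reversion cl_reversion_involution)
  moreover have "cl_reversion (h u) = cl_reversion (left_proj k h u) + cl_reversion (q u) \<odot> cl_vec_n u" for u
    using fun_cong [OF hq, of u] by (metis cl_reversion_mult cl_reversion_vec_n linear_add [OF cl_reversion_linear])
  ultimately show "(\<lambda>u. cl_reversion (h u)) \<in> harmonic_polys k \<and> (\<lambda>u. cl_reversion (left_proj k h u)) \<in> right_monogenic (int k) \<and>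
      (\<exists>q\<in>right_monogenic (int k - 1). (\<lambda>u. cl_reversion (h u)) = (\<lambda>u. cl_reversion (left_proj k h u) + q u \<odot> cl_vec_n u))"
    using rh by (intro conjI bexI [of _ "\<lambda>u. cl_reversion (q u)"]) simp_all
  fix p' assume "(\<lambda>u. cl_reversion (h u)) \<in> harmonic_polys k \<and> p' \<in> right_monogenic (int k) \<and>
      (\<exists>q\<in>right_monogenic (int k - 1). (\<lambda>u. cl_reversion (h u)) = (\<lambda>u. p' u + q u \<odot> cl_vec_n u))"
  then obtain q' where q': "p' \<in> right_monogenic (int k)" "q' \<in> right_monogenic (int k - 1)"
    "(\<lambda>u. cl_reversion (h u)) = (\<lambda>u. p' u + q' u \<odot> cl_vec_n u)" by blast
  have "h u = cl_reversion (p' u) + cl_vec_n u \<odot> cl_reversion (q' u)" for u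
    using fun_cong [OF q'(3), of u]
    by (metis cl_reversion_mult cl_reversion_vec_n cl_reversion_involution linear_add [OF cl_reversion_linear])
  then have "left_proj k h = (\<lambda>u. cl_reversion (p' u))"
    using q'(1,2) by (intro left_proj_eqI [OF h, of _ "\<lambda>u. cl_reversion (q' u)"]) (auto simp: right_monogenic_reversion)
  then show "p' = (\<lambda>u. cl_reversion (left_proj k h u))" by (simp add: cl_reversion_involution)
qed

subsection \<open>Orthogonality on the unit sphere of \<open>\<real>\<^sup>n\<close>\<close>

lemma C1_fun_polynomial:
  assumes "real_polynomial_function f" shows "C1_fun S f"
proof -
  obtain D D2 where D: "\<And>u. (f has_derivative D u) (at u)" "\<And>u h. ((\<lambda>u. D u h) has_derivative D2 u h) (at u)"
    using real_polynomial_second_derivative [OF assms] by blast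
  show ?thesis
    by (rule C1_funI [where f'=D], rule D(1))
      (rule continuous_at_imp_continuous_on, blast intro: has_derivative_continuous D(2))
qed

text \<open>\<open>y \<bullet> y - 1\<close> is a defining function away from the origin, the only
  zero of its gradient.\<close>

lemma unit_ball_C1_domain: "C1_domain (ball 0 1 :: (real ^ 'n::finite) set) (\<lambda>x. x)"
proof
  fix x :: "real ^ 'n" assume x: "x \<in> frontier (ball 0 1)"
  have nx: "norm y = 1" if "y \<in> frontier (ball 0 1)" for y :: "real ^ 'n" using that by simp
  have "defining_function (ball 0 1) (- {0}) (\<lambda>y. y \<bullet> y - 1) (\<lambda>y :: real ^ 'n. 2 *\<^sub>R y)"
    unfolding defining_function_def
  proof (intro conjI ballI)
    show "((\<lambda>y. y \<bullet> y - 1) has_derivative (\<lambda>h. (2 *\<^sub>R y) \<bullet> h)) (at y)" for y :: "real ^ 'n"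
      by (auto intro!: derivative_eq_intros simp: inner_commute)
    show "ball 0 1 \<inter> - {0} = {y \<in> - {0}. y \<bullet> y - 1 < (0::real)}"
      by (auto simp: norm_lt_square [of _ 1] dist_norm norm_minus_commute)
  qed (auto intro: continuous_intros)
  moreover have "x \<in> - {0}" using nx [OF x] by auto
  moreover have "\<forall>y\<in>- {0} \<inter> frontier (ball 0 1). y = (2 *\<^sub>R y) /\<^sub>R norm (2 *\<^sub>R y)" using nx by auto
  ultimately show "\<exists>W \<rho> G. x \<in> W \<and> defining_function (ball 0 1) W \<rho> G \<and>
      (\<forall>y\<in>W \<inter> frontier (ball 0 1). y = G y /\<^sub>R norm (G y))"
    by (intro exI [of _ "- {0}"] exI [of _ "\<lambda>y. y \<bullet> y - 1"] exI [of _ "\<lambda>y. 2 *\<^sub>R y"] conjI)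
qed auto

lemma set_integrable_sphere:
  fixes f :: "real ^ 'n::finite \<Rightarrow> 'b::euclidean_space"
  assumes "continuous_on (sphere 0 1) f"
  shows "set_integrable (hausdorff_measure (CARD('n) - 1)) (sphere 0 1) f"
proof -
  interpret C1_domain "ball 0 1 :: (real ^ 'n) set" "\<lambda>x. x" by (rule unit_ball_C1_domain)
  have "emeasure (hausdorff_measure (CARD('n) - 1)) (sphere 0 1 :: (real ^ 'n) set) < \<infinity>"
    using emeasure_frontier_finite by simp
  then show ?thesis
    by (intro set_integrable_continuous_compact [OF sets_hausdorff_measure _ _ assms]) auto
qed

lemma set_integral_component:
  fixes f :: "'a \<Rightarrow> real ^ 'b::finite"
  assumes "set_integrable M S f"
  shows "(LINT x:S|M. f x) $ A = (LINT x:S|M. f x $ A)"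
  using integral_bounded_linear [OF bounded_linear_vec_nth [of A], of M "\<lambda>x. indicator S x *\<^sub>R f x"] assms
  by (simp add: set_integrable_def set_lebesgue_integral_def)

text \<open>A vector-valued function that is not integrable has integral \<open>0\<close>.\<close>

lemma set_integral_zero_componentwise:
  fixes f :: "'a \<Rightarrow> real ^ 'b::finite"
  assumes "\<And>A. (LINT x:S|M. f x $ A) = 0"
  shows "(LINT x:S|M. f x) = 0"
proof (cases "set_integrable M S f")
  case True
  then show ?thesis using assms by (simp add: vec_eq_iff set_integral_component)
next
  case False
  then show ?thesis unfolding set_integrable_def set_lebesgue_integral_def by (rule not_integrable_integral_eq)
qed

section \<open>Pairing of polynomials over the unit sphere\<close>

lemma sphere_integrable_pairing:
  fixes P Q :: "('n::{finite,linorder}) cl_fun"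
  assumes "polynomial_function P" "polynomial_function Q"
  shows "set_integrable (hausdorff_measure (CARD('n) - 1)) (sphere 0 1) (\<lambda>u. P u \<odot> Q u)"
  by (intro set_integrable_sphere continuous_on_polymonial_function polynomial_function_cl_mult assms)

lemma polynomial_component_derivative:
  fixes p :: "real ^ 'a::finite \<Rightarrow> real ^ 'b::finite"
  assumes "polynomial_function p"
  shows "frechet_derivative (\<lambda>u. p u $ A) (at u) (axis j 1) = partial_deriv j p u $ A"
proof -
  have "((\<lambda>u. p u $ A) has_derivative (\<lambda>h. frechet_derivative p (at u) h $ A)) (at u)"
    by (rule bounded_linear.has_derivative [OF bounded_linear_vec_nth polynomial_has_derivative [OF assms]])
  from frechet_derivative_at [OF this] show ?thesis by (metis partial_deriv_frechet [OF assms])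
qed

text \<open>The field with components \<open>P e_j Q\<close> has divergence
  \<open>(P D) Q + P (D Q) = 0\<close>. The outward normal of the unit ball at \<open>u\<close> is
  \<open>u\<close> itself, so its flux density is \<open>P u Q\<close>.\<close>

lemma sphere_pairing_orthogonal:
  fixes P Q :: "('n::{finite,linorder}) cl_fun"
  assumes P: "polynomial_function P" "\<And>u. (\<Sum>j\<in>UNIV. partial_deriv j P u \<odot> cl_gen (Some j)) = 0"
    and Q: "polynomial_function Q" "\<And>u. left_dirac Q u = 0"
  shows "sphere_pairing P (\<lambda>u. cl_vec_n u \<odot> Q u) = 0"
  unfolding sphere_pairing_def
proof (rule set_integral_zero_componentwise)
  fix A :: "'n option set"
  interpret C1_domain "ball 0 1 :: (real ^ 'n::{finite,linorder}) set" "\<lambda>x. x" by (rule unit_ball_C1_domain)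
  define R where "R j u = P u \<odot> (cl_gen (Some j) \<odot> Q u)" for j u
  define Y where "Y u = (\<chi> j. R j u $ A)" for u
  have gQ: "polynomial_function (\<lambda>u. cl_gen (Some j) \<odot> Q u)" for j
    by (intro polynomial_function_cl_mult Q) simp
  have R: "polynomial_function (R j)" for j
    unfolding R_def [abs_def] by (intro polynomial_function_cl_mult P gQ)
  have dR: "partial_deriv j (R j) u = partial_deriv j P u \<odot> (cl_gen (Some j) \<odot> Q u) + P u \<odot> (cl_gen (Some j) \<odot> partial_deriv j Q u)" for j u
    unfolding R_def [abs_def]
    by (simp only: partial_deriv_cl_mult [OF polynomial_has_derivative [OF P(1)] polynomial_has_derivative [OF gQ]]
        partial_deriv_linear [OF cl.bounded_linear_right polynomial_has_derivative [OF Q(1)]])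
  have "(\<Sum>j\<in>UNIV. partial_deriv j (R j) u) = (\<Sum>j\<in>UNIV. partial_deriv j P u \<odot> cl_gen (Some j)) \<odot> Q u + P u \<odot> left_dirac Q u" for u
    unfolding dR by (simp add: sum.distrib cl.sum_left cl.sum_right cl_mult_assoc left_dirac_def)
  then have div: "(\<Sum>j\<in>UNIV. partial_deriv j (R j) u) = 0" for u
    by (simp only: P(2) Q(2) cl.zero_left cl.zero_right add_0)
  have dY: "(\<Sum>j\<in>UNIV. frechet_derivative (\<lambda>u. Y u $ j) (at u) (axis j 1)) = 0" for u
  proof -
    have "(\<Sum>j\<in>UNIV. frechet_derivative (\<lambda>u. Y u $ j) (at u) (axis j 1)) = (\<Sum>j\<in>UNIV. partial_deriv j (R j) u) $ A"
      by (simp add: Y_def polynomial_component_derivative [OF R])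
    then show ?thesis by (simp add: div)
  qed
  have "(LINT u:frontier (ball 0 1)|H. Y u \<bullet> u)
      = slab_factor TYPE('n) * (LINT u:ball 0 1|lborel. \<Sum>j\<in>UNIV. frechet_derivative (\<lambda>u. Y u $ j) (at u) (axis j 1))"
    by (rule gauss_green [OF open_UNIV subset_UNIV])
      (simp add: Y_def C1_fun_polynomial polynomial_function_component [OF R])
  then have "(LINT u:sphere 0 1|H. Y u \<bullet> u) = 0" by (simp add: set_lebesgue_integral_def dY)
  moreover have "Y u \<bullet> u = (P u \<odot> (cl_vec_n u \<odot> Q u)) $ A" for u
    by (simp add: Y_def R_def inner_vec_def cl_vec_n_def cl.sum_left cl.sum_right cl_mult_bilinear mult.commute)
  ultimately show "(LINT u:sphere 0 1|hausdorff_measure (CARD('n) - 1). (P u \<odot> (cl_vec_n u \<odot> Q u)) $ A) = 0" by simp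
qed

text \<open>The integrals on the right form the Gram matrix of the \<open>L i\<close>; after this
  expansion the variable \<open>u\<close> enters only through these numbers.\<close>

lemma sphere_pairing_expansion:
  fixes L :: "nat \<Rightarrow> real ^ 'n::{finite,linorder} \<Rightarrow> real"
  assumes L: "\<And>i. i < N \<Longrightarrow> real_polynomial_function (L i)"
  shows "sphere_pairing (\<lambda>u. \<Sum>i<N. L i u *\<^sub>R c i) (\<lambda>u. \<Sum>l<N. L l u *\<^sub>R d l)
    = (\<Sum>i<N. \<Sum>l<N. (LINT u:sphere 0 1|hausdorff_measure (CARD('n) - 1). L i u * L l u) *\<^sub>R (c i \<odot> d l))"
proof -
  let ?M = "hausdorff_measure (CARD('n) - 1) :: (real ^ 'n::{finite,linorder}) measure"
  have int: "set_integrable ?M (sphere 0 1) (\<lambda>u. L i u * L l u)" if "i < N" "l < N" for i l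
    using that L by (intro set_integrable_sphere continuous_on_polymonial_function)
      (auto simp flip: real_polynomial_function_eq intro: real_polynomial_function.intros(4))
  have "(LINT u:sphere 0 1|?M. (\<Sum>i<N. L i u *\<^sub>R c i) \<odot> (\<Sum>l<N. L l u *\<^sub>R d l))
      = (LINT u|?M. (\<Sum>i<N. \<Sum>l<N. (indicator (sphere 0 1) u *\<^sub>R (L i u * L l u)) *\<^sub>R (c i \<odot> d l)))"
    unfolding set_lebesgue_integral_def
    by (intro arg_cong [of _ _ "integral\<^sup>L ?M"] ext)
      (simp add: cl.sum_left cl.sum_right cl_mult_bilinear scaleR_sum_right, subst sum.swap, simp add: mult_ac)
  also have "\<dots> = (\<Sum>i<N. \<Sum>l<N. (LINT u:sphere 0 1|?M. L i u * L l u) *\<^sub>R (c i \<odot> d l))"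
    using int unfolding set_lebesgue_integral_def set_integrable_def
    by (subst Bochner_Integration.integral_sum, force)
      (intro sum.cong refl, subst Bochner_Integration.integral_sum, auto)
  finally show ?thesis unfolding sphere_pairing_def .
qed

section \<open>Stability of harmonic polynomials\<close>

lemma harmonic_polys_add:
  fixes p q :: "('n::finite) cl_fun"
  assumes "p \<in> harmonic_polys k" "q \<in> harmonic_polys k"
  shows "(\<lambda>u. p u + q u) \<in> harmonic_polys k"
proof -
  have p: "polynomial_function p" "polynomial_function q"
    using assms by (auto simp: harmonic_polys_def homogeneous_polysD(1))
  have "partial_deriv j (\<lambda>u. p u + q u) = (\<lambda>u. partial_deriv j p u + partial_deriv j q u)" for j
    by (rule ext) (rule partial_deriv_add [OF polynomial_has_derivative [OF p(1)] polynomial_has_derivative [OF p(2)]])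
  moreover have "partial_deriv j (\<lambda>u. partial_deriv j p u + partial_deriv j q u) u
      = partial_deriv j (partial_deriv j p) u + partial_deriv j (partial_deriv j q) u" for j u
    by (rule partial_deriv_add [OF polynomial_has_derivative [OF polynomial_partial_deriv(1) [OF p(1)]]
          polynomial_has_derivative [OF polynomial_partial_deriv(1) [OF p(2)]]])
  ultimately show ?thesis using assms by (simp add: harmonic_polys_def homogeneous_polys_add sum.distrib)
qed

lemma harmonic_polys_cl_mult_left:
  fixes p :: "('n::{finite,linorder}) cl_fun"
  assumes "p \<in> harmonic_polys k" shows "(\<lambda>u. c \<odot> p u) \<in> harmonic_polys k"
proof -
  have p: "polynomial_function p" using assms by (auto simp: harmonic_polys_def homogeneous_polysD(1))
  have "partial_deriv j (\<lambda>u. c \<odot> p u) = (\<lambda>u. c \<odot> partial_deriv j p u)" for j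
    by (rule ext) (rule partial_deriv_linear [OF cl.bounded_linear_right polynomial_has_derivative [OF p]])
  moreover have "partial_deriv j (\<lambda>u. c \<odot> partial_deriv j p u) u = c \<odot> partial_deriv j (partial_deriv j p) u" for j u
    by (rule partial_deriv_linear [OF cl.bounded_linear_right
          polynomial_has_derivative [OF polynomial_partial_deriv(1) [OF p]]])
  ultimately show ?thesis using assms
    by (simp add: harmonic_polys_def homogeneous_polys_cl_mult_left flip: cl.sum_right) (simp add: cl.zero_right)
qed

lemma harmonic_polys_zero: "(\<lambda>_. 0) \<in> harmonic_polys k"
proof -
  have "partial_deriv j (\<lambda>_. 0) = (\<lambda>_. 0 :: ('a option) clifford)" for j :: 'a by (rule ext) (rule partial_deriv_zero)
  then show ?thesis by (simp add: harmonic_polys_def homogeneous_polys_def)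
qed

lemma harmonic_polys_sum:
  assumes "\<And>i. i \<in> I \<Longrightarrow> p i \<in> harmonic_polys k"
  shows "(\<lambda>u. \<Sum>i\<in>I. p i u) \<in> harmonic_polys k"
  using assms by (induction I rule: infinite_finite_induct) (auto intro: harmonic_polys_add harmonic_polys_zero)

subsection \<open>The spherical Dirac operator\<close>

lemma sum_pairs_triangle:
  fixes f :: "'a::{finite,linorder} \<Rightarrow> 'a \<Rightarrow> 'b::comm_monoid_add"
  shows "(\<Sum>i\<in>UNIV. \<Sum>j\<in>UNIV. f i j) = (\<Sum>i\<in>UNIV. f i i) + (\<Sum>(i, j)\<in>{(i, j). i < j}. f i j + f j i)"
proof -
  let ?T = "{(i, j). i < j} :: ('a \<times> 'a) set" and ?D = "(\<lambda>i. (i, i)) ` (UNIV :: 'a set)"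
  have U: "UNIV = ?D \<union> (?T \<union> prod.swap ` ?T)" by (auto simp: image_iff)
  have "(\<Sum>i\<in>UNIV. \<Sum>j\<in>UNIV. f i j) = (\<Sum>p\<in>UNIV. f (fst p) (snd p))"
    by (simp add: sum.cartesian_product case_prod_unfold)
  also have "\<dots> = (\<Sum>p\<in>?D. f (fst p) (snd p)) + (\<Sum>p\<in>?T \<union> prod.swap ` ?T. f (fst p) (snd p))"
    by (subst U, rule sum.union_disjoint) auto
  also have "(\<Sum>p\<in>?T \<union> prod.swap ` ?T. f (fst p) (snd p))
      = (\<Sum>p\<in>?T. f (fst p) (snd p)) + (\<Sum>p\<in>prod.swap ` ?T. f (fst p) (snd p))"
    by (rule sum.union_disjoint) auto
  also have "(\<Sum>p\<in>prod.swap ` ?T. f (fst p) (snd p)) = (\<Sum>p\<in>?T. f (snd p) (fst p))"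
    by (subst sum.reindex) auto
  also have "(\<Sum>p\<in>?D. f (fst p) (snd p)) = (\<Sum>i\<in>UNIV. f i i)" by (subst sum.reindex) (auto simp: inj_on_def)
  finally show ?thesis by (simp add: case_prod_unfold sum.distrib)
qed

lemma cl_gen_swap: "i \<noteq> j \<Longrightarrow> cl_gen j \<odot> (cl_gen i \<odot> a) = - (cl_gen i \<odot> (cl_gen j \<odot> a))"
proof -
  assume "i \<noteq> j"
  then have "cl_gen j \<odot> cl_gen i + cl_gen i \<odot> cl_gen j = 0" using cl_gen_anticommute [of j i] by simp
  then have "(cl_gen j \<odot> cl_gen i + cl_gen i \<odot> cl_gen j) \<odot> a = 0" by (simp only: cl.zero_left)
  then show ?thesis by (simp add: cl_mult_bilinear cl_mult_assoc eq_neg_iff_add_eq_0)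
qed

lemma cl_vec_square: "cl_vec x \<odot> (cl_vec x \<odot> a) = - ((x \<bullet> x) *\<^sub>R a)"
proof -
  have "cl_vec x \<odot> (cl_vec x \<odot> a) = (\<Sum>i\<in>UNIV. \<Sum>j\<in>UNIV. (x $ i * x $ j) *\<^sub>R (cl_gen i \<odot> (cl_gen j \<odot> a)))"
    by (simp add: cl_vec_def cl.sum_left cl.sum_right cl_mult_bilinear scaleR_sum_right, subst sum.swap)
      (simp add: mult.commute)
  also have "\<dots> = (\<Sum>i\<in>UNIV. (x $ i * x $ i) *\<^sub>R (cl_gen i \<odot> (cl_gen i \<odot> a))) +
      (\<Sum>(i, j)\<in>{(i, j). i < j}. (x $ i * x $ j) *\<^sub>R (cl_gen i \<odot> (cl_gen j \<odot> a)) + (x $ j * x $ i) *\<^sub>R (cl_gen j \<odot> (cl_gen i \<odot> a)))"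
    by (rule sum_pairs_triangle)
  also have "(\<Sum>(i, j)\<in>{(i, j). i < j}. (x $ i * x $ j) *\<^sub>R (cl_gen i \<odot> (cl_gen j \<odot> a)) + (x $ j * x $ i) *\<^sub>R (cl_gen j \<odot> (cl_gen i \<odot> a))) = 0"
    by (rule sum.neutral) (auto simp: cl_gen_swap [OF less_imp_neq] mult.commute)
  also have "(\<Sum>i\<in>UNIV. (x $ i * x $ i) *\<^sub>R (cl_gen i \<odot> (cl_gen i \<odot> a))) = - ((x \<bullet> x) *\<^sub>R a)"
    by (simp add: cl_gen_square inner_vec_def sum_negf scaleR_sum_left)
  finally show ?thesis by simp
qed

lemma sphere_extension_radial:
  assumes x: "x \<noteq> 0" and D: "(sphere_extension f has_derivative D) (at x)"
  shows "D x = 0"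
proof -
  have "((\<lambda>t. sphere_extension f (x + t *\<^sub>R x)) has_vector_derivative D x) (at 0)"
    using has_vector_derivative_along_line [of "sphere_extension f" D x 0 x] D by simp
  moreover have "((\<lambda>t. sphere_extension f (x + t *\<^sub>R x)) has_vector_derivative 0) (at 0)"
  proof (rule has_vector_derivative_transform_within_open [of "\<lambda>_. sphere_extension f x" _ _ "{- 1<..}"])
    fix t :: real assume "t \<in> {- 1<..}"
    then have t: "0 < 1 + t" by simp
    have "x + t *\<^sub>R x = (1 + t) *\<^sub>R x" by (simp add: scaleR_add_left)
    then have "(x + t *\<^sub>R x) /\<^sub>R norm (x + t *\<^sub>R x) = x /\<^sub>R norm x" using t by simp
    then show "sphere_extension f x = sphere_extension f (x + t *\<^sub>R x)" by (simp add: sphere_extension_def)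
  qed auto
  ultimately show ?thesis by (rule vector_derivative_unique_at)
qed

lemma linear_axis_expansion:
  fixes D :: "real ^ 'a::finite \<Rightarrow> 'b::real_vector"
  assumes "linear D" shows "D x = (\<Sum>a\<in>UNIV. x $ a *\<^sub>R D (axis a 1))"
proof -
  have "x = (\<Sum>a\<in>UNIV. x $ a *\<^sub>R axis a 1)"
    by (simp add: vec_eq_iff axis_def if_distrib cong: if_cong)
  then have "D x = D (\<Sum>a\<in>UNIV. x $ a *\<^sub>R axis a 1)" by simp
  then show ?thesis by (simp only: linear_sum [OF assms] linear_cmul [OF assms])
qed

text \<open>On the sphere \<open>x D = \<Lambda> - E\<close>, where the Euler operator \<open>E\<close> annihilates the extension.\<close>

lemma sphere_dirac_eq:
  fixes f :: "real ^ ('n::{finite,linorder} option) \<Rightarrow> ('n option) clifford"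
  assumes x: "norm x = 1" and D: "(sphere_extension f has_derivative D) (at x)"
  shows "sphere_dirac f x = (real CARD('n) / 2) *\<^sub>R (cl_vec x \<odot> f x) - (\<Sum>a\<in>UNIV. cl_gen a \<odot> D (axis a 1))"
proof -
  let ?d = "\<lambda>a. D (axis a 1)"
  have "x \<noteq> 0" using x by auto
  then have E: "(\<Sum>a\<in>UNIV. x $ a *\<^sub>R ?d a) = 0"
    using sphere_extension_radial [OF _ D] linear_axis_expansion [OF has_derivative_linear [OF D], of x] by simp
  have "cl_vec x \<odot> (\<Sum>a\<in>UNIV. cl_gen a \<odot> ?d a) = (\<Sum>i\<in>UNIV. \<Sum>j\<in>UNIV. x $ i *\<^sub>R (cl_gen i \<odot> (cl_gen j \<odot> ?d j)))"
    by (simp add: cl_vec_def cl.sum_left cl.sum_right cl_mult_bilinear scaleR_sum_right) (rule sum.swap)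
  also have "\<dots> = (\<Sum>i\<in>UNIV. x $ i *\<^sub>R (cl_gen i \<odot> (cl_gen i \<odot> ?d i))) +
      (\<Sum>(i, j)\<in>{(i, j). i < j}. x $ i *\<^sub>R (cl_gen i \<odot> (cl_gen j \<odot> ?d j)) + x $ j *\<^sub>R (cl_gen j \<odot> (cl_gen i \<odot> ?d i)))"
    by (rule sum_pairs_triangle)
  also have "(\<Sum>i\<in>UNIV. x $ i *\<^sub>R (cl_gen i \<odot> (cl_gen i \<odot> ?d i))) = 0"
    using E by (simp add: cl_gen_square sum_negf)
  also have "(\<Sum>(i, j)\<in>{(i, j). i < j}. x $ i *\<^sub>R (cl_gen i \<odot> (cl_gen j \<odot> ?d j)) + x $ j *\<^sub>R (cl_gen j \<odot> (cl_gen i \<odot> ?d i)))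
      = sphere_Lambda f x"
    unfolding sphere_Lambda_def partial_deriv_eq [OF D]
    by (intro sum.cong refl)
      (auto simp: cl_gen_swap [OF less_imp_neq] cl_mult_assoc cl.diff_right cl_mult_bilinear)
  finally have "cl_vec x \<odot> sphere_Lambda f x = cl_vec x \<odot> (cl_vec x \<odot> (\<Sum>a\<in>UNIV. cl_gen a \<odot> ?d a))" by simp
  also have "\<dots> = - (\<Sum>a\<in>UNIV. cl_gen a \<odot> ?d a)" unfolding cl_vec_square using x by (simp add: dot_square_norm)
  finally show ?thesis by (simp add: sphere_dirac_def cl_mult_bilinear)
qed

subsection \<open>Monogenic fields on the sphere\<close>

lemma C1_fun_local:
  assumes "\<And>y. y \<in> S \<Longrightarrow> \<exists>T. open T \<and> y \<in> T \<and> C1_fun T f"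
  shows "C1_fun S f"
  unfolding C1_fun_def
proof (intro conjI ballI allI continuous_at_imp_continuous_on)
  fix y assume "y \<in> S"
  then obtain T where T: "open T" "y \<in> T" "C1_fun T f" using assms by blast
  show "f differentiable (at y)" using T unfolding C1_fun_def by blast
next
  fix h y assume "y \<in> S"
  then obtain T where T: "open T" "y \<in> T" "C1_fun T f" using assms by blast
  show "isCont (\<lambda>y. frechet_derivative f (at y) h) y"
    using C1_fun_derivative_continuous [OF T(3), of h] T(1,2) by (simp add: continuous_on_eq_continuous_at)
qed

lemma C1_fun_cong_open:
  assumes "open T" "C1_fun T g" "\<And>y. y \<in> T \<Longrightarrow> g y = f y"
  shows "C1_fun T f"
proof (rule C1_funI)
  show "(f has_derivative frechet_derivative g (at y)) (at y)" if "y \<in> T" for y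
    by (rule has_derivative_transform_within_open [OF C1_fun_has_derivative [OF assms(2) that] assms(1) that assms(3)])
  show "continuous_on T (\<lambda>y. frechet_derivative g (at y) h)" for h
    by (rule C1_fun_derivative_continuous [OF assms(2)])
qed

text \<open>
  In the definition of \<^const>\<open>C1_on\<close> the derivative is continuous as a map into the function space,
  that is, pointwise.
\<close>

definition locally_C1 :: "'a::real_normed_vector set \<Rightarrow> ('a \<Rightarrow> 'b::real_normed_vector) \<Rightarrow> bool" where
  "locally_C1 S f \<longleftrightarrow> (\<forall>x\<in>S. \<exists>W (F :: 'a \<Rightarrow> 'b) (F' :: 'a \<Rightarrow> 'a \<Rightarrow> 'b). open W \<and> x \<in> W \<and> (\<forall>y\<in>W. (F has_derivative F' y) (at y)) \<and>
     (\<forall>h. continuous_on W (\<lambda>y. F' y h)) \<and> (\<forall>y\<in>W. y \<in> S \<longrightarrow> F y = f y))"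

lemma locally_C1E:
  fixes f :: "'a::real_normed_vector \<Rightarrow> 'b::real_normed_vector"
  assumes "locally_C1 S f" "x \<in> S"
  obtains W and F :: "'a \<Rightarrow> 'b" and F' :: "'a \<Rightarrow> 'a \<Rightarrow> 'b" where "open W" "x \<in> W" "\<forall>y\<in>W. (F has_derivative F' y) (at y)"
    "\<forall>h. continuous_on W (\<lambda>y. F' y h)" "\<forall>y\<in>W. y \<in> S \<longrightarrow> F y = f y"
proof -
  from bspec [OF assms(1) [unfolded locally_C1_def] assms(2)] show thesis
    by (elim exE conjE) (rule that)
qed

lemma locally_C1I:
  fixes f :: "'a::real_normed_vector \<Rightarrow> 'b::real_normed_vector"
  assumes "\<And>x. x \<in> S \<Longrightarrow> \<exists>W (F :: 'a \<Rightarrow> 'b) (F' :: 'a \<Rightarrow> 'a \<Rightarrow> 'b). open W \<and> x \<in> W \<and> (\<forall>y\<in>W. (F has_derivative F' y) (at y)) \<and>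
     (\<forall>h. continuous_on W (\<lambda>y. F' y h)) \<and> (\<forall>y\<in>W. y \<in> S \<longrightarrow> F y = f y)"
  shows "locally_C1 S f"
  using assms unfolding locally_C1_def by (rule ballI)

lemma locally_C1_linear:
  fixes f :: "'a::real_normed_vector \<Rightarrow> 'b::real_normed_vector" and g :: "'b \<Rightarrow> 'c::real_normed_vector"
  assumes f: "locally_C1 S f" and h: "bounded_linear g"
  shows "locally_C1 S (\<lambda>x. g (f x))"
proof (rule locally_C1I)
  fix x assume x: "x \<in> S"
  from f x obtain W and F :: "'a \<Rightarrow> 'b" and F' :: "'a \<Rightarrow> 'a \<Rightarrow> 'b" where W: "open W" "x \<in> W" "\<forall>y\<in>W. (F has_derivative F' y) (at y)"
    "\<forall>h. continuous_on W (\<lambda>y. F' y h)" "\<forall>y\<in>W. y \<in> S \<longrightarrow> F y = f y" by (rule locally_C1E)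
  show "\<exists>W (F :: 'a \<Rightarrow> 'c) (F' :: 'a \<Rightarrow> 'a \<Rightarrow> 'c). open W \<and> x \<in> W \<and> (\<forall>y\<in>W. (F has_derivative F' y) (at y)) \<and>
      (\<forall>h. continuous_on W (\<lambda>y. F' y h)) \<and> (\<forall>y\<in>W. y \<in> S \<longrightarrow> F y = g (f y))"
  proof (intro exI [of _ W] exI [of _ "\<lambda>y. g (F y)"] exI [of _ "\<lambda>y h. g (F' y h)"] conjI ballI allI impI)
    show "((\<lambda>y. g (F y)) has_derivative (\<lambda>k. g (F' y k))) (at y)" if "y \<in> W" for y
      by (rule bounded_linear.has_derivative [OF h bspec [OF W(3) that]])
    show "continuous_on W (\<lambda>y. g (F' y k))" for k by (rule bounded_linear.continuous_on [OF h spec [OF W(4)]])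
  qed (use W in auto)
qed

lemma C1_on_slice:
  fixes f :: "'a::real_normed_vector \<Rightarrow> 'b::real_normed_vector \<Rightarrow> 'c::real_normed_vector"
  assumes f: "C1_on (U \<times> UNIV) (\<lambda>(x, u). f x u)"
  shows "locally_C1 U (\<lambda>x. f x a)"
proof (rule locally_C1I)
  fix x assume x: "x \<in> U"
  then have xa: "(x, a) \<in> U \<times> UNIV" by simp
  from bspec [OF f [unfolded C1_on_def] xa] obtain W and F :: "'a \<times> 'b \<Rightarrow> 'c" and F' :: "'a \<times> 'b \<Rightarrow> ('a \<times> 'b) \<Rightarrow>\<^sub>L 'c"
    where W: "open W" "(x, a) \<in> W" "\<forall>y\<in>W. (F has_derivative blinfun_apply (F' y)) (at y)"
    "continuous_on W (\<lambda>y. blinfun_apply (F' y))" "\<forall>y\<in>W \<inter> U \<times> UNIV. F y = (case y of (x, u) \<Rightarrow> f x u)"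
    by (elim exE conjE)
  have j: "((\<lambda>y. (y, a)) has_derivative (\<lambda>h. (h, 0))) (at y)" for y :: 'a
    by (auto intro!: derivative_eq_intros)
  have cj: "continuous_on S (\<lambda>y :: 'a. (y, a))" for S by (intro continuous_intros)
  let ?W = "(\<lambda>y. (y, a)) -` W"
  show "\<exists>W (F :: 'a \<Rightarrow> 'c) (F' :: 'a \<Rightarrow> 'a \<Rightarrow> 'c). open W \<and> x \<in> W \<and> (\<forall>y\<in>W. (F has_derivative F' y) (at y)) \<and>
      (\<forall>h. continuous_on W (\<lambda>y. F' y h)) \<and> (\<forall>y\<in>W. y \<in> U \<longrightarrow> F y = f y a)"
  proof (intro exI [of _ ?W] exI [of _ "\<lambda>y. F (y, a)"] exI [of _ "\<lambda>y h. blinfun_apply (F' (y, a)) (h, 0)"] conjI ballI allI impI)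
    show "open ?W" by (rule open_vimage [OF W(1) cj])
    show "x \<in> ?W" using W(2) by simp
    show "((\<lambda>y. F (y, a)) has_derivative (\<lambda>h. blinfun_apply (F' (y, a)) (h, 0))) (at y)" if "y \<in> ?W" for y
      using diff_chain_at [OF j bspec [OF W(3)], of y] that by (simp add: comp_def)
    show "continuous_on ?W (\<lambda>y. blinfun_apply (F' (y, a)) (h, 0))" for h
      by (rule continuous_on_compose2 [OF continuous_on_product_then_coordinatewise [OF W(4)] cj]) auto
    show "F (y, a) = f y a" if "y \<in> ?W" "y \<in> U" for y using bspec [OF W(5), of "(y, a)"] that by simp
  qed
qed

section \<open>Extension constant along rays\<close>

text \<open>Where the extension along rays is determined by values on \<open>U\<close>. For
  \<open>U\<close> relatively open it is an open set, so differentiation on the sphere becomes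
  differentiation on an open set of the ambient space.\<close>

definition cone_over :: "(real ^ 'a::finite) set \<Rightarrow> (real ^ 'a) set" where
  "cone_over U = {x. x \<noteq> 0 \<and> x /\<^sub>R norm x \<in> U}"

lemma continuous_on_normalize: "continuous_on (- {0}) (\<lambda>x :: 'a::real_normed_vector. x /\<^sub>R norm x)"
  by (intro continuous_intros) auto

lemma open_cone_over:
  assumes "openin (top_of_set (sphere 0 1)) U" shows "open (cone_over U)"
proof -
  obtain T where T: "open T" "U = sphere 0 1 \<inter> T" using assms by (auto simp: openin_open)
  have "cone_over U = - {0} \<inter> (\<lambda>x. x /\<^sub>R norm x) -` T" unfolding cone_over_def T(2) by auto
  then show ?thesis
    by (simp only: continuous_open_preimage [OF continuous_on_normalize open_Compl [OF closed_singleton] T(1)])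
qed

lemma subset_cone_over:
  assumes "U \<subseteq> sphere 0 1" "x \<in> U" shows "x \<in> cone_over U" "norm x = 1" "x /\<^sub>R norm x = x"
proof -
  show "norm x = 1" using assms by auto
  then show "x /\<^sub>R norm x = x" "x \<in> cone_over U" using assms(2) by (auto simp: cone_over_def)
qed

lemma normalize_has_derivative:
  fixes y :: "'a::real_inner"
  assumes "y \<noteq> 0"
  shows "((\<lambda>x. x /\<^sub>R norm x) has_derivative
    (\<lambda>h. inverse (norm y) *\<^sub>R h + (- (inverse (norm y) * (h \<bullet> sgn y) * inverse (norm y))) *\<^sub>R y)) (at y)"
  using assms
  using has_derivative_scaleR [OF Deriv.has_derivative_inverse [OF _ has_derivative_norm [OF assms]] has_derivative_ident] assms
  by simp

text \<open>Near a point of the cone the extension along rays is a local extension of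
  \<open>f\<close> composed with normalisation to the sphere.\<close>

lemma C1_fun_sphere_extension:
  fixes f :: "real ^ 'a::finite \<Rightarrow> real ^ 'b::finite"
  assumes U: "openin (top_of_set (sphere 0 1)) U" and f: "locally_C1 U f"
  shows "C1_fun (cone_over U) (\<lambda>x. sphere_extension f x $ A)"
proof (rule C1_fun_local)
  fix y assume y: "y \<in> cone_over U"
  let ?s = "\<lambda>x :: real ^ 'a. x /\<^sub>R norm x"
  let ?d = "\<lambda>y h :: real ^ 'a. inverse (norm y) *\<^sub>R h + (- (inverse (norm y) * (h \<bullet> sgn y) * inverse (norm y))) *\<^sub>R y"
  have "?s y \<in> U" using y by (simp add: cone_over_def)
  from f this obtain W and F :: "real ^ 'a \<Rightarrow> real ^ 'b" and F' :: "real ^ 'a \<Rightarrow> real ^ 'a \<Rightarrow> real ^ 'b" where W: "open W" "?s y \<in> W" "\<forall>y\<in>W. (F has_derivative F' y) (at y)"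
    "\<forall>h. continuous_on W (\<lambda>y. F' y h)" "\<forall>y\<in>W. y \<in> U \<longrightarrow> F y = f y" by (rule locally_C1E)
  let ?T = "cone_over U \<inter> (- {0} \<inter> ?s -` W)"
  have T: "open ?T"
    by (rule open_Int [OF open_cone_over [OF U]
          continuous_open_preimage [OF continuous_on_normalize open_Compl [OF closed_singleton] W(1)]])
  have yT: "y \<in> ?T" using y W(2) by (auto simp: cone_over_def)
  have cs: "continuous_on ?T ?s" by (rule continuous_on_subset [OF continuous_on_normalize]) auto
  have "C1_fun ?T (\<lambda>x. F (?s x) $ A)"
  proof (rule C1_funI)
    fix z assume z: "z \<in> ?T"
    then have "z \<noteq> 0" "?s z \<in> W" by auto
    from diff_chain_at [OF normalize_has_derivative [OF this(1)] bspec [OF W(3) this(2)]]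
    have "((\<lambda>x. F (?s x)) has_derivative (\<lambda>h. F' (?s z) (?d z h))) (at z)"
      by (simp add: comp_def)
    then show "((\<lambda>x. F (?s x) $ A) has_derivative (\<lambda>h. F' (?s z) (?d z h) $ A)) (at z)"
      by (rule bounded_linear.has_derivative [OF bounded_linear_vec_nth])
  next
    fix h
    \<comment> \<open>Continuity of \<open>F'\<close> is known for fixed directions only, while the
      direction \<open>?d z h\<close> varies with \<open>z\<close>; hence the expansion in the
      axes.\<close>
    have e: "F' (?s z) (?d z h) = (\<Sum>b\<in>UNIV. ?d z h $ b *\<^sub>R F' (?s z) (axis b 1))" if "z \<in> ?T" for z
      by (rule linear_axis_expansion [OF has_derivative_linear [OF bspec [OF W(3)]]]) (use that in auto)
    have "continuous_on ?T (\<lambda>z. \<Sum>b\<in>UNIV. ?d z h $ b *\<^sub>R F' (?s z) (axis b 1))"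
      by (intro continuous_on_sum continuous_on_scaleR continuous_on_component continuous_on_compose2 [OF spec [OF W(4)] cs])
        (auto intro!: continuous_intros)
    then have "continuous_on ?T (\<lambda>z. F' (?s z) (?d z h))" by (rule continuous_on_eq) (rule e [symmetric])
    then show "continuous_on ?T (\<lambda>z. F' (?s z) (?d z h) $ A)" by (rule continuous_on_component)
  qed
  then have "C1_fun ?T (\<lambda>x. sphere_extension f x $ A)"
    by (rule C1_fun_cong_open [OF T]) (use W(5) in \<open>auto simp: sphere_extension_def cone_over_def\<close>)
  then show "\<exists>T. open T \<and> y \<in> T \<and> C1_fun T (\<lambda>x. sphere_extension f x $ A)" using T yT by blast
qed

text \<open>The mechanism by which properties of \<open>f x\<close> as a polynomial in
  \<open>u\<close> pass to its derivatives in \<open>x\<close>.\<close>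

lemma linear_relation_derivative:
  assumes "open S" "x \<in> S" and F: "\<And>i. i < N \<Longrightarrow> (F i has_derivative D i) (at x)"
    and T: "\<And>i. i < N \<Longrightarrow> bounded_linear (T i)" and eq: "\<And>y. y \<in> S \<Longrightarrow> (\<Sum>i<N. T i (F i y)) = 0"
  shows "(\<Sum>i<(N::nat). T i (D i h)) = 0"
proof -
  have d: "((\<lambda>y. \<Sum>i<N. T i (F i y)) has_derivative (\<lambda>h. \<Sum>i<N. T i (D i h))) (at x)"
    using F T by (intro has_derivative_sum bounded_linear.has_derivative [of "T _"]) auto
  have z: "((\<lambda>y. \<Sum>i<N. T i (F i y)) has_derivative (\<lambda>_. 0)) (at x)"
    by (rule has_derivative_transform_within_open [of "\<lambda>_. 0" _ _ UNIV S]) (use assms in auto)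
  show ?thesis using fun_cong [OF has_derivative_unique [OF d z], of h] .
qed

lemma left_dirac_expansion:
  fixes L :: "nat \<Rightarrow> real ^ 'n::{finite,linorder} \<Rightarrow> real"
  assumes L: "\<And>i. i < N \<Longrightarrow> real_polynomial_function (L i)"
  shows "left_dirac (\<lambda>u. \<Sum>i<N. L i u *\<^sub>R c i) u
    = (\<Sum>i<N. \<Sum>j\<in>UNIV. cl_gen (Some j) \<odot> (partial_deriv j (L i) u *\<^sub>R c i))"
proof -
  have "\<exists>D. (L i has_derivative D) (at u)" if "i < N" for i
    using real_polynomial_second_derivative [OF L [OF that]] by blast
  then obtain D where D: "\<And>i. i < N \<Longrightarrow> (L i has_derivative D i) (at u)" by metis
  have "partial_deriv j (\<lambda>u. \<Sum>i<N. L i u *\<^sub>R c i) u = (\<Sum>i<N. partial_deriv j (\<lambda>u. L i u *\<^sub>R c i) u)" for j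
    by (rule partial_deriv_sum [where D="\<lambda>i h. D i h *\<^sub>R c i"])
      (use D in \<open>auto intro: has_derivative_scaleR_left\<close>)
  also have "(\<Sum>i<N. partial_deriv j (\<lambda>u. L i u *\<^sub>R c i) u) = (\<Sum>i<N. partial_deriv j (L i) u *\<^sub>R c i)" for j
    by (intro sum.cong refl partial_deriv_linear [OF bounded_linear_scaleR_left D]) simp
  finally show ?thesis unfolding left_dirac_def by (simp add: cl.sum_right sum.swap [of _ UNIV])
qed

lemma polynomial_expansion:
  assumes "\<And>i. i < N \<Longrightarrow> real_polynomial_function (L i)"
  shows "polynomial_function (\<lambda>u. \<Sum>i<(N::nat). L i u *\<^sub>R c i)"
  using assms by (intro polynomial_function_sum polynomial_function_mult) (auto simp: real_polynomial_function_eq)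

section \<open>Coefficients of a field of monogenic polynomials\<close>

text \<open>Stated for left monogenic values so as to be instantiated twice, with \<open>f\<close>
  and with the reversion of \<open>g\<close>, over the same weights and nodes.\<close>

locale monogenic_field =
  fixes U :: "(real ^ ('n::{finite,linorder} option)) set" and f :: "real ^ ('n::{finite,linorder} option) \<Rightarrow> 'n cl_fun"
    and k N :: nat and L :: "nat \<Rightarrow> real ^ ('n::{finite,linorder}) \<Rightarrow> real" and a :: "nat \<Rightarrow> real ^ ('n::{finite,linorder})"
  assumes U: "openin (top_of_set (sphere 0 1)) U"
    and C1: "\<And>u. locally_C1 U (\<lambda>x. f x u)"
    and monogenic: "\<And>x. x \<in> U \<Longrightarrow> f x \<in> left_monogenic (int k)"
    and L: "\<And>i. i < N \<Longrightarrow> real_polynomial_function (L i)"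
    and interpolation: "\<And>p u. p \<in> homogeneous_polys k \<Longrightarrow> p u = (\<Sum>i<N. L i u *\<^sub>R p (a i))"
begin

definition F :: "nat \<Rightarrow> real ^ ('n option) \<Rightarrow> ('n option) clifford" where
  "F i = sphere_extension (\<lambda>x. f x (a i))"

text \<open>Assembled from components, the form in which \<open>C1_fun\<close> provides
  derivatives.\<close>

definition dF :: "nat \<Rightarrow> real ^ ('n option) \<Rightarrow> real ^ ('n option) \<Rightarrow> ('n option) clifford" where
  "dF i x h = (\<chi> A. frechet_derivative (\<lambda>x. F i x $ A) (at x) h)"

text \<open>For \<open>x\<close> in \<open>U\<close>, the coefficient of \<open>L i\<close> in the
  spherical Dirac operator applied to the field, with that operator expressed through the flat
  one.\<close>

definition dirac_coeff :: "nat \<Rightarrow> real ^ ('n option) \<Rightarrow> ('n option) clifford" where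
  "dirac_coeff i x = (real CARD('n) / 2) *\<^sub>R (cl_vec x \<odot> F i x) - (\<Sum>b\<in>UNIV. cl_gen b \<odot> dF i x (axis b 1))"

lemma C1_fun_F: "C1_fun (cone_over U) (\<lambda>x. F i x $ A)"
  unfolding F_def by (rule C1_fun_sphere_extension [OF U C1])

lemma F_has_derivative: "x \<in> cone_over U \<Longrightarrow> (F i has_derivative dF i x) (at x)"
  by (rule has_derivative_vec_componentwise) (simp add: dF_def C1_fun_has_derivative [OF C1_fun_F])

lemma U_sphere: "U \<subseteq> sphere 0 1"
  using openin_imp_subset [OF U] .

lemmas on_U = subset_cone_over [OF U_sphere]

lemma dF_radial: "x \<in> cone_over U \<Longrightarrow> dF i x x = 0"
  using sphere_extension_radial [of x] F_has_derivative [of x i] unfolding F_def cone_over_def by blast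

lemma expansion: "x \<in> cone_over U \<Longrightarrow> f (x /\<^sub>R norm x) u = (\<Sum>i<N. L i u *\<^sub>R F i x)"
proof -
  assume "x \<in> cone_over U"
  then have "f (x /\<^sub>R norm x) \<in> homogeneous_polys k"
    using monogenic [of "x /\<^sub>R norm x"] by (simp add: cone_over_def left_monogenic_iff)
  then show ?thesis by (simp add: interpolation [of "f (x /\<^sub>R norm x)" u] F_def sphere_extension_def)
qed

text \<open>Being a monogenic polynomial is a linear condition on the coefficients, so it is inherited by derivatives.\<close>

lemma derivative_monogenic:
  assumes x: "x \<in> cone_over U"
  shows "(\<lambda>u. \<Sum>i<N. L i u *\<^sub>R dF i x h) \<in> left_monogenic (int k)"
  unfolding left_monogenic_iff homogeneous_polys_def
proof (intro conjI CollectI allI)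
  note rel = linear_relation_derivative [OF open_cone_over [OF U] x F_has_derivative [OF x], where N=N and h=h]
  have fx: "f (y /\<^sub>R norm y) \<in> homogeneous_polys k" "left_dirac (f (y /\<^sub>R norm y)) u = 0" if "y \<in> cone_over U" for y u
    using that monogenic [of "y /\<^sub>R norm y"] by (auto simp: cone_over_def left_monogenic_iff)
  have fe: "f (y /\<^sub>R norm y) = (\<lambda>u. \<Sum>i<N. L i u *\<^sub>R F i y)" if "y \<in> cone_over U" for y
    using expansion [OF that] by (simp add: fun_eq_iff)
  show "polynomial_function (\<lambda>u. \<Sum>i<N. L i u *\<^sub>R dF i x h)" by (rule polynomial_expansion [OF L])
  show "(\<Sum>i<N. L i (t *\<^sub>R u) *\<^sub>R dF i x h) = t ^ k *\<^sub>R (\<Sum>i<N. L i u *\<^sub>R dF i x h)" for t u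
  proof -
    have "(\<Sum>i<N. (L i (t *\<^sub>R u) - t ^ k * L i u) *\<^sub>R F i y) = 0" if y: "y \<in> cone_over U" for y
      using homogeneous_polysD(2) [OF fx(1) [OF y], of t u]
      by (simp add: fe [OF y] scaleR_diff_left sum_subtractf scaleR_sum_right)
    then have "(\<Sum>i<N. (L i (t *\<^sub>R u) - t ^ k * L i u) *\<^sub>R dF i x h) = 0"
      by (rule rel [where T="\<lambda>i c. (L i (t *\<^sub>R u) - t ^ k * L i u) *\<^sub>R c", OF bounded_linear_scaleR_right])
    then show ?thesis by (simp add: scaleR_diff_left sum_subtractf scaleR_sum_right)
  qed
  show "left_dirac (\<lambda>u. \<Sum>i<N. L i u *\<^sub>R dF i x h) u = 0" for u
  proof -
    have "(\<Sum>i<N. \<Sum>j\<in>UNIV. cl_gen (Some j) \<odot> (partial_deriv j (L i) u *\<^sub>R F i y)) = 0" if y: "y \<in> cone_over U" for y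
      using fx(2) [OF y, of u] by (simp only: fe [OF y] left_dirac_expansion [OF L])
    moreover have "bounded_linear (\<lambda>c. \<Sum>j\<in>UNIV. cl_gen (Some j) \<odot> (partial_deriv j (L i) u *\<^sub>R c))" for i
      by (intro bounded_linear_sum bounded_linear_compose [OF cl.bounded_linear_right bounded_linear_scaleR_right])
    ultimately have "(\<Sum>i<N. \<Sum>j\<in>UNIV. cl_gen (Some j) \<odot> (partial_deriv j (L i) u *\<^sub>R dF i x h)) = 0"
      by (intro rel [where T="\<lambda>i c. \<Sum>j\<in>UNIV. cl_gen (Some j) \<odot> (partial_deriv j (L i) u *\<^sub>R c)"])
    then show ?thesis by (simp only: left_dirac_expansion [OF L])
  qed
qed

lemma sphere_dirac_expansion:
  assumes x: "x \<in> U"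
  shows "sphere_dirac (\<lambda>y. f y u) x = (\<Sum>i<N. L i u *\<^sub>R dirac_coeff i x)"
proof -
  have "((\<lambda>y. \<Sum>i<N. L i u *\<^sub>R F i y) has_derivative (\<lambda>h. \<Sum>i<N. L i u *\<^sub>R dF i x h)) (at x)"
    by (intro has_derivative_sum has_derivative_scaleR_right F_has_derivative on_U x)
  then have "(sphere_extension (\<lambda>y. f y u) has_derivative (\<lambda>h. \<Sum>i<N. L i u *\<^sub>R dF i x h)) (at x)"
    by (rule has_derivative_transform_within_open [OF _ open_cone_over [OF U] on_U(1) [OF x]])
      (simp add: sphere_extension_def flip: expansion)
  note sphere_dirac_eq [OF on_U(2) [OF x] this]
  moreover have "f x u = (\<Sum>i<N. L i u *\<^sub>R F i x)" using expansion [OF on_U(1) [OF x], of u] on_U(3) [OF x] by simp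
  ultimately show ?thesis
    by (simp add: dirac_coeff_def cl.sum_right cl_mult_bilinear scaleR_sum_right scaleR_diff_right sum_subtractf
        sum.swap [of _ UNIV] mult.commute)
qed

text \<open>The values and \<open>x\<close>-derivatives of the field are monogenic in
  \<open>u\<close>, hence harmonic. Left multiplication by \<open>cl_vec x\<close> and
  \<open>cl_gen b\<close> preserves harmonicity, though in general not monogenicity, so the result
  lies in the domain of \<open>left_proj\<close>.\<close>

lemma sphere_dirac_harmonic:
  assumes x: "x \<in> U"
  shows "(\<lambda>u. sphere_dirac (\<lambda>y. f y u) x) \<in> harmonic_polys k"
proof -
  define m where "m b u = (\<Sum>i<N. L i u *\<^sub>R dF i x (axis b 1))" for b u
  have m: "m b \<in> harmonic_polys k" for b
    unfolding m_def [abs_def] by (rule left_monogenic_harmonic [OF derivative_monogenic [OF on_U(1) [OF x]]])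
  have fx: "f x \<in> harmonic_polys k" by (rule left_monogenic_harmonic [OF monogenic [OF x]])
  have e: "f x u = (\<Sum>i<N. L i u *\<^sub>R F i x)" for u using expansion [OF on_U(1) [OF x], of u] on_U(3) [OF x] by simp
  have "(\<lambda>u. (real CARD('n) / 2) *\<^sub>R cl_vec x \<odot> f x u + (\<Sum>b\<in>UNIV. (- cl_gen b) \<odot> m b u)) \<in> harmonic_polys k"
    by (intro harmonic_polys_add harmonic_polys_sum harmonic_polys_cl_mult_left m fx)
  moreover have "(real CARD('n) / 2) *\<^sub>R cl_vec x \<odot> f x u + (\<Sum>b\<in>UNIV. (- cl_gen b) \<odot> m b u)
      = sphere_dirac (\<lambda>y. f y u) x" for u
    unfolding sphere_dirac_expansion [OF x] m_def dirac_coeff_def e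
    by (simp add: cl.sum_right cl_mult_bilinear cl.minus_left scaleR_sum_right scaleR_diff_right sum_subtractf
        sum.swap [of _ UNIV] sum_negf)
  ultimately show ?thesis by simp
qed

text \<open>A vanishing projection leaves only the summand \<open>cl_vec_n u \<odot> q u\<close> of
  the Fischer decomposition.\<close>

lemma rarita_schwinger_zero:
  assumes x: "x \<in> U" and z: "\<And>u. left_proj k (\<lambda>u. sphere_dirac (\<lambda>y. f y u) x) u = 0"
  shows "\<exists>q\<in>left_monogenic (int k - 1). \<forall>u. (\<Sum>i<N. L i u *\<^sub>R dirac_coeff i x) = cl_vec_n u \<odot> q u"
proof -
  obtain q where q: "q \<in> left_monogenic (int k - 1)" "(\<lambda>u. sphere_dirac (\<lambda>y. f y u) x)
      = (\<lambda>u. left_proj k (\<lambda>u. sphere_dirac (\<lambda>y. f y u) x) u + cl_vec_n u \<odot> q u)"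
    using left_proj_decomposition [OF sphere_dirac_harmonic [OF x]] by blast
  have "(\<Sum>i<N. L i u *\<^sub>R dirac_coeff i x) = cl_vec_n u \<odot> q u" for u
    using fun_cong [OF q(2), of u] by (simp only: z flip: sphere_dirac_expansion [OF x]) (simp only: add_0)
  with q(1) show ?thesis by blast
qed

end

lemma left_monogenicD:
  fixes q :: "('n::{finite,linorder}) cl_fun"
  assumes "q \<in> left_monogenic j"
  shows "polynomial_function q" "left_dirac q u = 0"
  using assms by (auto simp: left_monogenic_def homogeneous_polys_def left_dirac_zero left_dirac_def [symmetric] split: if_splits)

lemma right_monogenicD:
  fixes q :: "('n::{finite,linorder}) cl_fun"
  assumes "q \<in> right_monogenic j"
  shows "polynomial_function q" "(\<Sum>j\<in>UNIV. partial_deriv j q u \<odot> cl_gen (Some j)) = 0"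
  using assms
  by (auto simp: right_monogenic_def homogeneous_polys_def partial_deriv_zero cl.zero_left split: if_splits)

section \<open>Orthogonality and the pairing of coefficients\<close>

lemma sphere_pairing_monogenic_orthogonal:
  fixes P Q :: "('n::{finite,linorder}) cl_fun"
  assumes "P \<in> right_monogenic i" "Q \<in> left_monogenic j"
  shows "sphere_pairing P (\<lambda>u. cl_vec_n u \<odot> Q u) = 0"
  by (rule sphere_pairing_orthogonal) (rule right_monogenicD [OF assms(1)] left_monogenicD [OF assms(2)])+

lemma sphere_pairing_add_right:
  fixes P Q R :: "('n::{finite,linorder}) cl_fun"
  assumes "polynomial_function P" "polynomial_function Q" "polynomial_function R"
  shows "sphere_pairing P (\<lambda>u. Q u + R u) = sphere_pairing P Q + sphere_pairing P R"
  unfolding sphere_pairing_def cl.add_right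
  by (intro set_integral_add(2) sphere_integrable_pairing assms)

text \<open>The summand that the projection removes is orthogonal to right monogenic
  polynomials.\<close>

lemma sphere_pairing_left_proj:
  fixes P h :: "('n::{finite,linorder}) cl_fun"
  assumes P: "P \<in> right_monogenic (int k)" and h: "h \<in> harmonic_polys k"
  shows "sphere_pairing P (left_proj k h) = sphere_pairing P h"
proof -
  obtain q where q: "left_proj k h \<in> left_monogenic (int k)" "q \<in> left_monogenic (int k - 1)"
    "h = (\<lambda>u. left_proj k h u + cl_vec_n u \<odot> q u)"
    using left_proj_decomposition [OF h] by blast
  have uq: "polynomial_function (\<lambda>u. cl_vec_n u \<odot> q u)"
    by (intro polynomial_function_cl_mult left_monogenicD(1) [OF q(2)]
        polynomial_function_bounded_linear bounded_linear_cl_vec_n)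
  have "sphere_pairing P h = sphere_pairing P (\<lambda>u. left_proj k h u + cl_vec_n u \<odot> q u)"
    by (rule arg_cong [OF q(3)])
  also have "\<dots> = sphere_pairing P (left_proj k h) + sphere_pairing P (\<lambda>u. cl_vec_n u \<odot> q u)"
    by (rule sphere_pairing_add_right [OF right_monogenicD(1) [OF P] left_monogenicD(1) [OF q(1)] uq])
  finally show ?thesis using sphere_pairing_monogenic_orthogonal [OF P q(2)] by simp
qed

lemma C1_fun_cl_mult:
  fixes p q :: "'a::real_normed_vector \<Rightarrow> 'b::{finite,linorder} clifford"
  assumes "\<And>A. C1_fun S (\<lambda>x. p x $ A)" "\<And>A. C1_fun S (\<lambda>x. q x $ A)"
  shows "C1_fun S (\<lambda>x. (p x \<odot> q x) $ C)"
proof -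
  have eq: "(\<lambda>x. (p x \<odot> q x) $ C) = (\<lambda>x. \<Sum>A\<in>UNIV. \<Sum>B\<in>UNIV. p x $ A * q x $ B * (cl_sign A B * cl_basis (sym_diff A B) $ C))"
    by (simp add: cl_mult_def fun_eq_iff mult_ac)
  show ?thesis unfolding eq by (intro C1_fun_sum C1_fun_mult C1_fun_const assms)
qed

text \<open>The pairing over \<open>u\<close> in terms of coefficients; \<open>w\<close> stands for
  the Gram matrix of the \<open>L i\<close>.\<close>

definition coeff_pairing ::
    "nat \<Rightarrow> (nat \<Rightarrow> nat \<Rightarrow> real) \<Rightarrow> (nat \<Rightarrow> 'a::{finite,linorder} clifford) \<Rightarrow> (nat \<Rightarrow> 'a clifford) \<Rightarrow> 'a clifford" where
  "coeff_pairing N w p q = (\<Sum>i<N. \<Sum>l<N. w i l *\<^sub>R (p i \<odot> q l))"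

lemma coeff_pairing_bilinear:
  "coeff_pairing N w (\<lambda>i. p i - p' i) q = coeff_pairing N w p q - coeff_pairing N w p' q"
  "coeff_pairing N w p (\<lambda>i. q i - q' i) = coeff_pairing N w p q - coeff_pairing N w p q'"
  "coeff_pairing N w (\<lambda>i. r *\<^sub>R p i) q = r *\<^sub>R coeff_pairing N w p q"
  "coeff_pairing N w p (\<lambda>i. r *\<^sub>R q i) = r *\<^sub>R coeff_pairing N w p q"
  by (simp_all add: coeff_pairing_def cl_mult_bilinear cl.diff_left cl.diff_right scaleR_add_right scaleR_diff_right
      sum.distrib sum_subtractf scaleR_sum_right mult_ac)

lemma coeff_pairing_sum:
  "coeff_pairing N w (\<lambda>i. \<Sum>b\<in>S. p b i) q = (\<Sum>b\<in>S. coeff_pairing N w (p b) q)"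
  "coeff_pairing N w p' (\<lambda>i. \<Sum>b\<in>S. q' b i) = (\<Sum>b\<in>S. coeff_pairing N w p' (q' b))"
  by (simp_all add: coeff_pairing_def cl.sum_left cl.sum_right scaleR_sum_right sum.swap [of _ S])

text \<open>Lets a generator between the two arguments act from the left on the coefficients of
  \<open>f\<close> or from the right on those of \<open>g\<close>, as the two Dirac operators
  require.\<close>

lemma coeff_pairing_assoc:
  "coeff_pairing N w (\<lambda>i. p i \<odot> c) q = coeff_pairing N w p (\<lambda>l. c \<odot> q l)"
  by (simp add: coeff_pairing_def cl_mult_assoc)

lemma coeff_pairing_has_derivative:
  assumes "\<And>i. i < N \<Longrightarrow> (p i has_derivative p' i) (at x)" "\<And>i. i < N \<Longrightarrow> (q i has_derivative q' i) (at x)"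
  shows "((\<lambda>x. coeff_pairing N w (\<lambda>i. p i x) (\<lambda>l. q l x)) has_derivative
    (\<lambda>h. coeff_pairing N w (\<lambda>i. p i x) (\<lambda>l. q' l h) + coeff_pairing N w (\<lambda>i. p' i h) (\<lambda>l. q l x))) (at x)"
proof -
  have "((\<lambda>x. coeff_pairing N w (\<lambda>i. p i x) (\<lambda>l. q l x)) has_derivative
    (\<lambda>h. \<Sum>i<N. \<Sum>l<N. w i l *\<^sub>R (p i x \<odot> q' l h + p' i h \<odot> q l x))) (at x)"
    unfolding coeff_pairing_def
    by (intro has_derivative_sum has_derivative_scaleR_right cl.FDERIV) (use assms in auto)
  then show ?thesis by (simp add: coeff_pairing_def scaleR_add_right sum.distrib)
qed

lemma coeff_pairing_cl_vec:
  "(\<Sum>b\<in>UNIV. v $ b *\<^sub>R coeff_pairing N w p (\<lambda>l. cl_gen b \<odot> q l)) = coeff_pairing N w p (\<lambda>l. cl_vec v \<odot> q l)"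
proof -
  have "(\<lambda>l. cl_vec v \<odot> q l) = (\<lambda>l. \<Sum>b\<in>UNIV. v $ b *\<^sub>R (cl_gen b \<odot> q l))"
    by (simp add: cl_vec_def cl.sum_left cl_mult_bilinear)
  then show ?thesis by (simp only: coeff_pairing_sum(2) coeff_pairing_bilinear(4))
qed

theorem corollary1:
  fixes U V :: "(real ^ ('n::{finite,linorder} option)) set"
    and f g :: "real ^ ('n option) \<Rightarrow> 'n cl_fun"
    and \<nu> :: "real ^ ('n option) \<Rightarrow> real ^ ('n option)"
    and k :: nat
  assumes "sphere_domain U"
    and "sphere_domain V" and "V \<subseteq> U"
    and "sphere_boundary V \<subseteq> U" and "C1_boundary V"
    and "\<And>x. x \<in> sphere_boundary V \<Longrightarrow> outward_unit_normal V x (\<nu> x)"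
    and "C1_on (U \<times> UNIV) (\<lambda>(x, u). f x u)"
    and "\<And>x. x \<in> U \<Longrightarrow> f x \<in> left_monogenic (int k)"
    and "C1_on (U \<times> UNIV) (\<lambda>(x, u). g x u)"
    and "\<And>x. x \<in> U \<Longrightarrow> g x \<in> right_monogenic (int k)"
    and "\<And>x u. x \<in> U \<Longrightarrow> rarita_schwinger k f x u = 0"
    and "\<And>x u. x \<in> U \<Longrightarrow> rarita_schwinger_right k g x u = 0"
  shows "(LINT x:sphere_boundary V|hausdorff_measure (CARD('n) - 1).
            sphere_pairing (g x) (left_proj k (\<lambda>u. cl_vec (\<nu> x) \<odot> f x u))) = 0"
proof -
  note rev_simps = cl_reversion_involution cl_reversion_mult linear_sum [OF cl_reversion_linear]
    linear_diff [OF cl_reversion_linear] linear_cmul [OF cl_reversion_linear] linear_0 [OF cl_reversion_linear]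
    cl_reversion_vec cl_reversion_gen cl_reversion_vec_n
  have U: "openin (top_of_set (sphere 0 1)) U" and V: "openin (top_of_set (sphere 0 1)) V"
    using assms(1,2) by (simp_all add: sphere_domain_def)
  obtain N :: nat and L :: "nat \<Rightarrow> real ^ 'n::{finite,linorder} \<Rightarrow> real" and a where
    I: "\<forall>i<N. real_polynomial_function (L i)"
      "\<forall>p\<in>homogeneous_polys k. \<forall>u. p u = (\<Sum>i<N. L i u *\<^sub>R p (a i))"
    using homogeneous_interpolation [of k] by (elim exE conjE) (rule that)
  have L: "real_polynomial_function (L i)" if "i < N" for i using I(1) that by simp
  have interp: "p u = (\<Sum>i<N. L i u *\<^sub>R p (a i))" if "p \<in> homogeneous_polys k" for p u
    by (rule spec [OF bspec [OF I(2) that]])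
  interpret l: monogenic_field U f k N L a
    by unfold_locales (use U L interp assms(8) C1_on_slice [OF assms(7)] in simp_all)
  interpret r: monogenic_field U "\<lambda>x u. cl_reversion (g x u)" k N L a
    by unfold_locales (use U L interp assms(10) locally_C1_linear [OF C1_on_slice [OF assms(9)] bounded_linear_cl_reversion]
        in \<open>simp_all add: right_monogenic_reversion\<close>)
  \<comment> \<open>Coefficients of \<open>g\<close>, of its derivatives and of its right spherical
    Dirac derivative, obtained by undoing the reversion.\<close>
  define G where "G i x = cl_reversion (r.F i x)" for i x
  define dG where "dG i x h = cl_reversion (r.dF i x h)" for i x h
  define T where "T i x = cl_reversion (r.dirac_coeff i x)" for i x
  define w where "w i m = (LINT u:sphere 0 1|hausdorff_measure (CARD('n) - 1). L i u * L m u)" for i m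
  have pairing: "sphere_pairing (\<lambda>u. \<Sum>i<N. L i u *\<^sub>R c i) (\<lambda>u. \<Sum>i<N. L i u *\<^sub>R d i) = coeff_pairing N w c d" for c d
    unfolding coeff_pairing_def w_def by (rule sphere_pairing_expansion [OF L])
  have f_expand: "f x = (\<lambda>u. \<Sum>i<N. L i u *\<^sub>R l.F i x)" if "x \<in> U" for x
    using l.expansion [OF l.on_U(1) [OF that]] l.on_U(3) [OF that] by (simp add: fun_eq_iff)
  have g_expand: "g x = (\<lambda>u. \<Sum>i<N. L i u *\<^sub>R G i x)" if x: "x \<in> U" for x
  proof
    fix u
    have "cl_reversion (cl_reversion (g x u)) = cl_reversion (\<Sum>i<N. L i u *\<^sub>R r.F i x)"
      using r.expansion [OF r.on_U(1) [OF x], of u] r.on_U(3) [OF x] by simp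
    then show "g x u = (\<Sum>i<N. L i u *\<^sub>R G i x)" by (simp add: rev_simps G_def)
  qed
  have S_zero: "coeff_pairing N w (\<lambda>i. G i x) (\<lambda>i. l.dirac_coeff i x) = 0" if x: "x \<in> U" for x
  proof -
    obtain q where q: "q \<in> left_monogenic (int k - 1)"
      "\<forall>u. (\<Sum>i<N. L i u *\<^sub>R l.dirac_coeff i x) = cl_vec_n u \<odot> q u"
      using l.rarita_schwinger_zero [OF x] assms(11) [OF x] unfolding rarita_schwinger_def by blast
    have "sphere_pairing (g x) (\<lambda>u. cl_vec_n u \<odot> q u) = 0"
      by (rule sphere_pairing_monogenic_orthogonal [OF assms(10) [OF x] q(1)])
    then show ?thesis unfolding pairing [symmetric] g_expand [OF x] using q(2) by simp
  qed
  have T_zero: "coeff_pairing N w (\<lambda>i. T i x) (\<lambda>i. l.F i x) = 0" if x: "x \<in> U" for x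
  proof -
    \<comment> \<open>The right equation for \<open>g\<close> is read as the left equation for the
      reversion of \<open>g\<close>.\<close>
    have "right_proj k (\<lambda>u. cl_reversion (sphere_dirac (\<lambda>y. cl_reversion (g y u)) x)) u = 0" for u
      using assms(12) [OF x, of u] unfolding rarita_schwinger_right_def sphere_dirac_right_def .
    then have "left_proj k (\<lambda>u. sphere_dirac (\<lambda>y. cl_reversion (g y u)) x) u = 0" for u
      unfolding right_proj_reversion [OF r.sphere_dirac_harmonic [OF x]] cl_reversion_zero_iff .
    then obtain q where q: "q \<in> left_monogenic (int k - 1)"
      "\<forall>u. (\<Sum>i<N. L i u *\<^sub>R r.dirac_coeff i x) = cl_vec_n u \<odot> q u"
      using r.rarita_schwinger_zero [OF x] by blast
    have "(\<lambda>u. cl_reversion (q u)) \<in> right_monogenic (int k - 1)"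
      using q(1) by (simp add: right_monogenic_reversion cl_reversion_involution)
    from sphere_pairing_monogenic_orthogonal [OF this assms(8) [OF x]]
    have "sphere_pairing (\<lambda>u. cl_reversion (q u) \<odot> cl_vec_n u) (f x) = 0"
      by (simp add: sphere_pairing_def cl_mult_assoc)
    moreover have "(\<Sum>i<N. L i u *\<^sub>R T i x) = cl_reversion (q u) \<odot> cl_vec_n u" for u
      using arg_cong [OF spec [OF q(2), of u], of cl_reversion] by (simp add: rev_simps T_def)
    ultimately show ?thesis unfolding pairing [symmetric] f_expand [OF x] by simp
  qed
  show ?thesis
  proof (rule set_integral_zero_componentwise)
    fix A
    \<comment> \<open>The divergence theorem is for real fields, so one Clifford component
      \<open>A\<close> is treated at a time.\<close>
    define X where "X x = (\<chi> b. coeff_pairing N w (\<lambda>i. G i x) (\<lambda>i. cl_gen b \<odot> l.F i x) $ A)" for x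
    define DX where "DX b x h = coeff_pairing N w (\<lambda>i. G i x) (\<lambda>i. cl_gen b \<odot> l.dF i x h)
        + coeff_pairing N w (\<lambda>i. dG i x h) (\<lambda>i. cl_gen b \<odot> l.F i x)" for b x h
    have X_inner: "v \<bullet> X x = coeff_pairing N w (\<lambda>i. G i x) (\<lambda>i. cl_vec v \<odot> l.F i x) $ A" for v x
      unfolding coeff_pairing_cl_vec [symmetric] by (simp add: X_def inner_vec_def)
    have dX: "frechet_derivative (\<lambda>x. X x $ b) (at x) = (\<lambda>h. DX b x h $ A)" if x: "x \<in> U" for b x
    proof -
      have "((\<lambda>x. coeff_pairing N w (\<lambda>i. G i x) (\<lambda>i. cl_gen b \<odot> l.F i x)) has_derivative DX b x) (at x)"
        unfolding DX_def [abs_def] G_def dG_def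
        by (intro coeff_pairing_has_derivative bounded_linear.has_derivative [OF bounded_linear_cl_reversion]
            bounded_linear.has_derivative [OF cl.bounded_linear_right] l.F_has_derivative r.F_has_derivative
            l.on_U x)
      then have "((\<lambda>x. X x $ b) has_derivative (\<lambda>h. DX b x h $ A)) (at x)"
        using bounded_linear.has_derivative [OF bounded_linear_vec_nth] by (simp add: X_def)
      then show ?thesis by (rule frechet_derivative_at [symmetric])
    qed
    have closure_V: "x \<in> U" if "x \<in> closure V" for x
      using that sphere_boundary_iff [OF V, of x] assms(3,4) by blast
    have flux: "(LINT x:sphere_boundary V|hausdorff_measure (CARD('n) - 1). X x \<bullet> \<nu> x) = 0"
    proof (rule sphere_flux_vanishes [OF V assms(5,6) open_cone_over [OF U]])
      show "closure V \<subseteq> cone_over U" using closure_V l.on_U(1) by blast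
      show "C1_fun (cone_over U) (\<lambda>x. X x $ b)" for b
      proof -
        have "C1_fun (cone_over U) (\<lambda>x. G i x $ B)" for i B
        proof -
          have "(\<lambda>x. G i x $ B) = (\<lambda>x. (- 1) ^ (card B choose 2) * r.F i x $ B)"
            by (simp add: G_def cl_reversion_def)
          then show ?thesis by (simp only: C1_fun_mult C1_fun_const r.C1_fun_F)
        qed
        then show ?thesis unfolding X_def coeff_pairing_def
          by (simp add: C1_fun_sum C1_fun_mult C1_fun_const C1_fun_cl_mult l.C1_fun_F)
      qed
      show "frechet_derivative (\<lambda>x. X x $ b) (at x) x = 0" if "x \<in> V" for x b
      proof -
        have x: "x \<in> U" using that assms(3) by blast
        \<comment> \<open>The extensions are constant along rays, hence so is the field built from
          them.\<close>
        have "dG i x x = 0" "l.dF i x x = 0" for i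
          using r.dF_radial [OF r.on_U(1) [OF x]] l.dF_radial [OF l.on_U(1) [OF x]] by (simp_all add: dG_def rev_simps)
        then show ?thesis unfolding dX [OF x] DX_def by (simp add: coeff_pairing_def cl.zero_left cl.zero_right)
      qed
      show "(\<Sum>b\<in>UNIV. frechet_derivative (\<lambda>x. X x $ b) (at x) (axis b 1)) = real CARD('n) * (x \<bullet> X x)" if "x \<in> V" for x
      proof -
        have x: "x \<in> U" using that assms(3) by blast
        let ?n = "real CARD('n) / 2"
        let ?GxF = "coeff_pairing N w (\<lambda>i. G i x) (\<lambda>i. cl_vec x \<odot> l.F i x)"
        \<comment> \<open>The definition of the Dirac coefficient is solved for the flat Dirac
          derivative. The terms with \<open>n / 2\<close>, one from \<open>f\<close> and one from
          \<open>g\<close>, add up to the factor \<open>n\<close> in the divergence.\<close>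
        have F: "(\<Sum>b\<in>UNIV. cl_gen b \<odot> l.dF i x (axis b 1)) = ?n *\<^sub>R (cl_vec x \<odot> l.F i x) - l.dirac_coeff i x" for i
          by (simp add: l.dirac_coeff_def)
        have G: "(\<Sum>b\<in>UNIV. dG i x (axis b 1) \<odot> cl_gen b) = ?n *\<^sub>R (G i x \<odot> cl_vec x) - T i x" for i
          by (simp add: T_def r.dirac_coeff_def G_def dG_def rev_simps)
        have "(\<Sum>b\<in>UNIV. DX b x (axis b 1)) = coeff_pairing N w (\<lambda>i. G i x) (\<lambda>i. \<Sum>b\<in>UNIV. cl_gen b \<odot> l.dF i x (axis b 1))
            + coeff_pairing N w (\<lambda>i. \<Sum>b\<in>UNIV. dG i x (axis b 1) \<odot> cl_gen b) (\<lambda>i. l.F i x)"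
          unfolding DX_def coeff_pairing_sum coeff_pairing_assoc by (rule sum.distrib)
        also have "\<dots> = ?n *\<^sub>R ?GxF + ?n *\<^sub>R ?GxF"
          unfolding F G coeff_pairing_bilinear S_zero [OF x] T_zero [OF x] coeff_pairing_assoc by simp
        finally show ?thesis
          by (simp add: dX [OF x] X_inner flip: sum_component scaleR_left_distrib)
      qed
    qed
    have e: "sphere_pairing (g x) (left_proj k (\<lambda>u. cl_vec (\<nu> x) \<odot> f x u)) $ A = X x \<bullet> \<nu> x"
      if "x \<in> sphere_boundary V" for x
    proof -
      have x: "x \<in> U" using that assms(4) by blast
      have "sphere_pairing (g x) (left_proj k (\<lambda>u. cl_vec (\<nu> x) \<odot> f x u))
          = sphere_pairing (g x) (\<lambda>u. cl_vec (\<nu> x) \<odot> f x u)"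
        by (rule sphere_pairing_left_proj [OF assms(10) [OF x]
              harmonic_polys_cl_mult_left [OF left_monogenic_harmonic [OF assms(8) [OF x]]]])
      also have "\<dots> = coeff_pairing N w (\<lambda>i. G i x) (\<lambda>i. cl_vec (\<nu> x) \<odot> l.F i x)"
        unfolding pairing [symmetric] f_expand [OF x] g_expand [OF x] by (simp add: cl.sum_right cl_mult_bilinear)
      finally show ?thesis by (simp only: inner_commute [of "X x" "\<nu> x"] X_inner)
    qed
    have "(\<lambda>x. indicator (sphere_boundary V) x *\<^sub>R (sphere_pairing (g x) (left_proj k (\<lambda>u. cl_vec (\<nu> x) \<odot> f x u)) $ A))
        = (\<lambda>x. indicator (sphere_boundary V) x *\<^sub>R (X x \<bullet> \<nu> x))"
      by (simp add: fun_eq_iff indicator_def e)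
    then show "(LINT x:sphere_boundary V|hausdorff_measure (CARD('n) - 1).
        sphere_pairing (g x) (left_proj k (\<lambda>u. cl_vec (\<nu> x) \<odot> f x u)) $ A) = 0"
      using flux unfolding set_lebesgue_integral_def by (simp only:)
  qed
qed

end
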